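(* Suppose that $p\ge2q$. Then for every spherical function $\varphi$ of $(G,K)$, the function $\widetilde\varphi(t)=\varphi(a_t)$, $t\in C$, satisfies for all $t,s\in C$ the product formula \[\widetilde\varphi(t)\widetilde\varphi(s)=\frac{1}{\kappa_{pd/2}}\int_{B_q}\int_{U_0(q,\mathbb F)}\widetilde\varphi\Bigl(\operatorname{arcosh}\bigl(\operatorname{spec}_s(\sinh\underline t\,w\,\sinh\underline s+\cosh\underline t\,v\,\cosh\underline s)\bigr)\Bigr)\,\Delta(I-w^*w)^{pd/2-\gamma}\,dv\,dw.\]
   Context: Let $\mathbb F\in\{\mathbb R,\mathbb C,\mathbb H\}$, $d=\dim_{\mathbb R}\mathbb F\in\{1,2,4\}$, and let $p>q\ge1$ be integers. $G$ is $SO_0(p,q)$, $SU(p,q)$ or $Sp(p,q)$ for $\mathbb F=\mathbb R,\mathbb C,\mathbb H$ respectively, realized inside the isometry group of the form $|x_1|^2+\dots+|x_p|^2-|x_{p+1}|^2-\dots-|x_{p+q}|^2$ on $\mathbb F^{p+q}$, and $K$ is the maximal compact subgroup $SO(p)\times SO(q)$, $S(U(p)\times U(q))$ or $Sp(p)\times Sp(q)$, respectively, embedded block-diagonally. A spherical function of $(G,K)$ is a non-zero $K$-biinvariant continuous function $\varphi:G\to\mathbb C$ with $\varphi(g)\varphi(h)=\int_K\varphi(gkh)\,dk$ for all $g,h\in G$, $dk$ the normalized Haar measure of $K$. Put $C=\{t\in\mathbb R^q:t_1\ge t_2\ge\dots\ge t_q\ge0\}$. For $t\in\mathbb R^q$,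 $\underline t=\mathrm{diag}(t_1,\dots,t_q)$, $\sinh\underline t,\cosh\underline t$ are the diagonal matrices with entries $\sinh t_i,\cosh t_i$, and \[a_t=\begin{pmatrix}\cosh\underline t&0_{q\times(p-q)}&\sinh\underline t\\0_{(p-q)\times q}&I_{p-q}&0_{(p-q)\times q}\\\sinh\underline t&0_{q\times(p-q)}&\cosh\underline t\end{pmatrix}\in G.\] Put $\gamma=d(q-\tfrac12)+1$, $B_q=\{w\in M_q(\mathbb F):w^*w<I\}$, and for $\operatorname{Re}\mu>\gamma-1$, $\kappa_\mu=\int_{B_q}\Delta(I-w^*w)^{\mu-\gamma}dw$ ($dw$ Lebesgue measure on $M_q(\mathbb F)$). Here $\Delta$ is the usual determinant for $\mathbb F=\mathbb R,\mathbb C$, and $\Delta(x)=(\det_{\mathbb C}x)^{1/2}$ for $\mathbb F=\mathbb H$, with $x$ regarded as a complex $2q\times2q$ matrix in the usual way. $U_0(q,\mathbb F)$ is the identity component of the unitary group $U(q,\mathbb F)$ over $\mathbb F$, with normalized Haar measure $dv$. For $x\in M_q(\mathbb F)$, $\operatorname{spec}_s(x)\in\mathbb R^q$ is the vector of singular values of $x$ in decreasing order; $\operatorname{arcosh}$ is taken componentwise (in the formula above the singular values are all $\ge1$). *)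

theory Defs
  imports "HOL-Analysis.Analysis"
begin

datatype quat = Quat (qRe: real) (qI: real) (qJ: real) (qK: real)

lemma quat_eq_iff:
  "x = y \<longleftrightarrow> qRe x = qRe y \<and> qI x = qI y \<and> qJ x = qJ y \<and> qK x = qK y"
  by (cases x; cases y) simp

instantiation quat :: ab_group_add
begin

definition "0 = Quat 0 0 0 0"
definition "x + y = Quat (qRe x + qRe y) (qI x + qI y) (qJ x + qJ y) (qK x + qK y)"
definition "- x = Quat (- qRe x) (- qI x) (- qJ x) (- qK x)"
definition "x - y = Quat (qRe x - qRe y) (qI x - qI y) (qJ x - qJ y) (qK x - qK y)"

instance
  by standard
    (simp_all add: quat_eq_iff zero_quat_def plus_quat_def uminus_quat_def minus_quat_def)

end

lemma quat_add_sel [simp]: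
  "qRe 0 = 0" "qI 0 = 0" "qJ 0 = 0" "qK 0 = 0"
  "qRe (x + y) = qRe x + qRe y" "qI (x + y) = qI x + qI y"
  "qJ (x + y) = qJ x + qJ y" "qK (x + y) = qK x + qK y"
  "qRe (- x) = - qRe x" "qI (- x) = - qI x" "qJ (- x) = - qJ x" "qK (- x) = - qK x"
  "qRe (x - y) = qRe x - qRe y" "qI (x - y) = qI x - qI y"
  "qJ (x - y) = qJ x - qJ y" "qK (x - y) = qK x - qK y"
  by (simp_all add: zero_quat_def plus_quat_def uminus_quat_def minus_quat_def)

instantiation quat :: ring_1
begin

definition "1 = Quat 1 0 0 0"
definition "x * y = Quat
  (qRe x * qRe y - qI x * qI y - qJ x * qJ y - qK x * qK y)
  (qRe x * qI y + qI x * qRe y + qJ x * qK y - qK x * qJ y)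
  (qRe x * qJ y - qI x * qK y + qJ x * qRe y + qK x * qI y)
  (qRe x * qK y + qI x * qJ y - qJ x * qI y + qK x * qRe y)"

instance
  by standard (simp_all add: quat_eq_iff one_quat_def times_quat_def algebra_simps)

end

lemma quat_mult_sel [simp]:
  "qRe 1 = 1" "qI 1 = 0" "qJ 1 = 0" "qK 1 = 0"
  "qRe (x * y) = qRe x * qRe y - qI x * qI y - qJ x * qJ y - qK x * qK y"
  "qI (x * y) = qRe x * qI y + qI x * qRe y + qJ x * qK y - qK x * qJ y"
  "qJ (x * y) = qRe x * qJ y - qI x * qK y + qJ x * qRe y + qK x * qI y"
  "qK (x * y) = qRe x * qK y + qI x * qJ y - qJ x * qI y + qK x * qRe y"
  by (simp_all add: one_quat_def times_quat_def)

instantiation quat :: real_algebra_1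
begin

definition "scaleR r x = Quat (r * qRe x) (r * qI x) (r * qJ x) (r * qK x)"

instance
  by standard (simp_all add: quat_eq_iff scaleR_quat_def algebra_simps)

end

lemma quat_scaleR_sel [simp]:
  "qRe (r *\<^sub>R x) = r * qRe x" "qI (r *\<^sub>R x) = r * qI x"
  "qJ (r *\<^sub>R x) = r * qJ x" "qK (r *\<^sub>R x) = r * qK x"
  by (simp_all add: scaleR_quat_def)

instantiation quat :: real_inner
begin

definition "inner x y = qRe x * qRe y + qI x * qI y + qJ x * qJ y + qK x * qK y"
definition "norm (x :: quat) = sqrt (inner x x)"
definition "dist (x :: quat) y = norm (x - y)"
definition "sgn (x :: quat) = x /\<^sub>R norm x"
definition [code del]:
  "(uniformity :: (quat \<times> quat) filter) = (INF e\<in>{0 <..}. principal {(x, y). dist x y < e})"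
definition [code del]:
  "open (U :: quat set) \<longleftrightarrow> (\<forall>x\<in>U. eventually (\<lambda>(x', y). x' = x \<longrightarrow> y \<in> U) uniformity)"

instance
proof
  fix x y z :: quat and r :: real and U :: "quat set"
  have nn: "0 \<le> a * a" for a :: real by simp
  show "0 \<le> inner x x"
    by (simp add: inner_quat_def)
  show "inner x x = 0 \<longleftrightarrow> x = 0"
    using nn[of "qRe x"] nn[of "qI x"] nn[of "qJ x"] nn[of "qK x"]
    by (auto simp: inner_quat_def quat_eq_iff add_nonneg_eq_0_iff)
  show "open U \<longleftrightarrow> (\<forall>x\<in>U. eventually (\<lambda>(x', y). x' = x \<longrightarrow> y \<in> U) uniformity)"
    by (rule open_quat_def)
qed (simp_all add: inner_quat_def norm_quat_def dist_quat_def sgn_quat_def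
      uniformity_quat_def algebra_simps)

end

instantiation quat :: real_normed_div_algebra
begin

definition "inverse x = Quat (qRe x / inner x x) (- qI x / inner x x)
  (- qJ x / inner x x) (- qK x / inner x x)"
definition "x div (y :: quat) = x * inverse y"

instance
proof
  fix x y :: quat
  have inv: "inverse x * x = (inner x x / inner x x) *\<^sub>R 1"
    "x * inverse x = (inner x x / inner x x) *\<^sub>R 1"
    by (simp_all add: quat_eq_iff inverse_quat_def inner_quat_def
        diff_divide_distrib [symmetric] add_divide_distrib [symmetric] mult.commute)
  show "x \<noteq> 0 \<Longrightarrow> inverse x * x = 1" "x \<noteq> 0 \<Longrightarrow> x * inverse x = 1"
    using inv by simp_all
  show "inverse (0 :: quat) = 0"
    by (simp add: inverse_quat_def quat_eq_iff)
  have "inner (x * y) (x * y) = inner x x * inner y y"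
    unfolding inner_quat_def quat_mult_sel by algebra
  then show "norm (x * y) = norm x * norm y"
    by (simp only: norm_quat_def real_sqrt_mult)
qed (simp add: divide_quat_def)

end

instantiation quat :: euclidean_space
begin

definition "Basis = {Quat 1 0 0 0, Quat 0 1 0 0, Quat 0 0 1 0, Quat 0 0 0 1}"

instance
proof
  fix x :: quat
  show "(\<forall>u\<in>Basis. inner x u = 0) \<longleftrightarrow> x = 0"
    unfolding Basis_quat_def by (auto simp: inner_quat_def quat_eq_iff [of x 0])
qed (auto simp: Basis_quat_def inner_quat_def)

end

lemma DIM_quat [simp]: "DIM(quat) = 4"
  by (simp add: Basis_quat_def)

text \<open>The instances of the following class are \<open>real\<close>, \<open>complex\<close> and \<open>quat\<close>;
  \<open>DIM('f)\<close> is the real dimension $d$. The class only carries the conjugation.\<close>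

class conj_algebra = real_normed_div_algebra + euclidean_space +
  fixes fconj :: "'a \<Rightarrow> 'a"

instantiation real :: conj_algebra
begin
definition "fconj (x :: real) = x"
instance ..
end

instantiation complex :: conj_algebra
begin
definition "fconj (z :: complex) = cnj z"
instance ..
end

instantiation quat :: conj_algebra
begin
definition "fconj x = Quat (qRe x) (- qI x) (- qJ x) (- qK x)"
instance ..
end

definition mstar :: "'f::conj_algebra^'n^'m \<Rightarrow> 'f^'m^'n"
  where "mstar A = (\<chi> i j. fconj (A $ j $ i))"

definition diag :: "real^'n \<Rightarrow> 'f::real_algebra_1^'n^'n"
  where "diag d = (\<chi> i j. if i = j then of_real (d $ i) else 0)"

definition sinh_diag :: "real^'n \<Rightarrow> 'f::real_algebra_1^'n^'n"
  where "sinh_diag t = diag (\<chi> i. sinh (t $ i))"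

definition cosh_diag :: "real^'n \<Rightarrow> 'f::real_algebra_1^'n^'n"
  where "cosh_diag t = diag (\<chi> i. cosh (t $ i))"

definition block :: "'f^'n^'m \<Rightarrow> 'f^'k^'m \<Rightarrow> 'f^'n^'l \<Rightarrow> 'f^'k^'l \<Rightarrow> 'f^('n + 'k)^('m + 'l)"
  where "block A B C D = (\<chi> i j.
    case i of
      Inl a \<Rightarrow> (case j of Inl b \<Rightarrow> A $ a $ b | Inr b \<Rightarrow> B $ a $ b)
    | Inr a \<Rightarrow> (case j of Inl b \<Rightarrow> C $ a $ b | Inr b \<Rightarrow> D $ a $ b))"

text \<open>For Hermitian \<open>A\<close> the quantity $x^* A x$ is real, and it is the real inner product of
  \<open>x\<close> with \<open>A *v x\<close>.\<close>

definition pos_definite :: "'f::conj_algebra^'n^'n \<Rightarrow> bool"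
  where "pos_definite A \<longleftrightarrow> mstar A = A \<and> (\<forall>x. x \<noteq> 0 \<longrightarrow> 0 < inner x (A *v x))"

definition unitary_group :: "('f::conj_algebra^'n^'n) set"
  where "unitary_group = {A. mstar A ** A = mat 1 \<and> A ** mstar A = mat 1}"

definition unitary_group0 :: "('f::conj_algebra^'n^'n) set"
  where "unitary_group0 = connected_component_set unitary_group (mat 1)"

definition B_ball :: "('f::conj_algebra^'n^'n) set"
  where "B_ball = {w. pos_definite (mat 1 - mstar w ** w)}"

text \<open>A quaternion is $a + b\,j$ with $a, b$ complex; this sends $A + B\,j$ to the
  complex matrix with rows $(A, B)$ and $(-\overline B, \overline A)$.\<close>

definition quat_to_complex :: "quat^'n^'n \<Rightarrow> complex^('n + 'n)^('n + 'n)"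
  where "quat_to_complex X = block
    (\<chi> i j. Complex (qRe (X $ i $ j)) (qI (X $ i $ j)))
    (\<chi> i j. Complex (qJ (X $ i $ j)) (qK (X $ i $ j)))
    (\<chi> i j. - cnj (Complex (qJ (X $ i $ j)) (qK (X $ i $ j))))
    (\<chi> i j. cnj (Complex (qRe (X $ i $ j)) (qI (X $ i $ j))))"

text \<open>The determinants are complex-valued; at positive definite arguments the values are positive
  reals, where complex \<open>powr\<close> and \<open>csqrt\<close> agree with the real power and square root.\<close>

definition Delta_R :: "real^'n^'n \<Rightarrow> complex"
  where "Delta_R x = of_real (det x)"

definition Delta_C :: "complex^'n^'n \<Rightarrow> complex"
  where "Delta_C x = det x"

definition Delta_H :: "quat^'n^'n \<Rightarrow> complex"
  where "Delta_H x = csqrt (det (quat_to_complex x))"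

definition gam :: "nat \<Rightarrow> nat \<Rightarrow> real"
  where "gam d q = real d * (real q - 1 / 2) + 1"

definition kappa :: "('f::conj_algebra^'q^'q \<Rightarrow> complex) \<Rightarrow> complex \<Rightarrow> complex"
  where "kappa \<Delta> \<mu> = (LINT w:B_ball|lborel.
    \<Delta> (mat 1 - mstar w ** w) powr (\<mu> - of_real (gam DIM('f) CARD('q))))"

text \<open>Here \<open>p = CARD('p)\<close> and \<open>q = CARD('q)\<close>; matrices act on column vectors from the left,
  so over the quaternions they are right-linear.\<close>

definition pq_form :: "'f::real_normed_vector^('p::finite + 'q::finite) \<Rightarrow> real"
  where "pq_form x = (\<Sum>i\<in>UNIV. (norm (x $ Inl i))\<^sup>2) - (\<Sum>j\<in>UNIV. (norm (x $ Inr j))\<^sup>2)"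

definition pq_isometries :: "('f::conj_algebra^('p::finite + 'q::finite)^('p + 'q)) set"
  where "pq_isometries = {A. \<forall>x. pq_form (A *v x) = pq_form x}"

definition SO0 :: "(real^('p::finite + 'q::finite)^('p + 'q)) set"
  where "SO0 = connected_component_set {A \<in> pq_isometries. det A = 1} (mat 1)"

definition SU :: "(complex^('p::finite + 'q::finite)^('p + 'q)) set"
  where "SU = {A \<in> pq_isometries. det A = 1}"

definition Sp :: "(quat^('p::finite + 'q::finite)^('p + 'q)) set"
  where "Sp = pq_isometries"

definition K_R :: "(real^('p::finite + 'q::finite)^('p + 'q)) set"
  where "K_R = {block A 0 0 D | A D.
    A \<in> unitary_group \<and> det A = 1 \<and> D \<in> unitary_group \<and> det D = 1}"

definition K_C :: "(complex^('p::finite + 'q::finite)^('p + 'q)) set"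
  where "K_C = {block A 0 0 D | A D.
    A \<in> unitary_group \<and> D \<in> unitary_group \<and> det A * det D = 1}"

definition K_H :: "(quat^('p::finite + 'q::finite)^('p + 'q)) set"
  where "K_H = {block A 0 0 D | A D. A \<in> unitary_group \<and> D \<in> unitary_group}"

text \<open>Here \<open>p - q = CARD('r)\<close>, so that every pair $p > q \ge 1$ is covered.\<close>

definition a_mat :: "real^'q::finite \<Rightarrow> 'f::real_algebra_1^(('q + 'r::finite) + 'q)^(('q + 'r) + 'q)"
  where "a_mat t = block
    (block (cosh_diag t) 0 0 (mat 1))
    (\<chi> i j. case i of Inl a \<Rightarrow> sinh_diag t $ a $ j | Inr b \<Rightarrow> 0)
    (\<chi> i j. case j of Inl a \<Rightarrow> sinh_diag t $ i $ a | Inr b \<Rightarrow> 0)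
    (cosh_diag t)"

text \<open>The normalized Haar measure of a compact matrix group \<open>U\<close> is characterised as the unique
  left-invariant Borel probability measure on \<open>U\<close> and is passed as a parameter.\<close>

definition normalized_haar :: "('f::conj_algebra^'n^'n) set \<Rightarrow> ('f^'n^'n) measure \<Rightarrow> bool"
  where "normalized_haar U M \<longleftrightarrow>
    sets M = sets (restrict_space borel U) \<and> emeasure M U = 1 \<and>
    (\<forall>u\<in>U. distr M M (\<lambda>x. u ** x) = M)"

definition spherical_function ::
    "('f::conj_algebra^'n^'n) set \<Rightarrow> ('f^'n^'n) set \<Rightarrow> ('f^'n^'n) measure \<Rightarrow> ('f^'n^'n \<Rightarrow> complex) \<Rightarrow> bool"
  where "spherical_function G K dk \<phi> \<longleftrightarrow>
    continuous_on G \<phi> \<and> (\<exists>g\<in>G. \<phi> g \<noteq> 0) \<and>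
    (\<forall>g\<in>G. \<forall>k\<in>K. \<forall>k'\<in>K. \<phi> (k ** g ** k') = \<phi> g) \<and>
    (\<forall>g\<in>G. \<forall>h\<in>G. \<phi> g * \<phi> h = (LINT k|dk. \<phi> (g ** k ** h)))"

definition chamber :: "(real^'q::{finite,linorder}) set"
  where "chamber = {t. (\<forall>i j. i \<le> j \<longrightarrow> t $ j \<le> t $ i) \<and> (\<forall>i. 0 \<le> t $ i)}"

text \<open>Each singular value \<open>\<sigma>\<close> of \<open>x\<close> is listed with the dimension over \<open>'f\<close> of the eigenspace of
  $x^* x$ for $\sigma^2$ as multiplicity; \<open>dim\<close> is the real dimension, hence the factor
  \<open>DIM('f)\<close>.\<close>

definition spec_s :: "'f::conj_algebra^'q::{finite,linorder}^'q::{finite,linorder} \<Rightarrow> real^'q::{finite,linorder}"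
  where "spec_s x = (THE s. s \<in> chamber \<and>
    (\<forall>\<sigma>\<ge>0. DIM('f) * card {i. s $ i = \<sigma>} = dim {v. (mstar x ** x) *v v = \<sigma>\<^sup>2 *\<^sub>R v}))"

definition arcosh_vec :: "real^'q \<Rightarrow> real^'q"
  where "arcosh_vec s = (\<chi> i. arcosh (s $ i))"

end

theory Submission
  imports Defs
begin

text \<open>For \<open>k = block A 0 0 D\<close> in \<open>K\<close> the lower right block of \<open>a\<^sub>t k a\<^sub>s\<close> is
  \<open>sinh t w sinh s + cosh t D cosh s\<close>, where \<open>w\<close> is the upper left \<open>q \<times> q\<close> corner of \<open>A\<close>. By the Cartan
  decomposition the singular values of this block determine the double coset \<open>K a\<^sub>t k a\<^sub>s K\<close>, so
  the functional equation becomes an integral over the joint distribution of \<open>(w, D)\<close> under Haar measure.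

  This distribution is found without Lie theory. Invariance of Haar measure allows one to replace
  the first \<open>q\<close> columns of \<open>A\<close> by the orthonormalisation \<open>X (X\<^sup>* X) powr (-1/2)\<close> of a Lebesgue distributed
  \<open>p \<times> q\<close> matrix \<open>X\<close> whose Gram matrix lies in a fixed neighbourhood of 1. Its upper \<open>q \<times> q\<close> block is
  governed by the distribution of the Gram matrix of the lower \<open>(p - q) \<times> q\<close> block, and here
  \<open>p \<ge> 2q\<close> makes that Gram matrix almost surely invertible. The push-forward of
  Lebesgue measure under \<open>B \<mapsto> B\<^sup>* B\<close> is relatively invariant under congruence, hence a multiple of a
  power of the determinant on the cone of positive definite matrices, and the power is determined by scaling.
  The resulting constant equals \<open>\<kappa>\<close> by comparing total masses.

  The three fields are treated uniformly: the product of the singular values replaces the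
  determinant, which is only needed to identify \<open>\<Delta>\<close> and to normalise elements of the special groups.\<close>

text \<open>The law of \<open>(w, D)\<close> must come out as a product measure, although
  \<open>K\<close> may tie the determinants of \<open>A\<close> and \<open>D\<close> together. Only
  the first q columns of \<open>A\<close> enter, and because p > q a further column is left to
  absorb any determinant. Hence every pair of an orthonormal q-frame and an element of
  \<open>unitary_group0\<close> is realised in \<open>K\<close>, and for the distribution this
  transitivity is what is used of \<open>K\<close> beside its block shape and the invariance of Haar
  measure. The exponent has this origin: with r = p - q, the Gram matrix of a Lebesgue distributed r
  x q matrix has a density proportional to the power e = d (r - q + 1) / 2 - 1 of
  \<open>adet\<close> on the cone, and e = p d / 2 - \<gamma>. Working without a determinant has a
  price: multiplicativity of \<open>adet\<close> is not algebra here. It is read off from the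
  Jacobians of matrix multiplication, which are multiplicative under composition.\<close>

section \<open>Conjugation on the three fields\<close>

text \<open>\<open>conj_algebra\<close> carries \<open>fconj\<close> without axioms. These are the
  laws shared by the three conjugations: an isometric involutive anti-automorphism with left
  multiplication by \<open>fconj a\<close> adjoint to left multiplication by \<open>a\<close>. That
  1 is a basis vector makes the real part a coordinate, as the Jacobian on Hermitian matrices
  requires.\<close>

class star_algebra = conj_algebra +
  assumes fconj_add: "fconj (x + y) = fconj x + fconj y"
    and fconj_scaleR: "fconj (r *\<^sub>R x) = r *\<^sub>R fconj x"
    and fconj_mult: "fconj (x * y) = fconj y * fconj x"
    and fconj_fconj [simp]: "fconj (fconj x) = x"
    and inner_fconj_fconj: "inner (fconj x) (fconj y) = inner x y"
    and inner_mult_left_fconj: "inner (a * x) y = inner x (fconj a * y)"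
    and fconj_mult_self: "fconj x * x = (norm x)\<^sup>2 *\<^sub>R 1"
    and one_in_Basis: "1 \<in> Basis"

instance real :: star_algebra
  by standard (simp_all add: fconj_real_def power2_eq_square)

instance complex :: star_algebra
proof
  show "inner (a * x) y = inner x (fconj a * y)" for a x y :: complex
    by (simp add: fconj_complex_def inner_complex_def algebra_simps)
  show "fconj x * x = (norm x)\<^sup>2 *\<^sub>R 1" for x :: complex
    by (simp only: cmod_power2) (simp add: fconj_complex_def complex_eq_iff power2_eq_square)
qed (simp_all add: fconj_complex_def inner_complex_def Basis_complex_def scaleR_conv_of_real)

instance quat :: star_algebra
proof
  show "inner (a * x) y = inner x (fconj a * y)" for a x y :: quat
    by (simp add: fconj_quat_def inner_quat_def algebra_simps)
  show "fconj x * x = (norm x)\<^sup>2 *\<^sub>R 1" for x :: quat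
    by (simp add: fconj_quat_def quat_eq_iff norm_quat_def inner_quat_def)
  show "fconj (x * y) = fconj y * fconj x" for x y :: quat
    by (simp add: fconj_quat_def quat_eq_iff)
qed (simp_all add: fconj_quat_def quat_eq_iff inner_quat_def Basis_quat_def one_quat_def)

lemma fconj_0 [simp]: "fconj 0 = (0 :: 'f::star_algebra)"
  using fconj_scaleR[of 0 "0 :: 'f"] by simp

lemma fconj_1 [simp]: "fconj 1 = (1 :: 'f::star_algebra)"
  using fconj_mult[of "fconj (1 :: 'f)" 1] by simp

lemma fconj_minus [simp]: "fconj (- x) = - fconj (x :: 'f::star_algebra)"
  using fconj_scaleR[of "-1" x] by simp

lemma fconj_diff: "fconj (x - y) = fconj x - fconj (y :: 'f::star_algebra)"
  using fconj_add[of x "- y"] by simp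

lemma fconj_sum: "fconj (sum f A) = (\<Sum>i\<in>A. fconj (f i :: 'f::star_algebra))"
  by (induction A rule: infinite_finite_induct) (simp_all add: fconj_add)

lemma norm_fconj [simp]: "norm (fconj x) = norm (x :: 'f::star_algebra)"
  by (simp add: norm_eq_sqrt_inner inner_fconj_fconj)

lemma fconj_of_real [simp]: "fconj (of_real r) = (of_real r :: 'f::star_algebra)"
  by (simp add: of_real_def fconj_scaleR)

lemma linear_fconj: "linear (fconj :: 'f::star_algebra \<Rightarrow> 'f)"
  by (simp add: linear_iff fconj_add fconj_scaleR)

lemma continuous_on_fconj [continuous_intros]:
  "continuous_on S f \<Longrightarrow> continuous_on S (\<lambda>x. fconj (f x) :: 'f::star_algebra)"
  using linear_continuous_on[OF linear_conv_bounded_linear[THEN iffD1, OF linear_fconj]]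
  by (rule continuous_on_compose2) auto

lemma self_mult_fconj: "x * fconj x = (norm x)\<^sup>2 *\<^sub>R (1 :: 'f::star_algebra)"
  using fconj_mult_self[of "fconj x"] by simp

section \<open>Matrices over a star algebra\<close>

lemma matrix_diff_ldistrib: "A ** (B - C) = A ** B - A ** (C :: 'a::ring_1^'n^'m)"
  by (simp add: matrix_matrix_mult_def vec_eq_iff right_diff_distrib sum_subtractf)

lemma matrix_add_rdistrib: "(B + C) ** A = B ** A + C ** (A :: 'a::ring_1^'n^'m)"
  by (simp add: matrix_matrix_mult_def vec_eq_iff distrib_right sum.distrib)

lemma matrix_diff_rdistrib: "(B - C) ** A = B ** A - C ** (A :: 'a::ring_1^'n^'m)"
  by (simp add: matrix_matrix_mult_def vec_eq_iff left_diff_distrib sum_subtractf)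

lemma matrix_vector_mult_scaleR_right:
  "A *v (c *\<^sub>R x) = c *\<^sub>R (A *v (x :: 'a::real_algebra_1^'n))"
  using linear_scale[OF matrix_vector_mul_linear] by blast

lemma continuous_on_matrix_mult [continuous_intros]:
  fixes f :: "'b::topological_space \<Rightarrow> 'a::real_normed_algebra_1^'n^'m"
  assumes "continuous_on S f" "continuous_on S g"
  shows "continuous_on S (\<lambda>x. f x ** g x)"
  unfolding matrix_matrix_mult_def
  by (intro continuous_on_vec_lambda continuous_intros assms)

lemma continuous_on_matrix_vector [continuous_intros]:
  fixes f :: "'b::topological_space \<Rightarrow> 'a::real_normed_algebra_1^'n^'m"
  assumes "continuous_on S f" "continuous_on S g"
  shows "continuous_on S (\<lambda>x. f x *v g x)"
  unfolding matrix_vector_mult_def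
  by (intro continuous_on_vec_lambda continuous_intros assms)

lemma mstar_nth [simp]: "mstar A $ i $ j = fconj (A $ j $ i)"
  by (simp add: mstar_def)

lemma mstar_mstar [simp]: "mstar (mstar A) = (A :: 'f::star_algebra^'n^'m)"
  by (simp add: vec_eq_iff)

lemma mstar_mult: "mstar (A ** B) = mstar B ** mstar (A :: 'f::star_algebra^'n^'m)"
  by (simp add: vec_eq_iff matrix_matrix_mult_def fconj_sum fconj_mult)

lemma mstar_add: "mstar (A + B) = mstar A + mstar (B :: 'f::star_algebra^'n^'m)"
  by (simp add: vec_eq_iff fconj_add)

lemma mstar_diff: "mstar (A - B) = mstar A - mstar (B :: 'f::star_algebra^'n^'m)"
  by (simp add: vec_eq_iff fconj_diff)

lemma mstar_scaleR: "mstar (c *\<^sub>R A) = c *\<^sub>R mstar (A :: 'f::star_algebra^'n^'m)"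
  by (simp add: vec_eq_iff fconj_scaleR)

lemma mstar_mat_1 [simp]: "mstar (mat 1) = (mat 1 :: 'f::star_algebra^'n^'n)"
  by (auto simp: vec_eq_iff mat_def)

lemma mstar_0 [simp]: "mstar 0 = (0 :: 'f::star_algebra^'n^'m)"
  by (simp add: vec_eq_iff)

lemma continuous_on_mstar [continuous_intros]:
  "continuous_on S f \<Longrightarrow> continuous_on S (\<lambda>x. mstar (f x :: 'f::star_algebra^'n^'m))"
  unfolding mstar_def by (intro continuous_on_vec_lambda continuous_intros)

lemma inner_matrix_vector:
  "inner (A *v x) y = inner x (mstar A *v (y :: 'f::star_algebra^'m))"
proof -
  have "inner (A *v x) y = (\<Sum>i\<in>UNIV. \<Sum>j\<in>UNIV. inner (x $ j) (fconj (A $ i $ j) * y $ i))"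
    by (simp add: inner_vec_def matrix_vector_mult_def inner_sum_left inner_mult_left_fconj)
  also have "\<dots> = (\<Sum>j\<in>UNIV. \<Sum>i\<in>UNIV. inner (x $ j) (fconj (A $ i $ j) * y $ i))"
    by (rule sum.swap)
  also have "\<dots> = inner x (mstar A *v y)"
    by (simp add: inner_vec_def matrix_vector_mult_def inner_sum_right)
  finally show ?thesis .
qed

lemma inner_matrix_vector_right:
  "inner x (A *v y) = inner (mstar A *v x) (y :: 'f::star_algebra^'m)"
  by (simp add: inner_matrix_vector)

lemma inner_matrix_mult_left:
  "inner (A ** B) C = inner B (mstar A ** (C :: 'f::star_algebra^'n^'m))"
proof -
  have "inner (A ** B) C = (\<Sum>i\<in>UNIV. \<Sum>j\<in>UNIV. \<Sum>k\<in>UNIV. inner (B $ k $ j) (fconj (A $ i $ k) * C $ i $ j))"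
    by (simp add: inner_vec_def matrix_matrix_mult_def inner_sum_left inner_mult_left_fconj)
  also have "\<dots> = (\<Sum>i\<in>UNIV. \<Sum>k\<in>UNIV. \<Sum>j\<in>UNIV. inner (B $ k $ j) (fconj (A $ i $ k) * C $ i $ j))"
    by (intro sum.cong sum.swap refl)
  also have "\<dots> = (\<Sum>k\<in>UNIV. \<Sum>i\<in>UNIV. \<Sum>j\<in>UNIV. inner (B $ k $ j) (fconj (A $ i $ k) * C $ i $ j))"
    by (rule sum.swap)
  also have "\<dots> = (\<Sum>k\<in>UNIV. \<Sum>j\<in>UNIV. \<Sum>i\<in>UNIV. inner (B $ k $ j) (fconj (A $ i $ k) * C $ i $ j))"
    by (intro sum.cong sum.swap refl)
  also have "\<dots> = inner B (mstar A ** C)"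
    by (simp add: inner_vec_def matrix_matrix_mult_def inner_sum_right)
  finally show ?thesis .
qed

lemma inner_mstar_mstar: "inner (mstar A) (mstar B) = inner A (B :: 'f::star_algebra^'n^'m)"
  unfolding inner_vec_def mstar_nth inner_fconj_fconj by (rule sum.swap)

lemma inner_matrix_mult_right:
  "inner (A ** B) C = inner A ((C :: 'f::star_algebra^'n^'m) ** mstar B)"
proof -
  have "inner (A ** B) C = inner (mstar B ** mstar A) (mstar C)"
    unfolding mstar_mult[symmetric] inner_mstar_mstar ..
  also have "\<dots> = inner (mstar A) (mstar (C ** mstar B))"
    by (simp add: inner_matrix_mult_left mstar_mult)
  finally show ?thesis by (simp add: inner_mstar_mstar)
qed

text \<open>\<open>inner (mat 1) X\<close> is the real part of the trace of \<open>X\<close>. It is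
  cyclic even over the quaternions, where the trace itself is not.\<close>

lemma inner_mat_1_commute:
  "inner (mat 1) (A ** B) = inner (mat 1) (B ** (A :: 'f::star_algebra^'n^'n))"
  unfolding inner_commute[of "mat 1"] inner_matrix_mult_left[of A] inner_matrix_mult_right[of B]
  by simp

lemma inner_mat_1_mult: "inner (mat 1) (A ** X) = inner A (mstar (X :: 'f::star_algebra^'n^'n))"
  unfolding inner_commute[of "mat 1"] inner_matrix_mult_right[of A] by simp

lemma inner_mat_1_mstar: "inner (mat 1) (mstar X) = inner (mat 1) (X :: 'f::star_algebra^'n^'n)"
  using inner_mat_1_mult[of "mat 1" X] by simp

lemma norm_matrix_mstar [simp]: "norm (mstar A) = norm (A :: 'f::star_algebra^'n^'m)"
  by (simp add: norm_eq_sqrt_inner inner_mstar_mstar)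

lemma diag_nth: "diag d $ i $ j = (if i = j then of_real (d $ i) else 0)"
  by (simp add: diag_def)

lemma diag_mult_nth [simp]:
  "(diag d ** A) $ i $ j = of_real (d $ i) * (A $ i $ j :: 'f::real_algebra_1)"
  by (simp add: diag_def matrix_matrix_mult_def if_distrib if_distribR cong: if_cong)

lemma mult_diag_nth [simp]:
  "(A ** diag d) $ i $ j = A $ i $ j * (of_real (d $ j) :: 'f::real_algebra_1)"
  by (simp add: diag_def matrix_matrix_mult_def if_distrib if_distribR cong: if_cong)

lemma diag_vector_nth [simp]: "(diag d *v x) $ i = of_real (d $ i) * (x $ i :: 'f::real_algebra_1)"
  by (simp add: diag_def matrix_vector_mult_def if_distrib if_distribR cong: if_cong)

lemma diag_mult_diag:
  "diag a ** diag b = (diag (\<chi> i. a $ i * b $ i) :: 'f::real_algebra_1^'n^'n)"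
  by (simp add: vec_eq_iff diag_nth)

lemma mstar_diag [simp]: "mstar (diag d) = (diag d :: 'f::star_algebra^'n^'n)"
  by (auto simp: vec_eq_iff diag_nth)

lemma diag_1: "diag 1 = (mat 1 :: 'f::real_algebra_1^'n^'n)"
  by (auto simp: vec_eq_iff diag_nth mat_def)

lemma continuous_on_diag [continuous_intros]:
  "continuous_on S f \<Longrightarrow> continuous_on S (\<lambda>x. diag (f x) :: 'f::real_normed_algebra_1^'n^'n)"
  unfolding diag_def
  by (intro continuous_on_vec_lambda, rename_tac i j, case_tac "i = j")
    (auto intro!: continuous_intros)

lemma inner_1_of_real: "inner 1 (of_real r :: 'f::star_algebra) = r"
  unfolding of_real_def inner_scaleR_right by (metis mult.right_neutral norm_eq_1 norm_one)

lemma inner_mat_1_diag: "inner (mat 1) (diag d :: 'f::star_algebra^'n^'n) = (\<Sum>i\<in>UNIV. d $ i)"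
proof -
  have "inner (mat 1 $ i) (diag d $ i :: 'f^'n) = d $ i" for i
  proof -
    have "inner (mat 1 $ i) (diag d $ i :: 'f^'n) = (\<Sum>j\<in>UNIV. if i = j then d $ i else 0)"
      unfolding inner_vec_def
      by (intro sum.cong) (auto simp: mat_def diag_nth inner_1_of_real)
    then show ?thesis by simp
  qed
  then show ?thesis by (subst inner_vec_def) simp
qed

section \<open>The unitary group\<close>

lemma unitary_groupD:
  assumes "A \<in> unitary_group"
  shows "mstar A ** A = mat 1" "A ** mstar A = mat 1"
  using assms by (auto simp: unitary_group_def)

lemma unitary_mat_1 [simp]: "mat 1 \<in> (unitary_group :: ('f::star_algebra^'n^'n) set)"
  by (simp add: unitary_group_def)

lemma unitary_mstar: "A \<in> unitary_group \<Longrightarrow> mstar A \<in> (unitary_group :: ('f::star_algebra^'n^'n) set)"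
  by (simp add: unitary_group_def)

lemma unitary_mult:
  assumes "A \<in> unitary_group" "B \<in> unitary_group"
  shows "A ** B \<in> (unitary_group :: ('f::star_algebra^'n^'n) set)"
proof -
  have "mstar (A ** B) ** (A ** B) = mstar B ** (mstar A ** A) ** B"
    "(A ** B) ** mstar (A ** B) = A ** (B ** mstar B) ** mstar A"
    by (simp_all add: mstar_mult matrix_mul_assoc)
  then show ?thesis
    using assms by (simp add: unitary_group_def)
qed

lemma norm_unitary_vector:
  assumes "A \<in> unitary_group" shows "norm (A *v x) = norm (x :: 'f::star_algebra^'n)"
  unfolding norm_eq_sqrt_inner inner_matrix_vector matrix_vector_mul_assoc unitary_groupD[OF assms]
  by simp

lemma norm_unitary_mult_left:
  assumes "U \<in> unitary_group" shows "norm (U ** A) = norm (A :: 'f::star_algebra^'m^'n)"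
  unfolding norm_eq_sqrt_inner inner_matrix_mult_left[of U] matrix_mul_assoc unitary_groupD[OF assms]
  by simp

lemma norm_unitary_mult_right:
  assumes "U \<in> unitary_group" shows "norm (A ** U) = norm (A :: 'f::star_algebra^'n^'m)"
  unfolding norm_eq_sqrt_inner inner_matrix_mult_right[of A U] matrix_mul_assoc[symmetric] unitary_groupD[OF assms]
  by simp

lemma compact_unitary_group: "compact (unitary_group :: ('f::star_algebra^'n^'n) set)"
proof (rule compact_eq_bounded_closed[THEN iffD2], rule conjI)
  have "norm A \<le> norm (mat 1 :: 'f^'n^'n)" if "A \<in> unitary_group" for A :: "'f^'n^'n"
    using norm_unitary_mult_left[OF that, of "mat 1"] by simp
  then show "bounded (unitary_group :: ('f^'n^'n) set)"
    by (auto simp: bounded_iff)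
  have "unitary_group = {A :: 'f^'n^'n. mstar A ** A = mat 1} \<inter> {A. A ** mstar A = mat 1}"
    by (auto simp: unitary_group_def)
  moreover have "closed \<dots>"
    by (intro closed_Int closed_Collect_eq continuous_intros)
  ultimately show "closed (unitary_group :: ('f^'n^'n) set)" by metis
qed

section \<open>Plane rotations and phase changes\<close>

lemma axis_axis_vector:
  "axis i (axis j a) *v x = axis i (a * (x $ j :: 'f::real_algebra_1))"
proof -
  have "(\<Sum>l\<in>UNIV. axis j a $ l * x $ l) = (\<Sum>l\<in>UNIV. if l = j then a * x $ l else 0)"
    by (intro sum.cong) (auto simp: axis_def)
  then have "(axis i (axis j a) *v x) $ k = axis i (a * (x $ j)) $ k" for k
    by (cases "k = i") (simp add: matrix_vector_mult_def, simp add: matrix_vector_mult_def axis_def)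
  then show ?thesis by (simp add: vec_eq_iff)
qed

text \<open>In the coordinates i, j this is the 2 x 2 block with rows (c, s u) and (-s conj(u), c).
  The unit u lets a rotation push an off-diagonal entry in every direction of the field.\<close>

definition givens :: "'n \<Rightarrow> 'n \<Rightarrow> 'f::star_algebra \<Rightarrow> real \<Rightarrow> real \<Rightarrow> 'f^'n^'n"
  where "givens i j u c s = mat 1 + (c - 1) *\<^sub>R (axis i (axis i 1) + axis j (axis j 1))
    + s *\<^sub>R (axis i (axis j u) - axis j (axis i (fconj u)))"

lemma scaleR_matrix_vector: "(c *\<^sub>R A) *v x = c *\<^sub>R (A *v (x :: 'f::real_algebra_1^'n))"
  by (simp add: vec_eq_iff matrix_vector_mult_def scaleR_sum_right)

lemma givens_vector:
  fixes u :: "'f::star_algebra"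
  assumes "i \<noteq> j"
  shows "givens i j u c s *v x = (\<chi> k. if k = i then c *\<^sub>R x $ i + s *\<^sub>R (u * x $ j)
    else if k = j then c *\<^sub>R x $ j - s *\<^sub>R (fconj u * x $ i) else x $ k)"
  using assms
  unfolding givens_def matrix_vector_mult_add_rdistrib matrix_vector_mult_diff_rdistrib
    scaleR_matrix_vector axis_axis_vector
  by (auto simp: vec_eq_iff axis_def algebra_simps)

lemma mstar_axis_axis: "mstar (axis i (axis j u)) = axis j (axis i (fconj (u :: 'f::star_algebra)))"
  by (auto simp: vec_eq_iff axis_def)

lemma mstar_givens: "mstar (givens i j u c s) = givens i j u c (- s)"
  by (simp add: givens_def mstar_add mstar_scaleR mstar_diff mstar_axis_axis algebra_simps)

lemma givens_mult_inverse:
  fixes u :: "'f::star_algebra"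
  assumes "i \<noteq> j" "norm u = 1" "c\<^sup>2 + s\<^sup>2 = 1"
  shows "givens i j u c s ** givens i j u c (- s) = mat 1"
proof -
  have u: "u * (fconj u * y) = y" "fconj u * (u * y) = y" for y :: 'f
    using assms(2) fconj_mult_self[of u] self_mult_fconj[of u] by (simp_all flip: mult.assoc)
  have cs: "(c * c) *\<^sub>R y + (s * s) *\<^sub>R y = y" for y :: 'f
    using assms(3) by (simp add: power2_eq_square flip: scaleR_add_left)
  have cancel: "p + w - (w - q) = p + q" "p - w + (w + q) = p + q" for p q w :: 'f
    by simp_all
  show ?thesis
    unfolding matrix_eq
  proof (intro allI)
    fix x
    show "(givens i j u c s ** givens i j u c (- s)) *v x = mat 1 *v x"
      unfolding matrix_vector_mul_assoc[symmetric] givens_vector[OF assms(1)]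
      using assms(1) cs by (auto simp: vec_eq_iff scaleR_right_diff_distrib
          scaleR_right_distrib distrib_left right_diff_distrib u mult.commute[of s c] cancel)
  qed
qed

lemma givens_unitary:
  assumes "i \<noteq> j" "norm u = 1" "c\<^sup>2 + s\<^sup>2 = 1"
  shows "givens i j u c s \<in> unitary_group"
  using givens_mult_inverse[OF assms] givens_mult_inverse[of i j u c "- s"] assms
  by (simp add: unitary_group_def mstar_givens)

lemma inner_mat_1_givens:
  fixes u :: "'f::star_algebra"
  assumes "i \<noteq> j"
  shows "inner (mat 1) (givens i j u c s ** X) = inner (mat 1) X
    + (c - 1) * (inner 1 (X $ i $ i) + inner 1 (X $ j $ j)) + s * inner u (fconj (X $ j $ i) - X $ i $ j)"
proof -
  have "inner (mat 1) (givens i j u c s ** X) = inner (givens i j u c s) (mstar X)"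
    by (rule inner_mat_1_mult)
  also have "\<dots> = inner (mat 1) (mstar X) + (c - 1) * (inner 1 (fconj (X $ i $ i)) + inner 1 (fconj (X $ j $ j)))
     + s * (inner u (fconj (X $ j $ i)) - inner (fconj u) (fconj (X $ i $ j)))"
    by (simp add: givens_def inner_add_left inner_diff_left inner_axis')
  also have "inner (mat 1) (mstar X) = inner (mat 1) X"
    by (rule inner_mat_1_mstar)
  finally have "inner (mat 1) (givens i j u c s ** X) = inner (mat 1) X
    + (c - 1) * (inner 1 (fconj (X $ i $ i)) + inner 1 (fconj (X $ j $ j)))
    + s * (inner u (fconj (X $ j $ i)) - inner (fconj u) (fconj (X $ i $ j)))" .
  moreover have "inner 1 (fconj y) = inner 1 y" for y :: 'f
    using inner_fconj_fconj[of 1 y] by simp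
  ultimately show ?thesis
    by (simp add: inner_fconj_fconj inner_diff_right)
qed

text \<open>To first order in s a rotation changes the real trace by s times the inner product of u
  with w, the difference of the two entries. At a maximum this vanishes for every u. An explicit
  rotation replaces the derivative.\<close>

lemma givens_stationary:
  assumes "i \<noteq> j"
    and max: "\<And>u c s. norm u = 1 \<Longrightarrow> c\<^sup>2 + s\<^sup>2 = 1 \<Longrightarrow>
      inner (mat 1) (givens i j u c s ** X) \<le> inner (mat 1) X"
  shows "X $ i $ j = fconj (X $ j $ i)"
proof (rule ccontr)
  define w where "w = fconj (X $ j $ i) - X $ i $ j"
  define a where "a = inner 1 (X $ i $ i) + inner 1 (X $ j $ j)"
  assume "X $ i $ j \<noteq> fconj (X $ j $ i)"
  then have w: "w \<noteq> 0" by (auto simp: w_def)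
  define b where "b = norm w"
  define u where "u = w /\<^sub>R norm w"
  have b: "b > 0" "inner u w = b" "norm u = 1"
    using w by (simp_all add: b_def u_def dot_square_norm power2_eq_square)
  \<comment> \<open>Tangent of the half angle of the rotation: c = (1 - \<tau>^2) / (1 + \<tau>^2)
    and s = 2 \<tau> / (1 + \<tau>^2). The gain is 2 (\<tau> b - \<tau>^2 a) / (1 + \<tau>^2), so
    \<tau> has to stay below b / a when a > 0; the denominator |a| + 1 achieves this for every
    a.\<close>
  define \<tau> where "\<tau> = b / (\<bar>a\<bar> + 1)"
  have \<tau>: "1 + \<tau>\<^sup>2 > 0" by (simp add: add_pos_nonneg)
  have "((1 - \<tau>\<^sup>2) / (1 + \<tau>\<^sup>2))\<^sup>2 + (2 * \<tau> / (1 + \<tau>\<^sup>2))\<^sup>2 = ((1 - \<tau>\<^sup>2)\<^sup>2 + (2 * \<tau>)\<^sup>2) / (1 + \<tau>\<^sup>2)\<^sup>2"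
    by (simp add: power_divide add_divide_distrib)
  also have "(1 - \<tau>\<^sup>2)\<^sup>2 + (2 * \<tau>)\<^sup>2 = (1 + \<tau>\<^sup>2)\<^sup>2"
    by (simp add: power2_eq_square algebra_simps)
  finally have "((1 - \<tau>\<^sup>2) / (1 + \<tau>\<^sup>2))\<^sup>2 + (2 * \<tau> / (1 + \<tau>\<^sup>2))\<^sup>2 = 1"
    using \<tau> by simp
  from max[OF b(3) this] have "((1 - \<tau>\<^sup>2) / (1 + \<tau>\<^sup>2) - 1) * a + (2 * \<tau> / (1 + \<tau>\<^sup>2)) * b \<le> 0"
    unfolding inner_mat_1_givens[OF assms(1)] using b(2) by (simp add: a_def w_def)
  moreover have "((1 - \<tau>\<^sup>2) / (1 + \<tau>\<^sup>2) - 1) * a + (2 * \<tau> / (1 + \<tau>\<^sup>2)) * b = 2 * (\<tau> * b - \<tau>\<^sup>2 * a) / (1 + \<tau>\<^sup>2)"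
  proof -
    have "(1 - \<tau>\<^sup>2) / (1 + \<tau>\<^sup>2) - 1 = - 2 * \<tau>\<^sup>2 / (1 + \<tau>\<^sup>2)"
      using \<tau> by (simp add: field_simps)
    then show ?thesis by (simp add: diff_divide_distrib)
  qed
  ultimately have "\<tau> * b - \<tau>\<^sup>2 * a \<le> 0"
    using \<tau> by (simp add: divide_le_0_iff)
  moreover have "\<tau> * b - \<tau>\<^sup>2 * a = (b / (\<bar>a\<bar> + 1))\<^sup>2 * (\<bar>a\<bar> + 1 - a)"
  proof -
    have "b = \<tau> * (\<bar>a\<bar> + 1)" by (simp add: \<tau>_def add_nonneg_eq_0_iff)
    then have "\<tau> * b = \<tau>\<^sup>2 * (\<bar>a\<bar> + 1)" by (simp add: power2_eq_square)
    then show ?thesis unfolding \<tau>_def[symmetric] by (simp add: algebra_simps)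
  qed
  moreover have "(b / (\<bar>a\<bar> + 1))\<^sup>2 * (\<bar>a\<bar> + 1 - a) > 0"
    using b by (intro mult_pos_pos) auto
  ultimately show False by simp
qed

definition phase :: "'n \<Rightarrow> 'f::star_algebra \<Rightarrow> 'f^'n^'n"
  where "phase i u = mat 1 + axis i (axis i (u - 1))"

lemma phase_vector: "phase i u *v x = (\<chi> k. if k = i then u * x $ i else x $ k)"
  unfolding phase_def matrix_vector_mult_add_rdistrib axis_axis_vector
  by (auto simp: vec_eq_iff axis_def algebra_simps)

lemma mstar_phase: "mstar (phase i u) = phase i (fconj u)"
  by (simp add: phase_def mstar_add mstar_axis_axis fconj_diff)

lemma phase_unitary:
  assumes "norm u = 1" shows "phase i u \<in> unitary_group"
proof -
  have u: "u * (fconj u * y) = y" "fconj u * (u * y) = y" for y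
    using assms fconj_mult_self[of u] self_mult_fconj[of u] by (simp_all flip: mult.assoc)
  show ?thesis
    unfolding unitary_group_def mem_Collect_eq mstar_phase matrix_eq matrix_vector_mul_assoc[symmetric]
    by (auto simp: phase_vector u vec_eq_iff)
qed

text \<open>Only the i-th diagonal entry x changes, and Re(u x) reaches |x| at u = conj(x) / |x|.
  Maximality at u = 1 gives Re x = |x|, and the squared distance of x from |x| is 2 |x|^2 - 2 |x| Re
  x.\<close>

lemma phase_stationary:
  fixes X :: "'f::star_algebra^'n^'n"
  assumes max: "\<And>u. norm u = 1 \<Longrightarrow> inner (mat 1) (phase i u ** X) \<le> inner (mat 1) X"
  shows "X $ i $ i = norm (X $ i $ i) *\<^sub>R 1"
proof -
  define x where "x = X $ i $ i"
  have phase: "inner (mat 1) (phase i u ** X) = inner (mat 1) X + inner (u - 1) (fconj x)" for u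
  proof -
    have "inner (mat 1) (phase i u ** X) = inner (phase i u) (mstar X)"
      by (rule inner_mat_1_mult)
    also have "\<dots> = inner (mat 1) (mstar X) + inner (u - 1) (fconj x)"
      by (simp add: phase_def inner_add_left inner_axis' x_def)
    also have "inner (mat 1) (mstar X) = inner (mat 1) X"
      by (rule inner_mat_1_mstar)
    finally show ?thesis .
  qed
  have "norm x \<le> inner 1 x"
  proof (cases "x = 0")
    case False
    then have "inner (fconj x /\<^sub>R norm x - 1) (fconj x) \<le> 0"
      using max[of "fconj x /\<^sub>R norm x"] phase by simp
    moreover have "inner (fconj x /\<^sub>R norm x) (fconj x) = norm x"
      using False by (simp add: inner_fconj_fconj dot_square_norm power2_eq_square)
    moreover have "inner 1 (fconj x) = inner 1 x"
      using inner_fconj_fconj[of 1 x] by simp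
    ultimately show ?thesis by (simp add: inner_diff_left)
  qed simp
  then have "norm x * norm x \<le> norm x * inner 1 x"
    by (rule mult_left_mono) simp
  moreover have "(norm (x - norm x *\<^sub>R 1))\<^sup>2 = 2 * (norm x * norm x) - 2 * (norm x * inner 1 x)"
  proof -
    have "inner 1 (1 :: 'f) = 1" "inner x x = norm x * norm x"
      using inner_1_of_real[of 1] by (simp_all add: dot_square_norm power2_eq_square)
    then show ?thesis
      unfolding power2_norm_eq_inner[of "x - norm x *\<^sub>R 1"]
      by (simp add: inner_diff_left inner_diff_right inner_commute[of x 1] algebra_simps)
  qed
  ultimately have "(norm (x - norm x *\<^sub>R 1))\<^sup>2 \<le> 0" by simp
  then show ?thesis by (simp add: x_def)
qed

section \<open>Singular values\<close>

text \<open>Maximising the weighted trace over a compact group containing the plane rotations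
  diagonalises a matrix; with pairwise different weights no induction on the size is needed.\<close>

lemma trace_maximizer:
  fixes M :: "'f::star_algebra^'n^'n" and c :: "real^'n"
  assumes "compact C" "mat 1 \<in> C" and C_mult: "\<And>P Q. P \<in> C \<Longrightarrow> Q \<in> C \<Longrightarrow> P ** Q \<in> C"
    and givens_C: "\<And>i j u a s. i \<noteq> j \<Longrightarrow> norm u = 1 \<Longrightarrow> a\<^sup>2 + s\<^sup>2 = 1 \<Longrightarrow> givens i j u a s \<in> C"
    and c: "\<And>i. c $ i > 0" "inj (($) c)"
  obtains P Q where "P \<in> C" "Q \<in> C" "\<And>i j. i \<noteq> j \<Longrightarrow> (P ** M ** Q) $ i $ j = 0"
    "\<And>P' Q'. P' \<in> C \<Longrightarrow> Q' \<in> C \<Longrightarrow> inner (mat 1) (P' ** (P ** M ** Q) ** Q' ** diag c)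
      \<le> inner (mat 1) (P ** M ** Q ** diag c)"
proof -
  define F where "F = (\<lambda>(P, Q). inner (mat 1) (P ** M ** Q ** diag c))"
  have "continuous_on (C \<times> C) F"
    unfolding F_def case_prod_beta by (intro continuous_intros)
  moreover have "compact (C \<times> C)" "C \<times> C \<noteq> {}"
    using assms(1,2) by (auto intro: compact_Times)
  ultimately obtain PQ where PQ: "PQ \<in> C \<times> C" "\<And>x. x \<in> C \<times> C \<Longrightarrow> F x \<le> F PQ"
    using continuous_attains_sup by metis
  obtain P Q where [simp]: "PQ = (P, Q)" by (cases PQ)
  define N where "N = P ** M ** Q"
  have max: "inner (mat 1) (P' ** N ** Q' ** diag c) \<le> inner (mat 1) (N ** diag c)"
    if "P' \<in> C" "Q' \<in> C" for P' Q'
    using PQ(2)[of "(P' ** P, Q ** Q')"] PQ(1) that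
    by (simp add: F_def N_def C_mult matrix_mul_assoc)
  have "N $ i $ j = 0" if "i \<noteq> j" for i j
  proof -
    have left: "inner (mat 1) (givens i j u a s ** (N ** diag c)) \<le> inner (mat 1) (N ** diag c)"
      if "norm u = 1" "a\<^sup>2 + s\<^sup>2 = 1" for u a s
      using max[OF givens_C[OF \<open>i \<noteq> j\<close> that] assms(2)] by (simp add: matrix_mul_assoc)
    have right: "inner (mat 1) (givens i j u a s ** (diag c ** N)) \<le> inner (mat 1) (diag c ** N)"
      if "norm u = 1" "a\<^sup>2 + s\<^sup>2 = 1" for u a s
    proof -
      have "inner (mat 1) (N ** givens i j u a s ** diag c) \<le> inner (mat 1) (N ** diag c)"
        using max[OF assms(2) givens_C[OF \<open>i \<noteq> j\<close> that]] by simp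
      moreover have "inner (mat 1) (N ** givens i j u a s ** diag c)
          = inner (mat 1) (givens i j u a s ** (diag c ** N))"
        using inner_mat_1_commute[of N "givens i j u a s ** diag c"] by (simp add: matrix_mul_assoc)
      ultimately show ?thesis
        using inner_mat_1_commute[of N "diag c"] by simp
    qed
    \<comment> \<open>The weights stand on the right of \<open>N\<close>, so rotations from the left
      and from the right give two different relations between N_ij and conj(N_ji). Eliminating the
      latter yields (c_j^2 - c_i^2) N_ij = 0.\<close>
    have e1: "c $ j *\<^sub>R N $ i $ j = c $ i *\<^sub>R fconj (N $ j $ i)"
      using givens_stationary[OF \<open>i \<noteq> j\<close> left] by (simp add: fconj_mult of_real_def fconj_scaleR)
    have e2: "c $ i *\<^sub>R N $ i $ j = c $ j *\<^sub>R fconj (N $ j $ i)"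
      using givens_stationary[OF \<open>i \<noteq> j\<close> right] by (simp add: fconj_mult of_real_def fconj_scaleR)
    have "(c $ j * c $ j) *\<^sub>R N $ i $ j = c $ j *\<^sub>R c $ i *\<^sub>R fconj (N $ j $ i)"
      by (simp only: e1 flip: scaleR_scaleR)
    also have "\<dots> = c $ i *\<^sub>R c $ j *\<^sub>R fconj (N $ j $ i)"
      by (simp add: mult.commute)
    also have "\<dots> = (c $ i * c $ i) *\<^sub>R N $ i $ j"
      by (simp only: e2 flip: scaleR_scaleR)
    finally have "(c $ j * c $ j) *\<^sub>R N $ i $ j = (c $ i * c $ i) *\<^sub>R N $ i $ j" .
    moreover have "c $ i \<noteq> c $ j"
      using c(2) that by (auto dest: injD)
    then have "c $ j * c $ j \<noteq> c $ i * c $ i"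
      using c(1)[of i] c(1)[of j] by (simp add: square_eq_iff)
    ultimately show ?thesis by simp
  qed
  then show ?thesis
    using that[of P Q] PQ(1) max by (simp add: N_def)
qed

text \<open>A quarter turn in the plane i, j exchanges two diagonal entries; the signs cancel in the
  conjugation. It plays the transposition in the rearrangement argument that orders the singular
  values.\<close>

lemma diag_swap:
  fixes r :: "real^'n"
  assumes "i \<noteq> j"
  shows "givens i j 1 0 1 ** diag r ** givens i j 1 0 (- 1)
    = (diag (\<chi> k. r $ (if k = i then j else if k = j then i else k)) :: 'f::star_algebra^'n^'n)"
  unfolding matrix_eq matrix_vector_mul_assoc[symmetric] givens_vector[OF assms] vec_eq_iff
  using assms by auto

lemma inner_mat_1_diag_mult_diag:
  "inner (mat 1) (diag a ** diag b :: 'f::star_algebra^'n^'n) = (\<Sum>k\<in>UNIV. a $ k * b $ k)"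
  by (simp add: diag_mult_diag inner_mat_1_diag)

text \<open>In the full unitary group the maximiser is tested further: against phases, which makes
  the diagonal real and nonnegative, and against transpositions, which by rearrangement orders the
  singular values as the weights are ordered.\<close>

theorem singular_value_decomposition_weighted:
  fixes M :: "'f::star_algebra^'n^'n" and c :: "real^'n"
  assumes c: "\<And>i. c $ i > 0" "inj (($) c)"
  obtains U V r where "U \<in> unitary_group" "V \<in> unitary_group" "M = U ** diag r ** V"
    "\<And>i. 0 \<le> r $ i" "\<And>i j. c $ j < c $ i \<Longrightarrow> r $ j \<le> r $ i"
proof -
  obtain P Q where PQ: "P \<in> unitary_group" "Q \<in> unitary_group"
      and off: "\<And>i j. i \<noteq> j \<Longrightarrow> (P ** M ** Q) $ i $ j = 0"
      and max: "\<And>P' Q'. P' \<in> unitary_group \<Longrightarrow> Q' \<in> unitary_group \<Longrightarrow>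
        inner (mat 1) (P' ** (P ** M ** Q) ** Q' ** diag c) \<le> inner (mat 1) (P ** M ** Q ** diag c)"
    using trace_maximizer[OF compact_unitary_group unitary_mat_1 unitary_mult givens_unitary c, where M = M]
    by blast
  define N where "N = P ** M ** Q"
  define r where "r = (\<chi> i. norm (N $ i $ i))"
  have diag_N: "N $ i $ i = of_real (r $ i)" for i
  proof -
    have "inner (mat 1) (phase i u ** (N ** diag c)) \<le> inner (mat 1) (N ** diag c)" if "norm u = 1" for u
      using max[OF phase_unitary[OF that] unitary_mat_1] by (simp add: N_def matrix_mul_assoc)
    from phase_stationary[OF this]
    have "c $ i *\<^sub>R N $ i $ i = (norm (N $ i $ i) * c $ i) *\<^sub>R 1"
      using c(1)[of i] by (simp add: norm_mult of_real_def)
    also have "\<dots> = c $ i *\<^sub>R of_real (r $ i)"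
      by (simp add: r_def of_real_def mult.commute)
    finally show ?thesis
      using c(1)[of i] by simp
  qed
  have N: "N = diag r"
    unfolding vec_eq_iff
  proof (intro allI)
    fix i j show "N $ i $ j = diag r $ i $ j"
      using off[of i j] diag_N[of i] by (cases "i = j") (simp_all add: diag_nth N_def)
  qed
  have r_mono: "r $ j \<le> r $ i" if ij: "c $ j < c $ i" for i j
  proof -
    define \<pi> where "\<pi> = (\<lambda>k. if k = i then j else if k = j then i else k)"
    have "i \<noteq> j" using ij by auto
    have "inner (mat 1) (givens i j (1::'f) 0 1 ** diag r ** givens i j 1 0 (- 1) ** diag c)
        \<le> inner (mat 1) (diag r ** diag c :: 'f^'n^'n)"
      using max[OF givens_unitary[OF \<open>i \<noteq> j\<close>] givens_unitary[OF \<open>i \<noteq> j\<close>], of 1 0 1 1 0 "-1"]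
      by (simp add: N flip: N_def)
    then have "(\<Sum>k\<in>UNIV. r $ (\<pi> k) * c $ k) \<le> (\<Sum>k\<in>UNIV. r $ k * c $ k)"
      unfolding diag_swap[OF \<open>i \<noteq> j\<close>] inner_mat_1_diag_mult_diag by (simp add: \<pi>_def)
    moreover have "(\<Sum>k\<in>UNIV. h k) = h i + h j + (\<Sum>k\<in>UNIV - {i, j}. h k)" for h :: "'n \<Rightarrow> real"
      using \<open>i \<noteq> j\<close> by (simp add: sum.remove[of UNIV i] sum.remove[of "UNIV - {i}" j]
          Diff_insert[of UNIV j "{i}"] insert_commute[of i j])
    moreover have "(\<Sum>k\<in>UNIV - {i, j}. r $ (\<pi> k) * c $ k) = (\<Sum>k\<in>UNIV - {i, j}. r $ k * c $ k)"
      by (intro sum.cong) (auto simp: \<pi>_def)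
    ultimately have "r $ j * c $ i + r $ i * c $ j \<le> r $ i * c $ i + r $ j * c $ j"
      using \<open>i \<noteq> j\<close> by (simp add: \<pi>_def)
    then have "0 \<le> (r $ i - r $ j) * (c $ i - c $ j)"
      by (simp add: algebra_simps)
    then show ?thesis
      using ij by (simp add: zero_le_mult_iff)
  qed
  have "mstar P ** N ** mstar Q = (mstar P ** P) ** M ** (Q ** mstar Q)"
    by (simp add: N_def matrix_mul_assoc)
  then have "M = mstar P ** diag r ** mstar Q"
    using PQ by (simp add: unitary_groupD N)
  then show ?thesis
    using that[of "mstar P" "mstar Q" r] PQ r_mono by (simp add: unitary_mstar r_def)
qed

theorem singular_value_decomposition:
  fixes M :: "'f::star_algebra^'n^'n"
  obtains U V r where "U \<in> unitary_group" "V \<in> unitary_group" "M = U ** diag r ** V" "\<And>i. 0 \<le> r $ i"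
proof -
  obtain f :: "'n \<Rightarrow> nat" where f: "inj f"
    using finite_imp_inj_to_nat_seg[of "UNIV :: 'n set"] by auto
  have "inj (($) (\<chi> i. real (f i) + 1))"
    using f by (auto simp: inj_def)
  then show ?thesis
    using singular_value_decomposition_weighted[of "\<chi> i. real (f i) + 1" M] that by auto
qed

theorem singular_value_decomposition_sorted:
  fixes M :: "'f::star_algebra^'n::{finite,linorder}^'n::{finite,linorder}"
  obtains U V r where "U \<in> unitary_group" "V \<in> unitary_group" "M = U ** diag r ** V" "r \<in> chamber"
proof -
  \<comment> \<open>Counts the indices from i on. These weights strictly decrease, so the singular
    values come out in decreasing order.\<close>
  define c :: "(real, 'n) vec" where "c = (\<chi> i. real (card {k. i \<le> k}))"
  have less: "c $ j < c $ i" if "i < j" for i j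
  proof -
    have "i \<in> {k. i \<le> k}" "i \<notin> {k. j \<le> k}" using that by auto
    moreover have "{k. j \<le> k} \<subseteq> {k. i \<le> k}" using that by auto
    ultimately have "{k. j \<le> k} \<subset> {k. i \<le> k}" by blast
    then show ?thesis by (auto simp: c_def intro: psubset_card_mono)
  qed
  have c: "\<And>i. 0 < c $ i" "inj (($) c)"
  proof -
    show "0 < c $ i" for i by (auto simp: c_def card_gt_0_iff)
    show "inj (($) c)"
    proof (rule injI)
      fix i j assume "c $ i = c $ j"
      then show "i = j" using less[of i j] less[of j i] by (cases i j rule: linorder_cases) auto
    qed
  qed
  obtain U V r where UVr: "U \<in> unitary_group" "V \<in> unitary_group" "M = U ** diag r ** V"
    "\<And>i. 0 \<le> r $ i" "\<And>i j. c $ j < c $ i \<Longrightarrow> r $ j \<le> r $ i"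
    using singular_value_decomposition_weighted[OF c, of M] by metis
  have "r $ j \<le> r $ i" if "i \<le> j" for i j
    using UVr(5)[OF less, of i j] that by (cases "i = j") auto
  then have "r \<in> chamber"
    using UVr(4) by (auto simp: chamber_def)
  then show ?thesis using that UVr by blast
qed

section \<open>Positive semidefinite matrices\<close>

definition psd :: "'f::star_algebra^'n^'n \<Rightarrow> bool"
  where "psd A \<longleftrightarrow> mstar A = A \<and> (\<forall>x. 0 \<le> inner x (A *v x))"

lemma inner_diag_vector:
  "inner x (diag s *v x) = (\<Sum>i\<in>UNIV. s $ i * (norm (x $ i :: 'f::star_algebra))\<^sup>2)"
  by (simp add: inner_vec_def of_real_def dot_square_norm)

lemma psd_diag: "(\<And>i. 0 \<le> s $ i) \<Longrightarrow> psd (diag s :: 'f::star_algebra^'n^'n)"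
  by (simp add: psd_def inner_diag_vector sum_nonneg)

lemma inner_congruence:
  "inner x ((mstar A ** S ** A) *v x) = inner (A *v x) (S *v (A *v (x :: 'f::star_algebra^'n)))"
  unfolding matrix_vector_mul_assoc[symmetric] inner_matrix_vector_right[of x "mstar A"] by simp

lemma inner_gram: "inner x ((mstar A ** A) *v x) = (norm (A *v (x :: 'f::star_algebra^'n)))\<^sup>2"
  using inner_congruence[of x A "mat 1"] by (simp add: dot_square_norm)

lemma psd_congruence:
  assumes "psd S" shows "psd (mstar A ** S ** (A :: 'f::star_algebra^'n^'m))"
  using assms by (simp add: psd_def mstar_mult matrix_mul_assoc inner_congruence)

text \<open>\<open>N\<close> commutes with its square, hence entry by entry with
  \<open>diag s\<close>, so (N + diag s) E = 0 for E = N - diag s. On the range of E the nonnegative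
  forms of \<open>N\<close> and \<open>diag s\<close> add up to 0, so both matrices vanish there.
  Thus E kills its own range and, being Hermitian, is 0.\<close>

lemma psd_sqrt_unique_diag:
  fixes N :: "'f::star_algebra^'n^'n"
  assumes "psd N" "\<And>i. 0 \<le> s $ i" "N ** N = diag s ** diag s"
  shows "N = diag s"
proof -
  have "N ** (diag s ** diag s) = (diag s ** diag s) ** N"
    unfolding assms(3)[symmetric] by (rule matrix_mul_assoc)
  then have eq: "(s $ j * s $ j) *\<^sub>R N $ i $ j = (s $ i * s $ i) *\<^sub>R N $ i $ j" for i j
    by (simp add: diag_mult_diag vec_eq_iff) (simp add: of_real_def)
  have "s $ j *\<^sub>R N $ i $ j = s $ i *\<^sub>R N $ i $ j" for i j
    using eq[of j i] assms(2)[of i] assms(2)[of j] by (cases "N $ i $ j = 0") (auto simp: square_eq_iff)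
  then have comm: "N ** diag s = diag s ** N"
    by (simp add: vec_eq_iff) (simp add: of_real_def)
  define E where "E = N - diag s"
  have "(N + diag s) ** E = 0"
    by (simp add: E_def matrix_add_rdistrib matrix_diff_ldistrib assms(3) comm)
  have "E *v x = 0" for x
  proof -
    define y where "y = E *v x"
    have "(N + diag s) *v y = 0"
      using \<open>(N + diag s) ** E = 0\<close> by (simp add: y_def matrix_vector_mul_assoc)
    then have "inner y (N *v y) + inner y (diag s *v y) = 0"
      by (simp add: matrix_vector_mult_add_rdistrib flip: inner_add_right)
    moreover have "0 \<le> inner y (N *v y)" "0 \<le> inner y (diag s *v y)"
      using assms(1) psd_diag[of s] assms(2) by (auto simp: psd_def)
    ultimately have "inner y (diag s *v y) = 0" by simp
    then have "s $ i * (norm (y $ i))\<^sup>2 = 0" for i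
      unfolding inner_diag_vector using assms(2) by (subst (asm) sum_nonneg_eq_0_iff) auto
    then have s0: "diag s *v y = 0"
      by (auto simp: vec_eq_iff)
    then have "N *v y = 0"
      using \<open>(N + diag s) *v y = 0\<close> by (simp add: matrix_vector_mult_add_rdistrib)
    then have "E *v y = 0" using s0 by (simp add: E_def matrix_vector_mult_diff_rdistrib)
    moreover have "mstar E = E" using assms(1) by (simp add: E_def mstar_diff psd_def)
    ultimately have "inner y y = 0"
      using inner_matrix_vector[of E x y] by (simp add: y_def)
    then show ?thesis by (simp add: y_def)
  qed
  then have "E = 0" by (simp add: matrix_eq)
  then show ?thesis by (simp add: E_def)
qed

lemma unitary_cancel:
  assumes "Q \<in> unitary_group"
  shows "A ** mstar Q ** Q = (A :: 'f::star_algebra^'n^'m)" "A ** Q ** mstar Q = A"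
    "mstar Q ** (Q ** B) = (B :: 'f::star_algebra^'m^'n)" "Q ** (mstar Q ** B) = B"
  using unitary_groupD[OF assms] by (simp_all flip: matrix_mul_assoc) (simp_all add: matrix_mul_assoc)

text \<open>The spectral theorem from a singular value decomposition
  \<open>P ** diag s ** Q\<close>: the matrix \<open>Q ** S ** mstar Q\<close> is positive
  semidefinite with the square of \<open>diag s\<close>, so uniqueness of square roots identifies it
  with \<open>diag s\<close>.\<close>

lemma psd_spectral:
  fixes S :: "'f::star_algebra^'n^'n"
  assumes "psd S"
  obtains Q s where "Q \<in> unitary_group" "\<And>i. 0 \<le> s $ i" "S = mstar Q ** diag s ** Q"
proof -
  obtain P Q s where PQs: "P \<in> unitary_group" "Q \<in> unitary_group" "S = P ** diag s ** Q" "\<And>i. 0 \<le> s $ i"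
    using singular_value_decomposition[of S] by blast
  define N where "N = Q ** S ** mstar Q"
  have "S ** S = mstar S ** S" using assms by (simp add: psd_def)
  also have "\<dots> = mstar Q ** diag s ** (mstar P ** P) ** diag s ** Q"
    by (simp add: PQs(3) mstar_mult matrix_mul_assoc)
  finally have SS: "S ** S = mstar Q ** diag s ** diag s ** Q"
    using PQs by (simp add: unitary_groupD)
  have "N ** N = Q ** (S ** S) ** mstar Q"
    by (simp add: N_def matrix_mul_assoc unitary_cancel(1)[OF PQs(2)])
  also have "\<dots> = diag s ** diag s"
    unfolding SS by (simp add: matrix_mul_assoc unitary_groupD[OF PQs(2)] unitary_cancel(2)[OF PQs(2)])
  finally have "N ** N = diag s ** diag s" .
  moreover have "psd N"
    using psd_congruence[OF assms, of "mstar Q"] by (simp add: N_def)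
  ultimately have "N = diag s" using psd_sqrt_unique_diag PQs(4) by blast
  then have "mstar Q ** diag s ** Q = mstar Q ** N ** Q" by simp
  also have "\<dots> = S"
    by (simp add: N_def matrix_mul_assoc unitary_groupD[OF PQs(2)] unitary_cancel(1)[OF PQs(2)])
  finally have "S = mstar Q ** diag s ** Q" ..
  then show ?thesis using that PQs by metis
qed

lemma psd_sqrt_unique:
  fixes S T :: "'f::star_algebra^'n^'n"
  assumes "psd S" "psd T" "T ** T = S ** S"
  shows "T = S"
proof -
  obtain Q s where Q: "Q \<in> unitary_group" "\<And>i. 0 \<le> s $ i" "S = mstar Q ** diag s ** Q"
    using psd_spectral[OF assms(1)] by metis
  have QSQ: "Q ** S ** mstar Q = diag s"
    by (simp add: Q(3) matrix_mul_assoc unitary_groupD[OF Q(1)] unitary_cancel(2)[OF Q(1)])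
  have "(Q ** T ** mstar Q) ** (Q ** T ** mstar Q) = Q ** (T ** T) ** mstar Q"
    by (simp add: matrix_mul_assoc unitary_cancel(1)[OF Q(1)])
  also have "\<dots> = (Q ** S ** mstar Q) ** (Q ** S ** mstar Q)"
    unfolding assms(3) by (simp add: matrix_mul_assoc unitary_cancel(1)[OF Q(1)])
  finally have "Q ** T ** mstar Q = diag s"
    unfolding QSQ using psd_congruence[OF assms(2), of "mstar Q"] Q(2)
    by (intro psd_sqrt_unique_diag) auto
  then have "mstar Q ** (Q ** T ** mstar Q) ** Q = S" by (simp add: Q(3))
  then show ?thesis
    by (simp add: matrix_mul_assoc unitary_groupD[OF Q(1)] unitary_cancel(1)[OF Q(1)])
qed

text \<open>The singular value decomposition supplies some polar decomposition, whose second factor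
  is \<open>T\<close> by uniqueness of square roots. Nothing is inverted, so \<open>T\<close> may be
  singular; completing frames below relies on that.\<close>

lemma polar_decomposition:
  fixes M :: "'f::star_algebra^'n^'n"
  assumes "psd T" "mstar M ** M = T ** T"
  obtains W where "W \<in> unitary_group" "M = W ** T"
proof -
  obtain P Q s where PQs: "P \<in> unitary_group" "Q \<in> unitary_group" "M = P ** diag s ** Q" "\<And>i. 0 \<le> s $ i"
    using singular_value_decomposition[of M] by blast
  define T' where "T' = mstar Q ** diag s ** Q"
  have "mstar M ** M = mstar Q ** diag s ** (mstar P ** P) ** diag s ** Q"
    by (simp add: PQs(3) mstar_mult matrix_mul_assoc)
  also have "\<dots> = T' ** T'"
    by (simp add: T'_def matrix_mul_assoc unitary_groupD[OF PQs(1)] unitary_cancel(2)[OF PQs(2)])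
  finally have "T' ** T' = T ** T" using assms(2) by simp
  moreover have "psd T'" unfolding T'_def by (intro psd_congruence psd_diag PQs(4))
  ultimately have "T' = T" using psd_sqrt_unique[OF assms(1)] by blast
  moreover have "M = (P ** Q) ** T'"
    by (simp add: T'_def PQs(3) matrix_mul_assoc unitary_cancel(2)[OF PQs(2)])
  ultimately show ?thesis using that[of "P ** Q"] unitary_mult[OF PQs(1,2)] by simp
qed

section \<open>Singular values in decreasing order\<close>

lemma down_closed_eq:
  fixes A B :: "'a::{finite,linorder} set"
  assumes "\<And>i j. i \<le> j \<Longrightarrow> j \<in> A \<Longrightarrow> i \<in> A" "\<And>i j. i \<le> j \<Longrightarrow> j \<in> B \<Longrightarrow> i \<in> B" "card A = card B"
  shows "A = B"
proof -
  have "A \<subseteq> B \<or> B \<subseteq> A"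
    using assms(1,2) by (meson linear subsetI)
  then show ?thesis
    using assms(3) by (metis card_subset_eq finite_code)
qed

text \<open>The superlevel sets of a decreasing vector are initial segments of the index order, so
  their cardinalities determine them, and the superlevel sets determine the vector.\<close>

lemma chamber_eqI:
  fixes r s :: "real^'q::{finite,linorder}"
  assumes "r \<in> chamber" "s \<in> chamber" "\<And>\<sigma>. 0 \<le> \<sigma> \<Longrightarrow> card {i. r $ i = \<sigma>} = card {i. s $ i = \<sigma>}"
  shows "r = s"
proof -
  have level: "{i. x \<le> r $ i} = {i. x \<le> s $ i}" if "0 \<le> x" for x
  proof (rule down_closed_eq)
    define R where "R = range (($) r) \<union> range (($) s)"
    have fib: "card {i. x \<le> v $ i} = (\<Sum>\<sigma>\<in>{\<sigma>\<in>R. x \<le> \<sigma>}. card {i. v $ i = \<sigma>})"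
      if "range (($) v) \<subseteq> R" for v
    proof -
      have "{i. x \<le> v $ i} = (\<Union>\<sigma>\<in>{\<sigma>\<in>R. x \<le> \<sigma>}. {i. v $ i = \<sigma>})"
        using that by auto
      also have "card \<dots> = (\<Sum>\<sigma>\<in>{\<sigma>\<in>R. x \<le> \<sigma>}. card {i. v $ i = \<sigma>})"
        by (rule card_UN_disjoint) (auto simp: R_def)
      finally show ?thesis .
    qed
    show "card {i. x \<le> r $ i} = card {i. x \<le> s $ i}"
      using assms(3) that by (subst (1 2) fib) (auto simp: R_def intro!: sum.cong)
  qed (use assms(1,2) in \<open>auto simp: chamber_def intro: order_trans\<close>)
  have "r $ i = s $ i" for i
  proof (rule antisym)
    have "i \<in> {k. r $ i \<le> s $ k}"
      by (subst level[symmetric]) (use assms(1) in \<open>auto simp: chamber_def\<close>)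
    then show "r $ i \<le> s $ i" by simp
    have "i \<in> {k. s $ i \<le> r $ k}"
      by (subst level) (use assms(2) in \<open>auto simp: chamber_def\<close>)
    then show "s $ i \<le> r $ i" by simp
  qed
  then show ?thesis by (simp add: vec_eq_iff)
qed

lemma dim_coordinate_subspace:
  "dim {x :: 'f::euclidean_space^'n. \<forall>i. i \<notin> I \<longrightarrow> x $ i = 0} = DIM('f) * card I"
proof -
  define d where "d = (\<lambda>(i, b). axis i b :: 'f^'n) ` (I \<times> Basis)"
  have "d \<subseteq> Basis" by (auto simp: d_def Basis_vec_def)
  have "{x :: 'f^'n. \<forall>i. i \<notin> I \<longrightarrow> x $ i = 0} = {x. \<forall>b\<in>Basis. b \<notin> d \<longrightarrow> inner x b = 0}"
  proof (intro Collect_cong iffI allI ballI impI)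
    fix x :: "'f^'n" and b assume x: "\<forall>i. i \<notin> I \<longrightarrow> x $ i = 0" and b: "b \<in> Basis" "b \<notin> d"
    then obtain i u where "b = axis i u" "u \<in> Basis" by (auto simp: Basis_vec_def)
    with b have "i \<notin> I" by (auto simp: d_def)
    with x \<open>b = axis i u\<close> show "inner x b = 0" by (simp add: inner_axis)
  next
    fix x :: "'f^'n" and i assume x: "\<forall>b\<in>Basis. b \<notin> d \<longrightarrow> inner x b = 0" and i: "i \<notin> I"
    have "inner (x $ i) u = 0" if "u \<in> Basis" for u
    proof -
      have "axis i u \<noteq> axis k v" if "k \<in> I" "v \<in> Basis" for k v
        using that \<open>u \<in> Basis\<close> i by (auto simp: axis_eq_axis nonzero_Basis)
      then have "axis i u \<notin> d" by (auto simp: d_def)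
      then show ?thesis using x that by (metis axis_in_Basis_iff inner_axis)
    qed
    then show "x $ i = 0" by (simp add: euclidean_eq_iff[of "x $ i"])
  qed
  also have "dim \<dots> = card d" by (rule dim_substandard[OF \<open>d \<subseteq> Basis\<close>])
  also have "inj_on (\<lambda>(i, b). axis i b :: 'f^'n) (I \<times> Basis)"
    by (auto simp: inj_on_def axis_eq_axis nonzero_Basis)
  then have "card d = DIM('f) * card I"
    by (simp add: d_def card_image card_cartesian_product)
  finally show ?thesis .
qed

text \<open>\<open>V\<close> carries the eigenspace of \<open>mstar M ** M\<close> onto the
  coordinate subspace where \<open>r $ i\<close> equals \<sigma>; nonnegativity turns equality of
  squares into equality. This links any decomposition, sorted or not, to the multiplicities in
  \<open>spec_s\<close>.\<close>

lemma dim_eigenspace_svd: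
  fixes M :: "'f::star_algebra^'n^'n"
  assumes "U \<in> unitary_group" "V \<in> unitary_group" "M = U ** diag r ** V" "\<And>i. 0 \<le> r $ i" "0 \<le> \<sigma>"
  shows "dim {v. (mstar M ** M) *v v = \<sigma>\<^sup>2 *\<^sub>R v} = DIM('f) * card {i. r $ i = \<sigma>}"
proof -
  define F where "F = {y :: 'f^'n. \<forall>i. i \<notin> {i. r $ i = \<sigma>} \<longrightarrow> y $ i = 0}"
  have F: "y \<in> F \<longleftrightarrow> diag r *v (diag r *v y) = \<sigma>\<^sup>2 *\<^sub>R y" for y
  proof -
    have "of_real (r $ i) * (of_real (r $ i) * y $ i) = \<sigma>\<^sup>2 *\<^sub>R y $ i \<longleftrightarrow> (r $ i = \<sigma> \<or> y $ i = 0)" for i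
    proof -
      have "of_real (r $ i) * (of_real (r $ i) * y $ i) = (r $ i)\<^sup>2 *\<^sub>R y $ i"
        by (simp add: of_real_def power2_eq_square)
      then show ?thesis
        using assms(4)[of i] assms(5) by (simp add: power2_eq_iff_nonneg)
    qed
    then show ?thesis by (auto simp: F_def vec_eq_iff)
  qed
  have MM: "mstar M ** M = mstar V ** (diag r ** diag r) ** V"
  proof -
    have "mstar M ** M = mstar V ** diag r ** (mstar U ** U) ** diag r ** V"
      by (simp add: assms(3) mstar_mult matrix_mul_assoc)
    then show ?thesis using assms(1) by (simp add: unitary_groupD matrix_mul_assoc)
  qed
  have VV: "V *v (mstar V *v y) = y" "mstar V *v (V *v y) = y" for y
    using unitary_groupD[OF assms(2)] by (simp_all add: matrix_vector_mul_assoc)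
  have "{v. (mstar M ** M) *v v = \<sigma>\<^sup>2 *\<^sub>R v} = (*v) (mstar V) ` F"
  proof (intro set_eqI iffI)
    fix v assume "v \<in> {v. (mstar M ** M) *v v = \<sigma>\<^sup>2 *\<^sub>R v}"
    then have "mstar V *v (diag r *v (diag r *v (V *v v))) = \<sigma>\<^sup>2 *\<^sub>R v"
      by (simp add: MM matrix_vector_mul_assoc matrix_mul_assoc)
    then have "V *v (mstar V *v (diag r *v (diag r *v (V *v v)))) = \<sigma>\<^sup>2 *\<^sub>R (V *v v)"
      by (simp add: matrix_vector_mult_scaleR_right)
    then have "V *v v \<in> F" by (simp add: F VV)
    then have "mstar V *v (V *v v) \<in> (*v) (mstar V) ` F" by (rule imageI)
    then show "v \<in> (*v) (mstar V) ` F" by (simp only: VV)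
  next
    fix v assume "v \<in> (*v) (mstar V) ` F"
    then obtain y where y: "v = mstar V *v y" "y \<in> F" by auto
    then have "mstar V *v (diag r *v (diag r *v (V *v v))) = \<sigma>\<^sup>2 *\<^sub>R v"
      by (simp add: VV F matrix_vector_mult_scaleR_right)
    then show "v \<in> {v. (mstar M ** M) *v v = \<sigma>\<^sup>2 *\<^sub>R v}"
      by (simp add: MM matrix_vector_mul_assoc matrix_mul_assoc)
  qed
  moreover have "dim ((*v) (mstar V) ` F) = dim F"
    by (rule dim_image_eq) (auto intro!: inj_on_inverseI[of _ "(*v) V"] simp: VV)
  ultimately show ?thesis
    using dim_coordinate_subspace[where 'f = 'f, of "{i. r $ i = \<sigma>}"] by (simp add: F_def)
qed

text \<open>A sorted decomposition has the multiplicities required by \<open>spec_s\<close>, and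
  \<open>chamber_eqI\<close> makes them determine the vector. This resolves the definite
  description.\<close>

lemma spec_s_eqI:
  fixes M :: "'f::star_algebra^'q::{finite,linorder}^'q::{finite,linorder}"
  assumes "U \<in> unitary_group" "V \<in> unitary_group" "M = U ** diag r ** V" "r \<in> chamber"
  shows "spec_s M = r"
proof -
  have r: "0 \<le> r $ i" for i using assms(4) by (simp add: chamber_def)
  note dim = dim_eigenspace_svd[OF assms(1-3) r]
  show ?thesis
    unfolding spec_s_def
  proof (rule the_equality)
    show "r \<in> chamber \<and> (\<forall>\<sigma>\<ge>0. DIM('f) * card {i. r $ i = \<sigma>} = dim {v. (mstar M ** M) *v v = \<sigma>\<^sup>2 *\<^sub>R v})"
      using dim assms(4) by simp
    fix s :: "(real, 'q) vec" assume "s \<in> chamber \<and> (\<forall>\<sigma>\<ge>0. DIM('f) * card {i. s $ i = \<sigma>} = dim {v. (mstar M ** M) *v v = \<sigma>\<^sup>2 *\<^sub>R v})"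
    then show "s = r"
      using dim assms(4) by (intro chamber_eqI) auto
  qed
qed

lemma spec_s_svd:
  fixes M :: "'f::star_algebra^'q::{finite,linorder}^'q::{finite,linorder}"
  obtains U V where "U \<in> unitary_group" "V \<in> unitary_group" "M = U ** diag (spec_s M) ** V" "spec_s M \<in> chamber"
proof -
  obtain U V r where UVr: "U \<in> unitary_group" "V \<in> unitary_group" "M = U ** diag r ** V" "r \<in> chamber"
    by (rule singular_value_decomposition_sorted[of M])
  then have "spec_s M = r" using spec_s_eqI by blast
  then show ?thesis using that UVr by metis
qed

lemma norm_diag: "norm (diag r :: 'f::star_algebra^'n^'n) = norm r"
proof -
  have "inner (diag r) (diag r :: 'f^'n^'n) = inner (mat 1) (diag r ** diag r :: 'f^'n^'n)"
    by (simp add: inner_mat_1_mult)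
  then show ?thesis
    unfolding norm_eq_sqrt_inner inner_mat_1_diag_mult_diag by (simp add: inner_vec_def)
qed

lemma norm_spec_s: "norm (spec_s M) = norm (M :: 'f::star_algebra^'q::{finite,linorder}^'q::{finite,linorder})"
proof -
  obtain U V where U: "U \<in> unitary_group" "V \<in> unitary_group" and M: "M = U ** diag (spec_s M) ** V"
    by (rule spec_s_svd[of M])
  have "norm M = norm (U ** diag (spec_s M) ** V)" by (rule arg_cong[OF M])
  then show ?thesis
    using U by (simp add: norm_unitary_mult_left norm_unitary_mult_right norm_diag)
qed

text \<open>The closed graph theorem with a locally bounded function in place of a compact range. It
  yields continuity of functions defined by closed relations without perturbation estimates.\<close>

lemma continuous_from_locally_closed_graph:
  fixes f :: "'a::euclidean_space \<Rightarrow> 'b::euclidean_space"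
  assumes "\<And>n. bounded (f ` cball 0 n)" "closed {(x, f x) | x. True}"
  shows "continuous_on UNIV f"
proof -
  have "isCont f x" for x
  proof -
    obtain B where B: "\<And>y. y \<in> cball 0 (norm x + 1) \<Longrightarrow> norm (f y) \<le> B"
      using assms(1)[of "norm x + 1"] unfolding bounded_iff by blast
    have "(\<lambda>y. (y, f y)) ` cball 0 (norm x + 1) = {(x, f x) | x. True} \<inter> cball 0 (norm x + 1) \<times> UNIV"
      by auto
    then have "closed ((\<lambda>y. (y, f y)) ` cball 0 (norm x + 1))"
      using assms(2) by (auto intro!: closed_Int closed_Times)
    then have "continuous_on (cball 0 (norm x + 1)) f"
      using B by (intro continuous_from_closed_graph[of "cball 0 B"]) auto
    moreover have "x \<in> interior (cball 0 (norm x + 1))" by simp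
    ultimately show ?thesis by (rule continuous_on_interior)
  qed
  then show ?thesis by (simp add: continuous_on_eq_continuous_within)
qed

text \<open>The graph consists of the pairs (M, r) with sorted \<open>r\<close> and M = U diag(r) V
  for some unitary U, V. It is the projection of a closed set along the compact group of pairs (U,
  V), hence closed.\<close>

lemma continuous_spec_s:
  "continuous_on UNIV (spec_s :: 'f::star_algebra^'q::{finite,linorder}^'q::{finite,linorder} \<Rightarrow> _)"
proof (rule continuous_from_locally_closed_graph)
  show "bounded (spec_s ` (cball 0 n :: (('f, 'q) vec, 'q) vec set))" for n
    unfolding bounded_iff by (rule exI[of _ n]) (auto simp: norm_spec_s)
  have "closed {(M, r). r \<in> chamber \<and> (\<exists>UV \<in> unitary_group \<times> unitary_group. M = fst UV ** diag r ** (snd UV :: (('f, 'q) vec, 'q) vec))}"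
  proof -
    have "closed {z :: ((('f, 'q) vec, 'q) vec \<times> (('f, 'q) vec, 'q) vec) \<times> ((('f, 'q) vec, 'q) vec \<times> (real, 'q) vec).
      fst (snd z) = fst (fst z) ** diag (snd (snd z)) ** snd (fst z)}"
      by (intro closed_Collect_eq continuous_intros)
    moreover have "compact (unitary_group \<times> unitary_group :: ((('f, 'q) vec, 'q) vec \<times> (('f, 'q) vec, 'q) vec) set)"
      by (intro compact_Times compact_unitary_group)
    ultimately have "closed {y. \<exists>x. x \<in> unitary_group \<times> unitary_group \<and> (x, y) \<in> {z :: ((('f, 'q) vec, 'q) vec \<times> (('f, 'q) vec, 'q) vec) \<times> ((('f, 'q) vec, 'q) vec \<times> (real, 'q) vec).
      fst (snd z) = fst (fst z) ** diag (snd (snd z)) ** snd (fst z)}}"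
      by (rule closed_compact_projection[rotated])
    moreover have "closed (UNIV \<times> chamber :: ((('f, 'q) vec, 'q) vec \<times> (real, 'q) vec) set)"
    proof -
      have "closed (chamber :: (real, 'q) vec set)"
        unfolding chamber_def by (intro closed_Collect_conj closed_Collect_all closed_Collect_imp
            closed_Collect_le open_Collect_const continuous_intros)
      then show ?thesis by (intro closed_Times closed_UNIV)
    qed
    ultimately have "closed ({y. \<exists>x. x \<in> unitary_group \<times> unitary_group \<and> (x, y) \<in> {z :: ((('f, 'q) vec, 'q) vec \<times> (('f, 'q) vec, 'q) vec) \<times> ((('f, 'q) vec, 'q) vec \<times> (real, 'q) vec).
      fst (snd z) = fst (fst z) ** diag (snd (snd z)) ** snd (fst z)}} \<inter> UNIV \<times> chamber)"
      by (rule closed_Int)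
    also have "\<dots> = {(M, r). r \<in> chamber \<and> (\<exists>UV \<in> unitary_group \<times> unitary_group. M = fst UV ** diag r ** snd UV)}"
      by auto blast+
    finally show ?thesis .
  qed
  also have "\<dots> = {(M, spec_s M) | M. True}"
  proof (intro set_eqI iffI)
    fix x :: "(('f, 'q) vec, 'q) vec \<times> (real, 'q) vec"
    assume "x \<in> {(M, spec_s M) | M. True}"
    then obtain M where x: "x = (M, spec_s M)" by auto
    obtain U V where "U \<in> unitary_group" "V \<in> unitary_group" "M = U ** diag (spec_s M) ** V" "spec_s M \<in> chamber"
      by (rule spec_s_svd[of M])
    then show "x \<in> {(M, r). r \<in> chamber \<and> (\<exists>UV \<in> unitary_group \<times> unitary_group. M = fst UV ** diag r ** snd UV)}"
      unfolding x by force
  qed (auto simp: spec_s_eqI)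
  finally show "closed {(M, spec_s M :: (real, 'q) vec) | M :: (('f, 'q) vec, 'q) vec. True}" .
qed

section \<open>The absolute determinant and positive definite matrices\<close>

text \<open>Over the real and complex numbers this is the absolute value of the determinant, over
  the quaternions the square root of that of the complex 2q x 2q matrix (a Dieudonne
  determinant).\<close>

definition adet :: "'f::star_algebra^'q::{finite,linorder}^'q::{finite,linorder} \<Rightarrow> real"
  where "adet M = (\<Prod>i\<in>UNIV. spec_s M $ i)"

text \<open>Here \<open>r\<close> need not be sorted. Its level sets have the cardinalities of those
  of \<open>spec_s M\<close>, since both count eigenspace dimensions, and the product depends on
  these cardinalities alone.\<close>

lemma adet_svd:
  fixes M :: "'f::star_algebra^'q::{finite,linorder}^'q::{finite,linorder}"
  assumes "U \<in> unitary_group" "V \<in> unitary_group" "M = U ** diag r ** V" "\<And>i. 0 \<le> r $ i"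
  shows "adet M = (\<Prod>i\<in>UNIV. r $ i)"
proof -
  obtain U' V' where UV: "U' \<in> unitary_group" "V' \<in> unitary_group" "M = U' ** diag (spec_s M) ** V'" "spec_s M \<in> chamber"
    by (rule spec_s_svd[of M])
  define s where "s = spec_s M"
  have s: "0 \<le> s $ i" for i using UV(4) by (simp add: chamber_def s_def)
  have card: "card {i. r $ i = \<sigma>} = card {i. s $ i = \<sigma>}" if "0 \<le> \<sigma>" for \<sigma>
    using dim_eigenspace_svd[OF assms that] dim_eigenspace_svd[OF UV(1,2) UV(3)[folded s_def] s that] by simp
  define R where "R = range (($) r) \<union> range (($) s)"
  have fib: "(\<Prod>i\<in>UNIV. v $ i) = (\<Prod>\<sigma>\<in>R. \<sigma> ^ card {i. v $ i = \<sigma>})"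
    if "range (($) v) \<subseteq> R" for v :: "(real, 'q) vec"
  proof -
    have "(\<Prod>i\<in>UNIV. v $ i) = (\<Prod>\<sigma>\<in>R. \<Prod>i\<in>{i\<in>UNIV. v $ i = \<sigma>}. v $ i)"
      using that by (subst prod.group) (auto simp: R_def)
    also have "\<dots> = (\<Prod>\<sigma>\<in>R. \<sigma> ^ card {i. v $ i = \<sigma>})"
      by (intro prod.cong) auto
    finally show ?thesis .
  qed
  have "(\<Prod>\<sigma>\<in>R. \<sigma> ^ card {i. r $ i = \<sigma>}) = (\<Prod>\<sigma>\<in>R. \<sigma> ^ card {i. s $ i = \<sigma>})"
    using card assms(4) s by (intro prod.cong) (auto simp: R_def)
  then show ?thesis
    using fib[of r] fib[of s] by (simp add: R_def adet_def s_def)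
qed

lemma adet_diag:
  "(\<And>i. 0 \<le> r $ i) \<Longrightarrow> adet (diag r :: 'f::star_algebra^'q::{finite,linorder}^'q::{finite,linorder}) = (\<Prod>i\<in>UNIV. r $ i)"
  using adet_svd[OF unitary_mat_1 unitary_mat_1, of "diag r" r] by simp

lemma adet_mat_1 [simp]: "adet (mat 1 :: 'f::star_algebra^'q::{finite,linorder}^'q::{finite,linorder}) = 1"
  unfolding diag_1[symmetric] by (subst adet_diag) simp_all

lemma adet_nonneg [simp]: "0 \<le> adet M"
proof -
  obtain U V where "spec_s M \<in> chamber"
    using spec_s_svd[of M] by blast
  then show ?thesis by (auto simp: adet_def chamber_def intro!: prod_nonneg)
qed

lemma continuous_on_adet [continuous_intros]:
  "continuous_on S f \<Longrightarrow> continuous_on S (\<lambda>x. adet (f x :: 'f::star_algebra^'q::{finite,linorder}^'q::{finite,linorder}))"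
  unfolding adet_def
  by (intro continuous_on_prod continuous_on_component continuous_on_compose2[OF continuous_spec_s]) auto

lemma adet_unitary_mult:
  fixes M :: "'f::star_algebra^'q::{finite,linorder}^'q::{finite,linorder}"
  assumes "U \<in> unitary_group" "V \<in> unitary_group"
  shows "adet (U ** M ** V) = adet M"
proof -
  obtain U' V' where UV: "U' \<in> unitary_group" "V' \<in> unitary_group" "M = U' ** diag (spec_s M) ** V'" "spec_s M \<in> chamber"
    by (rule spec_s_svd[of M])
  then have s: "0 \<le> spec_s M $ i" for i by (simp add: chamber_def)
  have "U ** M ** V = U ** (U' ** diag (spec_s M) ** V') ** V"
    by (rule arg_cong[OF UV(3)])
  also have "\<dots> = (U ** U') ** diag (spec_s M) ** (V' ** V)"
    by (simp add: matrix_mul_assoc)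
  finally show ?thesis
    using adet_svd[OF unitary_mult[OF assms(1) UV(1)] unitary_mult[OF UV(2) assms(2)] _ s]
    by (simp add: adet_def)
qed

lemma adet_mstar [simp]:
  fixes M :: "'f::star_algebra^'q::{finite,linorder}^'q::{finite,linorder}"
  shows "adet (mstar M) = adet M"
proof -
  obtain U V where UV: "U \<in> unitary_group" "V \<in> unitary_group" "M = U ** diag (spec_s M) ** V" "spec_s M \<in> chamber"
    by (rule spec_s_svd[of M])
  then have s: "0 \<le> spec_s M $ i" for i by (simp add: chamber_def)
  have "mstar M = mstar (U ** diag (spec_s M) ** V)"
    by (rule arg_cong[OF UV(3)])
  then have "mstar M = mstar V ** diag (spec_s M) ** mstar U"
    by (simp add: mstar_mult matrix_mul_assoc)
  then show ?thesis
    using adet_svd[OF unitary_mstar[OF UV(2)] unitary_mstar[OF UV(1)] _ s] by (simp add: adet_def)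
qed

lemma adet_nonzero_inverse:
  fixes M :: "'f::star_algebra^'q::{finite,linorder}^'q::{finite,linorder}"
  assumes "adet M \<noteq> 0"
  obtains N where "M ** N = mat 1" "N ** M = mat 1"
proof -
  obtain U V where UV: "U \<in> unitary_group" "V \<in> unitary_group" "M = U ** diag (spec_s M) ** V" "spec_s M \<in> chamber"
    by (rule spec_s_svd[of M])
  define s where "s = spec_s M"
  have "s $ i \<noteq> 0" for i using assms by (auto simp: adet_def s_def)
  then have D: "diag s ** diag (\<chi> i. 1 / s $ i) = (mat 1 :: (('f, 'q) vec, 'q) vec)"
    "diag (\<chi> i. 1 / s $ i) ** diag s = (mat 1 :: (('f, 'q) vec, 'q) vec)"
    by (simp_all add: diag_mult_diag flip: diag_1) (simp_all add: one_vec_def)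
  define N where "N = mstar V ** diag (\<chi> i. 1 / s $ i) ** mstar U"
  have M: "M = U ** diag s ** V" using UV(3) by (simp add: s_def)
  have "M ** N = U ** (diag s ** diag (\<chi> i. 1 / s $ i)) ** mstar U"
    by (simp add: M N_def matrix_mul_assoc unitary_cancel(2)[OF UV(2)])
  then have "M ** N = mat 1" by (simp add: D unitary_groupD[OF UV(1)])
  moreover have "N ** M = mstar V ** (diag (\<chi> i. 1 / s $ i) ** diag s) ** V"
    by (simp add: M N_def matrix_mul_assoc unitary_cancel(1)[OF UV(1)])
  then have "N ** M = mat 1" by (simp add: D unitary_groupD[OF UV(2)])
  ultimately show ?thesis using that by blast
qed

lemma adet_nonzero_iff:
  fixes M :: "'f::star_algebra^'q::{finite,linorder}^'q::{finite,linorder}"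
  shows "adet M \<noteq> 0 \<longleftrightarrow> (\<forall>x. M *v x = 0 \<longrightarrow> x = 0)"
proof
  assume "adet M \<noteq> 0"
  then obtain N where "N ** M = mat 1" by (rule adet_nonzero_inverse)
  then show "\<forall>x. M *v x = 0 \<longrightarrow> x = 0"
    by (metis matrix_vector_mul_assoc matrix_vector_mul_lid matrix_vector_mult_0_right)
next
  assume inj: "\<forall>x. M *v x = 0 \<longrightarrow> x = 0"
  obtain U V where UV: "U \<in> unitary_group" "V \<in> unitary_group" "M = U ** diag (spec_s M) ** V" "spec_s M \<in> chamber"
    by (rule spec_s_svd[of M])
  define s where "s = spec_s M"
  have "s $ i \<noteq> 0" for i
  proof
    assume "s $ i = 0"
    define x :: "('f, 'q) vec" where "x = mstar V *v axis i 1"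
    have "V *v x = axis i 1"
      by (simp add: x_def matrix_vector_mul_assoc unitary_groupD[OF UV(2)])
    then have "diag s *v (V *v x) = 0"
      using \<open>s $ i = 0\<close> by (auto simp: vec_eq_iff axis_def)
    then have "(U ** diag s ** V) *v x = 0"
      by (simp flip: matrix_vector_mul_assoc)
    then have "M *v x = 0"
      using UV(3) by (simp add: s_def)
    then have "x = 0" using inj by blast
    then have "axis i (1 :: 'f) = 0" using \<open>V *v x = axis i 1\<close> by simp
    then show False by (simp add: axis_eq_0_iff)
  qed
  then show "adet M \<noteq> 0" by (simp add: adet_def s_def)
qed

lemma psd_inner_zero:
  fixes S :: "'f::star_algebra^'n^'n"
  assumes "psd S" "inner x (S *v x) = 0"
  shows "S *v x = 0"
proof -
  obtain Q s where Q: "Q \<in> unitary_group" "\<And>i. 0 \<le> s $ i" "S = mstar Q ** diag s ** Q"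
    using psd_spectral[OF assms(1)] by metis
  have "(\<Sum>i\<in>UNIV. s $ i * (norm ((Q *v x) $ i))\<^sup>2) = 0"
    using assms(2) by (simp add: Q(3) inner_congruence inner_diag_vector)
  then have "s $ i * (norm ((Q *v x) $ i))\<^sup>2 = 0" for i
    using Q(2) by (subst (asm) sum_nonneg_eq_0_iff) auto
  then have "diag s *v (Q *v x) = 0" by (auto simp: vec_eq_iff)
  then show ?thesis by (simp add: Q(3) flip: matrix_vector_mul_assoc)
qed

lemma pos_definite_imp_psd:
  assumes "pos_definite S" shows "psd S"
proof -
  have "0 \<le> inner x (S *v x)" for x
    using assms by (cases "x = 0") (auto simp: pos_definite_def less_imp_le)
  then show ?thesis using assms by (auto simp: psd_def pos_definite_def)
qed

lemma pos_definite_iff: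
  fixes S :: "'f::star_algebra^'q::{finite,linorder}^'q::{finite,linorder}"
  shows "pos_definite S \<longleftrightarrow> psd S \<and> adet S \<noteq> 0"
proof
  assume S: "pos_definite S"
  have "x = 0" if "S *v x = 0" for x
    using S that unfolding pos_definite_def by fastforce
  then show "psd S \<and> adet S \<noteq> 0"
    using S by (auto simp: pos_definite_imp_psd adet_nonzero_iff)
next
  assume S: "psd S \<and> adet S \<noteq> 0"
  have "inner x (S *v x) > 0" if "x \<noteq> 0" for x
  proof -
    have "inner x (S *v x) \<noteq> 0"
      using psd_inner_zero[of S x] S that by (auto simp: adet_nonzero_iff)
    then show ?thesis using S by (auto simp: psd_def less_le)
  qed
  then show "pos_definite S" using S by (simp add: pos_definite_def psd_def)
qed

lemma pos_definite_spectral: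
  fixes S :: "'f::star_algebra^'q::{finite,linorder}^'q::{finite,linorder}"
  assumes "pos_definite S"
  obtains Q s where "Q \<in> unitary_group" "\<And>i. 0 < s $ i" "S = mstar Q ** diag s ** Q" "adet S = (\<Prod>i\<in>UNIV. s $ i)"
proof -
  obtain Q s where Q: "Q \<in> unitary_group" "\<And>i. 0 \<le> s $ i" "S = mstar Q ** diag s ** Q"
    using psd_spectral[of S] assms by (metis pos_definite_iff)
  have "adet S = (\<Prod>i\<in>UNIV. s $ i)"
    by (rule adet_svd[OF unitary_mstar[OF Q(1)] Q(1) Q(3) Q(2)])
  moreover have "s $ i \<noteq> 0" for i
    using assms calculation by (auto simp: pos_definite_iff)
  ultimately show ?thesis using that Q by (metis less_le)
qed

lemma pos_definite_diag:
  "(\<And>i. 0 < s $ i) \<Longrightarrow> pos_definite (diag s :: 'f::star_algebra^'q::{finite,linorder}^'q::{finite,linorder})"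
  by (auto simp: pos_definite_iff adet_diag less_imp_le psd_diag dest: less_imp_neq[symmetric])

lemma pos_definite_congruence_injective:
  fixes A :: "'f::star_algebra^'n^'m"
  assumes "pos_definite S" "\<And>x. A *v x = 0 \<Longrightarrow> x = 0"
  shows "pos_definite (mstar A ** S ** A)"
  using assms by (auto simp: pos_definite_def mstar_mult matrix_mul_assoc inner_congruence)

lemma pos_definite_mat_1: "pos_definite (mat 1 :: 'f::star_algebra^'n^'n)"
  by (simp add: pos_definite_def)

lemma pos_definite_gram:
  fixes A :: "'f::star_algebra^'n^'m"
  assumes "\<And>x. A *v x = 0 \<Longrightarrow> x = 0"
  shows "pos_definite (mstar A ** A)"
  using pos_definite_congruence_injective[OF pos_definite_mat_1 assms] by simp

lemma pos_definite_congruence_iff: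
  fixes S :: "'f::star_algebra^'q::{finite,linorder}^'q::{finite,linorder}"
  assumes "adet g \<noteq> 0"
  shows "pos_definite (mstar g ** S ** g) \<longleftrightarrow> pos_definite S"
proof
  obtain h where h: "g ** h = mat 1" "h ** g = mat 1"
    using assms by (rule adet_nonzero_inverse)
  have hg: "mstar h ** mstar g = mat 1" using h(1) by (metis mstar_mat_1 mstar_mult)
  assume *: "pos_definite (mstar g ** S ** g)"
  have "x = 0" if "h *v x = 0" for x
    using that h(1) by (metis matrix_vector_mul_assoc matrix_vector_mul_lid matrix_vector_mult_0_right)
  then have "pos_definite (mstar h ** (mstar g ** S ** g) ** h)"
    using pos_definite_congruence_injective[OF *] by blast
  also have "mstar h ** (mstar g ** S ** g) ** h = (mstar h ** mstar g) ** S ** (g ** h)"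
    by (simp add: matrix_mul_assoc)
  finally show "pos_definite S" by (simp add: h hg)
next
  assume "pos_definite S"
  then show "pos_definite (mstar g ** S ** g)"
    using assms by (intro pos_definite_congruence_injective) (auto simp: adet_nonzero_iff)
qed

lemma pos_definite_sqrt:
  fixes S :: "'f::star_algebra^'q::{finite,linorder}^'q::{finite,linorder}"
  assumes "pos_definite S"
  obtains R where "pos_definite R" "S = mstar R ** R" "adet S = (adet R)\<^sup>2"
proof -
  obtain Q s where Q: "Q \<in> unitary_group" "\<And>i. 0 < s $ i" "S = mstar Q ** diag s ** Q" "adet S = (\<Prod>i\<in>UNIV. s $ i)"
    using pos_definite_spectral[OF assms] by metis
  define r where "r = (\<chi> i. sqrt (s $ i))"
  have r: "0 < r $ i" for i using Q(2) by (simp add: r_def)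
  define R where "R = mstar Q ** diag r ** Q"
  have "adet Q \<noteq> 0" using adet_unitary_mult[OF Q(1) unitary_mat_1, of "mat 1"] by simp
  then have "pos_definite R"
    unfolding R_def using pos_definite_diag[OF r] by (simp add: pos_definite_congruence_iff)
  moreover have "mstar R ** R = mstar Q ** (diag r ** diag r) ** Q"
    by (simp add: R_def mstar_mult matrix_mul_assoc unitary_cancel(2)[OF Q(1)])
  then have "mstar R ** R = S"
    using Q(2) by (simp add: Q(3) diag_mult_diag r_def less_imp_le)
  moreover have "adet R = (\<Prod>i\<in>UNIV. r $ i)"
    by (rule adet_svd[OF unitary_mstar[OF Q(1)] Q(1) R_def]) (use r in \<open>simp add: less_imp_le\<close>)
  then have "adet S = (adet R)\<^sup>2"
    using Q(2) by (simp add: Q(4) r_def less_imp_le prod_power_distrib)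
  ultimately show ?thesis using that by metis
qed

section \<open>Closedness of the cone and Loewner neighbourhoods\<close>

lemma closed_psd: "closed {A. psd (A :: 'f::star_algebra^'n^'n)}"
  unfolding psd_def
  by (intro closed_Collect_conj closed_Collect_all closed_Collect_eq closed_Collect_le continuous_intros)

text \<open>A two-sided Loewner comparison: the orbit of the unit ball around the identity under
  congruence, used as a test function which involves no matrix inverse.\<close>

definition near :: "'f::star_algebra^'n^'n \<Rightarrow> 'f^'n^'n \<Rightarrow> bool"
  where "near S P \<longleftrightarrow> psd (S - (1/2) *\<^sub>R P) \<and> psd (2 *\<^sub>R P - S)"

lemma matrix_mult_scaleR_left: "(c *\<^sub>R A) ** B = c *\<^sub>R (A ** (B :: 'f::real_algebra_1^'n^'m))"
  by (simp add: scalar_matrix_assoc)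

lemma matrix_mult_scaleR_right: "A ** (c *\<^sub>R B) = c *\<^sub>R (A ** (B :: 'f::real_algebra_1^'n^'m))"
  by (simp add: matrix_matrix_mult_def vec_eq_iff scaleR_sum_right)

lemma near_congruence:
  "near S P \<Longrightarrow> near (mstar g ** S ** g) (mstar g ** P ** (g :: 'f::star_algebra^'n^'n))"
  using psd_congruence[of "S - (1/2) *\<^sub>R P" g] psd_congruence[of "2 *\<^sub>R P - S" g]
  by (simp add: near_def matrix_diff_ldistrib matrix_diff_rdistrib matrix_mult_scaleR_left matrix_mult_scaleR_right)

lemma near_congruence_iff:
  fixes S :: "'f::star_algebra^'q::{finite,linorder}^'q::{finite,linorder}"
  assumes "adet g \<noteq> 0"
  shows "near (mstar g ** S ** g) (mstar g ** P ** g) \<longleftrightarrow> near S P"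
proof
  obtain h where h: "g ** h = mat 1" "h ** g = mat 1"
    using assms by (rule adet_nonzero_inverse)
  have hg: "mstar h ** mstar g = mat 1" using h(1) by (metis mstar_mat_1 mstar_mult)
  have c: "mstar h ** (mstar g ** S ** g) ** h = S" for S
  proof -
    have "mstar h ** (mstar g ** S ** g) ** h = (mstar h ** mstar g) ** S ** (g ** h)"
      by (simp add: matrix_mul_assoc)
    then show ?thesis by (simp add: h hg)
  qed
  assume "near (mstar g ** S ** g) (mstar g ** P ** g)"
  from near_congruence[OF this, of h] show "near S P" by (simp add: c)
qed (rule near_congruence)

lemma closed_near: "closed {(S, P). near S (P :: 'f::star_algebra^'n^'n)}"
proof -
  have "{(S, P). near S P} = (\<lambda>z. fst z - (1/2) *\<^sub>R snd z) -` {A. psd (A :: 'f^'n^'n)}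
      \<inter> (\<lambda>z. 2 *\<^sub>R snd z - fst z) -` {A. psd A}"
    by (auto simp: near_def)
  also have "closed \<dots>"
    by (intro closed_Int continuous_closed_vimage closed_psd continuous_intros) (auto intro!: continuous_intros)
  finally show ?thesis .
qed

lemma near_1_pos_definite: "near S (mat 1) \<Longrightarrow> pos_definite (S :: 'f::star_algebra^'n^'n)"
proof -
  assume S: "near S (mat 1)"
  have "mstar (S - (1/2) *\<^sub>R mat 1) = S - (1/2) *\<^sub>R mat 1"
    using S unfolding near_def psd_def by blast
  then have "mstar S = S" by (simp add: mstar_diff mstar_scaleR)
  moreover have "0 < inner x (S *v x)" if "x \<noteq> 0" for x
  proof -
    have "0 \<le> inner x ((S - (1/2) *\<^sub>R mat 1) *v x)"
      using S unfolding near_def psd_def by blast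
    then have "inner x x / 2 \<le> inner x (S *v x)"
      by (simp add: matrix_vector_mult_diff_rdistrib scaleR_matrix_vector inner_diff_right)
    then show ?thesis using that by (smt (verit) half_gt_zero inner_gt_zero_iff)
  qed
  ultimately show ?thesis by (simp add: pos_definite_def)
qed

lemma norm_axis: "norm (axis i (x :: 'a::real_inner)) = norm x"
  by (simp add: norm_eq_sqrt_inner inner_axis_axis)

text \<open>The comparison with twice the identity bounds every eigenvalue by 2, and the norm of
  \<open>S\<close> is that of its vector of eigenvalues. The bound gives compactness of the
  neighbourhoods used as test sets.\<close>

lemma near_1_norm:
  fixes S :: "'f::star_algebra^'n^'n"
  assumes "near S (mat 1)" shows "norm S \<le> 2 * norm (mat 1 :: 'f^'n^'n)"
proof -
  have S: "psd (S - (1/2) *\<^sub>R mat 1)" "psd (2 *\<^sub>R mat 1 - S)" using assms by (auto simp: near_def)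
  have "psd S"
    using near_1_pos_definite[OF assms] by (rule pos_definite_imp_psd)
  then obtain Q s where Q: "Q \<in> unitary_group" "\<And>i. 0 \<le> s $ i" "S = mstar Q ** diag s ** Q"
    using psd_spectral by blast
  have "s $ i \<le> 2" for i
  proof -
    define x where "x = mstar Q *v axis i (1 :: 'f)"
    have Qx: "Q *v x = axis i 1"
      by (simp add: x_def matrix_vector_mul_assoc unitary_groupD[OF Q(1)])
    have "inner x (S *v x) = s $ i"
      unfolding Q(3) inner_congruence Qx by (simp add: inner_axis' inner_1_of_real)
    moreover have "inner x x = 1"
      using norm_unitary_vector[OF Q(1), of x] by (simp add: Qx dot_square_norm norm_axis)
    moreover have "0 \<le> inner x ((2 *\<^sub>R mat 1 - S) *v x)"
      using S(2) by (simp add: psd_def)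
    ultimately show ?thesis
      by (simp add: matrix_vector_mult_diff_rdistrib scaleR_matrix_vector inner_diff_right)
  qed
  then have "norm s \<le> norm (2 *\<^sub>R (1 :: real^'n))"
    using Q(2) by (intro norm_le_componentwise_cart) auto
  moreover have "norm S = norm s"
    by (simp add: Q(3) norm_unitary_mult_left norm_unitary_mult_right unitary_mstar Q(1) norm_diag)
  moreover have "norm (1 :: real^'n) = norm (mat 1 :: 'f^'n^'n)"
    by (metis norm_diag diag_1)
  ultimately show ?thesis by simp
qed

section \<open>Connectedness of the unitary group\<close>

lemma unitary_group0_subset: "unitary_group0 \<subseteq> (unitary_group :: ('f::star_algebra^'n^'n) set)"
  by (simp add: unitary_group0_def connected_component_subset)

lemma mat_1_unitary_group0: "mat 1 \<in> (unitary_group0 :: ('f::star_algebra^'n^'n) set)"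
  by (simp add: unitary_group0_def)

lemma connected_unitary_group0: "connected (unitary_group0 :: ('f::star_algebra^'n^'n) set)"
  by (simp add: unitary_group0_def)

lemma unitary_group0_maximal:
  assumes "connected T" "T \<subseteq> unitary_group" "A \<in> T" "A \<in> unitary_group0"
  shows "T \<subseteq> (unitary_group0 :: ('f::star_algebra^'n^'n) set)"
proof -
  have "connected_component_set unitary_group (mat 1) = connected_component_set unitary_group A"
    using connected_component_eq assms(4)[unfolded unitary_group0_def] by blast
  then show ?thesis
    using connected_component_maximal[OF assms(3,1,2)] by (simp add: unitary_group0_def)
qed

lemma compact_unitary_group0: "compact (unitary_group0 :: ('f::star_algebra^'n^'n) set)"
proof (rule compact_eq_bounded_closed[THEN iffD2], rule conjI)
  show "bounded (unitary_group0 :: ('f^'n^'n) set)"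
    using compact_imp_bounded[OF compact_unitary_group] bounded_subset unitary_group0_subset by blast
  show "closed (unitary_group0 :: ('f^'n^'n) set)"
    unfolding unitary_group0_def
    by (intro closed_connected_component compact_imp_closed compact_unitary_group)
qed

lemma unitary_group0_mult:
  assumes "P \<in> unitary_group0" "Q \<in> unitary_group0"
  shows "P ** Q \<in> (unitary_group0 :: ('f::star_algebra^'n^'n) set)"
proof -
  have "(**) P ` unitary_group0 \<subseteq> unitary_group0"
  proof (rule unitary_group0_maximal)
    show "connected ((**) P ` unitary_group0)"
      by (intro connected_continuous_image continuous_intros connected_unitary_group0)
    show "(**) P ` unitary_group0 \<subseteq> unitary_group"
      using assms(1) unitary_group0_subset by (auto intro: unitary_mult)
    show "P \<in> (**) P ` unitary_group0"
      using mat_1_unitary_group0 by (force intro: image_eqI[of _ _ "mat 1"])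
  qed (rule assms(1))
  then show ?thesis using assms(2) by blast
qed

lemma unitary_group0_mstar:
  assumes "P \<in> unitary_group0" shows "mstar P \<in> (unitary_group0 :: ('f::star_algebra^'n^'n) set)"
proof -
  have "mstar ` unitary_group0 \<subseteq> (unitary_group0 :: ('f^'n^'n) set)"
  proof (rule unitary_group0_maximal)
    show "connected (mstar ` unitary_group0 :: ('f^'n^'n) set)"
      by (intro connected_continuous_image continuous_intros connected_unitary_group0)
    show "mstar ` unitary_group0 \<subseteq> (unitary_group :: ('f^'n^'n) set)"
      using unitary_group0_subset by (auto intro: unitary_mstar)
    show "mat 1 \<in> mstar ` (unitary_group0 :: ('f^'n^'n) set)"
      using mat_1_unitary_group0 by (force intro: image_eqI[of _ _ "mat 1"])
  qed (rule mat_1_unitary_group0)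
  then show ?thesis using assms by blast
qed

lemma givens_unitary_group0:
  assumes "i \<noteq> j" "norm u = 1" "c\<^sup>2 + s\<^sup>2 = 1"
  shows "givens i j u c s \<in> (unitary_group0 :: ('f::star_algebra^'n^'n) set)"
proof -
  obtain \<theta> where \<theta>: "c = cos \<theta>" "s = sin \<theta>"
    using sincos_total_2pi[OF assms(3)] by metis
  define T where "T = (\<lambda>\<theta>. givens i j u (cos \<theta>) (sin \<theta>)) ` (UNIV :: real set)"
  have "T \<subseteq> unitary_group0"
  proof (rule unitary_group0_maximal)
    show "connected T"
      unfolding T_def givens_def by (intro connected_continuous_image continuous_intros connected_UNIV)
    show "T \<subseteq> unitary_group"
      using assms by (auto simp: T_def intro!: givens_unitary)
    have "givens i j u (cos 0) (sin 0) = mat 1" by (simp add: givens_def)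
    then show "mat 1 \<in> T" unfolding T_def by (intro image_eqI[of _ _ 0]) simp_all
  qed (rule mat_1_unitary_group0)
  then show ?thesis by (auto simp: T_def \<theta>)
qed

lemma continuous_on_axis:
  "continuous_on S f \<Longrightarrow> continuous_on S (\<lambda>x. axis i (f x :: 'a::{topological_space, zero}))"
  unfolding axis_def
  by (intro continuous_on_vec_lambda, rename_tac k, case_tac "k = i") auto

lemma unitary_diagonal_entry:
  assumes "N \<in> unitary_group" "\<And>i j. i \<noteq> j \<Longrightarrow> N $ i $ j = 0"
  shows "norm (N $ i $ i :: 'f::star_algebra) = 1"
proof -
  have "(\<Sum>j\<in>UNIV. N $ k $ j * axis i 1 $ j) = (\<Sum>j\<in>UNIV. if j = i then N $ k $ i else 0)" for k
    by (intro sum.cong) (auto simp: axis_def)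
  then have "(N *v axis i 1) $ k = N $ k $ i" for k
    by (simp add: matrix_vector_mult_def)
  then have "N *v axis i 1 = axis i (N $ i $ i)"
    using assms(2) by (auto simp: vec_eq_iff axis_def)
  then show ?thesis
    using norm_unitary_vector[OF assms(1), of "axis i 1"] by (simp add: norm_axis)
qed

text \<open>Maximising over the identity component leaves a diagonal unitary matrix. The maximality
  that remains, against all of \<open>unitary_group0\<close>, later pins down its diagonal
  entries.\<close>

lemma unitary_group0_diagonal:
  fixes A :: "'f::star_algebra^'n^'n"
  assumes "A \<in> unitary_group"
  obtains P Q c where "P \<in> unitary_group0" "Q \<in> unitary_group0" "\<And>i. c $ i > 0"
    "P ** A ** Q \<in> unitary_group" "\<And>i j. i \<noteq> j \<Longrightarrow> (P ** A ** Q) $ i $ j = 0"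
    "\<And>P'. P' \<in> unitary_group0 \<Longrightarrow> inner (mat 1) (P' ** ((P ** A ** Q) ** diag c))
      \<le> inner (mat 1) ((P ** A ** Q) ** diag c)"
proof -
  obtain f :: "'n \<Rightarrow> nat" where f: "inj f"
    using finite_imp_inj_to_nat_seg[of "UNIV :: 'n set"] by auto
  define c where "c = (\<chi> i. real (f i) + 1)"
  have c: "\<And>i. c $ i > 0" "inj (($) c)"
    using f by (auto simp: inj_def c_def)
  obtain P Q where PQ: "P \<in> unitary_group0" "Q \<in> unitary_group0"
      "\<And>i j. i \<noteq> j \<Longrightarrow> (P ** A ** Q) $ i $ j = 0"
      "\<And>P' Q'. P' \<in> unitary_group0 \<Longrightarrow> Q' \<in> unitary_group0 \<Longrightarrow>
        inner (mat 1) (P' ** (P ** A ** Q) ** Q' ** diag c) \<le> inner (mat 1) (P ** A ** Q ** diag c)"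
    using trace_maximizer[OF compact_unitary_group0 mat_1_unitary_group0 unitary_group0_mult
        givens_unitary_group0 c, where M = A] by blast
  show ?thesis
  proof (rule that[OF PQ(1,2) c(1) _ PQ(3)])
    show "P ** A ** Q \<in> unitary_group"
      using PQ(1,2) assms unitary_group0_subset by (auto intro!: unitary_mult)
    show "inner (mat 1) (P' ** ((P ** A ** Q) ** diag c)) \<le> inner (mat 1) ((P ** A ** Q) ** diag c)"
      if "P' \<in> unitary_group0" for P'
      using PQ(4)[OF that mat_1_unitary_group0] by (simp add: matrix_mul_assoc)
  qed
qed

lemma unitary_group0_cancel:
  assumes "P \<in> unitary_group0" "Q \<in> unitary_group0" "P ** A ** Q \<in> unitary_group0"
  shows "A \<in> (unitary_group0 :: ('f::star_algebra^'n^'n) set)"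
proof -
  have "mstar P ** (P ** A ** Q) ** mstar Q = (mstar P ** P) ** A ** (Q ** mstar Q)"
    by (simp add: matrix_mul_assoc)
  moreover have "P \<in> unitary_group" "Q \<in> unitary_group"
    using assms(1,2) unitary_group0_subset by blast+
  ultimately have "A = mstar P ** (P ** A ** Q) ** mstar Q"
    by (simp add: unitary_groupD)
  then show ?thesis
    using assms by (metis unitary_group0_mult unitary_group0_mstar)
qed

text \<open>For d at least 2 the unit sphere of the field is connected, so all phases lie in the
  identity component. Maximality against phases makes the diagonal entries positive; being units
  they equal 1.\<close>

lemma unitary_group_connected:
  assumes "2 \<le> DIM('f::star_algebra)"
  shows "(unitary_group0 :: ('f^'n^'n) set) = unitary_group"
proof (intro equalityI unitary_group0_subset subsetI)
  fix A :: "'f^'n^'n" assume "A \<in> unitary_group"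
  then obtain P Q c where PQ: "P \<in> unitary_group0" "Q \<in> unitary_group0" "\<And>i. c $ i > 0"
    "P ** A ** Q \<in> unitary_group" "\<And>i j. i \<noteq> j \<Longrightarrow> (P ** A ** Q) $ i $ j = 0"
    "\<And>P'. P' \<in> unitary_group0 \<Longrightarrow> inner (mat 1) (P' ** ((P ** A ** Q) ** diag c))
      \<le> inner (mat 1) ((P ** A ** Q) ** diag c)"
    using unitary_group0_diagonal by blast
  have phase0: "phase i u \<in> (unitary_group0 :: ('f^'n^'n) set)" if "norm u = 1" for i :: 'n and u :: 'f
  proof -
    have "phase i ` sphere 0 1 \<subseteq> (unitary_group0 :: ('f^'n^'n) set)"
    proof (rule unitary_group0_maximal)
      have "continuous_on (sphere 0 1) (phase i :: 'f \<Rightarrow> 'f^'n^'n)"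
        unfolding phase_def by (intro continuous_intros continuous_on_axis)
      then show "connected (phase i ` sphere 0 1 :: ('f^'n^'n) set)"
        using connected_sphere[OF assms] by (rule connected_continuous_image)
      have "phase i (1 :: 'f) = mat 1" by (auto simp: phase_def axis_def vec_eq_iff)
      then show "mat 1 \<in> phase i ` (sphere 0 1 :: 'f set)" by (intro image_eqI[of _ _ "1 :: 'f"]) simp_all
    qed (auto intro: phase_unitary mat_1_unitary_group0)
    then show ?thesis using that by auto
  qed
  define N where "N = P ** A ** Q"
  have "N $ i $ i = 1" for i
  proof -
    have "(N ** diag c) $ i $ i = norm ((N ** diag c) $ i $ i) *\<^sub>R 1"
      using PQ(6)[OF phase0] by (intro phase_stationary) (simp add: N_def)
    moreover have "norm (N $ i $ i) = 1"
      using unitary_diagonal_entry[OF PQ(4,5)] by (simp add: N_def)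
    ultimately have "c $ i *\<^sub>R N $ i $ i = c $ i *\<^sub>R 1"
      using PQ(3)[of i] by (simp add: norm_mult of_real_def)
    then show ?thesis using PQ(3)[of i] by simp
  qed
  then have "N = mat 1" using PQ(5) by (auto simp: vec_eq_iff mat_def N_def)
  then show "A \<in> unitary_group0"
    using unitary_group0_cancel[OF PQ(1,2), of A] mat_1_unitary_group0 by (simp add: N_def)
qed

lemma det_unitary_real:
  fixes A :: "real^'n^'n"
  assumes "A \<in> unitary_group" shows "(det A)\<^sup>2 = 1"
proof -
  have "mstar A = transpose A" by (simp add: mstar_def transpose_def fconj_real_def)
  then have "det (transpose A) * det A = 1"
    using unitary_groupD(1)[OF assms] by (metis det_I det_mul)
  then show ?thesis by (simp add: power2_eq_square det_transpose)
qed

lemma continuous_on_det_real [continuous_intros]: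
  "continuous_on S f \<Longrightarrow> continuous_on S (\<lambda>x. det (f x :: 'a::{comm_ring_1, real_normed_field}^'n^'n))"
  unfolding det_def by (intro continuous_intros)

lemma det_unitary_group0_real:
  fixes A :: "real^'n^'n"
  assumes "A \<in> unitary_group0" shows "det A = 1"
proof -
  have "connected (det ` (unitary_group0 :: (real^'n^'n) set))"
    by (intro connected_continuous_image continuous_intros connected_unitary_group0)
  moreover have "det ` (unitary_group0 :: (real^'n^'n) set) \<subseteq> {1, -1}"
    using det_unitary_real unitary_group0_subset by (force simp: power2_eq_1_iff)
  then have "finite (det ` (unitary_group0 :: (real^'n^'n) set))" by (rule finite_subset) simp
  ultimately obtain d where d: "det ` (unitary_group0 :: (real^'n^'n) set) \<subseteq> {d}"
    using connected_finite_iff_sing by (metis empty_subsetI order_refl)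
  have "det (mat 1 :: real^'n^'n) \<in> {d}" "det A \<in> {d}"
    using d assms mat_1_unitary_group0 by blast+
  then show ?thesis by simp
qed

text \<open>The diagonal entries of the maximiser are 1 or -1. A half turn in the plane of two
  entries -1 would increase the weighted trace, so at most one is -1, and determinant 1 excludes
  that.\<close>

lemma unitary_group0_real:
  "(unitary_group0 :: (real^'n^'n) set) = {A \<in> unitary_group. det A = 1}"
proof (intro equalityI subsetI)
  fix A :: "real^'n^'n" assume A: "A \<in> unitary_group0"
  have "det A = 1" by (rule det_unitary_group0_real[OF A])
  then show "A \<in> {A \<in> unitary_group. det A = 1}"
    using A unitary_group0_subset by auto
next
  fix A :: "real^'n^'n" assume "A \<in> {A \<in> unitary_group. det A = 1}"
  then have A: "A \<in> unitary_group" "det A = 1" by auto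
  obtain P Q c where PQ: "P \<in> unitary_group0" "Q \<in> unitary_group0" "\<And>i. c $ i > 0"
    "P ** A ** Q \<in> unitary_group" "\<And>i j. i \<noteq> j \<Longrightarrow> (P ** A ** Q) $ i $ j = 0"
    "\<And>P'. P' \<in> unitary_group0 \<Longrightarrow> inner (mat 1) (P' ** ((P ** A ** Q) ** diag c))
      \<le> inner (mat 1) ((P ** A ** Q) ** diag c)"
    using unitary_group0_diagonal[OF A(1)] by blast
  define N where "N = P ** A ** Q"
  have N: "N $ i $ i = 1 \<or> N $ i $ i = -1" for i
    using unitary_diagonal_entry[OF PQ(4,5), of i] by (auto simp: N_def)
  have atmost1: False if "i \<noteq> j" "N $ i $ i = -1" "N $ j $ j = -1" for i j
  proof -
    have "inner (mat 1) (givens i j 1 (-1) 0 ** (N ** diag c)) \<le> inner (mat 1) (N ** diag c)"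
      using PQ(6)[OF givens_unitary_group0[OF that(1), of 1 "-1" 0]] by (simp add: N_def)
    then have "0 \<le> - c $ i - c $ j"
      unfolding inner_mat_1_givens[OF that(1)] using that by simp
    then show False using PQ(3)[of i] PQ(3)[of j] by linarith
  qed
  have "det N = 1" using A PQ(1,2) by (simp add: N_def det_mul det_unitary_group0_real)
  moreover have "det N = (\<Prod>i\<in>UNIV. N $ i $ i)"
    using PQ(5) by (intro det_diagonal) (simp add: N_def)
  ultimately have prod: "(\<Prod>i\<in>UNIV. N $ i $ i) = 1" by simp
  have "N $ i $ i = 1" for i
  proof (rule ccontr)
    assume "N $ i $ i \<noteq> 1"
    then have i: "N $ i $ i = -1" using N by blast
    have "(\<Prod>k\<in>UNIV. N $ k $ k) = N $ i $ i * (\<Prod>k\<in>UNIV - {i}. N $ k $ k)"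
      by (rule prod.remove) auto
    also have "(\<Prod>k\<in>UNIV - {i}. N $ k $ k) = 1"
      using N atmost1[OF _ _ i] by (intro prod.neutral) blast
    finally show False using i prod by simp
  qed
  then have "N = mat 1" using PQ(5) by (auto simp: vec_eq_iff mat_def N_def)
  then show "A \<in> unitary_group0"
    using unitary_group0_cancel[OF PQ(1,2), of A] mat_1_unitary_group0 by (simp add: N_def)
qed

section \<open>Linear changes of variables\<close>

text \<open>The condition on c covers translations and point reflections at once; the uniqueness
  argument for invariant measures uses both.\<close>

lemma nn_integral_lborel_affine:
  fixes t :: "'a::euclidean_space"
  assumes [measurable]: "h \<in> borel_measurable borel" and c: "\<bar>c\<bar> = 1"
  shows "(\<integral>\<^sup>+x. h (t + c *\<^sub>R x) \<partial>lborel) = (\<integral>\<^sup>+x. h x \<partial>lborel)"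
proof -
  have "lborel = distr lborel borel (\<lambda>x. t + c *\<^sub>R x)"
    using lborel_affine[of c t] c by (auto simp: density_1)
  then have "(\<integral>\<^sup>+x. h x \<partial>lborel) = (\<integral>\<^sup>+x. h x \<partial>distr lborel borel (\<lambda>x. t + c *\<^sub>R x))"
    by metis
  then show ?thesis by (simp add: nn_integral_distr)
qed

text \<open>\<open>c\<close> is the reciprocal of the absolute Jacobian determinant. Stating it
  through integrals allows maps between different Euclidean spaces and makes composition
  immediate.\<close>

definition scales :: "('a::euclidean_space \<Rightarrow> 'b::euclidean_space) \<Rightarrow> real \<Rightarrow> bool"
  where "scales f c \<longleftrightarrow> 0 < c \<and> (\<forall>h \<in> borel_measurable borel.
    (\<integral>\<^sup>+x. h (f x) \<partial>lborel) = ennreal c * (\<integral>\<^sup>+x. h x \<partial>lborel))"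

lemma scalesD:
  "scales f c \<Longrightarrow> h \<in> borel_measurable borel \<Longrightarrow>
    (\<integral>\<^sup>+x. h (f x) \<partial>lborel) = ennreal c * (\<integral>\<^sup>+x. h x \<partial>lborel)"
  by (simp add: scales_def)

lemma borel_measurable_linear:
  "linear (f :: 'a::euclidean_space \<Rightarrow> 'b::euclidean_space) \<Longrightarrow> f \<in> borel_measurable borel"
  by (simp add: borel_measurable_continuous_onI linear_continuous_on linear_conv_bounded_linear)

lemma emeasure_lborel_open_bounded:
  assumes "open E" "bounded E" "x \<in> (E :: 'a::euclidean_space set)"
  shows "emeasure lborel E \<noteq> 0" "emeasure lborel E < \<infinity>"
proof -
  obtain e where "e > 0" "ball x e \<subseteq> E"
    using assms by (meson openE)
  moreover have "emeasure lborel (ball x e) \<noteq> 0"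
    using \<open>e > 0\<close> open_not_negligible[of "ball x e"]
    by (auto simp: negligible_iff_emeasure0 emeasure_completion)
  ultimately show "emeasure lborel E \<noteq> 0"
    using assms(1) by (metis borel_open emeasure_mono le_zero_eq sets_lborel)
  show "emeasure lborel E < \<infinity>"
    by (rule emeasure_bounded_finite[OF assms(2)])
qed

lemma borel_measurable_indicator_ball:
  "(indicator (ball x e) :: 'a::metric_space \<Rightarrow> ennreal) \<in> borel_measurable borel"
  by (intro borel_measurable_indicator borel_open open_ball)

text \<open>The map is measure-preserving up to a constant because translation invariant measures
  are unique up to a constant.\<close>

lemma scales_exists:
  fixes f :: "'a::euclidean_space \<Rightarrow> 'b::euclidean_space"
  assumes "linear f" "bij f"
  obtains c where "scales f c"
proof -
  have [measurable]: "f \<in> borel_measurable borel" by (rule borel_measurable_linear[OF assms(1)])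
  define \<mu> where "\<mu> h = (\<integral>\<^sup>+x. h (f x) \<partial>lborel)" for h :: "'b \<Rightarrow> ennreal"
  define \<Lambda> where "\<Lambda> h = (\<integral>\<^sup>+x. h x \<partial>lborel)" for h :: "'b \<Rightarrow> ennreal"
  \<comment> \<open>Both sides equal the double integral of h(f x) g(f x + y). For the right side,
    shift x by a preimage of y, which gives h(f x - y) g(f x), then substitute y by f x - y.\<close>
  have symm: "\<mu> h * \<Lambda> g = \<mu> g * \<Lambda> h"
    if [measurable]: "h \<in> borel_measurable borel" "g \<in> borel_measurable borel" for g h :: "'b \<Rightarrow> ennreal"
  proof -
    have "\<mu> h * \<Lambda> g = (\<integral>\<^sup>+x. h (f x) * \<Lambda> g \<partial>lborel)"
      by (simp add: \<mu>_def nn_integral_multc)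
    also have "\<dots> = (\<integral>\<^sup>+x. \<integral>\<^sup>+y. h (f x) * g y \<partial>lborel \<partial>lborel)"
      by (simp add: \<Lambda>_def nn_integral_cmult)
    also have "\<dots> = (\<integral>\<^sup>+x. \<integral>\<^sup>+y. h (f x) * g (f x + 1 *\<^sub>R y) \<partial>lborel \<partial>lborel)"
      by (intro nn_integral_cong nn_integral_lborel_affine[symmetric]) auto
    also have "\<dots> = (\<integral>\<^sup>+y. \<integral>\<^sup>+x. h (f x) * g (f x + y) \<partial>lborel \<partial>lborel)"
      by (subst lborel_pair.Fubini') auto
    also have "\<dots> = (\<integral>\<^sup>+y. \<integral>\<^sup>+x. h (f x - y) * g (f x) \<partial>lborel \<partial>lborel)"
    proof (rule nn_integral_cong)
      fix y :: 'b
      obtain z where z: "f z = y" using assms(2) by (metis bij_pointE)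
      have "(\<integral>\<^sup>+x. h (f x) * g (f x + y) \<partial>lborel) = (\<integral>\<^sup>+x. (\<lambda>x. h (f x - y) * g (f x)) (z + 1 *\<^sub>R x) \<partial>lborel)"
        using linear_add[OF assms(1)] by (intro nn_integral_cong) (simp add: z add.commute)
      also have "\<dots> = (\<integral>\<^sup>+x. h (f x - y) * g (f x) \<partial>lborel)"
        by (rule nn_integral_lborel_affine) auto
      finally show "(\<integral>\<^sup>+x. h (f x) * g (f x + y) \<partial>lborel) = (\<integral>\<^sup>+x. h (f x - y) * g (f x) \<partial>lborel)" .
    qed
    also have "\<dots> = (\<integral>\<^sup>+x. \<integral>\<^sup>+y. h (f x + (-1) *\<^sub>R y) * g (f x) \<partial>lborel \<partial>lborel)"
      by (subst lborel_pair.Fubini') auto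
    also have "\<dots> = (\<integral>\<^sup>+x. \<integral>\<^sup>+y. h y * g (f x) \<partial>lborel \<partial>lborel)"
      by (intro nn_integral_cong nn_integral_lborel_affine) auto
    also have "\<dots> = (\<integral>\<^sup>+x. \<Lambda> h * g (f x) \<partial>lborel)"
      by (simp add: \<Lambda>_def nn_integral_multc)
    also have "\<dots> = \<mu> g * \<Lambda> h"
      by (simp add: \<mu>_def nn_integral_cmult mult.commute)
    finally show ?thesis .
  qed
  define g :: "'b \<Rightarrow> ennreal" where "g = indicator (ball 0 1)"
  have [measurable]: "g \<in> borel_measurable borel" by (simp add: g_def borel_measurable_indicator_ball)
  have \<Lambda>g: "\<Lambda> g \<noteq> 0" "\<Lambda> g < \<infinity>"
    using emeasure_lborel_open_bounded[of "ball 0 1" "0 :: 'b"] by (simp_all add: \<Lambda>_def g_def)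
  obtain B where B: "B > 0" "\<And>x. B * norm x \<le> norm (f x)"
    using linear_inj_bounded_below_pos[of f] assms by (auto simp: bij_def mult.commute)
  have "bounded (f -` ball 0 1)"
    unfolding bounded_iff
  proof (intro exI ballI)
    fix x assume "x \<in> f -` ball 0 1"
    then show "norm x \<le> 1 / B" using B(2)[of x] B(1) by (simp add: field_simps)
  qed
  moreover have "open (f -` ball 0 1)"
    by (intro continuous_open_vimage linear_continuous_on allI)
      (auto simp: linear_conv_bounded_linear[symmetric] assms linear_continuous_at)
  ultimately have \<mu>g: "\<mu> g \<noteq> 0" "\<mu> g < \<infinity>"
    using emeasure_lborel_open_bounded[of "f -` ball 0 1" 0] linear_0[OF assms(1)]
    by (simp_all add: \<mu>_def g_def indicator_vimage flip: vimage_def[of _ "ball 0 1"])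
     (simp_all add: indicator_def vimage_def nn_integral_indicator[symmetric] del: nn_integral_indicator)
  obtain a where a: "\<mu> g = ennreal a" "0 < a"
    using \<mu>g by (cases "\<mu> g") (auto simp: less_le)
  obtain b where b: "\<Lambda> g = ennreal b" "0 < b"
    using \<Lambda>g by (cases "\<Lambda> g") (auto simp: less_le)
  define c where "c = a / b"
  have c: "0 < c" using a b by (simp add: c_def)
  have "\<mu> h = ennreal c * \<Lambda> h" if "h \<in> borel_measurable borel" for h
  proof -
    have "\<mu> h = ennreal (1 / b) * (\<mu> h * \<Lambda> g)"
      using b by (simp add: mult.left_commute[of _ "\<mu> h"] flip: ennreal_mult')
    also have "\<dots> = ennreal (1 / b) * (\<mu> g * \<Lambda> h)"
      using that by (subst symm) auto
    also have "\<dots> = ennreal c * \<Lambda> h"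
      using a b by (simp add: c_def flip: mult.assoc ennreal_mult')
    finally show ?thesis .
  qed
  then have "scales f c"
    using c by (simp add: scales_def \<mu>_def \<Lambda>_def)
  then show ?thesis by (rule that)
qed

lemma scales_unique:
  fixes f :: "'a::euclidean_space \<Rightarrow> 'b::euclidean_space"
  assumes "scales f c" "scales f d"
  shows "c = d"
proof -
  define g :: "'b \<Rightarrow> ennreal" where "g = indicator (ball 0 1)"
  have g: "(\<integral>\<^sup>+x. g x \<partial>lborel) \<noteq> 0" "(\<integral>\<^sup>+x. g x \<partial>lborel) < \<infinity>"
    using emeasure_lborel_open_bounded[of "ball 0 1" "0 :: 'b"] by (simp_all add: g_def)
  have "ennreal c * (\<integral>\<^sup>+x. g x \<partial>lborel) = ennreal d * (\<integral>\<^sup>+x. g x \<partial>lborel)"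
    using scalesD[OF assms(1), of g] scalesD[OF assms(2), of g]
    by (simp add: g_def borel_measurable_indicator_ball)
  then have "ennreal c = ennreal d"
    using g by (metis ennreal_mult_divide_eq infinity_ennreal_def less_irrefl)
  then show ?thesis using assms by (simp add: scales_def)
qed

lemma scales_comp:
  fixes f :: "'b::euclidean_space \<Rightarrow> 'c::euclidean_space" and g :: "'a::euclidean_space \<Rightarrow> 'b"
  assumes "scales f c" "scales g d" and [measurable]: "f \<in> borel_measurable borel"
  shows "scales (\<lambda>x. f (g x)) (c * d)"
proof -
  have "(\<integral>\<^sup>+x. h (f (g x)) \<partial>lborel) = ennreal (c * d) * (\<integral>\<^sup>+x. h x \<partial>lborel)"
    if [measurable]: "h \<in> borel_measurable borel" for h
  proof -
    have "(\<integral>\<^sup>+x. h (f (g x)) \<partial>lborel) = ennreal d * (\<integral>\<^sup>+x. h (f x) \<partial>lborel)"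
      by (rule scalesD[OF assms(2)]) simp
    also have "\<dots> = ennreal d * (ennreal c * (\<integral>\<^sup>+x. h x \<partial>lborel))"
      by (simp add: scalesD[OF assms(1)])
    finally show ?thesis
      using assms by (simp add: scales_def ennreal_mult mult_ac)
  qed
  then show ?thesis using assms by (simp add: scales_def)
qed

text \<open>Applied to the indicator of an invariant set of positive finite measure, the scaling
  identity leaves only the factor 1.\<close>

lemma scales_invariant_set:
  fixes f :: "'a::euclidean_space \<Rightarrow> 'a"
  assumes "linear f" "bij f" "E \<in> sets borel" "emeasure lborel E \<noteq> 0" "emeasure lborel E < \<infinity>"
    and inv: "\<And>x. f x \<in> E \<longleftrightarrow> x \<in> E"
  shows "scales f 1"
proof -
  obtain c where c: "scales f c" by (rule scales_exists[OF assms(1,2)])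
  have "(\<integral>\<^sup>+x. indicator E (f x) \<partial>lborel) = (\<integral>\<^sup>+x. indicator E x \<partial>lborel)"
    using inv by (intro nn_integral_cong) (simp add: indicator_def)
  then have "emeasure lborel E = ennreal c * emeasure lborel E"
    using scalesD[OF c, of "indicator E"] assms(3) by simp
  then have "ennreal 1 = ennreal c"
    using assms(4,5) by (metis ennreal_mult_divide_eq infinity_ennreal_def less_irrefl mult_1 ennreal_1)
  then show ?thesis using c by (simp add: scales_def)
qed

lemma scales_isometry:
  fixes f :: "'a::euclidean_space \<Rightarrow> 'a"
  assumes "linear f" "\<And>x. norm (f x) = norm x"
  shows "scales f 1"
proof (rule scales_invariant_set[OF assms(1), of "ball 0 1"])
  have "inj f"
    using assms by (metis linear_injective_0 norm_eq_zero)
  then show "bij f"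
    using linear_injective_imp_surjective[OF assms(1)] by (simp add: bij_def)
qed (use emeasure_lborel_open_bounded[of "ball 0 1" "0 :: 'a"] assms(2) in simp_all)

lemma scales_diagonal:
  fixes f :: "'a::euclidean_space \<Rightarrow> 'a"
  assumes "linear f" "\<And>b. b \<in> Basis \<Longrightarrow> f b = c b *\<^sub>R b" "\<And>b. b \<in> Basis \<Longrightarrow> 0 < c b"
  shows "scales f (inverse (\<Prod>b\<in>Basis. c b))"
proof -
  have f: "f x = 0 + (\<Sum>b\<in>Basis. (c b * inner x b) *\<^sub>R b)" for x
  proof -
    have "f x = f (\<Sum>b\<in>Basis. inner x b *\<^sub>R b)" by (simp add: euclidean_representation)
    also have "\<dots> = (\<Sum>b\<in>Basis. inner x b *\<^sub>R f b)"
      by (simp add: linear_sum[OF assms(1)] linear_scale[OF assms(1)])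
    finally show ?thesis using assms(2) by (simp add: mult.commute)
  qed
  have [measurable]: "f \<in> borel_measurable borel" by (rule borel_measurable_linear[OF assms(1)])
  define p where "p = (\<Prod>b\<in>Basis. c b)"
  have p: "0 < p" using assms(3) by (simp add: p_def prod_pos)
  have "lborel = density (distr lborel borel (\<lambda>x. 0 + (\<Sum>b\<in>Basis. (c b * inner x b) *\<^sub>R b))) (\<lambda>_. ennreal (\<Prod>b\<in>Basis. \<bar>c b\<bar>))"
    by (rule lborel_affine_euclidean) (use assms(3) in force)
  moreover have "(\<Prod>b\<in>Basis. \<bar>c b\<bar>) = p"
    using assms(3) by (auto simp: p_def abs_of_pos intro!: prod.cong)
  ultimately have l: "lborel = density (distr lborel borel f) (\<lambda>_. ennreal p)"
    unfolding f[symmetric] by simp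
  have "(\<integral>\<^sup>+x. h (f x) \<partial>lborel) = ennreal (inverse p) * (\<integral>\<^sup>+x. h x \<partial>lborel)"
    if [measurable]: "h \<in> borel_measurable borel" for h
  proof -
    have "(\<integral>\<^sup>+x. h x \<partial>lborel) = (\<integral>\<^sup>+x. h x \<partial>density (distr lborel borel f) (\<lambda>_. ennreal p))"
      using l by metis
    also have "\<dots> = ennreal p * (\<integral>\<^sup>+x. h (f x) \<partial>lborel)"
      by (simp add: nn_integral_density nn_integral_distr nn_integral_cmult)
    finally show ?thesis
      using p by (simp flip: mult.assoc ennreal_mult')
  qed
  then show ?thesis using p by (simp add: scales_def p_def)
qed

lemma prod_Basis_vec:
  fixes c :: "'a::euclidean_space^'n \<Rightarrow> real"
  shows "(\<Prod>b\<in>Basis. c b) = (\<Prod>i\<in>UNIV. \<Prod>u\<in>Basis. c (axis i u))"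
proof -
  have "(Basis :: ('a^'n) set) = (\<lambda>(i, u). axis i u) ` (UNIV \<times> Basis)"
    by (auto simp: Basis_vec_def)
  then have "(\<Prod>b\<in>Basis. c b) = (\<Prod>b\<in>(\<lambda>(i, u). axis i u) ` (UNIV \<times> Basis). c b)"
    by (rule arg_cong)
  also have "inj_on (\<lambda>(i, u). axis i u :: 'a^'n) (UNIV \<times> Basis)"
    by (auto simp: inj_on_def axis_eq_axis nonzero_Basis)
  then have "(\<Prod>b\<in>(\<lambda>(i, u). axis i u) ` (UNIV \<times> Basis). c b) = (\<Prod>(i, u)\<in>UNIV \<times> Basis. c (axis i u))"
    by (simp add: prod.reindex case_prod_unfold)
  also have "\<dots> = (\<Prod>i\<in>UNIV. \<Prod>u\<in>Basis. c (axis i u))"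
    by (simp add: prod.cartesian_product)
  finally show ?thesis .
qed

section \<open>Jacobians of matrix multiplication\<close>

lemma linear_matrix_right: "linear (\<lambda>A. A ** (g :: 'f::star_algebra^'n^'m) :: 'f^'n^'k)"
  by (simp add: linear_iff matrix_add_rdistrib matrix_mult_scaleR_left)

lemma linear_matrix_left: "linear (\<lambda>A. (g :: 'f::star_algebra^'n^'m) ** A :: 'f^'k^'m)"
  by (simp add: linear_iff matrix_add_ldistrib matrix_mult_scaleR_right)

lemma scales_scale_entries:
  fixes f :: "'f::star_algebra^'n^'m \<Rightarrow> 'f^'n^'m"
  assumes "linear f" "\<And>i j u. u \<in> Basis \<Longrightarrow> f (axis i (axis j u)) = w i j u *\<^sub>R axis i (axis j u)"
    "\<And>i j u. u \<in> Basis \<Longrightarrow> 0 < w i j u"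
  shows "scales f (inverse (\<Prod>i\<in>UNIV. \<Prod>j\<in>UNIV. \<Prod>u\<in>Basis. w i j u))"
proof -
  define c where "c b = inner (f b) b" for b
  have c: "c (axis i (axis j u)) = w i j u" if "u \<in> Basis" for i j u
    using that by (simp add: c_def assms(2) inner_axis_axis inner_Basis)
  have "scales f (inverse (\<Prod>b\<in>Basis. c b))"
    by (rule scales_diagonal[OF assms(1)]) (auto simp: Basis_vec_def c assms(2,3))
  moreover have "(\<Prod>b\<in>Basis. c b) = (\<Prod>i\<in>UNIV. \<Prod>j\<in>UNIV. \<Prod>u\<in>Basis. w i j u)"
    by (simp add: prod_Basis_vec c)
  ultimately show ?thesis by simp
qed

text \<open>The Jacobians below are multiplicative and trivial on unitary matrices, so by the singular
  value decomposition they are determined by their values on diagonal matrices.\<close>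

lemma scales_matrix_right:
  fixes g :: "'f::star_algebra^'q::{finite,linorder}^'q::{finite,linorder}"
  assumes "adet g \<noteq> 0"
  shows "scales (\<lambda>A. A ** g :: ('f, 'q) vec^'n) (adet g powr - (real DIM('f) * real CARD('n)))"
proof -
  obtain U V where UV: "U \<in> unitary_group" "V \<in> unitary_group" "g = U ** diag (spec_s g) ** V" "spec_s g \<in> chamber"
    by (rule spec_s_svd[of g])
  define r where "r = spec_s g"
  have g: "g = U ** diag r ** V" using UV(3) by (simp add: r_def)
  have "r $ i \<noteq> 0" for i using assms by (auto simp: adet_def r_def)
  moreover have "0 \<le> r $ i" for i using UV(4) by (simp add: chamber_def r_def)
  ultimately have r: "0 < r $ i" for i by (metis less_le)
  have isom: "scales (\<lambda>A. A ** W :: ('f, 'q) vec^'n) 1" if "W \<in> unitary_group" for W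
    using that by (intro scales_isometry linear_matrix_right norm_unitary_mult_right)
  have "scales (\<lambda>A. A ** diag r :: ('f, 'q) vec^'n) (inverse (\<Prod>i\<in>(UNIV :: 'n set). \<Prod>j\<in>UNIV. \<Prod>u\<in>(Basis :: 'f set). r $ j))"
    by (rule scales_scale_entries[OF linear_matrix_right])
      (auto simp: vec_eq_iff axis_def of_real_def r)
  moreover have "inverse (\<Prod>i\<in>(UNIV :: 'n set). \<Prod>j\<in>UNIV. \<Prod>u\<in>(Basis :: 'f set). r $ j)
      = adet g powr - (real DIM('f) * real CARD('n))"
  proof -
    have a: "0 < adet g" using assms adet_nonneg[of g] by linarith
    have "(\<Prod>i\<in>(UNIV :: 'n set). \<Prod>j\<in>UNIV. \<Prod>u\<in>(Basis :: 'f set). r $ j) = adet g ^ (DIM('f) * CARD('n))"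
      by (simp add: adet_def r_def prod_power_distrib power_mult)
    also have "\<dots> = adet g powr (real DIM('f) * real CARD('n))"
      using a by (simp add: powr_realpow[symmetric])
    finally show ?thesis by (simp add: powr_minus)
  qed
  ultimately have D: "scales (\<lambda>A. A ** diag r :: ('f, 'q) vec^'n) (adet g powr - (real DIM('f) * real CARD('n)))"
    by simp
  have "scales (\<lambda>A. A ** U ** diag r ** V :: ('f, 'q) vec^'n) (1 * (adet g powr - (real DIM('f) * real CARD('n)) * 1))"
    by (intro scales_comp[OF isom[OF UV(2)]] scales_comp[OF D isom[OF UV(1)]])
      (auto intro!: borel_measurable_linear linear_matrix_right)
  then show ?thesis by (simp add: g matrix_mul_assoc)
qed

lemma scales_matrix_left:
  fixes g :: "'f::star_algebra^'q::{finite,linorder}^'q::{finite,linorder}"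
  assumes "adet g \<noteq> 0"
  shows "scales (\<lambda>A. g ** A :: ('f^'n, 'q) vec) (adet g powr - (real DIM('f) * real CARD('n)))"
proof -
  obtain U V where UV: "U \<in> unitary_group" "V \<in> unitary_group" "g = U ** diag (spec_s g) ** V" "spec_s g \<in> chamber"
    by (rule spec_s_svd[of g])
  define r where "r = spec_s g"
  have g: "g = U ** diag r ** V" using UV(3) by (simp add: r_def)
  have "r $ i \<noteq> 0" for i using assms by (auto simp: adet_def r_def)
  moreover have "0 \<le> r $ i" for i using UV(4) by (simp add: chamber_def r_def)
  ultimately have r: "0 < r $ i" for i by (metis less_le)
  have isom: "scales (\<lambda>A. W ** A :: (('f, 'n) vec, 'q) vec) 1" if "W \<in> unitary_group" for W
    using that by (intro scales_isometry linear_matrix_left norm_unitary_mult_left)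
  have "scales (\<lambda>A. diag r ** A :: (('f, 'n) vec, 'q) vec) (inverse (\<Prod>i\<in>UNIV. \<Prod>j\<in>(UNIV :: 'n set). \<Prod>u\<in>(Basis :: 'f set). r $ i))"
    by (rule scales_scale_entries[OF linear_matrix_left])
      (auto simp: vec_eq_iff axis_def of_real_def r)
  moreover have "inverse (\<Prod>i\<in>UNIV. \<Prod>j\<in>(UNIV :: 'n set). \<Prod>u\<in>(Basis :: 'f set). r $ i)
      = adet g powr - (real DIM('f) * real CARD('n))"
  proof -
    have a: "0 < adet g" using assms adet_nonneg[of g] by linarith
    have "(\<Prod>i\<in>UNIV. \<Prod>j\<in>(UNIV :: 'n set). \<Prod>u\<in>(Basis :: 'f set). r $ i) = adet g ^ (DIM('f) * CARD('n))"
      by (simp add: adet_def r_def prod_power_distrib power_mult)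
    also have "\<dots> = adet g powr (real DIM('f) * real CARD('n))"
      using a by (simp add: powr_realpow[symmetric])
    finally show ?thesis by (simp add: powr_minus)
  qed
  ultimately have D: "scales (\<lambda>A. diag r ** A :: (('f, 'n) vec, 'q) vec) (adet g powr - (real DIM('f) * real CARD('n)))"
    by simp
  have "scales (\<lambda>A. U ** (diag r ** (V ** A)) :: (('f, 'n) vec, 'q) vec) (1 * (adet g powr - (real DIM('f) * real CARD('n)) * 1))"
    by (intro scales_comp[OF isom[OF UV(1)]] scales_comp[OF D isom[OF UV(2)]])
      (auto intro!: borel_measurable_linear linear_matrix_left)
  then show ?thesis by (simp add: g matrix_mul_assoc)
qed

text \<open>The scale factor of right multiplication by \<open>g ** h\<close> is computed directly
  and as that of a composition. Scale factors are unique, and the power - d q can be undone on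
  positive numbers.\<close>

lemma adet_mult_invertible:
  fixes g h :: "'f::star_algebra^'q::{finite,linorder}^'q::{finite,linorder}"
  assumes "adet g \<noteq> 0" "adet h \<noteq> 0"
  shows "adet (g ** h) = adet g * adet h"
proof -
  define N where "N = real DIM('f) * real CARD('q)"
  have N: "0 < N" by (simp add: N_def)
  have pos: "0 < adet g" "0 < adet h" using assms adet_nonneg[of g] adet_nonneg[of h] by linarith+
  have "g ** h *v x = 0 \<Longrightarrow> x = 0" for x
    using assms by (metis adet_nonzero_iff matrix_vector_mul_assoc)
  then have "adet (g ** h) \<noteq> 0" by (simp add: adet_nonzero_iff)
  then have gh: "0 < adet (g ** h)" using adet_nonneg[of "g ** h"] by linarith
  have "scales (\<lambda>A. A ** g ** h :: (('f, 'q) vec, 'q) vec) (adet h powr - N * adet g powr - N)"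
    unfolding N_def
    by (intro scales_comp[OF scales_matrix_right[OF assms(2)] scales_matrix_right[OF assms(1)]]
        borel_measurable_linear linear_matrix_right)
  moreover have "scales (\<lambda>A. A ** g ** h :: (('f, 'q) vec, 'q) vec) (adet (g ** h) powr - N)"
    unfolding N_def using scales_matrix_right[OF \<open>adet (g ** h) \<noteq> 0\<close>] by (simp add: matrix_mul_assoc)
  ultimately have "adet h powr - N * adet g powr - N = adet (g ** h) powr - N"
    by (rule scales_unique)
  then have "(adet g * adet h) powr - N = adet (g ** h) powr - N"
    using pos by (simp add: powr_mult mult.commute)
  then have "((adet g * adet h) powr - N) powr (- 1 / N) = (adet (g ** h) powr - N) powr (- 1 / N)"
    by simp
  then show ?thesis
    using N pos gh by (simp add: powr_powr)
qed

section \<open>Lebesgue measure on Hermitian matrices\<close>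

text \<open>A matrix \<open>X\<close> is split into its upper part, which carries a Hermitian matrix, and the
  complementary coordinates; Lebesgue measure on Hermitian matrices is Lebesgue measure
  of \<open>X\<close> with the complementary coordinates restricted to a ball.\<close>

definition herm :: "'f::star_algebra^'q::{finite,linorder}^'q::{finite,linorder} \<Rightarrow> 'f^'q::{finite,linorder}^'q::{finite,linorder}"
  where "herm X = (\<chi> i j. if i < j then X $ i $ j else if j < i then fconj (X $ j $ i)
    else of_real (inner 1 (X $ i $ i)))"

definition upper :: "'f::star_algebra^'q::{finite,linorder}^'q::{finite,linorder} \<Rightarrow> 'f^'q::{finite,linorder}^'q::{finite,linorder}"
  where "upper X = (\<chi> i j. if i < j then X $ i $ j else if j < i then 0
    else of_real (inner 1 (X $ i $ i)))"

text \<open>Congruence by \<open>g\<close> on the Hermitian part and the identity on the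
  complementary coordinates. It is an endomorphism of the whole matrix space whose Jacobian is that
  of the congruence.\<close>

definition herm_act :: "'f::star_algebra^'q::{finite,linorder}^'q::{finite,linorder} \<Rightarrow> 'f^'q::{finite,linorder}^'q::{finite,linorder} \<Rightarrow> 'f^'q::{finite,linorder}^'q::{finite,linorder}"
  where "herm_act g X = upper (mstar g ** herm X ** g) + (X - upper X)"

lemma linear_herm: "linear (herm :: 'f::star_algebra^'q::{finite,linorder}^'q::{finite,linorder} \<Rightarrow> _)"
  by (auto simp: linear_iff herm_def vec_eq_iff fconj_add fconj_scaleR inner_add_right of_real_def scaleR_add_left)

lemma linear_upper: "linear (upper :: 'f::star_algebra^'q::{finite,linorder}^'q::{finite,linorder} \<Rightarrow> _)"
  by (auto simp: linear_iff upper_def vec_eq_iff inner_add_right of_real_def scaleR_add_left)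

lemma linear_herm_act: "linear (herm_act (g :: 'f::star_algebra^'q::{finite,linorder}^'q::{finite,linorder}))"
  unfolding herm_act_def
  by (intro linear_compose_add linear_compose_sub linear_ident linear_upper
      linear_compose[OF _ linear_upper, unfolded o_def] linear_compose[OF _ linear_matrix_right, unfolded o_def]
      linear_compose[OF linear_herm linear_matrix_left, unfolded o_def])

lemma mstar_herm [simp]: "mstar (herm X) = herm X"
  by (auto simp: vec_eq_iff herm_def)

lemma herm_upper [simp]: "herm (upper X) = herm X"
  by (auto simp: vec_eq_iff herm_def upper_def inner_1_of_real)

lemma upper_upper [simp]: "upper (upper X) = upper X"
  by (auto simp: vec_eq_iff upper_def inner_1_of_real)

lemma upper_herm [simp]: "upper (herm X) = upper X"
  by (auto simp: vec_eq_iff herm_def upper_def inner_1_of_real)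

text \<open>A self-conjugate x satisfies x^2 = |x|^2, and without zero divisors this forces x = |x|
  or x = -|x|.\<close>

lemma fconj_eq_self: "fconj x = x \<Longrightarrow> of_real (inner 1 x) = (x :: 'f::star_algebra)"
proof -
  assume "fconj x = x"
  then have "x * x = (norm x)\<^sup>2 *\<^sub>R 1" using fconj_mult_self[of x] by simp
  then have "(x - of_real (norm x)) * (x + of_real (norm x)) = 0"
    by (simp add: algebra_simps of_real_def power2_eq_square)
  then have "x = of_real (norm x) \<or> x = of_real (- norm x)"
    by (auto simp: eq_neg_iff_add_eq_0)
  then show ?thesis by (metis inner_1_of_real)
qed

lemma herm_eq_self:
  assumes "mstar S = S" shows "herm S = S"
proof -
  have "fconj (S $ i $ j) = S $ j $ i" for i j using assms by (metis mstar_nth)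
  then show ?thesis by (auto simp: vec_eq_iff herm_def fconj_eq_self)
qed

lemma herm_herm_act [simp]: "herm (herm_act g X) = mstar g ** herm X ** g"
proof -
  have "herm (herm_act g X) = herm (mstar g ** herm X ** g)"
    by (simp add: herm_act_def linear_add[OF linear_herm] linear_diff[OF linear_herm])
  also have "\<dots> = mstar g ** herm X ** g"
    by (rule herm_eq_self) (simp add: mstar_mult matrix_mul_assoc)
  finally show ?thesis .
qed

lemma lower_herm_act [simp]: "herm_act g X - upper (herm_act g X) = X - upper X"
  by (simp add: herm_act_def linear_add[OF linear_upper] linear_diff[OF linear_upper])

lemma herm_act_mat_1 [simp]: "herm_act (mat 1) X = X"
  by (simp add: herm_act_def)

lemma herm_act_mult: "herm_act g (herm_act h X) = herm_act (h ** g) X"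
  by (simp add: herm_act_def[of g] herm_act_def[of "h ** g"] mstar_mult matrix_mul_assoc)

lemma bij_herm_act:
  assumes "adet g \<noteq> 0" shows "bij (herm_act g)"
proof -
  obtain h where "g ** h = mat 1" "h ** g = mat 1" using assms by (rule adet_nonzero_inverse)
  then show ?thesis
    by (intro o_bij[of "herm_act h"]) (auto simp: fun_eq_iff herm_act_mult)
qed

lemma continuous_on_herm [continuous_intros]:
  "continuous_on S f \<Longrightarrow> continuous_on S (\<lambda>x. herm (f x))"
  by (rule continuous_on_compose2[of UNIV herm]) (auto simp: linear_continuous_on linear_herm linear_conv_bounded_linear[symmetric])

lemma continuous_on_upper [continuous_intros]:
  "continuous_on S f \<Longrightarrow> continuous_on S (\<lambda>x. upper (f x))"
  by (rule continuous_on_compose2[of UNIV upper]) (auto simp: linear_continuous_on linear_upper linear_conv_bounded_linear[symmetric])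

lemma bounded_herm_lower:
  "bounded {X :: 'f::star_algebra^'q::{finite,linorder}^'q::{finite,linorder}. norm (herm X) \<le> a \<and> norm (X - upper X) \<le> b}"
proof -
  obtain B where B: "\<And>X :: (('f, 'q) vec, 'q) vec. norm (upper X) \<le> B * norm X"
    using linear_bounded[OF linear_upper] by blast
  have "norm X \<le> \<bar>B\<bar> * \<bar>a\<bar> + b" if "norm (herm X) \<le> a" "norm (X - upper X) \<le> b" for X :: "(('f, 'q) vec, 'q) vec"
  proof -
    have "norm (upper X) \<le> B * norm (herm X)" using B[of "herm X"] by simp
    also have "\<dots> \<le> \<bar>B\<bar> * \<bar>a\<bar>"
      using that(1) by (intro mult_mono) auto
    finally have "norm (upper X + (X - upper X)) \<le> \<bar>B\<bar> * \<bar>a\<bar> + b"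
      using that(2) by (intro norm_triangle_le) simp
    then show ?thesis by simp
  qed
  then show ?thesis unfolding bounded_iff by blast
qed

text \<open>\<open>herm_act k\<close> need not preserve the matrix norm, since \<open>herm\<close>
  counts off-diagonal entries twice. It does preserve the norms of the Hermitian part and of the
  complementary part, so \<open>E\<close> is an invariant set.\<close>

lemma scales_herm_act_unitary:
  fixes k :: "'f::star_algebra^'q::{finite,linorder}^'q::{finite,linorder}"
  assumes "k \<in> unitary_group" shows "scales (herm_act k) 1"
proof -
  define E where "E = {X :: (('f, 'q) vec, 'q) vec. norm (herm X) < 1 \<and> norm (X - upper X) < 1}"
  have open_E: "open E"
    unfolding E_def by (intro open_Collect_conj open_Collect_less continuous_intros)
  have "bounded E"
    by (rule bounded_subset[OF bounded_herm_lower[of 1 1]]) (auto simp: E_def)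
  moreover have "0 \<in> E" by (simp add: E_def linear_0[OF linear_herm] linear_0[OF linear_upper])
  ultimately have E: "emeasure lborel E \<noteq> 0" "emeasure lborel E < \<infinity>"
    using emeasure_lborel_open_bounded[OF open_E] by blast+
  have "adet k \<noteq> 0" using adet_unitary_mult[OF assms unitary_mat_1, of "mat 1"] by simp
  moreover have "herm_act k X \<in> E \<longleftrightarrow> X \<in> E" for X
    using assms by (simp add: E_def norm_unitary_mult_right norm_unitary_mult_left unitary_mstar)
  ultimately show ?thesis
    using open_E E by (intro scales_invariant_set[of _ E] linear_herm_act bij_herm_act) auto
qed

text \<open>Each \<open>r i\<close> enters through q - 1 pairs with exponent d and through its own
  diagonal entry with exponent 2.\<close>

lemma prod_pairs:
  fixes r :: "'q::{finite,linorder} \<Rightarrow> real"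
  shows "(\<Prod>i\<in>UNIV. \<Prod>j\<in>UNIV. if i < j then (r i * r j) ^ d else if j < i then 1 else (r i)\<^sup>2)
    = (\<Prod>i\<in>UNIV. r i) ^ (2 + d * (CARD('q) - 1))"
proof -
  define a where "a i = r i ^ d" for i
  have "(\<Prod>i\<in>UNIV. \<Prod>j\<in>UNIV. if i < j then (r i * r j) ^ d else if j < i then 1 else (r i)\<^sup>2)
    = (\<Prod>i\<in>UNIV. \<Prod>j\<in>UNIV. (if i < j then a i else 1) * (if i < j then a j else 1) * (if i = j then (r i)\<^sup>2 else 1))"
    by (intro prod.cong) (auto simp: a_def power_mult_distrib)
  also have "\<dots> = (\<Prod>i\<in>UNIV. \<Prod>j\<in>UNIV. if i < j then a i else 1)
      * (\<Prod>i\<in>UNIV. \<Prod>j\<in>UNIV. if i < j then a j else 1) * (\<Prod>i\<in>UNIV. (r i)\<^sup>2)"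
    by (simp add: prod.distrib)
  also have "(\<Prod>i\<in>UNIV. \<Prod>j\<in>UNIV. if i < j then a j else 1) = (\<Prod>i\<in>UNIV. \<Prod>j\<in>UNIV. if j < i then a i else 1)"
    by (rule prod.swap)
  also have "(\<Prod>i\<in>UNIV. \<Prod>j\<in>UNIV. if i < j then a i else 1) * (\<Prod>i\<in>UNIV. \<Prod>j\<in>UNIV. if j < i then a i else 1)
      = (\<Prod>i\<in>UNIV. \<Prod>j\<in>UNIV. if j \<noteq> i then a i else 1)"
    unfolding prod.distrib[symmetric] by (intro prod.cong) auto
  also have "\<dots> = (\<Prod>i\<in>UNIV. a i ^ (CARD('q) - 1))"
  proof (rule prod.cong[OF refl])
    fix i :: 'q
    have "(\<Prod>j\<in>UNIV. if j \<noteq> i then a i else 1) = (\<Prod>j\<in>UNIV - {i}. a i)"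
      by (rule prod.mono_neutral_cong_right) auto
    then show "(\<Prod>j\<in>UNIV. if j \<noteq> i then a i else 1) = a i ^ (CARD('q) - 1)" by simp
  qed
  also have "\<dots> * (\<Prod>i\<in>UNIV. (r i)\<^sup>2) = (\<Prod>i\<in>UNIV. r i) ^ (2 + d * (CARD('q) - 1))"
    by (simp add: a_def prod_power_distrib prod.distrib[symmetric] power_add power_mult mult_ac power2_eq_square)
  finally show ?thesis .
qed

lemma inner_1_Basis: "u \<in> Basis \<Longrightarrow> inner 1 u = (if u = (1 :: 'f::star_algebra) then 1 else 0)"
  using inner_Basis[OF one_in_Basis, of u] by auto

lemma herm_act_diag_axis:
  fixes r :: "real^'q::{finite,linorder}"
  assumes "u \<in> Basis"
  shows "herm_act (diag r) (axis i (axis j (u :: 'f::star_algebra)))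
    = (if i < j then r $ i * r $ j else if i = j \<and> u = 1 then (r $ i)\<^sup>2 else 1) *\<^sub>R axis i (axis j u)"
proof -
  have "upper (mstar (diag r) ** herm X ** diag r) $ k $ l
      = (if k \<le> l then (r $ k * r $ l) *\<^sub>R upper X $ k $ l else 0)" for X :: "(('f, 'q) vec, 'q) vec" and k l
    using inner_1_of_real[of 1, where 'f = 'f] by (auto simp: upper_def herm_def of_real_def)
  then have act: "herm_act (diag r) X $ k $ l
      = (if k \<le> l then (r $ k * r $ l) *\<^sub>R upper X $ k $ l else 0) + (X $ k $ l - upper X $ k $ l)"
    for X :: "(('f, 'q) vec, 'q) vec" and k l
    by (simp add: herm_act_def)
  have up: "upper (axis i (axis j u)) = (if i < j \<or> i = j \<and> u = 1 then axis i (axis j u) else 0)"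
    using inner_1_Basis[OF assms] by (auto simp: upper_def vec_eq_iff axis_def)
  show ?thesis
    unfolding vec_eq_iff act up by (auto simp: axis_def power2_eq_square)
qed

text \<open>The exponent is 2 / q times the real dimension q + d q (q - 1) / 2 of the space of
  Hermitian matrices, as the case of a scalar \<open>g\<close> shows.\<close>

lemma scales_herm_act:
  fixes g :: "'f::star_algebra^'q::{finite,linorder}^'q::{finite,linorder}"
  assumes "adet g \<noteq> 0"
  shows "scales (herm_act g) (adet g powr - (2 + real DIM('f) * (real CARD('q) - 1)))"
proof -
  define N where "N = 2 + real DIM('f) * (real CARD('q) - 1)"
  obtain U V where UV: "U \<in> unitary_group" "V \<in> unitary_group" "g = U ** diag (spec_s g) ** V" "spec_s g \<in> chamber"
    by (rule spec_s_svd[of g])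
  define r where "r = spec_s g"
  have g: "g = U ** diag r ** V" using UV(3) by (simp add: r_def)
  have r0: "r $ i \<noteq> 0" for i using assms by (auto simp: adet_def r_def)
  moreover have "0 \<le> r $ i" for i using UV(4) by (simp add: chamber_def r_def)
  ultimately have r: "0 < r $ i" for i by (metis less_le)
  define w where "w i j u = (if i < j then r $ i * r $ j else if i = j \<and> u = 1 then (r $ i)\<^sup>2 else 1)"
    for i j and u :: 'f
  have "scales (herm_act (diag r :: (('f, 'q) vec, 'q) vec)) (inverse (\<Prod>i\<in>UNIV. \<Prod>j\<in>UNIV. \<Prod>u\<in>Basis. w i j u))"
    by (rule scales_scale_entries[OF linear_herm_act]) (auto simp: herm_act_diag_axis w_def r r0)
  moreover have "(\<Prod>u\<in>Basis. w i j u) = (if i < j then (r $ i * r $ j) ^ DIM('f) else if j < i then 1 else (r $ i)\<^sup>2)" for i j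
  proof -
    have "(\<Prod>u\<in>(Basis :: 'f set). if u = 1 then (r $ i)\<^sup>2 else 1) = (r $ i)\<^sup>2"
      by (simp add: one_in_Basis)
    then show ?thesis by (cases "i = j") (auto simp: w_def)
  qed
  then have "(\<Prod>i\<in>UNIV. \<Prod>j\<in>UNIV. \<Prod>u\<in>Basis. w i j u) = adet g ^ (2 + DIM('f) * (CARD('q) - 1))"
    by (simp only: prod_pairs) (simp add: adet_def r_def)
  moreover have "inverse (adet g ^ (2 + DIM('f) * (CARD('q) - 1))) = adet g powr - N"
  proof -
    have a: "0 < adet g" using assms adet_nonneg[of g] by linarith
    have "N = real (2 + DIM('f) * (CARD('q) - 1))"
      by (simp add: N_def of_nat_diff)
    then have "adet g powr N = adet g ^ (2 + DIM('f) * (CARD('q) - 1))"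
      using a by (simp only: powr_realpow)
    then show ?thesis by (simp add: powr_minus)
  qed
  ultimately have D: "scales (herm_act (diag r :: (('f, 'q) vec, 'q) vec)) (adet g powr - N)"
    by simp
  have "scales (\<lambda>X. herm_act V (herm_act (diag r) (herm_act U X))) (1 * (adet g powr - N * 1))"
    by (intro scales_comp[OF scales_herm_act_unitary[OF UV(2)]] scales_comp[OF D scales_herm_act_unitary[OF UV(1)]])
      (auto intro!: borel_measurable_linear linear_herm_act linear_compose[OF linear_herm_act linear_herm_act, unfolded o_def])
  moreover have "(\<lambda>X. herm_act V (herm_act (diag r) (herm_act U X))) = herm_act g"
    by (simp add: g herm_act_mult fun_eq_iff matrix_mul_assoc)
  ultimately show ?thesis by (simp add: N_def)
qed

lemma adet_mult:
  fixes g h :: "'f::star_algebra^'q::{finite,linorder}^'q::{finite,linorder}"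
  shows "adet (g ** h) = adet g * adet h"
proof -
  have zero: "adet (g ** h) = 0" if z: "adet h = 0" for g h :: "(('f, 'q) vec, 'q) vec"
  proof -
    obtain x where x: "x \<noteq> 0" "h *v x = 0"
      using z adet_nonzero_iff[of h] by auto
    then have "(g ** h) *v x = 0" by (simp flip: matrix_vector_mul_assoc)
    then show ?thesis using x(1) adet_nonzero_iff[of "g ** h"] by auto
  qed
  have "adet (g ** h) = adet (mstar h ** mstar g)"
    using adet_mstar[of "g ** h"] by (simp add: mstar_mult)
  then have "adet (g ** h) = 0" if "adet g = 0"
    using zero[of "mstar g" "mstar h"] that by simp
  then show ?thesis
    using zero[of h g] adet_mult_invertible[of g h] by (cases "adet g = 0"; cases "adet h = 0") simp_all
qed

section \<open>Relatively invariant measures on the cone of positive definite matrices\<close>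

lemma norm_matrix_vector_le: "norm (A *v x) \<le> norm A * norm (x :: 'f::star_algebra^'n)"
proof -
  have "norm ((A *v x) $ i) \<le> norm (A $ i) * norm x" for i
  proof -
    have "norm ((A *v x) $ i) \<le> (\<Sum>j\<in>UNIV. \<bar>norm (A $ i $ j)\<bar> * \<bar>norm (x $ j)\<bar>)"
      unfolding matrix_vector_mult_def by (simp add: sum_norm_le norm_mult)
    also have "\<dots> \<le> norm (A $ i) * norm x"
      unfolding norm_vec_def by (rule L2_set_mult_ineq)
    finally show ?thesis .
  qed
  then have "norm (A *v x) \<le> L2_set (\<lambda>i. norm (A $ i) * norm x) UNIV"
    unfolding norm_vec_def[of "A *v x"] by (intro L2_set_mono) auto
  also have "\<dots> = norm A * norm x"
    by (simp add: norm_vec_def[of A] L2_set_left_distrib)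
  finally show ?thesis .
qed

lemma near_1I:
  fixes S :: "'f::star_algebra^'n^'n"
  assumes "mstar S = S" "norm (S - mat 1) \<le> 1 / 2"
  shows "near S (mat 1)"
proof -
  have *: "\<bar>inner x ((S - mat 1) *v x)\<bar> \<le> inner x x / 2" for x
  proof -
    have "\<bar>inner x ((S - mat 1) *v x)\<bar> \<le> norm x * norm ((S - mat 1) *v x)"
      by (rule Cauchy_Schwarz_ineq2)
    also have "\<dots> \<le> norm x * (norm (S - mat 1) * norm x)"
      by (intro mult_left_mono norm_matrix_vector_le) auto
    also have "\<dots> \<le> norm x * (1 / 2 * norm x)"
      using assms(2) by (intro mult_left_mono mult_right_mono) auto
    finally show ?thesis by (simp add: dot_square_norm power2_eq_square)
  qed
  have "0 \<le> inner x ((S - (1 / 2) *\<^sub>R mat 1) *v x)" "0 \<le> inner x ((2 *\<^sub>R mat 1 - S) *v x)" for x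
  proof -
    have "inner x ((S - mat 1) *v x) = inner x (S *v x) - inner x x"
      by (simp add: matrix_vector_mult_diff_rdistrib inner_diff_right)
    then have "inner x x / 2 \<le> inner x (S *v x)" "inner x (S *v x) \<le> 2 * inner x x"
      using *[of x] inner_ge_zero[of x] by linarith+
    then show "0 \<le> inner x ((S - (1 / 2) *\<^sub>R mat 1) *v x)" "0 \<le> inner x ((2 *\<^sub>R mat 1 - S) *v x)"
      by (simp_all add: matrix_vector_mult_diff_rdistrib scaleR_matrix_vector inner_diff_right)
  qed
  then show ?thesis
    using assms(1) by (simp add: near_def psd_def mstar_diff mstar_scaleR)
qed

lemma closed_Collect_near:
  assumes "continuous_on UNIV f" "continuous_on UNIV g"
  shows "closed {x. near (f x :: 'f::star_algebra^'n^'n) (g x)}"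
  using closed_vimage[OF closed_near continuous_on_Pair[OF assms]] by (simp add: vimage_def)

lemma psd_scaleR: "psd A \<Longrightarrow> 0 \<le> c \<Longrightarrow> psd (c *\<^sub>R A)"
  by (simp add: psd_def mstar_scaleR scaleR_matrix_vector)

text \<open>The constants 1/2 and 2 in \<open>near\<close> are reciprocal, so rescaling exchanges
  the two comparisons.\<close>

lemma near_sym: "near S P \<longleftrightarrow> near P S"
proof -
  have "near P S" if "near S P" for S P :: "'f::star_algebra^'n^'n"
    using psd_scaleR[of "2 *\<^sub>R P - S" "1/2"] psd_scaleR[of "S - (1/2) *\<^sub>R P" 2] that
    by (simp add: near_def scaleR_diff_right)
  then show ?thesis by blast
qed

text \<open>Test integrals are divided out below; this shows that they are neither 0 nor
  infinite.\<close>

lemma nn_integral_compact_pos: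
  fixes K :: "'a::euclidean_space set"
  assumes "compact K" "continuous_on K f" "\<And>x. x \<in> K \<Longrightarrow> 0 < f x"
    and "open E" "E \<subseteq> K" "x \<in> E"
  shows "0 < (\<integral>\<^sup>+x. indicator K x * ennreal (f x) \<partial>lborel)"
    "(\<integral>\<^sup>+x. indicator K x * ennreal (f x) \<partial>lborel) < \<infinity>"
proof -
  have K: "K \<in> sets borel" using assms(1) by (simp add: borel_compact)
  have ne: "K \<noteq> {}" using assms(5,6) by auto
  obtain a where a: "a \<in> K" "\<And>y. y \<in> K \<Longrightarrow> f a \<le> f y"
    using continuous_attains_inf[OF assms(1) ne assms(2)] by blast
  obtain b where b: "b \<in> K" "\<And>y. y \<in> K \<Longrightarrow> f y \<le> f b"
    using continuous_attains_sup[OF assms(1) ne assms(2)] by blast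
  have "0 < ennreal (f a)" using assms(3)[OF a(1)] by simp
  have E: "emeasure lborel E \<noteq> 0"
    using emeasure_lborel_open_bounded(1)[OF assms(4) bounded_subset[OF compact_imp_bounded[OF assms(1)] assms(5)] assms(6)] .
  have "ennreal (f a) * emeasure lborel E = (\<integral>\<^sup>+x. ennreal (f a) * indicator E x \<partial>lborel)"
    using assms(4) by (simp add: nn_integral_cmult_indicator)
  also have "\<dots> \<le> (\<integral>\<^sup>+x. indicator K x * ennreal (f x) \<partial>lborel)"
    using a assms(5) by (intro nn_integral_mono) (auto simp: indicator_def intro: ennreal_leI)
  finally have "ennreal (f a) * emeasure lborel E \<le> (\<integral>\<^sup>+x. indicator K x * ennreal (f x) \<partial>lborel)" .
  moreover have "0 < ennreal (f a) * emeasure lborel E"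
    using E \<open>0 < ennreal (f a)\<close> by (simp add: ennreal_zero_less_mult_iff zero_less_iff_neq_zero)
  ultimately show "0 < (\<integral>\<^sup>+x. indicator K x * ennreal (f x) \<partial>lborel)" by (rule order.strict_trans2[rotated])
  have "(\<integral>\<^sup>+x. indicator K x * ennreal (f x) \<partial>lborel) \<le> (\<integral>\<^sup>+x. ennreal (f b) * indicator K x \<partial>lborel)"
    using b by (intro nn_integral_mono) (auto simp: indicator_def intro: ennreal_leI)
  also have "\<dots> = ennreal (f b) * emeasure lborel K"
    using K by (simp add: nn_integral_cmult_indicator)
  also have "\<dots> < \<infinity>"
    using emeasure_bounded_finite[OF compact_imp_bounded[OF assms(1)]] by (simp add: ennreal_mult_less_top)
  finally show "(\<integral>\<^sup>+x. indicator K x * ennreal (f x) \<partial>lborel) < \<infinity>" .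
qed

section \<open>Measurability of the matrix operations\<close>

lemma measurable_matrix_mult [measurable]:
  fixes f :: "'a \<Rightarrow> 'f::star_algebra^'n^'m" and g :: "'a \<Rightarrow> 'f^'k^'n"
  assumes "f \<in> borel_measurable M" "g \<in> borel_measurable M"
  shows "(\<lambda>x. f x ** g x) \<in> borel_measurable M"
  using assms by (rule borel_measurable_continuous_Pair) (intro continuous_intros)

lemma measurable_mstar [measurable]:
  fixes f :: "'a \<Rightarrow> 'f::star_algebra^'n^'m"
  assumes "f \<in> borel_measurable M"
  shows "(\<lambda>x. mstar (f x)) \<in> borel_measurable M"
  using assms by (rule measurable_compose) (intro borel_measurable_continuous_onI continuous_intros)

lemma measurable_adet [measurable]:
  fixes f :: "'a \<Rightarrow> 'f::star_algebra^'q::{finite,linorder}^'q::{finite,linorder}"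
  assumes "f \<in> borel_measurable M"
  shows "(\<lambda>x. adet (f x)) \<in> borel_measurable M"
  using assms by (rule measurable_compose) (intro borel_measurable_continuous_onI continuous_intros)

lemma measurable_herm [measurable]:
  fixes f :: "'a \<Rightarrow> 'f::star_algebra^'q::{finite,linorder}^'q::{finite,linorder}"
  assumes "f \<in> borel_measurable M"
  shows "(\<lambda>x. herm (f x)) \<in> borel_measurable M"
  using assms by (rule measurable_compose) (intro borel_measurable_continuous_onI continuous_intros)

lemma measurable_upper [measurable]:
  fixes f :: "'a \<Rightarrow> 'f::star_algebra^'q::{finite,linorder}^'q::{finite,linorder}"
  assumes "f \<in> borel_measurable M"
  shows "(\<lambda>x. upper (f x)) \<in> borel_measurable M"
  using assms by (rule measurable_compose) (intro borel_measurable_continuous_onI continuous_intros)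

lemma pred_near [measurable]:
  fixes f g :: "'a \<Rightarrow> 'f::star_algebra^'n^'n"
  assumes [measurable]: "f \<in> borel_measurable M" "g \<in> borel_measurable M"
  shows "Measurable.pred M (\<lambda>x. near (f x) (g x))"
proof -
  have "(\<lambda>x. (f x, g x)) \<in> borel_measurable M" by measurable
  from measurable_sets[OF this borel_closed[OF closed_near]] show ?thesis
    by (simp add: pred_def vimage_def Int_def conj_commute)
qed

lemma pred_pos_definite [measurable]:
  fixes f :: "'a \<Rightarrow> 'f::star_algebra^'q::{finite,linorder}^'q::{finite,linorder}"
  assumes [measurable]: "f \<in> borel_measurable M"
  shows "Measurable.pred M (\<lambda>x. pos_definite (f x))"
proof -
  have "{x \<in> space M. psd (f x)} \<in> sets M"
    using measurable_sets[OF assms borel_closed[OF closed_psd]] by (simp add: vimage_def Int_def conj_commute)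
  then have [measurable]: "Measurable.pred M (\<lambda>x. psd (f x))" by (simp add: pred_def)
  show ?thesis unfolding pos_definite_iff by measurable
qed

lemma of_bool_near_congruence:
  fixes S :: "'f::star_algebra^'q::{finite,linorder}^'q::{finite,linorder}"
  assumes "adet g \<noteq> 0"
  shows "(of_bool (near (mstar g ** S ** g) (mstar g ** P ** g)) :: ennreal) = of_bool (near S P)"
  using near_congruence_iff[OF assms] by simp

section \<open>Invariant integrals over invertible matrices\<close>

text \<open>The weight turns Lebesgue measure into a Haar measure of the general linear group; the
  constant is the Haar mass of the \<open>C\<close> whose Gram matrix is comparable to the
  identity.\<close>

definition test_const :: "('f::star_algebra^'q::{finite,linorder}^'q::{finite,linorder}) itself \<Rightarrow> ennreal"
  where "test_const _ = (\<integral>\<^sup>+C. ennreal (adet C powr - (real DIM('f) * real CARD('q)))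
    * of_bool (near (mat 1) (mstar C ** (C :: (('f, 'q) vec, 'q) vec))) \<partial>lborel)"

lemma test_const_pos_finite:
  "0 < test_const TYPE('f::star_algebra^'q::{finite,linorder}^'q::{finite,linorder})"
  "test_const TYPE('f::star_algebra^'q::{finite,linorder}^'q::{finite,linorder}) < \<infinity>"
proof -
  define K where "K = {C :: (('f, 'q) vec, 'q) vec. near (mat 1) (mstar C ** C)}"
  define w where "w C = adet C powr - (real DIM('f) * real CARD('q))" for C :: "(('f, 'q) vec, 'q) vec"
  have eq: "test_const TYPE((('f, 'q) vec, 'q) vec) = (\<integral>\<^sup>+C. indicator K C * ennreal (w C) \<partial>lborel)"
    unfolding test_const_def by (intro nn_integral_cong) (auto simp: K_def w_def indicator_def)
  have nonzero: "adet C \<noteq> 0" if "C \<in> K" for C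
  proof -
    have "pos_definite (mstar C ** C)"
      using that by (auto simp: K_def near_sym[of "mat 1"] intro: near_1_pos_definite)
    then show ?thesis by (auto simp: pos_definite_iff adet_mult)
  qed
  have "closed K"
    unfolding K_def by (intro closed_Collect_near continuous_intros)
  moreover have "norm C \<le> 1 + norm (mat 1 :: (('f, 'q) vec, 'q) vec) * (2 * norm (mat 1 :: (('f, 'q) vec, 'q) vec))"
    if "C \<in> K" for C
  proof -
    have "(norm C)\<^sup>2 = inner (mat 1) (mstar C ** C)"
      by (simp add: inner_mat_1_mult inner_mstar_mstar dot_square_norm)
    also have "\<dots> \<le> norm (mat 1 :: (('f, 'q) vec, 'q) vec) * norm (mstar C ** C)"
      by (rule norm_cauchy_schwarz)
    also have "\<dots> \<le> norm (mat 1 :: (('f, 'q) vec, 'q) vec) * (2 * norm (mat 1 :: (('f, 'q) vec, 'q) vec))"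
      using that near_1_norm[of "mstar C ** C"] by (intro mult_left_mono) (auto simp: K_def near_sym[of "mat 1"])
    finally have *: "(norm C)\<^sup>2 \<le> norm (mat 1 :: (('f, 'q) vec, 'q) vec) * (2 * norm (mat 1 :: (('f, 'q) vec, 'q) vec))" .
    have "2 * norm C \<le> 1 + (norm C)\<^sup>2"
      using sum_squares_bound[of 1 "norm C"] by simp
    then show ?thesis using * norm_ge_zero[of C] by linarith
  qed
  then have "bounded K" unfolding bounded_iff by blast
  ultimately have "compact K" by (simp add: compact_eq_bounded_closed)
  moreover have "continuous_on K w"
    unfolding w_def using nonzero by (intro continuous_intros) auto
  moreover have "0 < w C" if "C \<in> K" for C
    using nonzero[OF that] by (simp add: w_def)
  moreover define E where "E = {C :: (('f, 'q) vec, 'q) vec. norm (mstar C ** C - mat 1) < 1 / 2}"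
  moreover have "open E"
    unfolding E_def by (intro open_Collect_less continuous_intros)
  moreover have "E \<subseteq> K"
    by (auto simp: E_def K_def near_sym[of "mat 1"] mstar_mult intro!: near_1I)
  moreover have "mat 1 \<in> E" by (simp add: E_def)
  ultimately show "0 < test_const TYPE((('f, 'q) vec, 'q) vec)" "test_const TYPE((('f, 'q) vec, 'q) vec) < \<infinity>"
    unfolding eq using nn_integral_compact_pos[of K w E "mat 1"] by blast+
qed

lemma powr_cancel_mult: "0 < a \<Longrightarrow> ennreal (a powr - x) * (ennreal (a powr x) * y) = y"
  by (simp add: powr_minus flip: mult.assoc ennreal_mult')

text \<open>With S = R* R substitute B = C R: the comparison \<open>near\<close> is invariant under
  congruence and the weighted measure under right translation.\<close>

lemma test_const_congruence:
  fixes S :: "'f::star_algebra^'q::{finite,linorder}^'q::{finite,linorder}"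
  assumes "pos_definite S"
  shows "(\<integral>\<^sup>+B. ennreal (adet B powr - (real DIM('f) * real CARD('q))) * of_bool (near S (mstar B ** B)) \<partial>lborel)
    = test_const TYPE((('f, 'q) vec, 'q) vec)"
proof -
  obtain R where R: "pos_definite R" "S = mstar R ** R" "adet S = (adet R)\<^sup>2"
    using pos_definite_sqrt[OF assms] by metis
  define N where "N = real DIM('f) * real CARD('q)"
  have R0: "adet R \<noteq> 0" using R(1) by (simp add: pos_definite_iff)
  then have Rpos: "0 < adet R" using adet_nonneg[of R] by linarith
  define F where "F B = ennreal (adet B powr - N) * of_bool (near S (mstar B ** B))" for B :: "(('f, 'q) vec, 'q) vec"
  have [measurable]: "F \<in> borel_measurable borel" unfolding F_def by measurable
  have "F (C ** R) = ennreal (adet R powr - N) * (ennreal (adet C powr - N) * of_bool (near (mat 1) (mstar C ** C)))" for C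
  proof -
    have "mstar (C ** R) ** (C ** R) = mstar R ** (mstar C ** C) ** R" "S = mstar R ** mat 1 ** R"
      by (simp_all add: mstar_mult matrix_mul_assoc R(2))
    then show ?thesis
      unfolding F_def using of_bool_near_congruence[OF R0, of "mat 1" "mstar C ** C"]
      by (simp add: adet_mult powr_mult ennreal_mult' mult_ac)
  qed
  then have "(\<integral>\<^sup>+C. F (C ** R) \<partial>lborel) = ennreal (adet R powr - N) * test_const TYPE((('f, 'q) vec, 'q) vec)"
    unfolding test_const_def N_def by (subst nn_integral_cmult[symmetric]) auto
  moreover have "(\<integral>\<^sup>+C. F (C ** R) \<partial>lborel) = ennreal (adet R powr - N) * (\<integral>\<^sup>+B. F B \<partial>lborel)"
    unfolding N_def by (rule scalesD[OF scales_matrix_right[OF R0]]) simp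
  ultimately have "ennreal (adet R powr N) * (ennreal (adet R powr - N) * (\<integral>\<^sup>+B. F B \<partial>lborel))
      = ennreal (adet R powr N) * (ennreal (adet R powr - N) * test_const TYPE((('f, 'q) vec, 'q) vec))"
    by simp
  then show ?thesis
    using powr_cancel_mult[OF Rpos, of "- N"] by (simp add: F_def N_def)
qed

text \<open>Left translation by a square root R of S turns B* S B into a Gram matrix. The weighted
  measure is adet^(d n) times Haar measure, so the cost is adet R to the power - d n, which is adet
  S to the power - d n / 2.\<close>

lemma gram_orbit_integral:
  fixes S :: "'f::star_algebra^'q::{finite,linorder}^'q::{finite,linorder}" and n :: real
  assumes "pos_definite S" and [measurable]: "h \<in> borel_measurable borel"
  defines "w \<equiv> \<lambda>B :: (('f, 'q) vec, 'q) vec. ennreal (adet B powr (real DIM('f) * (n - real CARD('q))))"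
  shows "(\<integral>\<^sup>+B. h (mstar B ** S ** B) * w B \<partial>lborel)
    = ennreal (adet S powr - (real DIM('f) * n / 2)) * (\<integral>\<^sup>+B. h (mstar B ** B) * w B \<partial>lborel)"
proof -
  obtain R where R: "pos_definite R" "S = mstar R ** R" "adet S = (adet R)\<^sup>2"
    using pos_definite_sqrt[OF assms(1)] by metis
  define x where "x = real DIM('f) * (n - real CARD('q))"
  define y where "y = real DIM('f) * real CARD('q)"
  have R0: "adet R \<noteq> 0" using R(1) by (simp add: pos_definite_iff)
  then have Rpos: "0 < adet R" using adet_nonneg[of R] by linarith
  have [measurable]: "w \<in> borel_measurable borel" unfolding w_def by measurable
  have wR: "w (R ** B) = ennreal (adet R powr x) * w B" for B
    by (simp add: w_def adet_mult powr_mult ennreal_mult' x_def)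
  have cong: "mstar (R ** B) ** (R ** B) = mstar B ** S ** B" for B
    by (simp add: R(2) mstar_mult matrix_mul_assoc)
  have "ennreal (adet R powr x) * (\<integral>\<^sup>+B. h (mstar B ** S ** B) * w B \<partial>lborel)
      = (\<integral>\<^sup>+B. h (mstar (R ** B) ** (R ** B)) * w (R ** B) \<partial>lborel)"
    unfolding cong wR by (subst nn_integral_cmult[symmetric]) (auto simp: mult_ac)
  also have "\<dots> = ennreal (adet R powr - y) * (\<integral>\<^sup>+B. h (mstar B ** B) * w B \<partial>lborel)"
    unfolding y_def by (rule scalesD[OF scales_matrix_left[OF R0], of "\<lambda>B. h (mstar B ** B) * w B"]) simp
  finally have "ennreal (adet R powr - x) * (ennreal (adet R powr x) * (\<integral>\<^sup>+B. h (mstar B ** S ** B) * w B \<partial>lborel))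
      = ennreal (adet R powr - x) * (ennreal (adet R powr - y) * (\<integral>\<^sup>+B. h (mstar B ** B) * w B \<partial>lborel))"
    by simp
  moreover have "ennreal (adet R powr - x) * (ennreal (adet R powr - y) * z) = ennreal (adet S powr - (real DIM('f) * n / 2)) * z" for z
  proof -
    have "adet R powr - x * adet R powr - y = adet R powr - (real DIM('f) * n)"
      by (simp add: x_def y_def algebra_simps flip: powr_add)
    also have "\<dots> = adet S powr - (real DIM('f) * n / 2)"
    proof -
      have "adet S = adet R powr 2" using Rpos by (simp add: R(3))
      then show ?thesis by (simp only: powr_powr) simp
    qed
    finally show ?thesis by (simp flip: mult.assoc ennreal_mult')
  qed
  ultimately show ?thesis
    by (simp add: powr_cancel_mult[OF Rpos])
qed

text \<open>The integral of \<open>h (B\<^sup>* S B)\<close> against the test function \<open>near S 1\<close> is evaluated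
  once by integrating over \<open>B\<close> first and once by integrating over \<open>S\<close> first.\<close>

lemma relatively_invariant_unique:
  fixes \<tau> :: "'a::euclidean_space \<Rightarrow> 'f::star_algebra^'q::{finite,linorder}^'q::{finite,linorder}" and n :: real
  assumes [measurable]: "\<tau> \<in> borel_measurable borel" "\<omega> \<in> borel_measurable borel" "h \<in> borel_measurable borel"
    and pd: "AE x in lborel. \<omega> x \<noteq> 0 \<longrightarrow> pos_definite (\<tau> x)"
    and inv: "\<And>g h. adet g \<noteq> 0 \<Longrightarrow> h \<in> borel_measurable borel \<Longrightarrow>
      (\<integral>\<^sup>+x. h (mstar g ** \<tau> x ** g) * \<omega> x \<partial>lborel)
        = ennreal (adet g powr - (real DIM('f) * n)) * (\<integral>\<^sup>+x. h (\<tau> x) * \<omega> x \<partial>lborel)"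
  shows "test_const TYPE((('f, 'q) vec, 'q) vec) * (\<integral>\<^sup>+x. h (\<tau> x) * \<omega> x \<partial>lborel)
    = (\<integral>\<^sup>+x. of_bool (near (\<tau> x) (mat 1)) * ennreal (adet (\<tau> x) powr - (real DIM('f) * n / 2)) * \<omega> x \<partial>lborel)
      * (\<integral>\<^sup>+B. h (mstar B ** B) * ennreal (adet (B :: (('f, 'q) vec, 'q) vec) powr (real DIM('f) * (n - real CARD('q)))) \<partial>lborel)"
proof -
  define d where "d = real DIM('f)"
  define q where "q = real CARD('q)"
  define w where "w B = ennreal (adet B powr (d * (n - q)))" for B :: "(('f, 'q) vec, 'q) vec"
  let ?nr = "\<lambda>S P. of_bool (near S P) :: ennreal"
  have [measurable]: "w \<in> borel_measurable borel" unfolding w_def by measurable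
  define J where "J = (\<integral>\<^sup>+x. \<integral>\<^sup>+B. h (mstar B ** \<tau> x ** B) * w B * (?nr (\<tau> x) (mat 1) * \<omega> x) \<partial>lborel \<partial>lborel)"
  define Q where "Q = (\<integral>\<^sup>+B. h (mstar B ** B) * w B \<partial>lborel)"
  have "J = (\<integral>\<^sup>+x. (?nr (\<tau> x) (mat 1) * ennreal (adet (\<tau> x) powr - (d * n / 2)) * \<omega> x) * Q \<partial>lborel)"
    unfolding J_def
  proof (intro nn_integral_cong_AE, use pd in eventually_elim)
    fix x assume x: "\<omega> x \<noteq> 0 \<longrightarrow> pos_definite (\<tau> x)"
    have "(\<integral>\<^sup>+B. h (mstar B ** \<tau> x ** B) * w B * (?nr (\<tau> x) (mat 1) * \<omega> x) \<partial>lborel)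
        = (\<integral>\<^sup>+B. h (mstar B ** \<tau> x ** B) * w B \<partial>lborel) * (?nr (\<tau> x) (mat 1) * \<omega> x)"
      by (rule nn_integral_multc) measurable
    then show "(\<integral>\<^sup>+B. h (mstar B ** \<tau> x ** B) * w B * (?nr (\<tau> x) (mat 1) * \<omega> x) \<partial>lborel)
        = (?nr (\<tau> x) (mat 1) * ennreal (adet (\<tau> x) powr - (d * n / 2)) * \<omega> x) * Q"
      using gram_orbit_integral[of "\<tau> x" h n] x
      by (cases "\<omega> x = 0") (simp_all add: Q_def w_def d_def q_def mult_ac)
  qed
  also have "\<dots> = (\<integral>\<^sup>+x. ?nr (\<tau> x) (mat 1) * ennreal (adet (\<tau> x) powr - (d * n / 2)) * \<omega> x \<partial>lborel) * Q"
    by (rule nn_integral_multc) measurable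
  finally have J1: "J = (\<integral>\<^sup>+x. ?nr (\<tau> x) (mat 1) * ennreal (adet (\<tau> x) powr - (d * n / 2)) * \<omega> x \<partial>lborel) * Q" .
  have "J = (\<integral>\<^sup>+B. \<integral>\<^sup>+x. h (mstar B ** \<tau> x ** B) * w B * (?nr (\<tau> x) (mat 1) * \<omega> x) \<partial>lborel \<partial>lborel)"
    unfolding J_def by (rule lborel_pair.Fubini') measurable
  also have "\<dots> = (\<integral>\<^sup>+B. \<integral>\<^sup>+x. ennreal (adet B powr - (d * q)) * (h (\<tau> x) * ?nr (\<tau> x) (mstar B ** B) * \<omega> x) \<partial>lborel \<partial>lborel)"
  proof (rule nn_integral_cong)
    fix B :: "(('f, 'q) vec, 'q) vec"
    show "(\<integral>\<^sup>+x. h (mstar B ** \<tau> x ** B) * w B * (?nr (\<tau> x) (mat 1) * \<omega> x) \<partial>lborel)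
        = (\<integral>\<^sup>+x. ennreal (adet B powr - (d * q)) * (h (\<tau> x) * ?nr (\<tau> x) (mstar B ** B) * \<omega> x) \<partial>lborel)"
    \<comment> \<open>For singular \<open>B\<close> both sides vanish, because 0 powr x = 0 for
      every exponent, including 0.\<close>
    proof (cases "adet B = 0")
      case False
      then have Bpos: "0 < adet B" using adet_nonneg[of B] by linarith
      \<comment> \<open>Absorbs the test function into the integrand, so that the assumed
        invariance, applied to the congruence by \<open>B\<close>, moves the base point of the
        comparison from the identity to \<open>mstar B ** B\<close>.\<close>
      define h' where "h' S = h S * ?nr S (mstar B ** B)" for S
      have [measurable]: "h' \<in> borel_measurable borel" unfolding h'_def by measurable
      have "?nr S (mat 1) = ?nr (mstar B ** S ** B) (mstar B ** B)" for S
        using of_bool_near_congruence[OF False, of S "mat 1"] by (simp add:)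
      then have "(\<integral>\<^sup>+x. h (mstar B ** \<tau> x ** B) * w B * (?nr (\<tau> x) (mat 1) * \<omega> x) \<partial>lborel)
          = (\<integral>\<^sup>+x. w B * (h' (mstar B ** \<tau> x ** B) * \<omega> x) \<partial>lborel)"
        by (simp add: h'_def mult_ac)
      also have "\<dots> = w B * (\<integral>\<^sup>+x. h' (mstar B ** \<tau> x ** B) * \<omega> x \<partial>lborel)"
        by (rule nn_integral_cmult) measurable
      also have "\<dots> = w B * (ennreal (adet B powr - (d * n)) * (\<integral>\<^sup>+x. h' (\<tau> x) * \<omega> x \<partial>lborel))"
        using inv[OF False, of h'] by (simp add: d_def)
      also have "\<dots> = ennreal (adet B powr - (d * q)) * (\<integral>\<^sup>+x. h' (\<tau> x) * \<omega> x \<partial>lborel)"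
      proof -
        have "adet B powr (d * (n - q)) * adet B powr - (d * n) = adet B powr - (d * q)"
          by (simp add: algebra_simps flip: powr_add)
        then show ?thesis by (simp add: w_def flip: mult.assoc ennreal_mult')
      qed
      also have "\<dots> = (\<integral>\<^sup>+x. ennreal (adet B powr - (d * q)) * (h' (\<tau> x) * \<omega> x) \<partial>lborel)"
        by (rule nn_integral_cmult[symmetric]) measurable
      finally show ?thesis by (simp add: h'_def)
    qed (simp add: w_def)
  qed
  also have "\<dots> = (\<integral>\<^sup>+x. \<integral>\<^sup>+B. ennreal (adet B powr - (d * q)) * (h (\<tau> x) * ?nr (\<tau> x) (mstar B ** B) * \<omega> x) \<partial>lborel \<partial>lborel)"
    by (rule lborel_pair.Fubini') measurable
  also have "\<dots> = (\<integral>\<^sup>+x. test_const TYPE((('f, 'q) vec, 'q) vec) * (h (\<tau> x) * \<omega> x) \<partial>lborel)"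
  proof (intro nn_integral_cong_AE, use pd in eventually_elim)
    fix x assume x: "\<omega> x \<noteq> 0 \<longrightarrow> pos_definite (\<tau> x)"
    have "(\<integral>\<^sup>+B. ennreal (adet B powr - (d * q)) * (h (\<tau> x) * ?nr (\<tau> x) (mstar B ** B) * \<omega> x) \<partial>lborel)
        = (\<integral>\<^sup>+B. (ennreal (adet B powr - (d * q)) * ?nr (\<tau> x) (mstar B ** B)) * (h (\<tau> x) * \<omega> x) \<partial>lborel)"
      by (simp add: mult_ac)
    also have "\<dots> = (\<integral>\<^sup>+B. ennreal (adet B powr - (d * q)) * ?nr (\<tau> x) (mstar B ** B) \<partial>lborel) * (h (\<tau> x) * \<omega> x)"
      by (rule nn_integral_multc) measurable
    also have "\<dots> = test_const TYPE((('f, 'q) vec, 'q) vec) * (h (\<tau> x) * \<omega> x)"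
      using x test_const_congruence[of "\<tau> x"] by (cases "\<omega> x = 0") (simp_all add: d_def q_def)
    finally show "(\<integral>\<^sup>+B. ennreal (adet B powr - (d * q)) * (h (\<tau> x) * ?nr (\<tau> x) (mstar B ** B) * \<omega> x) \<partial>lborel)
        = test_const TYPE((('f, 'q) vec, 'q) vec) * (h (\<tau> x) * \<omega> x)" .
  qed
  also have "\<dots> = test_const TYPE((('f, 'q) vec, 'q) vec) * (\<integral>\<^sup>+x. h (\<tau> x) * \<omega> x \<partial>lborel)"
    by (rule nn_integral_cmult) measurable
  finally show ?thesis
    using J1 by (simp add: Q_def w_def d_def q_def)
qed

section \<open>The distribution of Gram matrices\<close>

text \<open>Eigenvectors for different eigenvalues are independent, so there are at most as many
  eigenvalues as dimensions. This bounds the singular members of a matrix pencil without a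
  determinant.\<close>

lemma finite_eigenvalues:
  fixes f :: "'a::euclidean_space \<Rightarrow> 'a"
  assumes "linear f"
  shows "finite {l. \<exists>x. x \<noteq> 0 \<and> f x = l *\<^sub>R x}"
proof -
  have "card G \<le> DIM('a)" if G: "G \<subseteq> {l. \<exists>x. x \<noteq> 0 \<and> f x = l *\<^sub>R x}" "finite G" for G
  proof -
    have "\<forall>l\<in>G. \<exists>x. x \<noteq> 0 \<and> f x = l *\<^sub>R x" using G(1) by auto
    from bchoice[OF this] obtain x where "\<forall>l\<in>G. x l \<noteq> 0 \<and> f (x l) = l *\<^sub>R x l" ..
    then have x: "\<And>l. l \<in> G \<Longrightarrow> x l \<noteq> 0 \<and> f (x l) = l *\<^sub>R x l" by blast
    have indep: "c l = 0" if "(\<Sum>l\<in>G. c l *\<^sub>R x l) = 0" "l \<in> G" for c l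
      using G(2) x that
    proof (induction G arbitrary: c l rule: finite_induct)
      case (insert \<mu> G)
      have s: "c \<mu> *\<^sub>R x \<mu> + (\<Sum>l\<in>G. c l *\<^sub>R x l) = 0"
        using insert by simp
      have "(\<Sum>l\<in>G. (c l * (l - \<mu>)) *\<^sub>R x l)
          = (\<Sum>l\<in>G. c l *\<^sub>R f (x l)) - \<mu> *\<^sub>R (\<Sum>l\<in>G. c l *\<^sub>R x l)"
        using insert.prems(1) by (simp add: scaleR_sum_right right_diff_distrib scaleR_diff_left sum_subtractf mult.commute)
      also have "\<dots> = f (\<Sum>l\<in>G. c l *\<^sub>R x l) - \<mu> *\<^sub>R (\<Sum>l\<in>G. c l *\<^sub>R x l)"
        by (simp add: linear_sum[OF assms] linear_scale[OF assms])
      also have "(\<Sum>l\<in>G. c l *\<^sub>R x l) = - (c \<mu> *\<^sub>R x \<mu>)"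
        using s by (simp add: eq_neg_iff_add_eq_0 add.commute)
      also have "f (- (c \<mu> *\<^sub>R x \<mu>)) - \<mu> *\<^sub>R - (c \<mu> *\<^sub>R x \<mu>) = 0"
        using insert.prems(1)[of \<mu>] by (simp add: linear_neg[OF assms] linear_scale[OF assms])
      finally have "c l * (l - \<mu>) = 0" if "l \<in> G" for l
        using insert.IH[of "\<lambda> l. c l * (l - \<mu>)" l] insert.prems(1) that by blast
      then have G0: "c l = 0" if "l \<in> G" for l
        using that insert.hyps(2) by (metis eq_iff_diff_eq_0 mult_eq_0_iff)
      then have "c \<mu> = 0" using s insert.prems(1)[of \<mu>] by simp
      then show ?case using G0 insert.prems(3) by blast
    qed simp
    have inj: "inj_on x G"
    proof (rule inj_onI)
      fix a b assume "a \<in> G" "b \<in> G" "x a = x b"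
      then have "a *\<^sub>R x a = b *\<^sub>R x a" using x by metis
      then show "a = b" using x[OF \<open>a \<in> G\<close>] by simp
    qed
    have "independent (x ` G)"
      unfolding dependent_finite[OF finite_imageI[OF G(2)]]
    proof safe
      fix u and l assume "(\<Sum>v\<in>x ` G. u v *\<^sub>R v) = 0" "l \<in> G" "u (x l) \<noteq> 0"
      then show False using indep[of "\<lambda> l. u (x l)" l] by (simp add: sum.reindex[OF inj])
    qed
    then have "card (x ` G) \<le> DIM('a)" using independent_bound by blast
    then show ?thesis by (simp add: card_image[OF inj])
  qed
  then show ?thesis using finite_if_finite_subsets_card_bdd by blast
qed

text \<open>Select q of the r rows by an injection. Moving \<open>A\<close> along \<open>E\<close>
  adds c times the identity to the selected square block, which is singular only when c is one of
  finitely many eigenvalues of its negative. Averaging over c in [0, 1] and exchanging integrals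
  shows that the exceptional set is null.\<close>

lemma AE_injective_matrix:
  assumes "CARD('q::{finite,linorder}) \<le> CARD('r::finite)"
  shows "AE A :: (('f::star_algebra, 'q) vec, 'r) vec in lborel. \<forall>x. A *v x = 0 \<longrightarrow> x = 0"
proof -
  obtain \<iota> :: "'q \<Rightarrow> 'r" where \<iota>: "inj \<iota>"
    using assms card_le_inj[of "UNIV :: 'q set" "UNIV :: 'r set"] by auto
  define P where "P A = (\<chi> k. A $ \<iota> k)" for A :: "('f, 'q) vec^'r"
  define E :: "('f, 'q) vec^'r" where "E = (\<chi> i j. if i = \<iota> j then 1 else 0)"
  have PE: "P (A + c *\<^sub>R E) = P A + c *\<^sub>R mat 1" for A c
    using \<iota> by (auto simp: P_def E_def vec_eq_iff mat_def inj_def)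
  have cont: "continuous_on UNIV P"
    unfolding P_def by (intro continuous_on_vec_lambda continuous_intros)
  then have [measurable]: "P \<in> borel_measurable borel" by (rule borel_measurable_continuous_onI)
  define Z where "Z = {A. adet (P A) = 0}"
  have [measurable]: "Z \<in> sets borel"
    unfolding Z_def by measurable
  have "finite {c. A + c *\<^sub>R E \<in> Z}" for A
  proof -
    have "{c. A + c *\<^sub>R E \<in> Z} \<subseteq> {c. \<exists>x. x \<noteq> 0 \<and> - (P A *v x) = c *\<^sub>R x}"
    proof safe
      fix c assume "A + c *\<^sub>R E \<in> Z"
      then have "adet (P A + c *\<^sub>R mat 1) = 0" by (simp add: Z_def PE)
      then obtain x where "x \<noteq> 0" "(P A + c *\<^sub>R mat 1) *v x = 0"
        using adet_nonzero_iff[of "P A + c *\<^sub>R mat 1"] by auto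
      then show "\<exists>x. x \<noteq> 0 \<and> - (P A *v x) = c *\<^sub>R x"
        by (auto simp: matrix_vector_mult_add_rdistrib scaleR_matrix_vector eq_neg_iff_add_eq_0 neg_eq_iff_add_eq_0 intro!: exI[of _ x])
    qed
    moreover have "linear (\<lambda>x. - (P A *v x))"
      by (intro linear_compose_neg matrix_vector_mul_linear)
    ultimately show ?thesis
      using finite_eigenvalues finite_subset by blast
  qed
  then have slice: "(\<integral>\<^sup>+c. indicator {0..1} c * indicator Z (A + c *\<^sub>R E) \<partial>lborel) = (0 :: ennreal)" for A
  proof -
    have "AE c in lborel. c \<notin> {c. A + c *\<^sub>R E \<in> Z}"
      using \<open>finite {c. A + c *\<^sub>R E \<in> Z}\<close> by (intro AE_not_in finite_imp_null_set_lborel)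
    then have "(\<integral>\<^sup>+c. indicator {0..1} c * indicator Z (A + c *\<^sub>R E) \<partial>lborel) = (\<integral>\<^sup>+(c::real). (0 :: ennreal) \<partial>lborel)"
      by (intro nn_integral_cong_AE) (auto simp: indicator_def elim!: eventually_mono)
    then show ?thesis by simp
  qed
  have "emeasure lborel Z = (\<integral>\<^sup>+(c::real). indicator {0..1} c * emeasure lborel Z \<partial>lborel)"
    by (simp add: nn_integral_multc)
  also have "\<dots> = (\<integral>\<^sup>+(c::real). \<integral>\<^sup>+A. indicator {0..1} c * indicator Z (A + c *\<^sub>R E) \<partial>lborel \<partial>lborel)"
  proof (rule nn_integral_cong)
    fix c :: real
    have "emeasure lborel Z = (\<integral>\<^sup>+A. indicator Z A \<partial>lborel)" by simp
    also have "\<dots> = (\<integral>\<^sup>+A. indicator Z (c *\<^sub>R E + 1 *\<^sub>R A) \<partial>lborel)"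
      by (rule nn_integral_lborel_affine[symmetric]) auto
    finally have "emeasure lborel Z = (\<integral>\<^sup>+A. indicator Z (A + c *\<^sub>R E) \<partial>lborel)"
      by (simp add: add.commute)
    then show "indicator {0..1} c * emeasure lborel Z = (\<integral>\<^sup>+A. indicator {0..1} c * indicator Z (A + c *\<^sub>R E) \<partial>lborel)"
      by (simp add: nn_integral_cmult)
  qed
  also have "\<dots> = (\<integral>\<^sup>+A. \<integral>\<^sup>+(c::real). indicator {0..1} c * indicator Z (A + c *\<^sub>R E) \<partial>lborel \<partial>lborel)"
    by (rule lborel_pair.Fubini') measurable
  also have "\<dots> = 0" by (simp add: slice)
  finally have "Z \<in> null_sets lborel" by (simp add: null_sets_def)
  then have "AE A in lborel. A \<notin> Z" by (rule AE_not_in)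
  then show ?thesis
  proof eventually_elim
    case (elim A)
    show ?case
    proof (intro allI impI)
      fix x assume "A *v x = 0"
      then have "P A *v x = 0" by (simp add: P_def vec_eq_iff matrix_vector_mult_def)
      then show "x = 0" using elim adet_nonzero_iff[of "P A"] by (auto simp: Z_def)
    qed
  qed
qed

definition herm_weight :: "real \<Rightarrow> 'f::star_algebra^'q::{finite,linorder}^'q::{finite,linorder} \<Rightarrow> ennreal"
  where "herm_weight e X = of_bool (norm (X - upper X) \<le> 1) * of_bool (pos_definite (herm X))
    * ennreal (adet (herm X) powr e)"

lemma measurable_herm_weight [measurable]: "herm_weight e \<in> borel_measurable borel"
  unfolding herm_weight_def by measurable

text \<open>Both sides are relatively invariant with the same character, which fixes the exponent.\<close>

theorem gram_integral:
  assumes "CARD('q::{finite,linorder}) \<le> CARD('r::finite)"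
  obtains c :: ennreal where "\<And>h. h \<in> borel_measurable borel \<Longrightarrow>
    (\<integral>\<^sup>+A. h (mstar A ** (A :: ('f::star_algebra, 'q) vec^'r)) \<partial>lborel)
      = c * (\<integral>\<^sup>+X. h (herm X) * herm_weight (real DIM('f) * (real CARD('r) - real CARD('q) + 1) / 2 - 1) X \<partial>lborel)"
proof -
  define d where "d = real DIM('f)"
  define q where "q = real CARD('q)"
  define n where "n = real CARD('r)"
  \<comment> \<open>Congruence by g multiplies \<open>herm_weight e\<close> by adet g to the power 2
    e, and the substitution contributes 2 + d (q - 1) more; e solves 2 e + 2 + d (q - 1) = d
    n.\<close>
  define e where "e = d * (n - q + 1) / 2 - 1"
  define t where "t = test_const TYPE((('f, 'q) vec, 'q) vec)"
  define Q where "Q h = (\<integral>\<^sup>+B. h (mstar B ** B) * ennreal (adet (B :: (('f, 'q) vec, 'q) vec) powr (d * (n - q))) \<partial>lborel)" for h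
  obtain t' where t': "t = ennreal t'" "0 < t'"
    using test_const_pos_finite[where 'f = 'f and 'q = 'q] by (cases t) (auto simp: t_def)
  define a where "a = (\<integral>\<^sup>+A. of_bool (near (mstar A ** A) (mat 1)) * ennreal (adet (mstar A ** A) powr - (d * n / 2)) * 1 \<partial>(lborel :: (('f, 'q) vec^'r) measure))"
  define b where "b = (\<integral>\<^sup>+X. of_bool (near (herm X) (mat 1)) * ennreal (adet (herm X) powr - (d * n / 2)) * herm_weight e X \<partial>(lborel :: (('f, 'q) vec, 'q) vec measure))"
  have gram: "t * (\<integral>\<^sup>+A. h (mstar A ** A) * 1 \<partial>(lborel :: (('f, 'q) vec^'r) measure)) = a * Q h"
    if [measurable]: "h \<in> borel_measurable borel" for h
    unfolding t_def Q_def a_def d_def q_def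
  proof (rule relatively_invariant_unique)
    show "AE A in lborel. (1 :: ennreal) \<noteq> 0 \<longrightarrow> pos_definite (mstar A ** (A :: ('f, 'q) vec^'r))"
      using AE_injective_matrix[OF assms, where 'f = 'f] by eventually_elim (auto intro: pos_definite_gram)
    fix g :: "(('f, 'q) vec, 'q) vec" and h :: "(('f, 'q) vec, 'q) vec \<Rightarrow> ennreal"
    assume g: "adet g \<noteq> 0" and [measurable]: "h \<in> borel_measurable borel"
    have "mstar g ** (mstar A ** A) ** g = mstar (A ** g) ** (A ** g)" for A :: "('f, 'q) vec^'r"
      by (simp add: mstar_mult matrix_mul_assoc)
    then show "(\<integral>\<^sup>+A. h (mstar g ** (mstar A ** A) ** g) * 1 \<partial>(lborel :: (('f, 'q) vec^'r) measure))
        = ennreal (adet g powr - (real DIM('f) * n)) * (\<integral>\<^sup>+A. h (mstar A ** A) * 1 \<partial>(lborel :: (('f, 'q) vec^'r) measure))"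
      unfolding n_def using scalesD[OF scales_matrix_right[OF g], of "\<lambda>A :: ('f, 'q) vec^'r. h (mstar A ** A)"] by simp
  qed measurable
  have herm: "t * (\<integral>\<^sup>+X. h (herm X) * herm_weight e X \<partial>lborel) = b * Q h"
    if [measurable]: "h \<in> borel_measurable borel" for h
    unfolding t_def Q_def b_def d_def q_def
  proof (rule relatively_invariant_unique)
    show "AE X in lborel. herm_weight e X \<noteq> 0 \<longrightarrow> pos_definite (herm X :: (('f, 'q) vec, 'q) vec)"
      by (intro AE_I2) (simp add: herm_weight_def)
    fix g :: "(('f, 'q) vec, 'q) vec" and h :: "(('f, 'q) vec, 'q) vec \<Rightarrow> ennreal"
    assume g: "adet g \<noteq> 0" and [measurable]: "h \<in> borel_measurable borel"
    have g0: "0 < adet g" using g adet_nonneg[of g] by linarith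
    have "herm_weight e (herm_act g X) = ennreal (adet g powr (2 * e)) * herm_weight e X" for X
    proof -
      have "adet (mstar g ** herm X ** g) powr e = adet g powr (2 * e) * adet (herm X) powr e"
      proof -
        have "adet (mstar g ** herm X ** g) = adet g * adet g * adet (herm X)"
          by (simp add: adet_mult)
        moreover have "adet g powr e * adet g powr e = adet g powr (2 * e)"
          by (simp flip: powr_add)
        ultimately show ?thesis by (simp add: powr_mult)
      qed
      then show ?thesis
        using pos_definite_congruence_iff[OF g, of "herm X"] by (simp add: herm_weight_def ennreal_mult' mult_ac)
    qed
    then have w: "herm_weight e X = ennreal (adet g powr - (2 * e)) * herm_weight e (herm_act g X)" for X
      by (simp add: powr_cancel_mult[OF g0])
    have "(\<integral>\<^sup>+X. h (mstar g ** herm X ** g) * herm_weight e X \<partial>lborel)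
        = (\<integral>\<^sup>+X. ennreal (adet g powr - (2 * e)) * (h (herm (herm_act g X)) * herm_weight e (herm_act g X)) \<partial>lborel)"
      by (subst w) (simp add: mult_ac)
    also have "\<dots> = ennreal (adet g powr - (2 + d * (q - 1))) *
        (\<integral>\<^sup>+X. ennreal (adet g powr - (2 * e)) * (h (herm X) * herm_weight e X) \<partial>lborel)"
      unfolding d_def q_def
      by (rule scalesD[OF scales_herm_act[OF g], of "\<lambda>X. ennreal (adet g powr - (2 * e)) * (h (herm X) * herm_weight e X)"])
        measurable
    also have "\<dots> = ennreal (adet g powr - (2 + d * (q - 1))) *
        (ennreal (adet g powr - (2 * e)) * (\<integral>\<^sup>+X. h (herm X) * herm_weight e X \<partial>lborel))"
      by (subst nn_integral_cmult) measurable
    also have "\<dots> = ennreal (adet g powr - (d * n)) * (\<integral>\<^sup>+X. h (herm X) * herm_weight e X \<partial>lborel)"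
    proof -
      have "2 * e = d * (n - q + 1) - 2" by (simp add: e_def)
      then have "- (2 + d * (q - 1)) + - (2 * e) = - (d * n)" by (simp add: algebra_simps)
      then have "adet g powr - (2 + d * (q - 1)) * adet g powr - (2 * e) = adet g powr - (d * n)"
        by (metis powr_add)
      then show ?thesis by (simp flip: mult.assoc ennreal_mult')
    qed
    finally show "(\<integral>\<^sup>+X. h (mstar g ** herm X ** g) * herm_weight e X \<partial>lborel)
        = ennreal (adet g powr - (real DIM('f) * n)) * (\<integral>\<^sup>+X. h (herm X) * herm_weight e X \<partial>lborel)"
      by (simp add: d_def)
  qed measurable
  \<comment> \<open>\<open>b\<close> is inverted below to express \<open>Q h\<close> by the
    Hermitian integral. Its integrand is positive and continuous on a compact set, because
    \<open>near\<close> keeps away from the boundary of the cone and from infinity.\<close>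
  have "0 < b" "b < \<infinity>"
  proof -
    define K where "K = {X :: (('f, 'q) vec, 'q) vec. near (herm X) (mat 1) \<and> norm (X - upper X) \<le> 1}"
    define w where "w X = adet (herm X) powr - (d * n / 2) * adet (herm X) powr e" for X :: "(('f, 'q) vec, 'q) vec"
    have pdK: "pos_definite (herm X)" if "X \<in> K" for X using that near_1_pos_definite by (auto simp: K_def)
    have "b = (\<integral>\<^sup>+X. indicator K X * ennreal (w X) \<partial>lborel)"
      unfolding b_def
    proof (rule nn_integral_cong)
      fix X :: "(('f, 'q) vec, 'q) vec"
      show "of_bool (near (herm X) (mat 1)) * ennreal (adet (herm X) powr - (d * n / 2)) * herm_weight e X
          = indicator K X * ennreal (w X)"
        using pdK[of X] by (auto simp: K_def w_def herm_weight_def indicator_def simp flip: ennreal_mult')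
    qed
    moreover have "compact K"
    proof -
      have "closed K"
        unfolding K_def by (intro closed_Collect_conj closed_Collect_near closed_Collect_le continuous_intros)
      moreover have "bounded K"
        by (rule bounded_subset[OF bounded_herm_lower[of "2 * norm (mat 1 :: (('f, 'q) vec, 'q) vec)" 1]])
          (auto simp: K_def near_1_norm)
      ultimately show ?thesis by (simp add: compact_eq_bounded_closed)
    qed
    moreover have "continuous_on K w"
      unfolding w_def using pdK by (intro continuous_intros) (auto simp: pos_definite_iff)
    moreover have "0 < w X" if "X \<in> K" for X
      using pdK[OF that] by (simp add: w_def pos_definite_iff)
    moreover define E where "E = {X :: (('f, 'q) vec, 'q) vec. norm (herm X - mat 1) < 1 / 2 \<and> norm (X - upper X) < 1}"
    moreover have "open E"
      unfolding E_def by (intro open_Collect_conj open_Collect_less continuous_intros)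
    moreover have "E \<subseteq> K"
      by (auto simp: E_def K_def intro!: near_1I)
    moreover have "upper (mat 1) \<in> E"
      by (simp add: E_def herm_eq_self)
    ultimately show "0 < b" "b < \<infinity>"
      using nn_integral_compact_pos[of K w E "upper (mat 1)"] by simp_all
  qed
  then obtain b' where b': "b = ennreal b'" "0 < b'" by (cases b) auto
  have "(\<integral>\<^sup>+A. h (mstar A ** A) \<partial>(lborel :: (('f, 'q) vec^'r) measure))
      = (ennreal (1 / t') * a * ennreal (t' / b')) * (\<integral>\<^sup>+X. h (herm X) * herm_weight e X \<partial>lborel)"
    if [measurable]: "h \<in> borel_measurable borel" for h
  proof -
    have "Q h = ennreal (1 / b') * (b * Q h)"
      using b' by (simp flip: mult.assoc ennreal_mult')
    also have "\<dots> = ennreal (1 / b') * (ennreal t' * (\<integral>\<^sup>+X. h (herm X) * herm_weight e X \<partial>lborel))"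
      using herm[OF that] t' by simp
    also have "\<dots> = ennreal (t' / b') * (\<integral>\<^sup>+X. h (herm X) * herm_weight e X \<partial>lborel)"
      using b' t' by (simp flip: mult.assoc ennreal_mult')
    finally have Q: "Q h = ennreal (t' / b') * (\<integral>\<^sup>+X. h (herm X) * herm_weight e X \<partial>lborel)" .
    have "(\<integral>\<^sup>+A. h (mstar A ** A) \<partial>(lborel :: (('f, 'q) vec^'r) measure))
        = ennreal (1 / t') * (t * (\<integral>\<^sup>+A. h (mstar A ** A) * 1 \<partial>(lborel :: (('f, 'q) vec^'r) measure)))"
      using t' by (simp flip: mult.assoc ennreal_mult')
    also have "\<dots> = ennreal (1 / t') * (a * Q h)" by (simp only: gram that)
    finally show ?thesis by (simp add: Q mult.assoc)
  qed
  then show ?thesis using that by (simp add: e_def d_def n_def q_def)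
qed

section \<open>The distribution of a truncated frame\<close>

lemma sum_UNIV_sum: "(\<Sum>x\<in>UNIV. f x) = (\<Sum>a\<in>UNIV. f (Inl a)) + (\<Sum>b\<in>UNIV. f (Inr b :: 'a::finite + 'b::finite))"
  using sum.Plus[of "UNIV :: 'a set" "UNIV :: 'b set" f] by simp

definition top_rows :: "'a^'n^('m::finite + 'k::finite) \<Rightarrow> 'a^'n^'m"
  where "top_rows A = (\<chi> i. A $ Inl i)"

definition bottom_rows :: "'a^'n^('m::finite + 'k::finite) \<Rightarrow> 'a^'n^'k"
  where "bottom_rows A = (\<chi> i. A $ Inr i)"

definition stack_rows :: "'a^'n^'m \<Rightarrow> 'a^'n^'k \<Rightarrow> 'a^'n^('m::finite + 'k::finite)"
  where "stack_rows A B = (\<chi> i. case i of Inl a \<Rightarrow> A $ a | Inr b \<Rightarrow> B $ b)"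

lemma stack_rows_simps [simp]:
  "top_rows (stack_rows A B) = A" "bottom_rows (stack_rows A B) = B"
  "stack_rows (top_rows C) (bottom_rows C) = C"
  by (auto simp: top_rows_def bottom_rows_def stack_rows_def vec_eq_iff split: sum.split)

lemma top_rows_mult: "top_rows (A ** B) = top_rows A ** B"
  by (simp add: top_rows_def vec_eq_iff matrix_matrix_mult_def)

lemma continuous_on_top_rows [continuous_intros]:
  "continuous_on S f \<Longrightarrow> continuous_on S (\<lambda>x. top_rows (f x :: 'a::topological_space^'n^('m::finite + 'k::finite)))"
  unfolding top_rows_def by (intro continuous_on_vec_lambda continuous_intros)

lemma measurable_top_rows [measurable]:
  fixes f :: "'a \<Rightarrow> 'f::star_algebra^'n^('m::finite + 'k::finite)"
  assumes "f \<in> borel_measurable M"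
  shows "(\<lambda>x. top_rows (f x)) \<in> borel_measurable M"
  using assms by (rule measurable_compose) (intro borel_measurable_continuous_onI continuous_intros)

lemma gram_stack_rows:
  fixes A :: "'f::star_algebra^'n^'m" and B :: "'f^'n^'k"
  shows "mstar (stack_rows A B) ** stack_rows A B = mstar A ** A + mstar B ** B"
  by (simp add: vec_eq_iff matrix_matrix_mult_def sum_UNIV_sum stack_rows_def)

text \<open>The factor of this linear bijection is left unspecified; it disappears in the final
  normalisation.\<close>

lemma stack_rows_integral:
  obtains c :: real where "0 < c" "\<And>h. h \<in> borel_measurable borel \<Longrightarrow>
    (\<integral>\<^sup>+A. h A \<partial>lborel) = ennreal c * (\<integral>\<^sup>+A. \<integral>\<^sup>+B. h (stack_rows A B :: 'f::star_algebra^'n^('m::finite + 'k::finite)) \<partial>lborel \<partial>lborel)"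
proof -
  define f where "f = (\<lambda>z. stack_rows (fst z) (snd z) :: 'f^'n^('m + 'k))"
  have lin: "linear f"
    by (auto simp: linear_iff f_def stack_rows_def vec_eq_iff split: sum.split)
  then have [measurable]: "f \<in> borel_measurable borel" by (rule borel_measurable_linear)
  have "bij f"
    by (rule o_bij[of "\<lambda>A. (top_rows A, bottom_rows A)"]) (auto simp: f_def fun_eq_iff)
  with lin obtain c where c: "scales f c" by (rule scales_exists)
  have "(\<integral>\<^sup>+A. h A \<partial>lborel) = ennreal (1 / c) * (\<integral>\<^sup>+A. \<integral>\<^sup>+B. h (stack_rows A B) \<partial>lborel \<partial>lborel)"
    if [measurable]: "h \<in> borel_measurable borel" for h :: "'f^'n^('m + 'k) \<Rightarrow> ennreal"
  proof -
    have [measurable]: "(\<lambda>z. h (f z)) \<in> borel_measurable (lborel \<Otimes>\<^sub>M lborel)"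
      unfolding lborel_prod by measurable
    have "(\<integral>\<^sup>+A. \<integral>\<^sup>+B. h (stack_rows A B) \<partial>lborel \<partial>lborel) = (\<integral>\<^sup>+A. \<integral>\<^sup>+B. h (f (A, B)) \<partial>lborel \<partial>lborel)"
      by (simp add: f_def)
    also have "\<dots> = (\<integral>\<^sup>+z. h (f z) \<partial>(lborel \<Otimes>\<^sub>M lborel))"
      by (rule lborel.nn_integral_fst) measurable
    also have "\<dots> = ennreal c * (\<integral>\<^sup>+A. h A \<partial>lborel)"
      unfolding lborel_prod by (rule scalesD[OF c that])
    finally show ?thesis
      using c by (simp add: scales_def flip: mult.assoc ennreal_mult')
  qed
  then show ?thesis using that[of "1 / c"] c by (simp add: scales_def)
qed

section \<open>The inverse square root near the identity\<close>

text \<open>From T S T = 1 it follows that T commutes with S, so that the square of T is the inverse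
  of S. Hence T and U have the same square, and semidefinite square roots are unique.\<close>

lemma isqrt_unique:
  fixes S T U :: "'f::star_algebra^'n^'n"
  assumes "psd T" "psd U" "T ** S ** T = mat 1" "U ** S ** U = mat 1"
  shows "T = U"
proof -
  have comm: "T ** S = S ** T" "S ** T ** T = mat 1" "T ** T ** S = mat 1"
    if "T ** S ** T = mat 1" for T :: "'f^'n^'n"
  proof -
    have "T ** S = T ** S ** (T ** S ** T)" by (simp add: that)
    also have "\<dots> = (T ** S ** T) ** (S ** T)" by (simp add: matrix_mul_assoc)
    finally show 1: "T ** S = S ** T" by (simp add: that)
    show "S ** T ** T = mat 1" using that by (simp flip: 1)
    have "T ** T ** S = T ** (S ** T)" by (simp add: 1 flip: matrix_mul_assoc)
    then show "T ** T ** S = mat 1" using that by (simp add: matrix_mul_assoc)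
  qed
  have "U ** U = U ** U ** (S ** T ** T)" by (simp add: comm(2)[OF assms(3)])
  also have "\<dots> = (U ** U ** S) ** (T ** T)" by (simp add: matrix_mul_assoc)
  finally have "T ** T = U ** U" by (simp add: comm(3)[OF assms(4)])
  then show ?thesis using psd_sqrt_unique[OF assms(2,1)] by blast
qed

text \<open>The power -1/2 of \<open>S\<close>, given by its equation. It is cut off outside a
  closed neighbourhood of the identity on which it is continuous, so the total function is
  Borel.\<close>

definition isqrt :: "'f::star_algebra^'n^'n \<Rightarrow> 'f^'n^'n"
  where "isqrt S = (if near S (mat 1) then (THE T. psd T \<and> T ** S ** T = mat 1) else 0)"

lemma isqrt:
  fixes S :: "'f::star_algebra^'q::{finite,linorder}^'q::{finite,linorder}"
  assumes "near S (mat 1)"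
  shows "psd (isqrt S)" "isqrt S ** S ** isqrt S = mat 1"
proof -
  obtain Q s where Q: "Q \<in> unitary_group" "\<And>i. 0 < s $ i" "S = mstar Q ** diag s ** Q"
    using pos_definite_spectral[OF near_1_pos_definite[OF assms]] by metis
  define t where "t = (\<chi> i. 1 / sqrt (s $ i))"
  define T where "T = mstar Q ** diag t ** Q"
  have "psd T"
    unfolding T_def using Q(2) by (intro psd_congruence psd_diag) (simp add: t_def less_imp_le)
  have "diag t ** diag s ** diag t = (mat 1 :: (('f, 'q) vec, 'q) vec)"
    using Q(2) by (simp add: diag_mult_diag t_def less_imp_le less_imp_neq[symmetric] real_div_sqrt
        vec_eq_iff diag_nth mat_def flip: power2_eq_square)
  moreover have "T ** S ** T = mstar Q ** (diag t ** diag s ** diag t) ** Q"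
    by (simp add: T_def Q(3) matrix_mul_assoc unitary_cancel(2)[OF Q(1)])
  ultimately have "T ** S ** T = mat 1" by (simp add: unitary_groupD[OF Q(1)])
  with \<open>psd T\<close> have T: "psd T \<and> T ** S ** T = mat 1" by blast
  have "(THE T. psd T \<and> T ** S ** T = mat 1) = T"
    using T by (rule the_equality) (use T isqrt_unique in blast)
  then show "psd (isqrt S)" "isqrt S ** S ** isqrt S = mat 1"
    using T assms by (simp_all add: isqrt_def)
qed

lemma adet_isqrt:
  fixes S :: "'f::star_algebra^'q::{finite,linorder}^'q::{finite,linorder}"
  assumes "near S (mat 1)" shows "adet (isqrt S) \<noteq> 0"
proof -
  have "adet (isqrt S ** S ** isqrt S) = 1" using isqrt[OF assms] by simp
  then show ?thesis by (auto simp: adet_mult)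
qed

text \<open>Closed graph again: the defining conditions are closed, and congruence of
  \<open>near S (mat 1)\<close> by T = \<open>isqrt S\<close> compares the identity with the Gram
  matrix of T, which bounds T.\<close>

lemma continuous_on_isqrt:
  "continuous_on {S. near S (mat 1)} (isqrt :: 'f::star_algebra^'q::{finite,linorder}^'q::{finite,linorder} \<Rightarrow> _)"
proof -
  define n where "n = norm (mat 1 :: (('f, 'q) vec, 'q) vec)"
  have bound: "norm (isqrt S) \<le> 1 + n * (2 * n)" if S: "near S (mat 1)" for S :: "(('f, 'q) vec, 'q) vec"
  proof -
    define T where "T = isqrt S"
    have T: "mstar T = T" "T ** S ** T = mat 1" using isqrt[OF S] by (auto simp: T_def psd_def)
    have "near (mat 1) (mstar T ** T)"
      using near_congruence[OF S, of T] by (simp add: T)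
    then have "norm (mstar T ** T) \<le> 2 * n"
      unfolding n_def by (intro near_1_norm) (simp add: near_sym)
    then have "n * norm (mstar T ** T) \<le> n * (2 * n)"
      by (intro mult_left_mono) (auto simp: n_def)
    moreover have "(norm T)\<^sup>2 = inner (mat 1) (mstar T ** T)"
      by (simp add: inner_mat_1_mult inner_mstar_mstar dot_square_norm)
    then have "(norm T)\<^sup>2 \<le> n * norm (mstar T ** T)"
      using norm_cauchy_schwarz[of "mat 1" "mstar T ** T"] by (simp add: n_def)
    moreover have "2 * norm T \<le> 1 + (norm T)\<^sup>2"
      using sum_squares_bound[of 1 "norm T"] by simp
    ultimately show ?thesis using norm_ge_zero[of T] unfolding T_def[symmetric] by linarith
  qed
  show ?thesis
  proof (rule continuous_from_closed_graph)
    show "compact (cball (0 :: (('f, 'q) vec, 'q) vec) (1 + n * (2 * n)))" by simp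
    show "isqrt \<in> {S. near S (mat 1)} \<rightarrow> cball (0 :: (('f, 'q) vec, 'q) vec) (1 + n * (2 * n))"
      using bound by auto
    have "(\<lambda>S. (S, isqrt S)) ` {S :: (('f, 'q) vec, 'q) vec. near S (mat 1)}
        = {z. near (fst z) (mat 1) \<and> snd z \<in> {A. psd A} \<and> snd z ** fst z ** snd z = mat 1}"
      using isqrt isqrt_unique by (force simp: image_iff)
    also have "closed \<dots>"
    proof (intro closed_Collect_conj closed_Collect_near closed_Collect_eq continuous_intros)
      show "closed {z :: (('f, 'q) vec, 'q) vec \<times> (('f, 'q) vec, 'q) vec. snd z \<in> {A. psd A}}"
        using closed_vimage[OF closed_psd continuous_on_snd[OF continuous_on_id]] by (simp add: vimage_def)
    qed
    finally show "closed ((\<lambda>S. (S, isqrt S)) ` {S :: (('f, 'q) vec, 'q) vec. near S (mat 1)})" .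
  qed
qed

lemma measurable_isqrt [measurable]:
  fixes f :: "'a \<Rightarrow> 'f::star_algebra^'q::{finite,linorder}^'q::{finite,linorder}"
  assumes "f \<in> borel_measurable M"
  shows "(\<lambda>x. isqrt (f x)) \<in> borel_measurable M"
proof (rule measurable_compose[OF assms])
  have "closed {S :: (('f, 'q) vec, 'q) vec. near S (mat 1)}"
    by (intro closed_Collect_near continuous_intros)
  then have "(\<lambda>S. if S \<in> {S :: (('f, 'q) vec, 'q) vec. near S (mat 1)} then isqrt S else 0) \<in> borel_measurable borel"
    by (intro borel_measurable_continuous_on_if continuous_on_isqrt continuous_intros) simp
  moreover have "(\<lambda>S. if S \<in> {S :: (('f, 'q) vec, 'q) vec. near S (mat 1)} then isqrt S else 0) = isqrt"
    by (auto simp: fun_eq_iff isqrt_def)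
  ultimately show "(isqrt :: (('f, 'q) vec, 'q) vec \<Rightarrow> _) \<in> borel_measurable borel" by simp
qed

text \<open>With T = \<open>isqrt S\<close> and w = A T one has 1 - w* w = T (S - A* A) T. The
  density then contributes 2 e to the exponent of adet T and the Jacobian of w contributes d
  q.\<close>

lemma truncated_frame_slice:
  fixes S :: "'f::star_algebra^'q::{finite,linorder}^'q::{finite,linorder}"
    and F :: "(('f, 'q) vec, 'q) vec \<Rightarrow> ennreal"
  assumes [measurable]: "F \<in> borel_measurable borel" and S: "near S (mat 1)"
  shows "(\<integral>\<^sup>+A. F (A ** isqrt S) * of_bool (pos_definite (S - mstar A ** A)) * ennreal (adet (S - mstar A ** A) powr e) \<partial>lborel)
    = ennreal (adet (isqrt S) powr - (2 * e + real DIM('f) * real CARD('q)))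
      * (\<integral>\<^sup>+w. F w * of_bool (pos_definite (mat 1 - mstar w ** w)) * ennreal (adet (mat 1 - mstar w ** w) powr e) \<partial>lborel)"
proof -
  define T where "T = isqrt S"
  have T: "mstar T = T" "T ** S ** T = mat 1" "adet T \<noteq> 0"
    using isqrt[OF S] adet_isqrt[OF S] by (auto simp: T_def psd_def)
  then have T0: "0 < adet T" using adet_nonneg[of T] by linarith
  define \<beta> where "\<beta> w = F w * of_bool (pos_definite (mat 1 - mstar w ** w)) * ennreal (adet (mat 1 - mstar w ** w) powr e)" for w
  have [measurable]: "\<beta> \<in> borel_measurable borel" unfolding \<beta>_def by measurable
  have eq: "F (A ** T) * of_bool (pos_definite (S - mstar A ** A)) * ennreal (adet (S - mstar A ** A) powr e)
      = ennreal (adet T powr - (2 * e)) * \<beta> (A ** T)" for A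
  proof -
    have c: "mat 1 - mstar (A ** T) ** (A ** T) = mstar T ** (S - mstar A ** A) ** T"
      by (simp add: mstar_mult T matrix_mul_assoc matrix_diff_ldistrib matrix_diff_rdistrib)
    have "adet (mstar T ** (S - mstar A ** A) ** T) = adet T * adet T * adet (S - mstar A ** A)"
      by (simp add: adet_mult)
    moreover have "adet T powr e * adet T powr e = adet T powr (2 * e)"
      by (simp flip: powr_add)
    ultimately have "adet (mat 1 - mstar (A ** T) ** (A ** T)) powr e
        = adet T powr (2 * e) * adet (S - mstar A ** A) powr e"
      unfolding c by (simp add: powr_mult)
    moreover have "pos_definite (mat 1 - mstar (A ** T) ** (A ** T)) \<longleftrightarrow> pos_definite (S - mstar A ** A)"
      unfolding c by (rule pos_definite_congruence_iff[OF T(3)])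
    ultimately have "\<beta> (A ** T) = ennreal (adet T powr (2 * e)) *
        (F (A ** T) * of_bool (pos_definite (S - mstar A ** A)) * ennreal (adet (S - mstar A ** A) powr e))"
      by (simp add: \<beta>_def ennreal_mult' mult_ac)
    then show ?thesis by (simp add: powr_cancel_mult[OF T0])
  qed
  have "(\<integral>\<^sup>+A. F (A ** T) * of_bool (pos_definite (S - mstar A ** A)) * ennreal (adet (S - mstar A ** A) powr e) \<partial>lborel)
      = ennreal (adet T powr - (2 * e)) * (\<integral>\<^sup>+A. \<beta> (A ** T) \<partial>lborel)"
    unfolding eq by (rule nn_integral_cmult) measurable
  also have "\<dots> = ennreal (adet T powr - (2 * e)) * (ennreal (adet T powr - (real DIM('f) * real CARD('q))) * (\<integral>\<^sup>+w. \<beta> w \<partial>lborel))"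
    by (subst scalesD[OF scales_matrix_right[OF T(3)], of \<beta>]) auto
  also have "\<dots> = ennreal (adet T powr - (2 * e + real DIM('f) * real CARD('q))) * (\<integral>\<^sup>+w. \<beta> w \<partial>lborel)"
    by (simp flip: mult.assoc ennreal_mult' powr_add)
  finally show ?thesis by (simp add: T_def \<beta>_def)
qed

text \<open>After writing the Gram matrix of the lower block as \<open>herm X\<close>, translating by the Gram matrix
  of the upper block turns \<open>herm X\<close> into the full Gram matrix, and the linear substitution
  \<open>w = A (herm X) powr (-1/2)\<close> separates the variables.\<close>

theorem truncated_frame_integral:
  assumes "CARD('q::{finite,linorder}) \<le> CARD('r::finite)"
  obtains C :: ennreal where "\<And>F :: (('f::star_algebra, 'q) vec, 'q) vec \<Rightarrow> ennreal. F \<in> borel_measurable borel \<Longrightarrow>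
    (\<integral>\<^sup>+A. F (top_rows A ** isqrt (mstar A ** A)) * of_bool (near (mstar A ** A) (mat 1)) \<partial>(lborel :: (('f, 'q) vec^('q + 'r)) measure))
      = C * (\<integral>\<^sup>+w. F w * of_bool (pos_definite (mat 1 - mstar w ** w))
          * ennreal (adet (mat 1 - mstar w ** w) powr (real DIM('f) * (real CARD('r) - real CARD('q) + 1) / 2 - 1)) \<partial>lborel)"
proof -
  define e where "e = real DIM('f) * (real CARD('r) - real CARD('q) + 1) / 2 - 1"
  obtain c1 :: real where c1: "\<And>h. h \<in> borel_measurable borel \<Longrightarrow>
    (\<integral>\<^sup>+A. h A \<partial>lborel) = ennreal c1 * (\<integral>\<^sup>+A. \<integral>\<^sup>+B. h (stack_rows A B :: ('f, 'q) vec^('q + 'r)) \<partial>lborel \<partial>lborel)"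
    using stack_rows_integral[where 'f = 'f and 'n = 'q and 'm = 'q and 'k = 'r] by blast
  obtain c2 where c2: "\<And>h. h \<in> borel_measurable borel \<Longrightarrow>
    (\<integral>\<^sup>+A. h (mstar A ** (A :: ('f, 'q) vec^'r)) \<partial>lborel) = c2 * (\<integral>\<^sup>+X. h (herm X) * herm_weight e X \<partial>lborel)"
    using gram_integral[OF assms, where 'f = 'f] unfolding e_def by blast
  \<comment> \<open>What depends on \<open>X\<close> alone once w has been substituted; its integral
    enters only through \<open>C\<close>.\<close>
  define g where "g X = of_bool (norm (X - upper X) \<le> 1) * of_bool (near (herm X) (mat 1))
    * ennreal (adet (isqrt (herm X)) powr - (2 * e + real DIM('f) * real CARD('q)))" for X :: "(('f, 'q) vec, 'q) vec"
  have [measurable]: "g \<in> borel_measurable borel" unfolding g_def by measurable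
  define C where "C = ennreal c1 * (c2 * (\<integral>\<^sup>+X. g X \<partial>lborel))"
  have "(\<integral>\<^sup>+A. F (top_rows A ** isqrt (mstar A ** A)) * of_bool (near (mstar A ** A) (mat 1)) \<partial>(lborel :: (('f, 'q) vec^('q + 'r)) measure))
      = C * (\<integral>\<^sup>+w. F w * of_bool (pos_definite (mat 1 - mstar w ** w)) * ennreal (adet (mat 1 - mstar w ** w) powr e) \<partial>lborel)"
    if [measurable]: "F \<in> borel_measurable borel" for F :: "(('f, 'q) vec, 'q) vec \<Rightarrow> ennreal"
  proof -
    define B where "B = (\<integral>\<^sup>+w. F w * of_bool (pos_definite (mat 1 - mstar w ** w)) * ennreal (adet (mat 1 - mstar w ** w) powr e) \<partial>lborel)"
    define H where "H A S = F (A ** isqrt S) * of_bool (near S (mat 1))" for A S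
    have H_measurable [measurable]: "(\<lambda>x. H (f x) (g x)) \<in> borel_measurable M"
      if [measurable]: "f \<in> borel_measurable M" "g \<in> borel_measurable M" for M :: "(('f, 'q) vec, 'q) vec measure" and f g
      unfolding H_def by measurable
    have inner: "(\<integral>\<^sup>+A2. H A (mstar A ** A + mstar A2 ** (A2 :: ('f, 'q) vec^'r)) \<partial>lborel)
        = c2 * (\<integral>\<^sup>+X. H A (herm X) * (of_bool (norm (X - upper X) \<le> 1) * of_bool (pos_definite (herm X - mstar A ** A))
            * ennreal (adet (herm X - mstar A ** A) powr e)) \<partial>lborel)" for A
    proof -
      \<comment> \<open>Translating by the upper part, rather than by the Gram matrix itself, shifts
        \<open>herm X\<close> by \<open>mstar A ** A\<close> and leaves the complementary
        coordinates fixed.\<close>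
      define u where "u = upper (mstar A ** A)"
      have herm_G: "herm (mstar A ** A) = mstar A ** A"
        by (rule herm_eq_self) (simp add: mstar_mult)
      have herm_u: "herm (X - u) = herm X - mstar A ** A" for X
        by (simp add: linear_diff[OF linear_herm] u_def herm_G)
      have low_u: "X - u - upper (X - u) = X - upper X" for X
        by (simp add: linear_diff[OF linear_upper] u_def)
      have eq2: "(\<integral>\<^sup>+A2. H A (mstar A ** A + mstar A2 ** (A2 :: ('f, 'q) vec^'r)) \<partial>lborel)
          = c2 * (\<integral>\<^sup>+X. H A (mstar A ** A + herm X) * herm_weight e X \<partial>lborel)"
        by (rule c2) measurable
      have m: "(\<lambda>X. H A (mstar A ** A + herm X) * herm_weight e X) \<in> borel_measurable borel"
        unfolding H_def by measurable
      have "(\<integral>\<^sup>+X. H A (mstar A ** A + herm X) * herm_weight e X \<partial>lborel)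
          = (\<integral>\<^sup>+X. H A (mstar A ** A + herm (- u + 1 *\<^sub>R X)) * herm_weight e (- u + 1 *\<^sub>R X) \<partial>lborel)"
        using nn_integral_lborel_affine[OF m, of 1 "- u"] by simp
      then show ?thesis
        unfolding eq2 by (simp add: herm_weight_def herm_u low_u)
    qed
    have "(\<integral>\<^sup>+A. F (top_rows A ** isqrt (mstar A ** A)) * of_bool (near (mstar A ** A) (mat 1)) \<partial>(lborel :: (('f, 'q) vec^('q + 'r)) measure))
        = ennreal c1 * (\<integral>\<^sup>+A. \<integral>\<^sup>+A2. H A (mstar A ** A + mstar A2 ** (A2 :: ('f, 'q) vec^'r)) \<partial>lborel \<partial>lborel)"
      by (subst c1) (simp_all add: gram_stack_rows H_def)
    also have "(\<integral>\<^sup>+A. \<integral>\<^sup>+A2. H A (mstar A ** A + mstar A2 ** (A2 :: ('f, 'q) vec^'r)) \<partial>lborel \<partial>lborel)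
        = c2 * (\<integral>\<^sup>+A. \<integral>\<^sup>+X. H A (herm X) * (of_bool (norm (X - upper X) \<le> 1) * of_bool (pos_definite (herm X - mstar A ** A))
            * ennreal (adet (herm X - mstar A ** A) powr e)) \<partial>lborel \<partial>lborel)"
      unfolding inner by (rule nn_integral_cmult) (unfold H_def, measurable)
    also have "(\<integral>\<^sup>+A. \<integral>\<^sup>+X. H A (herm X) * (of_bool (norm (X - upper X) \<le> 1) * of_bool (pos_definite (herm X - mstar A ** A))
            * ennreal (adet (herm X - mstar A ** A) powr e)) \<partial>lborel \<partial>lborel)
        = (\<integral>\<^sup>+X. \<integral>\<^sup>+A. H A (herm X) * (of_bool (norm (X - upper X) \<le> 1) * of_bool (pos_definite (herm X - mstar A ** A))
            * ennreal (adet (herm X - mstar A ** A) powr e)) \<partial>lborel \<partial>lborel)"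
      unfolding H_def by (rule lborel_pair.Fubini') measurable
    also have "\<dots> = (\<integral>\<^sup>+X. g X * B \<partial>lborel)"
    proof (rule nn_integral_cong)
      fix X :: "(('f, 'q) vec, 'q) vec"
      show "(\<integral>\<^sup>+A. H A (herm X) * (of_bool (norm (X - upper X) \<le> 1) * of_bool (pos_definite (herm X - mstar A ** A))
            * ennreal (adet (herm X - mstar A ** A) powr e)) \<partial>lborel) = g X * B"
      proof (cases "near (herm X) (mat 1) \<and> norm (X - upper X) \<le> 1")
        case True
        then show ?thesis
          using truncated_frame_slice[OF that, of "herm X" e] by (simp add: H_def g_def B_def mult.assoc)
      qed (auto simp: H_def g_def)
    qed
    also have "\<dots> = (\<integral>\<^sup>+X. g X \<partial>lborel) * B"
      by (rule nn_integral_multc) measurable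
    finally show ?thesis by (simp add: C_def B_def mult.assoc)
  qed
  then show ?thesis using that by (simp add: e_def)
qed

section \<open>Block matrices\<close>

lemma block_mult:
  fixes A :: "'f::semiring_1^'n::finite^'m" and B :: "'f^'k::finite^'m"
  shows "block A B C D ** block A' B' C' D'
    = block (A ** A' + B ** C') (A ** B' + B ** D') (C ** A' + D ** C') (C ** B' + D ** D')"
  by (auto simp: vec_eq_iff block_def matrix_matrix_mult_def sum_UNIV_sum split: sum.split)

lemma mstar_block: "mstar (block A B C D) = block (mstar A) (mstar C) (mstar B) (mstar D)"
  by (auto simp: vec_eq_iff block_def split: sum.split)

lemma block_mat_1: "block (mat 1) 0 0 (mat 1) = (mat 1 :: 'f::zero_neq_one^('n::finite + 'm::finite)^('n + 'm))"
  by (auto simp: vec_eq_iff block_def mat_def split: sum.split)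

definition ul_block :: "'f^('n::finite + 'k::finite)^('m::finite + 'l::finite) \<Rightarrow> 'f^'n^'m"
  where "ul_block M = (\<chi> i j. M $ Inl i $ Inl j)"

definition ur_block :: "'f^('n::finite + 'k::finite)^('m::finite + 'l::finite) \<Rightarrow> 'f^'k^'m"
  where "ur_block M = (\<chi> i j. M $ Inl i $ Inr j)"

definition ll_block :: "'f^('n::finite + 'k::finite)^('m::finite + 'l::finite) \<Rightarrow> 'f^'n^'l"
  where "ll_block M = (\<chi> i j. M $ Inr i $ Inl j)"

definition lr_block :: "'f^('n::finite + 'k::finite)^('m::finite + 'l::finite) \<Rightarrow> 'f^'k^'l"
  where "lr_block M = (\<chi> i j. M $ Inr i $ Inr j)"

lemma block_simps [simp]:
  "ul_block (block A B C D) = A" "ur_block (block A B C D) = B"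
  "ll_block (block A B C D) = C" "lr_block (block A B C D) = D"
  "block (ul_block M) (ur_block M) (ll_block M) (lr_block M) = M"
  by (auto simp: vec_eq_iff block_def ul_block_def ur_block_def ll_block_def lr_block_def split: sum.split)

lemma block_eq_iff: "block A B C D = block A' B' C' D' \<longleftrightarrow> A = A' \<and> B = B' \<and> C = C' \<and> D = (D' :: 'f^'k::finite^'l::finite)"
  for A :: "'f^'n::finite^'m::finite"
  by (metis block_simps(1-4))

lemma measurable_ul_block [measurable]:
  fixes f :: "'a \<Rightarrow> 'f::star_algebra^('n::finite + 'k::finite)^('m::finite + 'l::finite)"
  assumes "f \<in> borel_measurable M"
  shows "(\<lambda>x. ul_block (f x)) \<in> borel_measurable M"
  using assms unfolding ul_block_def
  by (rule measurable_compose) (intro borel_measurable_continuous_onI continuous_on_vec_lambda continuous_intros)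

lemma measurable_lr_block [measurable]:
  fixes f :: "'a \<Rightarrow> 'f::star_algebra^('n::finite + 'k::finite)^('m::finite + 'l::finite)"
  assumes "f \<in> borel_measurable M"
  shows "(\<lambda>x. lr_block (f x)) \<in> borel_measurable M"
  using assms unfolding lr_block_def
  by (rule measurable_compose) (intro borel_measurable_continuous_onI continuous_on_vec_lambda continuous_intros)

section \<open>Invariance of the Haar measure\<close>

text \<open>\<open>normalized_haar\<close> provides left invariance only. Inside the unitary group
  \<open>mstar\<close> is inversion, and closure under it yields invariance under inversion and
  right translation.\<close>

locale haar_group =
  fixes U :: "('f::star_algebra^'n^'n) set" and M
  assumes haar: "normalized_haar U M"
    and unitary: "U \<subseteq> unitary_group"
    and one: "mat 1 \<in> U"
    and mult: "\<And>x y. x \<in> U \<Longrightarrow> y \<in> U \<Longrightarrow> x ** y \<in> U"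
    and inv: "\<And>x. x \<in> U \<Longrightarrow> mstar x \<in> U"
begin

lemma sets_M: "sets M = sets (restrict_space borel U)"
  using haar by (simp add: normalized_haar_def)

lemma space_M: "space M = U"
  using sets_eq_imp_space_eq[OF sets_M] by (simp add: space_restrict_space)

lemma emeasure_space_1: "emeasure M (space M) = 1"
  using haar by (simp add: space_M normalized_haar_def)

sublocale finite_measure M
  by standard (simp add: emeasure_space_1)

lemma measurable_M_borel: "(\<lambda>x. x) \<in> borel_measurable M"
  by (subst measurable_cong_sets[OF sets_M refl]) (rule measurable_restrict_space1, simp)

lemma measurable_M: "f \<in> borel_measurable borel \<Longrightarrow> f \<in> borel_measurable M"
  using measurable_compose[OF measurable_M_borel] by blast

lemma measurable_into_borel:
  "f \<in> measurable N M \<Longrightarrow> f \<in> borel_measurable N"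
  using measurable_compose[OF _ measurable_M_borel, of f N] by simp

lemma nn_integral_left:
  assumes [measurable]: "h \<in> borel_measurable borel" and u: "u \<in> U"
  shows "(\<integral>\<^sup>+x. h (u ** x) \<partial>M) = (\<integral>\<^sup>+x. h x \<partial>M)"
proof -
  have [measurable]: "(\<lambda>x. u ** x) \<in> measurable M M"
    by (subst measurable_cong_sets[OF refl sets_M], rule measurable_restrict_space2)
      (use mult u measurable_M_borel in \<open>auto simp: space_M\<close>)
  have "(\<integral>\<^sup>+x. h x \<partial>M) = (\<integral>\<^sup>+x. h x \<partial>distr M M (\<lambda>x. u ** x))"
    using haar u by (simp add: normalized_haar_def)
  also have "\<dots> = (\<integral>\<^sup>+x. h (u ** x) \<partial>M)"
    by (rule nn_integral_distr) (simp_all add: measurable_M)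
  finally show ?thesis ..
qed

text \<open>Integrate h(y* x) over both variables. The inner integral over x gives the integral of
  h; integrating over y after replacing y by x y gives that of h composed with inversion.\<close>

lemma nn_integral_inverse:
  assumes [measurable]: "h \<in> borel_measurable borel"
  shows "(\<integral>\<^sup>+x. h (mstar x) \<partial>M) = (\<integral>\<^sup>+x. h x \<partial>M)"
proof -
  interpret pair_sigma_finite M M ..
  have [measurable]: "fst \<in> borel_measurable (M \<Otimes>\<^sub>M M)" "snd \<in> borel_measurable (M \<Otimes>\<^sub>M M)"
    by (rule measurable_into_borel[OF measurable_fst], rule measurable_into_borel[OF measurable_snd])
  have "(\<integral>\<^sup>+x. h x \<partial>M) = (\<integral>\<^sup>+y. (\<integral>\<^sup>+x. h (mstar y ** x) \<partial>M) \<partial>M)"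
    using emeasure_space_1 by (subst nn_integral_cong[OF nn_integral_left]) (auto simp: space_M inv)
  also have "\<dots> = (\<integral>\<^sup>+x. (\<integral>\<^sup>+y. h (mstar y ** x) \<partial>M) \<partial>M)"
    by (rule Fubini') (simp add: case_prod_beta)
  also have "\<dots> = (\<integral>\<^sup>+x. (\<integral>\<^sup>+y. h (mstar y) \<partial>M) \<partial>M)"
  proof (rule nn_integral_cong)
    fix x assume "x \<in> space M"
    then have x: "x \<in> U" by (simp add: space_M)
    have "(\<integral>\<^sup>+y. h (mstar y ** x) \<partial>M) = (\<integral>\<^sup>+y. h (mstar (x ** y) ** x) \<partial>M)"
      by (rule nn_integral_left[OF _ x, of "\<lambda>y. h (mstar y ** x)", symmetric]) measurable
    also have "\<dots> = (\<integral>\<^sup>+y. h (mstar y) \<partial>M)"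
    proof -
      have "x \<in> unitary_group" using x unitary by blast
      then have "mstar (x ** y) ** x = mstar y" for y :: "'f^'n^'n"
        by (simp add: mstar_mult unitary_groupD flip: matrix_mul_assoc)
      then show ?thesis by simp
    qed
    finally show "(\<integral>\<^sup>+y. h (mstar y ** x) \<partial>M) = (\<integral>\<^sup>+y. h (mstar y) \<partial>M)" .
  qed
  also have "\<dots> = (\<integral>\<^sup>+y. h (mstar y) \<partial>M)"
    using emeasure_space_1 by simp
  finally show ?thesis ..
qed

lemma nn_integral_right:
  assumes [measurable]: "h \<in> borel_measurable borel" and u: "u \<in> U"
  shows "(\<integral>\<^sup>+x. h (x ** u) \<partial>M) = (\<integral>\<^sup>+x. h x \<partial>M)"
proof -
  have "(\<integral>\<^sup>+x. h (x ** u) \<partial>M) = (\<integral>\<^sup>+x. h (mstar x ** u) \<partial>M)"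
    by (rule nn_integral_inverse[of "\<lambda>x. h (x ** u)", symmetric]) measurable
  also have "\<dots> = (\<integral>\<^sup>+x. h (mstar (mstar u ** x)) \<partial>M)"
    by (simp add: mstar_mult)
  also have "\<dots> = (\<integral>\<^sup>+x. h (mstar x) \<partial>M)"
    by (rule nn_integral_left[of "\<lambda>x. h (mstar x)"]) (measurable, use inv u in blast)
  also have "\<dots> = (\<integral>\<^sup>+x. h x \<partial>M)"
    by (rule nn_integral_inverse) measurable
  finally show ?thesis .
qed

end

lemma haar_group_unitary_group0:
  assumes "normalized_haar (unitary_group0 :: ('f::star_algebra^'n^'n) set) M"
  shows "haar_group unitary_group0 M"
  using assms by unfold_locales
    (auto simp: unitary_group0_subset mat_1_unitary_group0 unitary_group0_mult unitary_group0_mstar)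

section \<open>Pushing the Haar measure forward to two blocks\<close>

text \<open>Multiplying by it on the right selects the first q columns, multiplying by its adjoint
  on the left the first q rows.\<close>

definition frame0 :: "'f::star_algebra^'q^('q::finite + 'r::finite)"
  where "frame0 = stack_rows (mat 1) 0"

lemma gram_frame0: "mstar frame0 ** frame0 = mat 1"
  by (simp add: frame0_def gram_stack_rows)

definition frame_mass :: "('f::star_algebra^'q::{finite,linorder}^('q::{finite,linorder} + 'r::finite)) itself \<Rightarrow> ennreal"
  where "frame_mass _ = (\<integral>\<^sup>+A. of_bool (near (mstar A ** A) (mat 1)) \<partial>(lborel :: (('f, 'q) vec, 'q + 'r) vec measure))"

lemma frame_mass_pos_finite:
  "0 < frame_mass TYPE('f::star_algebra^'q::{finite,linorder}^('q::{finite,linorder} + 'r::finite))"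
  "frame_mass TYPE('f::star_algebra^'q::{finite,linorder}^('q::{finite,linorder} + 'r::finite)) < \<infinity>"
proof -
  define K where "K = {A :: (('f, 'q) vec, 'q + 'r) vec. near (mstar A ** A) (mat 1)}"
  define n where "n = norm (mat 1 :: (('f, 'q) vec, 'q) vec)"
  have eq: "frame_mass TYPE((('f, 'q) vec, 'q + 'r) vec) = (\<integral>\<^sup>+A. indicator K A * ennreal 1 \<partial>lborel)"
    unfolding frame_mass_def by (intro nn_integral_cong) (auto simp: K_def indicator_def)
  have "closed K" unfolding K_def by (intro closed_Collect_near continuous_intros)
  moreover have "norm A \<le> 1 + n * (2 * n)" if "A \<in> K" for A
  proof -
    have "norm (mstar A ** A) \<le> 2 * n"
      using near_1_norm[of "mstar A ** A"] that by (simp add: K_def n_def)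
    then have "n * norm (mstar A ** A) \<le> n * (2 * n)"
      by (intro mult_left_mono) (auto simp: n_def)
    moreover have "(norm A)\<^sup>2 = inner (mat 1) (mstar A ** A)"
      using inner_matrix_mult_left[of "mstar A" A "mat 1"] by (simp add: inner_commute[of "mat 1"] dot_square_norm)
    then have "(norm A)\<^sup>2 \<le> n * norm (mstar A ** A)"
      using norm_cauchy_schwarz[of "mat 1" "mstar A ** A"] by (simp add: n_def)
    moreover have "2 * norm A \<le> 1 + (norm A)\<^sup>2"
      using sum_squares_bound[of 1 "norm A"] by simp
    ultimately show ?thesis using norm_ge_zero[of A] by linarith
  qed
  then have "bounded K" unfolding bounded_iff by blast
  ultimately have "compact K" by (simp add: compact_eq_bounded_closed)
  moreover define E where "E = {A :: (('f, 'q) vec, 'q + 'r) vec. norm (mstar A ** A - mat 1) < 1 / 2}"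
  moreover have "open E" unfolding E_def by (intro open_Collect_less continuous_intros)
  moreover have "E \<subseteq> K" by (auto simp: E_def K_def mstar_mult intro!: near_1I)
  moreover have "frame0 \<in> E" by (simp add: E_def gram_frame0)
  ultimately show "0 < frame_mass TYPE((('f, 'q) vec, 'q + 'r) vec)" "frame_mass TYPE((('f, 'q) vec, 'q + 'r) vec) < \<infinity>"
    unfolding eq using nn_integral_compact_pos[of K "\<lambda>_. 1" E frame0] by auto
qed

text \<open>The q x q matrix \<open>w\<close> of the product formula. It is written through
  \<open>frame0\<close> because it depends on \<open>k\<close> only through the first q columns of
  the upper left block.\<close>

definition corner :: "'f::star_algebra^(('q::finite + 'r::finite) + 'q)^(('q + 'r) + 'q) \<Rightarrow> 'f^'q^'q"
  where "corner k = top_rows (ul_block k ** frame0)"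

lemma measurable_corner [measurable]:
  assumes "f \<in> borel_measurable M"
  shows "(\<lambda>x. corner (f x)) \<in> borel_measurable M"
  using assms unfolding corner_def by measurable

definition ball_density :: "real \<Rightarrow> 'f::star_algebra^'q::{finite,linorder}^'q::{finite,linorder} \<Rightarrow> real"
  where "ball_density e w = (if w \<in> B_ball then adet (mat 1 - mstar w ** w) powr e else 0)"

lemma measurable_ball_density [measurable]: "ball_density e \<in> borel_measurable borel"
  unfolding ball_density_def B_ball_def mem_Collect_eq by measurable

text \<open>What the three compact groups share. By \<open>transitive\<close> a frame and a lower
  right block can be prescribed independently of each other, although the determinants of the two
  blocks of \<open>k\<close> may be coupled. The condition \<open>card\<close> is p >= 2q, with p =
  q + r.\<close>

locale block_group = K: haar_group K dk + V: haar_group unitary_group0 dv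
  for K :: "('f::star_algebra^(('q::{finite,linorder} + 'r::finite) + 'q::{finite,linorder})^(('q::{finite,linorder} + 'r::finite) + 'q::{finite,linorder})) set"
    and dk and dv :: "('f^'q::{finite,linorder}^'q::{finite,linorder}) measure" +
  assumes block: "\<And>k. k \<in> K \<Longrightarrow> \<exists>A \<in> unitary_group. \<exists>D \<in> unitary_group0. k = block A 0 0 D"
    and transitive: "\<And>X v. mstar X ** X = mat 1 \<Longrightarrow> v \<in> unitary_group0 \<Longrightarrow> \<exists>A. block A 0 0 v \<in> K \<and> A ** frame0 = X"
    and card: "CARD('q) \<le> CARD('r)"
begin

text \<open>With p = q + r this is p d / 2 - \<gamma>.\<close>

definition expo :: real
  where "expo = real DIM('f) * (real CARD('r) - real CARD('q) + 1) / 2 - 1"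

text \<open>The left side is unchanged when A and v are multiplied from the left by the two blocks
  of \<open>k\<close>; average this over \<open>k\<close> and exchange integrals. For fixed A and v
  the orthonormalised A is a frame, so \<open>transitive\<close> makes it, together with v, the
  translate of \<open>frame0\<close> and the identity by one element of \<open>K\<close>. Right
  invariance of \<open>dk\<close> then removes A and v.\<close>

lemma frame_integral:
  fixes F :: "(('f, 'q) vec, 'q) vec \<Rightarrow> (('f, 'q) vec, 'q) vec \<Rightarrow> ennreal"
  assumes [measurable]: "case_prod F \<in> borel_measurable borel"
  shows "(\<integral>\<^sup>+v. \<integral>\<^sup>+A. F (top_rows (A ** isqrt (mstar A ** A))) v * of_bool (near (mstar A ** A) (mat 1))
      \<partial>(lborel :: (('f, 'q) vec, 'q + 'r) vec measure) \<partial>dv)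
    = (\<integral>\<^sup>+k. F (corner k) (lr_block k) \<partial>dk) * frame_mass TYPE((('f, 'q) vec, 'q + 'r) vec)"
proof -
  interpret kv: pair_sigma_finite dk dv ..
  interpret kl: pair_sigma_finite dk "lborel :: (('f, 'q) vec, 'q + 'r) vec measure" ..
  have [measurable]:
    "(\<lambda>x. fst (fst x)) \<in> borel_measurable ((dk \<Otimes>\<^sub>M dv) \<Otimes>\<^sub>M (lborel :: (('f, 'q) vec, 'q + 'r) vec measure))"
    "fst \<in> borel_measurable (dk \<Otimes>\<^sub>M (lborel :: (('f, 'q) vec, 'q + 'r) vec measure))"
    by (rule K.measurable_into_borel[OF measurable_compose[OF measurable_fst measurable_fst]],
        rule K.measurable_into_borel[OF measurable_fst])
  have [measurable]:
    "(\<lambda>x. snd (fst x)) \<in> borel_measurable ((dk \<Otimes>\<^sub>M dv) \<Otimes>\<^sub>M (lborel :: (('f, 'q) vec, 'q + 'r) vec measure))"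
    by (rule V.measurable_into_borel[OF measurable_compose[OF measurable_fst measurable_snd]])
  have F_measurable [measurable (raw)]: "(\<lambda>x. F (f x) (g x)) \<in> borel_measurable N"
    if "f \<in> borel_measurable N" "g \<in> borel_measurable N" for f g and N :: "'z measure"
    using measurable_compose[OF borel_measurable_Pair[OF that] assms] by simp
  let ?T = "\<lambda>A :: (('f, 'q) vec, 'q + 'r) vec. isqrt (mstar A ** A)"
  let ?\<chi> = "\<lambda>A :: (('f, 'q) vec, 'q + 'r) vec. of_bool (near (mstar A ** A) (mat 1)) :: ennreal"
  define I where "I = (\<integral>\<^sup>+v. \<integral>\<^sup>+A. F (top_rows (A ** ?T A)) v * ?\<chi> A \<partial>lborel \<partial>dv)"
  define L where "L = (\<integral>\<^sup>+k. F (corner k) (lr_block k) \<partial>dk)"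
  have "I = (\<integral>\<^sup>+k. I \<partial>dk)"
    using K.emeasure_space_1 by simp
  also have "\<dots> = (\<integral>\<^sup>+k. \<integral>\<^sup>+v. \<integral>\<^sup>+A. F (top_rows (ul_block k ** (A ** ?T A))) (lr_block k ** v) * ?\<chi> A \<partial>lborel \<partial>dv \<partial>dk)"
  proof (rule nn_integral_cong)
    fix k assume "k \<in> space dk"
    then have "k \<in> K" by (simp add: K.space_M)
    then obtain U D where U: "U \<in> unitary_group" "D \<in> unitary_group0" "k = block U 0 0 D"
      using block by blast
    have isom: "scales (\<lambda>A. U ** A :: (('f, 'q) vec, 'q + 'r) vec) 1"
      by (intro scales_isometry linear_matrix_left norm_unitary_mult_left U)
    have gram: "mstar (U ** A) ** (U ** A) = mstar A ** A" for A :: "(('f, 'q) vec, 'q + 'r) vec"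
      by (simp add: mstar_mult unitary_cancel(3)[OF U(1)] flip: matrix_mul_assoc)
    have A: "(\<integral>\<^sup>+A. F (top_rows (A ** ?T A)) v * ?\<chi> A \<partial>lborel)
        = (\<integral>\<^sup>+A. F (top_rows (U ** (A ** ?T A))) v * ?\<chi> A \<partial>lborel)" for v
      using scalesD[OF isom, of "\<lambda>A. F (top_rows (A ** ?T A)) v * ?\<chi> A"] unfolding gram by (simp add: matrix_mul_assoc)
    have "I = (\<integral>\<^sup>+v. \<integral>\<^sup>+A. F (top_rows (U ** (A ** ?T A))) v * ?\<chi> A \<partial>lborel \<partial>dv)"
      unfolding I_def A ..
    also have "\<dots> = (\<integral>\<^sup>+v. \<integral>\<^sup>+A. F (top_rows (U ** (A ** ?T A))) (D ** v) * ?\<chi> A \<partial>lborel \<partial>dv)"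
      by (rule V.nn_integral_left[OF _ U(2), symmetric]) measurable
    finally show "I = (\<integral>\<^sup>+v. \<integral>\<^sup>+A. F (top_rows (ul_block k ** (A ** ?T A))) (lr_block k ** v) * ?\<chi> A \<partial>lborel \<partial>dv)"
      by (simp add: U(3))
  qed
  also have "\<dots> = (\<integral>\<^sup>+v. \<integral>\<^sup>+k. \<integral>\<^sup>+A. F (top_rows (ul_block k ** (A ** ?T A))) (lr_block k ** v) * ?\<chi> A \<partial>lborel \<partial>dk \<partial>dv)"
    by (rule kv.Fubini'[symmetric]) measurable
  also have "\<dots> = (\<integral>\<^sup>+v. \<integral>\<^sup>+A. \<integral>\<^sup>+k. F (top_rows (ul_block k ** (A ** ?T A))) (lr_block k ** v) * ?\<chi> A \<partial>dk \<partial>lborel \<partial>dv)"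
    by (intro nn_integral_cong kl.Fubini'[symmetric]) measurable
  also have "\<dots> = (\<integral>\<^sup>+v. \<integral>\<^sup>+A. L * ?\<chi> A \<partial>lborel \<partial>dv)"
  proof (intro nn_integral_cong)
    fix v and A :: "(('f, 'q) vec, 'q + 'r) vec" assume "v \<in> space dv"
    then have v: "v \<in> unitary_group0" by (simp add: V.space_M)
    show "(\<integral>\<^sup>+k. F (top_rows (ul_block k ** (A ** ?T A))) (lr_block k ** v) * ?\<chi> A \<partial>dk) = L * ?\<chi> A"
    proof (cases "near (mstar A ** A) (mat 1)")
      case True
      have "mstar (A ** ?T A) ** (A ** ?T A) = mstar (?T A) ** (mstar A ** A) ** ?T A"
        by (simp add: mstar_mult matrix_mul_assoc)
      also have "\<dots> = mat 1" using isqrt[OF True] by (simp add: psd_def)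
      finally obtain U where U: "block U 0 0 v \<in> K" "U ** frame0 = A ** ?T A"
        using transitive v by blast
      have "(\<integral>\<^sup>+k. F (top_rows (ul_block k ** (A ** ?T A))) (lr_block k ** v) \<partial>dk)
          = (\<integral>\<^sup>+k. F (corner (k ** block U 0 0 v)) (lr_block (k ** block U 0 0 v)) \<partial>dk)"
      proof (rule nn_integral_cong)
        fix k assume "k \<in> space dk"
        then have "k \<in> K" by (simp add: K.space_M)
        then obtain U' D where k: "k = block U' 0 0 D" using block by blast
        show "F (top_rows (ul_block k ** (A ** ?T A))) (lr_block k ** v)
            = F (corner (k ** block U 0 0 v)) (lr_block (k ** block U 0 0 v))"
          by (simp add: k block_mult corner_def U(2) flip: matrix_mul_assoc)
      qed
      also have "\<dots> = L"
        unfolding L_def by (rule K.nn_integral_right[OF _ U(1), of "\<lambda>k. F (corner k) (lr_block k)"]) measurable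
      finally show ?thesis using True by simp
    qed simp
  qed
  also have "\<dots> = (\<integral>\<^sup>+v. L * frame_mass TYPE((('f, 'q) vec, 'q + 'r) vec) \<partial>dv)"
    unfolding frame_mass_def by (subst nn_integral_cmult) measurable
  also have "\<dots> = L * frame_mass TYPE((('f, 'q) vec, 'q + 'r) vec)"
    using V.emeasure_space_1 by simp
  finally show ?thesis by (simp add: I_def L_def)
qed

text \<open>The constant is determined by the total mass.\<close>

lemma block_integral:
    "\<And>F :: (('f, 'q) vec, 'q) vec \<Rightarrow> (('f, 'q) vec, 'q) vec \<Rightarrow> ennreal. case_prod F \<in> borel_measurable borel \<Longrightarrow>
      (\<integral>\<^sup>+w. ennreal (ball_density expo w) \<partial>(lborel :: (('f, 'q) vec, 'q) vec measure)) * (\<integral>\<^sup>+k. F (corner k) (lr_block k) \<partial>dk)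
      = (\<integral>\<^sup>+v. \<integral>\<^sup>+w. F w v * ennreal (ball_density expo w) \<partial>lborel \<partial>dv)"
    and ball_density_integral: "0 < (\<integral>\<^sup>+w. ennreal (ball_density expo w) \<partial>(lborel :: (('f, 'q) vec, 'q) vec measure))"
    "(\<integral>\<^sup>+w. ennreal (ball_density expo w) \<partial>(lborel :: (('f, 'q) vec, 'q) vec measure)) < \<infinity>"
proof -
  define \<kappa> where "\<kappa> = (\<integral>\<^sup>+w. ennreal (ball_density expo w) \<partial>(lborel :: (('f, 'q) vec, 'q) vec measure))"
  define \<Lambda> where "\<Lambda> = frame_mass TYPE((('f, 'q) vec, 'q + 'r) vec)"
  have \<Lambda>: "0 < \<Lambda>" "\<Lambda> < \<infinity>" unfolding \<Lambda>_def by (rule frame_mass_pos_finite)+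
  obtain C where C: "\<And>F :: (('f, 'q) vec, 'q) vec \<Rightarrow> ennreal. F \<in> borel_measurable borel \<Longrightarrow>
    (\<integral>\<^sup>+A. F (top_rows A ** isqrt (mstar A ** A)) * of_bool (near (mstar A ** A) (mat 1)) \<partial>(lborel :: (('f, 'q) vec, 'q + 'r) vec measure))
      = C * (\<integral>\<^sup>+w. F w * ennreal (ball_density expo w) \<partial>lborel)"
  proof -
    have dens: "F w * of_bool (pos_definite (mat 1 - mstar w ** w)) * ennreal (adet (mat 1 - mstar w ** w) powr expo)
        = F w * ennreal (ball_density expo w)" for F :: "(('f, 'q) vec, 'q) vec \<Rightarrow> ennreal" and w
      by (simp add: ball_density_def B_ball_def)
    show ?thesis
      using truncated_frame_integral[OF card, where 'f = 'f] that
      unfolding expo_def[symmetric] dens by blast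
  qed
  \<comment> \<open>The case F = 1. Since \<Lambda> is positive and finite, so are both factors;
    this proves convergence of the integral over the ball as well.\<close>
  have "\<Lambda> = C * \<kappa>"
    using C[of "\<lambda>_. 1"] by (simp add: \<Lambda>_def frame_mass_def \<kappa>_def)
  then have \<kappa>: "0 < \<kappa>" "\<kappa> < \<infinity>" "0 < C" "C < \<infinity>"
    using \<Lambda> by (auto simp: zero_less_iff_neq_zero ennreal_mult_less_top less_top[symmetric] ennreal_mult_eq_top_iff)
  then show "0 < (\<integral>\<^sup>+w. ennreal (ball_density expo w) \<partial>(lborel :: (('f, 'q) vec, 'q) vec measure))"
    "(\<integral>\<^sup>+w. ennreal (ball_density expo w) \<partial>(lborel :: (('f, 'q) vec, 'q) vec measure)) < \<infinity>"
    by (simp_all add: \<kappa>_def)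
  fix F :: "(('f, 'q) vec, 'q) vec \<Rightarrow> (('f, 'q) vec, 'q) vec \<Rightarrow> ennreal"
  assume assms: "case_prod F \<in> borel_measurable borel"
  have [measurable]: "(\<lambda>w. F w v) \<in> borel_measurable borel" for v
    using measurable_compose[OF borel_measurable_Pair[OF measurable_ident_sets[OF refl] borel_measurable_const] assms, of v] by simp
  have F2: "(\<lambda>(v, w). F w v) \<in> borel_measurable (dv \<Otimes>\<^sub>M lborel)"
  proof -
    have "(\<lambda>x. (snd x, fst x)) \<in> borel_measurable (dv \<Otimes>\<^sub>M (lborel :: (('f, 'q) vec, 'q) vec measure))"
      by (intro borel_measurable_Pair V.measurable_into_borel[OF measurable_fst]) measurable
    from measurable_compose[OF this assms] show ?thesis by (simp add: case_prod_beta)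
  qed
  have "(\<integral>\<^sup>+k. F (corner k) (lr_block k) \<partial>dk) * \<Lambda> = (\<integral>\<^sup>+v. C * (\<integral>\<^sup>+w. F w v * ennreal (ball_density expo w) \<partial>lborel) \<partial>dv)"
    unfolding \<Lambda>_def frame_integral[OF assms, symmetric] top_rows_mult
    by (intro nn_integral_cong C) measurable
  also have "\<dots> = C * (\<integral>\<^sup>+v. \<integral>\<^sup>+w. F w v * ennreal (ball_density expo w) \<partial>lborel \<partial>dv)"
    by (rule nn_integral_cmult) (intro lborel.borel_measurable_nn_integral, use F2 in \<open>simp add: case_prod_beta\<close>)
  finally have "C * (\<kappa> * (\<integral>\<^sup>+k. F (corner k) (lr_block k) \<partial>dk)) = C * (\<integral>\<^sup>+v. \<integral>\<^sup>+w. F w v * ennreal (ball_density expo w) \<partial>lborel \<partial>dv)"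
    by (simp add: \<open>\<Lambda> = C * \<kappa>\<close> mult_ac)
  then show "(\<integral>\<^sup>+w. ennreal (ball_density expo w) \<partial>(lborel :: (('f, 'q) vec, 'q) vec measure)) * (\<integral>\<^sup>+k. F (corner k) (lr_block k) \<partial>dk)
      = (\<integral>\<^sup>+v. \<integral>\<^sup>+w. F w v * ennreal (ball_density expo w) \<partial>lborel \<partial>dv)"
    using \<kappa> by (auto simp: \<kappa>_def ennreal_mult_cancel_left)
qed

end

section \<open>Cartan decomposition\<close>

lemma stack_rows_mult: "stack_rows A B ** C = stack_rows (A ** C) (B ** (C :: 'f::semiring_1^'n^'k))"
  by (auto simp: vec_eq_iff stack_rows_def matrix_matrix_mult_def split: sum.split)

lemma frame0_mult: "frame0 ** C = stack_rows C (0 :: 'f::star_algebra^'n^'r::finite)"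
  by (simp add: frame0_def stack_rows_mult)

lemma mstar_frame0_mult: "mstar frame0 ** A = top_rows (A :: 'f::star_algebra^'n^('q::finite + 'r::finite))"
proof -
  have "mstar (frame0 :: 'f^'q^('q + 'r)) $ i $ j = (case j of Inl a \<Rightarrow> if i = a then 1 else 0 | Inr b \<Rightarrow> 0)" for i j
    by (auto simp: frame0_def stack_rows_def mat_def split: sum.split)
  moreover have "(\<Sum>j\<in>UNIV. (if i = j then 1 else 0) * x j) = (x i :: 'f)" for i :: 'q and x
  proof -
    have "(\<Sum>j\<in>UNIV. (if i = j then 1 else 0) * x j) = (\<Sum>j\<in>UNIV. if j = i then x j else 0)"
      by (intro sum.cong) auto
    then show ?thesis by simp
  qed
  ultimately show ?thesis
    by (simp add: vec_eq_iff matrix_matrix_mult_def sum_UNIV_sum top_rows_def)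
qed

lemma frame0_nth:
  "frame0 $ Inl k $ j = (if k = j then 1 else 0 :: 'f::star_algebra)" "frame0 $ Inr l $ j = (0 :: 'f)"
  by (simp_all add: frame0_def stack_rows_def mat_def)

lemma block_frame0:
  fixes A :: "'f::star_algebra^'q::finite^'m::finite" and B :: "'f^'k::finite^'m"
    and C :: "'f^'q^'l::finite" and D :: "'f^'k^'l"
  shows "block A B C D ** frame0 = stack_rows A C"
proof -
  have b: "block A B C D $ i $ Inl j = stack_rows A C $ i $ j" for i j
    by (auto simp: block_def stack_rows_def split: sum.split)
  have d: "(\<Sum>j\<in>UNIV. x j * (if j = i then 1 else 0)) = (x i :: 'f)" for i :: 'q and x
  proof -
    have "(\<Sum>j\<in>UNIV. x j * (if j = i then 1 else 0)) = (\<Sum>j\<in>UNIV. if j = i then x j else 0)"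
      by (intro sum.cong) auto
    then show ?thesis by simp
  qed
  show ?thesis
    by (simp add: vec_eq_iff matrix_matrix_mult_def sum_UNIV_sum b d frame0_nth)
qed

section \<open>The indefinite form and the one-parameter groups a_t\<close>

definition Jmat :: "'f::star_algebra^('p::finite + 'q::finite)^('p + 'q)"
  where "Jmat = diag (\<chi> i. case i of Inl _ \<Rightarrow> 1 | Inr _ \<Rightarrow> -1)"

lemma Jmat_block: "Jmat = block (mat 1) 0 0 (- mat 1)"
  by (auto simp: vec_eq_iff Jmat_def diag_nth block_def mat_def split: sum.split)

lemma pq_form_Jmat: "pq_form x = inner x (Jmat *v x)"
  by (simp add: Jmat_def inner_diag_vector sum_UNIV_sum pq_form_def sum_negf)

text \<open>The isometry condition as matrix equations, recorded for g and for its adjoint so that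
  block identities of both kinds can be read off.\<close>

definition jiso :: "'f::star_algebra^('p::finite + 'q::finite)^('p + 'q) \<Rightarrow> bool"
  where "jiso g \<longleftrightarrow> mstar g ** Jmat ** g = Jmat \<and> g ** Jmat ** mstar g = Jmat"

lemma jiso_mult:
  assumes "jiso g" "jiso h" shows "jiso (g ** h)"
proof -
  have "mstar (g ** h) ** Jmat ** (g ** h) = mstar h ** (mstar g ** Jmat ** g) ** h"
    "(g ** h) ** Jmat ** mstar (g ** h) = g ** (h ** Jmat ** mstar h) ** mstar g"
    by (simp_all add: mstar_mult matrix_mul_assoc)
  then show ?thesis using assms by (simp add: jiso_def)
qed

lemma jiso_pq_isometries: "jiso g \<Longrightarrow> g \<in> pq_isometries"
  by (auto simp: pq_isometries_def pq_form_Jmat jiso_def inner_congruence[symmetric])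

lemma matrix_mult_minus_left: "(- A) ** B = - (A ** (B :: 'a::ring_1^'n^'m))"
  by (simp add: vec_eq_iff matrix_matrix_mult_def sum_negf)

lemma matrix_mult_minus_right: "A ** (- B) = - (A ** (B :: 'a::ring_1^'n^'m))"
  by (simp add: vec_eq_iff matrix_matrix_mult_def sum_negf)

lemma jiso_block_diagonal:
  assumes "A \<in> unitary_group" "D \<in> unitary_group"
  shows "jiso (block A 0 0 D)"
  using unitary_groupD[OF assms(1)] unitary_groupD[OF assms(2)]
  by (simp add: jiso_def Jmat_block mstar_block block_mult matrix_mult_minus_left matrix_mult_minus_right)

lemma jiso_block:
  fixes P :: "'f::star_algebra^'p::finite^'p" and D :: "'f^'q::finite^'q"
  assumes "jiso (block P B L D)"
  shows "mstar P ** P - mstar L ** L = mat 1" "mstar B ** P = mstar D ** L"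
    "mstar D ** D = mat 1 + mstar B ** B" "P ** mstar P - B ** mstar B = mat 1"
proof -
  have "block (mstar P ** P - mstar L ** L) (mstar P ** B - mstar L ** D)
      (mstar B ** P - mstar D ** L) (mstar B ** B - mstar D ** D) = block (mat 1) 0 0 (- mat 1)"
    using assms by (simp add: jiso_def Jmat_block mstar_block block_mult matrix_mult_minus_left matrix_mult_minus_right)
  then show "mstar P ** P - mstar L ** L = mat 1" "mstar B ** P = mstar D ** L"
    "mstar D ** D = mat 1 + mstar B ** B"
    unfolding block_eq_iff by (auto simp: algebra_simps)
  have "block (P ** mstar P - B ** mstar B) (P ** mstar L - B ** mstar D)
      (L ** mstar P - D ** mstar B) (L ** mstar L - D ** mstar D) = block (mat 1) 0 0 (- mat 1)"
    using assms by (simp add: jiso_def Jmat_block mstar_block block_mult matrix_mult_minus_left matrix_mult_minus_right)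
  then show "P ** mstar P - B ** mstar B = mat 1"
    unfolding block_eq_iff by blast
qed

lemma a_mat_block: "a_mat t = block (block (cosh_diag t) 0 0 (mat 1 :: 'f::star_algebra^'r::finite^'r)) (frame0 ** sinh_diag t)
    (sinh_diag t ** mstar frame0) (cosh_diag t :: 'f^'q::finite^'q)"
proof -
  have "(\<chi> i j. case i of Inl a \<Rightarrow> sinh_diag t $ a $ j | Inr b \<Rightarrow> 0) = (frame0 ** sinh_diag t :: 'f^'q^('q + 'r::finite))"
    by (auto simp: frame0_mult stack_rows_def vec_eq_iff split: sum.split)
  moreover have "(\<chi> i j. case j of Inl a \<Rightarrow> sinh_diag t $ i $ a | Inr b \<Rightarrow> 0)
      = (sinh_diag t ** mstar frame0 :: 'f^('q + 'r::finite)^'q)"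
  proof -
    have "sinh_diag t ** mstar frame0 = mstar (frame0 ** sinh_diag t :: 'f^'q^('q + 'r::finite))"
      by (simp add: mstar_mult sinh_diag_def)
    then show ?thesis
      by (auto simp: frame0_mult vec_eq_iff stack_rows_def sinh_diag_def diag_nth split: sum.split)
  qed
  ultimately show ?thesis by (simp add: a_mat_def)
qed

lemma sinh_diag_minus: "sinh_diag (- t) = - (sinh_diag t :: 'f::star_algebra^'q^'q)"
  by (auto simp: sinh_diag_def vec_eq_iff diag_nth)

lemma cosh_diag_minus: "cosh_diag (- t) = (cosh_diag t :: 'f::star_algebra^'q^'q)"
  by (auto simp: cosh_diag_def vec_eq_iff diag_nth)

lemma sinh_cosh_comm: "sinh_diag t ** cosh_diag t = cosh_diag t ** (sinh_diag t :: 'f::star_algebra^'q^'q)"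
  by (simp add: sinh_diag_def cosh_diag_def diag_mult_diag mult.commute)

lemma cosh_sinh_square: "cosh_diag t ** cosh_diag t = mat 1 + sinh_diag t ** (sinh_diag t :: 'f::star_algebra^'q^'q)"
  by (auto simp: sinh_diag_def cosh_diag_def diag_mult_diag vec_eq_iff diag_nth mat_def cosh_square_eq
      simp flip: power2_eq_square)

lemma mstar_sinh_cosh [simp]:
  "mstar (sinh_diag t) = (sinh_diag t :: 'f::star_algebra^'q^'q)"
  "mstar (cosh_diag t) = (cosh_diag t :: 'f::star_algebra^'q^'q)"
  by (simp_all add: sinh_diag_def cosh_diag_def)

lemma mstar_frame0_frame0: "mstar frame0 ** (frame0 ** A) = (A :: 'f::star_algebra^'n^'q::finite)"
  by (simp add: mstar_frame0_mult frame0_mult)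

lemma cosh_block_frame0:
  "block (cosh_diag t) 0 0 (mat 1 :: 'f^'r::finite^'r) ** (frame0 ** A) = frame0 ** (cosh_diag t ** (A :: 'f::star_algebra^'n^'q::finite))"
proof -
  have "block (cosh_diag t) 0 0 (mat 1 :: 'f^'r^'r) ** frame0 = frame0 ** (cosh_diag t :: 'f^'q^'q)"
    by (simp add: block_frame0 frame0_mult)
  then show ?thesis by (simp add: matrix_mul_assoc)
qed

lemma frame0_conj: "frame0 ** A ** mstar frame0 = block A 0 0 (0 :: 'f::star_algebra^'r::finite^'r)"
proof -
  have "frame0 ** A ** mstar frame0 = mstar (frame0 ** mstar (frame0 ** A))"
    by (simp add: mstar_mult)
  also have "\<dots> = block A 0 0 0"
    by (auto simp: frame0_mult vec_eq_iff stack_rows_def block_def split: sum.split)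
  finally show ?thesis .
qed

lemma a_mat_mult: "a_mat s ** a_mat t = (a_mat (s + t) :: 'f::star_algebra^(('q::finite + 'r::finite) + 'q)^(('q + 'r) + 'q))"
proof -
  have c: "cosh_diag (s + t) = cosh_diag s ** cosh_diag t + sinh_diag s ** (sinh_diag t :: 'f^'q^'q)"
    by (auto simp: sinh_diag_def cosh_diag_def diag_mult_diag vec_eq_iff diag_nth cosh_add)
  have s: "sinh_diag (s + t) = sinh_diag s ** cosh_diag t + cosh_diag s ** (sinh_diag t :: 'f^'q^'q)"
    by (auto simp: sinh_diag_def cosh_diag_def diag_mult_diag vec_eq_iff diag_nth sinh_add)
  have comm: "cosh_diag t ** sinh_diag s = sinh_diag s ** (cosh_diag t :: 'f^'q^'q)" for s t
    by (simp add: sinh_diag_def cosh_diag_def diag_mult_diag mult.commute)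
  have 1: "block (cosh_diag s) 0 0 (mat 1) ** block (cosh_diag t) 0 0 (mat 1)
      + frame0 ** sinh_diag s ** (sinh_diag t ** mstar frame0)
      = block (cosh_diag (s + t)) 0 0 (mat 1 :: 'f^'r^'r)"
  proof -
    have "frame0 ** sinh_diag s ** (sinh_diag t ** mstar frame0)
        = block (sinh_diag s ** sinh_diag t) 0 0 (0 :: 'f^'r^'r)"
      by (simp add: matrix_mul_assoc flip: frame0_conj)
    then show ?thesis
      by (auto simp: block_mult c) (auto simp: vec_eq_iff block_def split: sum.split)
  qed
  have 2: "block (cosh_diag s) 0 0 (mat 1 :: 'f^'r^'r) ** (frame0 ** sinh_diag t) + frame0 ** sinh_diag s ** cosh_diag t
      = frame0 ** sinh_diag (s + t)"
    by (simp add: cosh_block_frame0 s matrix_add_ldistrib add.commute flip: matrix_mul_assoc)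
  have 3: "sinh_diag s ** mstar frame0 ** block (cosh_diag t) 0 0 (mat 1 :: 'f^'r^'r) + cosh_diag s ** (sinh_diag t ** mstar frame0)
      = sinh_diag (s + t) ** mstar frame0"
  proof -
    have "mstar frame0 ** block (cosh_diag t) 0 0 (mat 1 :: 'f^'r^'r) = cosh_diag t ** mstar frame0"
      using arg_cong[OF cosh_block_frame0[of t "mat 1 :: 'f^'q^'q", where 'r = 'r], of mstar]
      by (simp add: mstar_mult mstar_block)
    then show ?thesis
      by (simp add: s matrix_add_rdistrib flip: matrix_mul_assoc)
  qed
  have 4: "sinh_diag s ** mstar (frame0 :: 'f^'q^('q + 'r)) ** (frame0 ** sinh_diag t) + cosh_diag s ** cosh_diag t = cosh_diag (s + t)"
    by (simp add: c mstar_frame0_frame0 add.commute flip: matrix_mul_assoc)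
  show ?thesis
    unfolding a_mat_block block_mult 1[unfolded block_mult] 2 3 4 ..
qed

lemma a_mat_0: "a_mat 0 = (mat 1 :: 'f::star_algebra^(('q::finite + 'r::finite) + 'q)^(('q + 'r) + 'q))"
proof -
  have "cosh_diag 0 = (mat 1 :: 'f^'q^'q)" "sinh_diag 0 = (0 :: 'f^'q^'q)"
    by (auto simp: vec_eq_iff cosh_diag_def sinh_diag_def diag_nth mat_def)
  then show ?thesis by (simp add: a_mat_block block_mat_1)
qed

lemma mstar_a_mat [simp]: "mstar (a_mat t) = (a_mat t :: 'f::star_algebra^(('q::finite + 'r::finite) + 'q)^(('q + 'r) + 'q))"
  by (simp add: a_mat_block mstar_block mstar_mult)

lemma Jmat_a_mat: "Jmat ** a_mat t ** Jmat = (a_mat (- t) :: 'f::star_algebra^(('q::finite + 'r::finite) + 'q)^(('q + 'r) + 'q))"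
  by (simp add: a_mat_block Jmat_block block_mult matrix_mult_minus_left matrix_mult_minus_right
      sinh_diag_minus cosh_diag_minus)

lemma Jmat_square: "Jmat ** Jmat = (mat 1 :: 'f::star_algebra^('p::finite + 'q::finite)^('p + 'q))"
  by (simp add: Jmat_block block_mult matrix_mult_minus_left matrix_mult_minus_right block_mat_1)

lemma jiso_a_mat: "jiso (a_mat t :: 'f::star_algebra^(('q::finite + 'r::finite) + 'q)^(('q + 'r) + 'q))"
proof -
  have "a_mat t ** Jmat ** a_mat t = a_mat t ** (Jmat ** a_mat t ** Jmat) ** (Jmat :: 'f^(('q + 'r) + 'q)^(('q + 'r) + 'q))"
    using Jmat_square[where 'f = 'f and 'p = "'q + 'r" and 'q = 'q] by (simp flip: matrix_mul_assoc)
  also have "\<dots> = Jmat" by (simp add: Jmat_a_mat a_mat_mult a_mat_0)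
  finally show ?thesis by (simp add: jiso_def)
qed

text \<open>Padding with zero columns makes \<open>B\<close> a square matrix with Gram matrix
  \<open>T ** T\<close>. Its polar decomposition supplies a unitary X even when some \<sigma>
  vanish.\<close>

lemma frame_extension:
  fixes B :: "'f::star_algebra^'q::finite^('q + 'r::finite)"
  assumes "mstar B ** B = diag \<sigma> ** diag \<sigma>" "\<And>i. 0 \<le> \<sigma> $ i"
  obtains X where "X \<in> unitary_group" "B = X ** frame0 ** diag \<sigma>"
proof -
  define T where "T = (frame0 :: 'f^'q^('q + 'r)) ** diag \<sigma> ** mstar (frame0 :: 'f^'q^('q + 'r))"
  have "psd T"
    using psd_congruence[OF psd_diag[OF assms(2)], of "mstar frame0"] by (simp add: T_def)
  moreover have "mstar (B ** mstar frame0) ** (B ** mstar frame0) = frame0 ** (mstar B ** B) ** mstar (frame0 :: 'f^'q^('q + 'r))"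
    by (simp add: mstar_mult matrix_mul_assoc)
  then have "mstar (B ** mstar frame0) ** (B ** mstar frame0) = T ** T"
    by (simp add: assms(1) T_def mstar_frame0_frame0 flip: matrix_mul_assoc)
  ultimately obtain X where X: "X \<in> unitary_group" "B ** mstar frame0 = X ** T"
    by (rule polar_decomposition)
  have "B = B ** mstar frame0 ** (frame0 :: 'f^'q^('q + 'r))"
    by (simp add: gram_frame0 flip: matrix_mul_assoc)
  also have "\<dots> = X ** frame0 ** diag \<sigma>"
    by (simp add: X(2) T_def gram_frame0 flip: matrix_mul_assoc)
  finally show ?thesis using that X(1) by blast
qed

text \<open>Since B* B = D* D - 1 = V* sinh^2(\<tau>) V, the matrix B V* has a known Gram matrix and
  \<open>frame_extension\<close> yields X. Removing X, U, V and a_\<tau> from g leaves an isometry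
  whose right column of blocks is (0, 1), hence a block-diagonal one. The singular value
  decomposition is an input so that determinants of U and V can be adjusted beforehand.\<close>

theorem cartan_decomposition:
  fixes g :: "'f::star_algebra^(('q::finite + 'r::finite) + 'q)^(('q + 'r) + 'q)"
  assumes "jiso g" "U \<in> unitary_group" "V \<in> unitary_group" "lr_block g = U ** cosh_diag \<tau> ** V" "\<And>i. 0 \<le> \<tau> $ i"
  obtains X Y where "X \<in> unitary_group" "Y \<in> unitary_group"
    "g = block X 0 0 U ** a_mat \<tau> ** block Y 0 0 V"
proof -
  define D where "D = lr_block g"
  define B where "B = ur_block g"
  have g: "g = block (ul_block g) B (ll_block g) D" by (simp add: B_def D_def)
  have D: "D = U ** cosh_diag \<tau> ** V" using assms(4) by (simp add: D_def)
  have BB: "mstar B ** B = mstar D ** D - mat 1"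
  proof -
    have "jiso (block (ul_block g) B (ll_block g) D)"
      using assms(1) by (simp add: B_def D_def)
    from jiso_block(3)[OF this] show ?thesis by simp
  qed
  have DD: "mstar D ** D = mstar V ** (cosh_diag \<tau> ** cosh_diag \<tau>) ** V"
    by (simp add: D mstar_mult matrix_mul_assoc unitary_cancel(1)[OF assms(2)])
  have "mstar (B ** mstar V) ** (B ** mstar V) = V ** (mstar B ** B) ** mstar V"
    by (simp add: mstar_mult matrix_mul_assoc)
  also have "\<dots> = (V ** mstar V) ** (cosh_diag \<tau> ** cosh_diag \<tau>) ** (V ** mstar V) - V ** mstar V"
    by (simp add: BB DD matrix_diff_ldistrib matrix_diff_rdistrib matrix_mul_assoc)
  also have "\<dots> = sinh_diag \<tau> ** sinh_diag \<tau>"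
    by (simp add: unitary_groupD[OF assms(3)] cosh_sinh_square)
  finally have "mstar (B ** mstar V) ** (B ** mstar V) = diag (\<chi> i. sinh (\<tau> $ i)) ** diag (\<chi> i. sinh (\<tau> $ i))"
    by (simp add: sinh_diag_def)
  moreover have "0 \<le> (\<chi> i. sinh (\<tau> $ i)) $ i" for i using assms(5) by simp
  ultimately obtain X where X: "X \<in> unitary_group" "B ** mstar V = X ** frame0 ** sinh_diag \<tau>"
    using frame_extension unfolding sinh_diag_def by blast
  define h where "h = block (mstar X) 0 0 (mstar U) ** g ** block (mat 1) 0 0 (mstar V)"
  define h2 where "h2 = a_mat (- \<tau>) ** h"
  have h: "h = block (mstar X ** ul_block g) (frame0 ** sinh_diag \<tau>) (mstar U ** ll_block g) (cosh_diag \<tau>)"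
  proof -
    have "mstar X ** B ** mstar V = frame0 ** sinh_diag \<tau>"
      using X by (simp add: unitary_cancel(3)[OF X(1)] flip: matrix_mul_assoc)
    moreover have "mstar U ** D ** mstar V = cosh_diag \<tau>"
      by (simp add: D matrix_mul_assoc unitary_groupD[OF assms(2)] unitary_cancel(2)[OF assms(3)])
    ultimately show ?thesis
      by (subst h_def, subst g) (simp add: block_mult)
  qed
  have "jiso h2"
    unfolding h2_def h_def
    using X(1) assms(1-3) by (intro jiso_mult jiso_a_mat jiso_block_diagonal unitary_mstar unitary_mat_1)
  define Y where "Y = ul_block h2"
  have "ur_block h2 = 0"
    by (simp add: h2_def h a_mat_block block_mult cosh_block_frame0 cosh_diag_minus sinh_diag_minus
        matrix_mult_minus_left matrix_mult_minus_right sinh_cosh_comm flip: matrix_mul_assoc)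
  moreover have "lr_block h2 = mat 1"
    by (simp add: h2_def h a_mat_block block_mult cosh_diag_minus sinh_diag_minus mstar_frame0_frame0
        matrix_mult_minus_left matrix_mult_minus_right cosh_sinh_square flip: matrix_mul_assoc)
  ultimately have h2: "h2 = block Y 0 (ll_block h2) (mat 1)"
    using block_simps(5)[of h2] by (simp add: Y_def)
  have "jiso (block Y 0 (ll_block h2) (mat 1))"
    using \<open>jiso h2\<close> unfolding h2[symmetric] .
  note J = jiso_block[OF this]
  have ll: "ll_block h2 = 0" using J(2) by simp
  have "h2 = block Y 0 0 (mat 1)" using h2 unfolding ll .
  moreover have "mstar Y ** Y = mat 1" using J(1) by (simp add: ll)
  moreover have "Y ** mstar Y = mat 1" using J(4) by simp
  ultimately have Y: "Y \<in> unitary_group" "h2 = block Y 0 0 (mat 1)" by (auto simp: unitary_group_def)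
  have "a_mat \<tau> ** h2 = h"
    by (simp add: h2_def matrix_mul_assoc a_mat_mult a_mat_0)
  then have "h = a_mat \<tau> ** block Y 0 0 (mat 1)" by (simp add: Y(2))
  moreover have "block X 0 0 U ** h ** block (mat 1) 0 0 V
      = (block X 0 0 U ** block (mstar X) 0 0 (mstar U)) ** g ** (block (mat 1) 0 0 (mstar V) ** block (mat 1) 0 0 V)"
    by (simp add: h_def matrix_mul_assoc)
  then have "block X 0 0 U ** h ** block (mat 1) 0 0 V = g"
    using X(1) assms(2,3) by (simp add: block_mult unitary_groupD block_mat_1)
  ultimately have "g = block X 0 0 U ** (a_mat \<tau> ** block Y 0 0 (mat 1)) ** block (mat 1) 0 0 V"
    by simp
  also have "\<dots> = block X 0 0 U ** a_mat \<tau> ** (block Y 0 0 (mat 1) ** block (mat 1) 0 0 V)"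
    by (simp add: matrix_mul_assoc)
  also have "block Y 0 0 (mat 1) ** block (mat 1) 0 0 V = block Y 0 0 V"
    by (simp add: block_mult)
  finally show ?thesis using that X(1) Y(1) by blast
qed

lemma corner_block: "corner (block A 0 0 D) = mstar frame0 ** A ** (frame0 :: 'f::star_algebra^'q::finite^('q + 'r::finite))"
  by (simp add: corner_def mstar_frame0_mult top_rows_mult)

lemma lr_block_a_mat:
  fixes A :: "'f::star_algebra^('q::finite + 'r::finite)^('q + 'r)"
  shows "lr_block (a_mat t ** block A 0 0 D ** a_mat s)
    = sinh_diag t ** corner (block A 0 0 D) ** sinh_diag s + cosh_diag t ** D ** cosh_diag s"
  by (simp add: a_mat_block block_mult corner_block matrix_mul_assoc)

text \<open>For an isometry D* D = 1 + B* B. All singular values of the lower right block are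
  therefore at least 1, where \<open>arcosh\<close> inverts \<open>cosh\<close>.\<close>

lemma lr_block_expanding:
  assumes "jiso (g :: 'f::star_algebra^('p::finite + 'q::finite)^('p + 'q))"
  shows "norm x \<le> norm (lr_block g *v x)"
proof -
  have "jiso (block (ul_block g) (ur_block g) (ll_block g) (lr_block g))" using assms by simp
  from jiso_block(3)[OF this] have "inner x ((mstar (lr_block g) ** lr_block g) *v x)
      = inner x x + inner x ((mstar (ur_block g) ** ur_block g) *v x)"
    by (simp add: matrix_vector_mult_add_rdistrib inner_add_right)
  then have "(norm x)\<^sup>2 \<le> (norm (lr_block g *v x))\<^sup>2"
    unfolding inner_gram by (simp add: dot_square_norm)
  then show ?thesis by (rule power2_le_imp_le) simp
qed

lemma spec_s_ge_1:
  fixes M :: "'f::star_algebra^'q::{finite,linorder}^'q::{finite,linorder}"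
  assumes "\<And>x. norm x \<le> norm (M *v x)"
  shows "1 \<le> spec_s M $ i"
proof -
  obtain U V where UV: "U \<in> unitary_group" "V \<in> unitary_group" "M = U ** diag (spec_s M) ** V" "spec_s M \<in> chamber"
    by (rule spec_s_svd[of M])
  define s where "s = spec_s M"
  define x where "x = mstar V *v axis i (1 :: 'f)"
  have Vx: "V *v x = axis i 1" by (simp add: x_def matrix_vector_mul_assoc unitary_groupD[OF UV(2)])
  have M: "M = U ** diag s ** V" using UV(3) by (simp add: s_def)
  have "M *v x = U *v (diag s *v (V *v x))" by (simp add: M matrix_vector_mul_assoc matrix_mul_assoc)
  also have "diag s *v (V *v x) = axis i (of_real (s $ i))"
    by (auto simp: Vx vec_eq_iff axis_def)
  finally have "norm (M *v x) = \<bar>s $ i\<bar>" using UV(1) by (simp add: norm_unitary_vector norm_axis)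
  moreover have "norm x = 1"
    using norm_unitary_vector[OF UV(2), of x] by (simp add: Vx norm_axis)
  moreover have "0 \<le> s $ i" using UV(4) by (simp add: chamber_def s_def)
  ultimately show ?thesis using assms[of x] by (simp add: s_def)
qed

lemma spec_s_cosh:
  fixes M :: "'f::star_algebra^'q::{finite,linorder}^'q::{finite,linorder}"
  assumes "\<And>x. norm x \<le> norm (M *v x)"
  obtains U V where "U \<in> unitary_group" "V \<in> unitary_group"
    "M = U ** cosh_diag (arcosh_vec (spec_s M)) ** V" "\<And>i. 0 \<le> arcosh_vec (spec_s M) $ i"
proof -
  obtain U V where UV: "U \<in> unitary_group" "V \<in> unitary_group" "M = U ** diag (spec_s M) ** V" "spec_s M \<in> chamber"
    by (rule spec_s_svd[of M])
  have s: "1 \<le> spec_s M $ i" for i using assms by (rule spec_s_ge_1)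
  then have "(cosh_diag (arcosh_vec (spec_s M)) :: (('f, 'q) vec, 'q) vec) = diag (spec_s M)"
    by (simp add: cosh_diag_def arcosh_vec_def)
  then show ?thesis using that[of U V] UV s by (simp add: arcosh_vec_def)
qed

section \<open>The product formula for a block-diagonal group\<close>

lemma continuous_on_block [continuous_intros]:
  assumes "continuous_on S A" "continuous_on S B" "continuous_on S C" "continuous_on S D"
  shows "continuous_on S (\<lambda>x. block (A x) (B x) (C x) (D x :: 'a::topological_space^'k::finite^'l::finite) :: 'a^('n::finite + 'k)^('m::finite + 'l))"
  unfolding block_def
proof (intro continuous_on_vec_lambda)
  fix i :: "'m + 'l" and j :: "'n + 'k"
  show "continuous_on S (\<lambda>x. case i of
      Inl a \<Rightarrow> (case j of Inl b \<Rightarrow> A x $ a $ b | Inr b \<Rightarrow> B x $ a $ b)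
    | Inr a \<Rightarrow> (case j of Inl b \<Rightarrow> C x $ a $ b | Inr b \<Rightarrow> D x $ a $ b))"
    using assms by (cases i; cases j) (auto intro!: continuous_on_component)
qed

lemma continuous_on_a_mat [continuous_intros]:
  assumes "continuous_on S f"
  shows "continuous_on S (\<lambda>x. a_mat (f x) :: 'f::star_algebra^(('q::finite + 'r::finite) + 'q)^(('q + 'r) + 'q))"
  unfolding a_mat_block sinh_diag_def cosh_diag_def
  by (intro continuous_intros continuous_on_vec_lambda continuous_on_component assms)

lemma norm_vec_square: "(norm X)\<^sup>2 = (\<Sum>i\<in>UNIV. (norm (X $ i :: 'a::real_inner))\<^sup>2)"
  by (simp add: power2_norm_eq_inner inner_vec_def)

lemma norm_stack_rows: "(norm (stack_rows A B :: 'f::star_algebra^'n^('m::finite + 'k::finite)))\<^sup>2 = (norm A)\<^sup>2 + (norm B)\<^sup>2"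
  unfolding norm_vec_square[of "stack_rows A B"] norm_vec_square[of A] norm_vec_square[of B] sum_UNIV_sum
  by (simp add: stack_rows_def)

lemma norm_top_rows_le: "norm (top_rows A) \<le> norm (A :: 'f::star_algebra^'n^('m::finite + 'k::finite))"
proof -
  have "(norm (top_rows A))\<^sup>2 \<le> (norm A)\<^sup>2"
    using norm_stack_rows[of "top_rows A" "bottom_rows A"] by simp
  then show ?thesis by (rule power2_le_imp_le) simp
qed

context block_group
begin

text \<open>The constant \<kappa> at p d / 2 as a real integral.\<close>

definition ball_mass :: real
  where "ball_mass = (LINT w|(lborel :: (('f, 'q) vec, 'q) vec measure). ball_density expo w)"

lemma ball_density_nonneg: "0 \<le> ball_density expo w"
  by (simp add: ball_density_def)

lemma ball_mass: "integrable lborel (ball_density expo :: (('f, 'q) vec, 'q) vec \<Rightarrow> real)" "0 < ball_mass"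
  "(\<integral>\<^sup>+w. ennreal (ball_density expo w) \<partial>(lborel :: (('f, 'q) vec, 'q) vec measure)) = ennreal ball_mass"
proof -
  show int: "integrable lborel (ball_density expo :: (('f, 'q) vec, 'q) vec \<Rightarrow> real)"
    using ball_density_integral(2) by (intro integrableI_nonneg) (auto simp: ball_density_nonneg)
  show eq: "(\<integral>\<^sup>+w. ennreal (ball_density expo w) \<partial>(lborel :: (('f, 'q) vec, 'q) vec measure)) = ennreal ball_mass"
    unfolding ball_mass_def by (rule nn_integral_eq_integral[OF int]) (simp add: ball_density_nonneg)
  show "0 < ball_mass"
    using ball_density_integral(1) unfolding eq by simp
qed

text \<open>Passes from nonnegative to complex integrands: the nonnegative case identifies the
  push-forward of \<open>dk\<close> with a density on the product space, and boundedness against a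
  finite measure gives the integrability needed for Fubini.\<close>

lemma block_lebesgue_integral:
  fixes \<Phi> :: "(('f, 'q) vec, 'q) vec \<times> (('f, 'q) vec, 'q) vec \<Rightarrow> complex"
  assumes [measurable]: "\<Phi> \<in> borel_measurable borel" and bound: "\<And>z. norm (\<Phi> z) \<le> B"
  shows "ball_mass *\<^sub>R (LINT k|dk. \<Phi> (corner k, lr_block k)) = (LINT w|lborel. LINT v|dv. ball_density expo w *\<^sub>R \<Phi> (w, v))"
proof -
  let ?L = "lborel :: (('f, 'q) vec, 'q) vec measure"
  interpret P: pair_sigma_finite ?L dv ..
  define g :: "(('f, ('q + 'r) + 'q) vec, ('q + 'r) + 'q) vec \<Rightarrow> _" where "g = (\<lambda>k. (corner k, lr_block k))"
  \<comment> \<open>The identity, as a map from the product with \<open>dv\<close>, whose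
    sigma-algebra lives on \<open>unitary_group0\<close>, to the Borel sets.\<close>
  define \<iota> :: "(('f, 'q) vec, 'q) vec \<times> (('f, 'q) vec, 'q) vec \<Rightarrow> _" where "\<iota> = (\<lambda>x. (fst x, snd x))"
  define \<rho> where "\<rho> x = ball_density expo (fst x) / ball_mass" for x :: "(('f, 'q) vec, 'q) vec \<times> (('f, 'q) vec, 'q) vec"
  have g [measurable]: "g \<in> measurable dk borel"
    unfolding g_def by (rule K.measurable_M) measurable
  have [measurable]: "snd \<in> borel_measurable (?L \<Otimes>\<^sub>M dv)"
    by (rule V.measurable_into_borel[OF measurable_snd])
  have [measurable]: "fst \<in> borel_measurable (?L \<Otimes>\<^sub>M dv)"
    using measurable_fst[of ?L dv] by simp
  have \<iota> [measurable]: "\<iota> \<in> measurable (?L \<Otimes>\<^sub>M dv) borel"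
    unfolding \<iota>_def by (intro borel_measurable_Pair) measurable
  have \<rho> [measurable]: "\<rho> \<in> borel_measurable (?L \<Otimes>\<^sub>M dv)"
    unfolding \<rho>_def by measurable
  have \<rho>_nonneg: "0 \<le> \<rho> x" for x
    using ball_mass(2) by (simp add: \<rho>_def ball_density_nonneg)
  define N where "N = distr (density (?L \<Otimes>\<^sub>M dv) (\<lambda>x. ennreal (\<rho> x))) borel \<iota>"
  have eq: "distr dk borel g = N"
  proof (rule measure_eqI)
    fix A assume "A \<in> sets (distr dk borel g)"
    then have A [measurable]: "A \<in> sets borel" by simp
    have A_pair [measurable]: "(\<lambda>x. indicator A (fst x, snd x)) \<in> borel_measurable (?L \<Otimes>\<^sub>M dv)"
      using measurable_compose[OF \<iota> borel_measurable_indicator[OF A]] by (simp add: \<iota>_def)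
    have m: "(\<lambda>x. indicator A (fst x, snd x) * ennreal (ball_density expo (fst x))) \<in> borel_measurable (?L \<Otimes>\<^sub>M dv)"
      by measurable
    have "emeasure N A = (\<integral>\<^sup>+x. indicator A x \<partial>N)"
      by (simp add: N_def)
    also have "\<dots> = (\<integral>\<^sup>+x. indicator A (\<iota> x) \<partial>density (?L \<Otimes>\<^sub>M dv) (\<lambda>x. ennreal (\<rho> x)))"
      unfolding N_def by (rule nn_integral_distr) measurable
    also have "\<dots> = (\<integral>\<^sup>+x. ennreal (\<rho> x) * indicator A (\<iota> x) \<partial>(?L \<Otimes>\<^sub>M dv))"
      by (rule nn_integral_density) measurable
    also have "\<dots> = (\<integral>\<^sup>+x. ennreal (1 / ball_mass) * (indicator A (fst x, snd x) * ennreal (ball_density expo (fst x))) \<partial>(?L \<Otimes>\<^sub>M dv))"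
      using ball_mass(2) by (intro nn_integral_cong) (simp add: \<rho>_def \<iota>_def ennreal_mult'[symmetric] mult_ac flip: divide_inverse_commute)
    also have "\<dots> = ennreal (1 / ball_mass) * (\<integral>\<^sup>+x. indicator A (fst x, snd x) * ennreal (ball_density expo (fst x)) \<partial>(?L \<Otimes>\<^sub>M dv))"
      by (rule nn_integral_cmult) measurable
    also have "(\<integral>\<^sup>+x. indicator A (fst x, snd x) * ennreal (ball_density expo (fst x)) \<partial>(?L \<Otimes>\<^sub>M dv))
        = (\<integral>\<^sup>+v. \<integral>\<^sup>+w. indicator A (w, v) * ennreal (ball_density expo w) \<partial>?L \<partial>dv)"
      by (subst P.nn_integral_snd[OF m, symmetric]) simp
    also have "\<dots> = ennreal ball_mass * (\<integral>\<^sup>+k. indicator A (corner k, lr_block k) \<partial>dk)"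
      using block_integral[of "\<lambda>w v. indicator A (w, v)"] A by (simp add: ball_mass(3) case_prod_unfold)
    also have "ennreal (1 / ball_mass) * (ennreal ball_mass * (\<integral>\<^sup>+k. indicator A (corner k, lr_block k) \<partial>dk))
        = (\<integral>\<^sup>+k. indicator A (corner k, lr_block k) \<partial>dk)"
      using ball_mass(2) by (simp flip: mult.assoc ennreal_mult')
    also have "\<dots> = (\<integral>\<^sup>+x. indicator A x \<partial>distr dk borel g)"
      using A by (subst nn_integral_distr[OF g]) (simp_all add: g_def)
    also have "\<dots> = emeasure (distr dk borel g) A" by simp
    finally show "emeasure (distr dk borel g) A = emeasure N A" ..
  qed (simp add: N_def)
  have \<Phi>_pair [measurable]: "(\<lambda>x. \<Phi> (\<iota> x)) \<in> borel_measurable (?L \<Otimes>\<^sub>M dv)" by measurable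
  have "finite_measure (distr dk borel g)"
    by (rule K.finite_measure_distr) measurable
  then have "integrable N \<Phi>"
    unfolding eq[symmetric] using bound by (intro finite_measure.integrable_const_bound[of _ _ B]) auto
  then have int: "integrable (?L \<Otimes>\<^sub>M dv) (\<lambda>x. \<rho> x *\<^sub>R \<Phi> (\<iota> x))"
    unfolding N_def using integrable_distr_eq[of \<iota> "density (?L \<Otimes>\<^sub>M dv) (\<lambda>x. ennreal (\<rho> x))" borel \<Phi>]
      integrable_density[OF \<Phi>_pair \<rho>] \<iota> assms(1) by (simp add: \<rho>_nonneg)
  have "(LINT k|dk. \<Phi> (corner k, lr_block k)) = (LINT x|distr dk borel g. \<Phi> x)"
    using assms(1) by (subst integral_distr[OF g]) (simp_all add: g_def)
  also have "\<dots> = (LINT x|density (?L \<Otimes>\<^sub>M dv) (\<lambda>x. ennreal (\<rho> x)). \<Phi> (\<iota> x))"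
    unfolding eq N_def by (rule integral_distr) measurable
  also have "\<dots> = (LINT x|(?L \<Otimes>\<^sub>M dv). \<rho> x *\<^sub>R \<Phi> (\<iota> x))"
    by (rule integral_density[OF \<Phi>_pair \<rho>]) (simp add: \<rho>_nonneg)
  also have "\<dots> = (LINT w|lborel. LINT v|dv. \<rho> (w, v) *\<^sub>R \<Phi> (\<iota> (w, v)))"
    by (rule P.integral_fst'[OF int, symmetric])
  also have "\<dots> = (LINT w|lborel. LINT v|dv. (1 / ball_mass) *\<^sub>R (ball_density expo w *\<^sub>R \<Phi> (w, v)))"
    by (simp add: \<rho>_def \<iota>_def)
  also have "\<dots> = (1 / ball_mass) *\<^sub>R (LINT w|lborel. LINT v|dv. ball_density expo w *\<^sub>R \<Phi> (w, v))"
    by (simp only: integral_scaleR_right)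
  finally show ?thesis using ball_mass(2) by simp
qed

text \<open>Complete w to an orthonormal frame with the lower block E R, where R* R = 1 - w* w and E
  embeds the q-dimensional space isometrically into the r-dimensional one. So every point of the
  integration domain comes from an element of \<open>K\<close>.\<close>

lemma corner_exists:
  fixes w v :: "(('f, 'q) vec, 'q) vec"
  assumes "w \<in> B_ball" "v \<in> unitary_group0"
  obtains k where "k \<in> K" "corner k = w" "lr_block k = v"
proof -
  have "pos_definite (mat 1 - mstar w ** w)" using assms(1) by (simp add: B_ball_def)
  then obtain R :: "(('f, 'q) vec, 'q) vec" where R: "mat 1 - mstar w ** w = mstar R ** R"
    by (rule pos_definite_sqrt)
  obtain \<iota> :: "'q \<Rightarrow> 'r" where \<iota>: "inj \<iota>"
    using card card_le_inj[of "UNIV :: 'q set" "UNIV :: 'r set"] by auto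
  define E :: "('f, 'q) vec^'r" where "E = (\<chi> i j. if i = \<iota> j then 1 else 0)"
  have "mstar E ** E = mat 1"
  proof -
    have "(\<Sum>k\<in>UNIV. fconj (E $ k $ i) * E $ k $ j) = (\<Sum>k\<in>UNIV. if k = \<iota> i then (if i = j then 1 else 0) else 0)" for i j
      using \<iota> by (intro sum.cong) (auto simp: E_def inj_def)
    then show ?thesis by (simp add: vec_eq_iff matrix_matrix_mult_def mat_def)
  qed
  then have "mstar (E ** R) ** (E ** R) = mstar R ** R"
    by (simp add: mstar_mult) (simp add: matrix_mul_assoc[of "mstar E"] flip: matrix_mul_assoc[of "mstar R"])
  then have "mstar (stack_rows w (E ** R)) ** stack_rows w (E ** R) = mat 1"
    unfolding gram_stack_rows R[symmetric] by simp
  then obtain A where "block A 0 0 v \<in> K" "A ** frame0 = stack_rows w (E ** R)"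
    using transitive assms(2) by blast
  then show ?thesis using that[of "block A 0 0 v"] by (simp add: corner_def)
qed

text \<open>The hypotheses isolate what depends on the field: the values of \<Delta> on the cone,
  a_\<tau> in \<open>G\<close>, and Cartan factors in \<open>K\<close>. The rest is the functional
  equation at a_t and a_s, rewritten by the joint law of \<open>corner\<close> and
  \<open>lr_block\<close>.\<close>

theorem product_formula:
  fixes \<phi> :: "(('f, ('q + 'r) + 'q) vec, ('q + 'r) + 'q) vec \<Rightarrow> complex" and \<Delta> :: "(('f, 'q) vec, 'q) vec \<Rightarrow> complex"
    and t s :: "(real, 'q) vec" and \<mu> :: real
  assumes \<Delta>: "\<And>x. pos_definite x \<Longrightarrow> \<Delta> x = of_real (adet x)"
    and spherical: "spherical_function G K dk \<phi>"
    and a_G: "\<And>\<tau>. a_mat \<tau> \<in> G"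
    and cartan: "\<And>k. k \<in> K \<Longrightarrow> \<exists>k1\<in>K. \<exists>k2\<in>K. a_mat t ** k ** a_mat s
      = k1 ** a_mat (arcosh_vec (spec_s (lr_block (a_mat t ** k ** a_mat s)))) ** k2"
    and \<mu>: "\<mu> - gam DIM('f) CARD('q) = expo"
  shows "\<phi> (a_mat t) * \<phi> (a_mat s) = 1 / kappa \<Delta> (of_real \<mu>) *
    (LINT w:B_ball|lborel. LINT v|dv.
      \<phi> (a_mat (arcosh_vec (spec_s (sinh_diag t ** w ** sinh_diag s + cosh_diag t ** v ** cosh_diag s)))) *
      \<Delta> (mat 1 - mstar w ** w) powr of_real (\<mu> - gam DIM('f) CARD('q)))"
proof -
  define L :: "(('f, 'q) vec, 'q) vec \<times> (('f, 'q) vec, 'q) vec \<Rightarrow> (('f, 'q) vec, 'q) vec"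
    where "L z = sinh_diag t ** fst z ** sinh_diag s + cosh_diag t ** snd z ** cosh_diag s" for z
  define R where "R = norm (frame0 :: ('f, 'q) vec^('q + 'r))"
  \<comment> \<open>\<open>\<phi>\<close> is given as continuous on \<open>G\<close> only, and
    \<open>arcosh\<close> is continuous on [1, infinity). The integrand is cut off to a compact set
    containing all pairs of blocks from \<open>K\<close>; there it is continuous, hence bounded, and
    its extension by 0 is Borel.\<close>
  define Dom where "Dom = (cball 0 R \<times> unitary_group0) \<inter> {z. \<forall>i. 1 \<le> spec_s (L z) $ i}"
  define \<psi> where "\<psi> z = \<phi> (a_mat (arcosh_vec (spec_s (L z))))" for z
  define \<Phi> where "\<Phi> z = (if z \<in> Dom then \<psi> z else 0)" for z
  have contL: "continuous_on S L" for S
    unfolding L_def by (intro continuous_intros)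
  have cont_spec: "continuous_on S (\<lambda>z. spec_s (L z) $ i)" for S i
    by (intro continuous_on_component continuous_on_compose2[OF continuous_spec_s contL]) auto
  have compact: "compact Dom"
    unfolding Dom_def
    by (intro compact_Int_closed compact_Times compact_cball compact_unitary_group0 closed_Collect_all
        closed_Collect_le continuous_intros cont_spec)
  have cont: "continuous_on Dom \<psi>"
  proof -
    have 1: "continuous_on G \<phi>" using spherical by (simp add: spherical_function_def)
    have 2: "continuous_on Dom (\<lambda>z. a_mat (arcosh_vec (spec_s (L z))) :: (('f, ('q + 'r) + 'q) vec, ('q + 'r) + 'q) vec)"
      unfolding arcosh_vec_def
      by (intro continuous_on_a_mat continuous_on_vec_lambda, rule continuous_on_compose2[OF continuous_on_arcosh[OF order.refl] cont_spec])
        (auto simp: Dom_def)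
    show ?thesis
      unfolding \<psi>_def by (rule continuous_on_compose2[OF 1 2]) (use a_G in auto)
  qed
  have \<Phi>_measurable: "\<Phi> \<in> borel_measurable borel"
    unfolding \<Phi>_def using compact cont
    by (intro borel_measurable_continuous_on_if borel_compact continuous_on_const)
  obtain B where B: "\<And>z. z \<in> Dom \<Longrightarrow> norm (\<psi> z) \<le> B"
    using compact_imp_bounded[OF compact_continuous_image[OF cont compact]] by (auto simp: bounded_iff)
  have \<Phi>_bound: "norm (\<Phi> z) \<le> max B 0" for z
    using B[of z] by (auto simp: \<Phi>_def)
  have Dom_K: "(corner k, lr_block k) \<in> Dom" "L (corner k, lr_block k) = lr_block (a_mat t ** k ** a_mat s)" if k: "k \<in> K" for k
  proof -
    obtain A D where AD: "A \<in> unitary_group" "D \<in> unitary_group0" "k = block A 0 0 D"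
      using block k by blast
    show eq: "L (corner k, lr_block k) = lr_block (a_mat t ** k ** a_mat s)"
      by (simp add: AD(3) L_def lr_block_a_mat)
    have "jiso (a_mat t ** k ** a_mat s)"
      using AD unitary_group0_subset by (auto simp: AD(3) intro!: jiso_mult jiso_a_mat jiso_block_diagonal)
    then have "1 \<le> spec_s (L (corner k, lr_block k)) $ i" for i
      unfolding eq by (intro spec_s_ge_1 lr_block_expanding)
    moreover have "norm (corner k) \<le> R"
      using norm_top_rows_le[of "A ** frame0"] AD(1) by (simp add: AD(3) corner_def R_def norm_unitary_mult_left)
    ultimately show "(corner k, lr_block k) \<in> Dom" using AD by (simp add: Dom_def)
  qed
  have "\<phi> (a_mat t) * \<phi> (a_mat s) = (LINT k|dk. \<phi> (a_mat t ** k ** a_mat s))"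
    using spherical a_G by (simp add: spherical_function_def)
  also have "\<dots> = (LINT k|dk. \<Phi> (corner k, lr_block k))"
  proof (rule Bochner_Integration.integral_cong[OF refl])
    fix k assume "k \<in> space dk"
    then have k: "k \<in> K" by (simp add: K.space_M)
    obtain k1 k2 where k12: "k1 \<in> K" "k2 \<in> K" "a_mat t ** k ** a_mat s
      = k1 ** a_mat (arcosh_vec (spec_s (lr_block (a_mat t ** k ** a_mat s)))) ** k2"
      using cartan[OF k] by blast
    have "\<phi> (a_mat t ** k ** a_mat s) = \<phi> (k1 ** a_mat (arcosh_vec (spec_s (lr_block (a_mat t ** k ** a_mat s)))) ** k2)"
      by (rule arg_cong[OF k12(3)])
    also have "\<dots> = \<phi> (a_mat (arcosh_vec (spec_s (lr_block (a_mat t ** k ** a_mat s)))))"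
      using spherical a_G k12(1,2) by (simp add: spherical_function_def)
    finally show "\<phi> (a_mat t ** k ** a_mat s) = \<Phi> (corner k, lr_block k)"
      using Dom_K[OF k] by (simp add: \<Phi>_def \<psi>_def)
  qed
  finally have lhs: "ball_mass *\<^sub>R (\<phi> (a_mat t) * \<phi> (a_mat s))
      = (LINT w|lborel. LINT v|dv. ball_density expo w *\<^sub>R \<Phi> (w, v))"
    using block_lebesgue_integral[OF \<Phi>_measurable \<Phi>_bound] by simp
  have powr: "\<Delta> (mat 1 - mstar w ** w) powr of_real expo = of_real (ball_density expo w)" if "w \<in> B_ball" for w
    using that \<Delta>[of "mat 1 - mstar w ** w"] by (simp add: B_ball_def ball_density_def powr_of_real)
  have "kappa \<Delta> (of_real \<mu>) = (LINT w|(lborel :: (('f, 'q) vec, 'q) vec measure). complex_of_real (ball_density expo w))"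
    unfolding kappa_def set_lebesgue_integral_def
  proof (rule Bochner_Integration.integral_cong[OF refl])
    fix w :: "(('f, 'q) vec, 'q) vec"
    have "of_real \<mu> - of_real (gam DIM('f) CARD('q)) = complex_of_real expo"
      by (simp flip: \<mu>)
    then show "indicat_real B_ball w *\<^sub>R \<Delta> (mat 1 - mstar w ** w) powr (of_real \<mu> - of_real (gam DIM('f) CARD('q)))
        = complex_of_real (ball_density expo w)"
      using powr[of w] by (cases "w \<in> B_ball") (auto simp: ball_density_def)
  qed
  also have "\<dots> = of_real ball_mass"
    by (simp add: ball_mass_def)
  finally have kappa: "kappa \<Delta> (of_real \<mu>) = of_real ball_mass" .
  have "(LINT w|lborel. LINT v|dv. ball_density expo w *\<^sub>R \<Phi> (w, v))
    = (LINT w:B_ball|lborel. LINT v|dv.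
      \<phi> (a_mat (arcosh_vec (spec_s (sinh_diag t ** w ** sinh_diag s + cosh_diag t ** v ** cosh_diag s)))) *
      \<Delta> (mat 1 - mstar w ** w) powr of_real (\<mu> - gam DIM('f) CARD('q)))"
    unfolding set_lebesgue_integral_def
  proof (rule Bochner_Integration.integral_cong[OF refl])
    fix w :: "(('f, 'q) vec, 'q) vec"
    show "(LINT v|dv. ball_density expo w *\<^sub>R \<Phi> (w, v)) = indicat_real B_ball w *\<^sub>R (LINT v|dv.
      \<phi> (a_mat (arcosh_vec (spec_s (sinh_diag t ** w ** sinh_diag s + cosh_diag t ** v ** cosh_diag s)))) *
      \<Delta> (mat 1 - mstar w ** w) powr of_real (\<mu> - gam DIM('f) CARD('q)))"
    proof (cases "w \<in> B_ball")
      case True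
      have "(LINT v|dv. ball_density expo w *\<^sub>R \<Phi> (w, v)) = (LINT v|dv.
        \<phi> (a_mat (arcosh_vec (spec_s (sinh_diag t ** w ** sinh_diag s + cosh_diag t ** v ** cosh_diag s)))) *
        \<Delta> (mat 1 - mstar w ** w) powr of_real (\<mu> - gam DIM('f) CARD('q)))"
      proof (rule Bochner_Integration.integral_cong[OF refl])
        fix v assume "v \<in> space dv"
        then have "v \<in> unitary_group0" by (simp add: V.space_M)
        then obtain k where "k \<in> K" "corner k = w" "lr_block k = v"
          using corner_exists True by blast
        then have "(w, v) \<in> Dom" using Dom_K(1) by blast
        then show "ball_density expo w *\<^sub>R \<Phi> (w, v) =
          \<phi> (a_mat (arcosh_vec (spec_s (sinh_diag t ** w ** sinh_diag s + cosh_diag t ** v ** cosh_diag s)))) *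
          \<Delta> (mat 1 - mstar w ** w) powr of_real (\<mu> - gam DIM('f) CARD('q))"
          unfolding \<mu> powr[OF True] by (simp add: \<Phi>_def \<psi>_def L_def scaleR_conv_of_real mult.commute)
      qed
      then show ?thesis using True by simp
    qed (simp add: ball_density_def)
  qed
  then show ?thesis
    using lhs ball_mass(2) by (simp add: kappa scaleR_conv_of_real field_simps)
qed

end

section \<open>Determinants of unitary matrices\<close>

lemma det_phase: "det (phase i u :: 'f::{star_algebra,real_normed_field}^'n^'n) = u"
proof -
  have nth: "phase i u $ k $ l = (if k = l then (if k = i then u else 1) else 0)" for k l
    by (auto simp: phase_def mat_def axis_def)
  have "det (phase i u) = (\<Prod>k\<in>UNIV. phase i u $ k $ k)"
    by (rule det_diagonal) (simp add: nth)
  then show ?thesis by (simp add: nth)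
qed

lemma givens_add:
  fixes u :: "'f::{star_algebra,real_normed_field}"
  assumes "i \<noteq> j" "norm u = 1"
  shows "givens i j u (cos a) (sin a) ** givens i j u (cos b) (sin b) = givens i j u (cos (a + b)) (sin (a + b))"
proof -
  have u: "u * (fconj u * y) = y" "fconj u * (u * y) = y" for y :: 'f
    using assms(2) fconj_mult_self[of u] self_mult_fconj[of u] by (simp_all flip: mult.assoc)
  show ?thesis
    unfolding matrix_eq matrix_vector_mul_assoc[symmetric] givens_vector[OF assms(1)] vec_eq_iff
    using assms(1) by (auto simp: u cos_add sin_add scaleR_right_distrib scaleR_right_diff_distrib
        scaleR_left_distrib scaleR_left_diff_distrib distrib_left right_diff_distrib mult.commute algebra_simps)
qed

text \<open>Conjugation by a sign inverts a plane rotation, so its determinant squares to 1; and every plane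
  rotation is a square.\<close>

lemma det_givens:
  fixes u :: "'f::{star_algebra,real_normed_field}"
  assumes "i \<noteq> j" "norm u = 1" "c\<^sup>2 + s\<^sup>2 = 1"
  shows "det (givens i j u c s :: 'f^'n^'n) = 1"
proof -
  obtain \<theta> where \<theta>: "c = cos \<theta>" "s = sin \<theta>"
    using sincos_total_2pi[OF assms(3)] by metis
  define g :: "real \<Rightarrow> 'f^'n^'n" where "g a = givens i j u (cos a) (sin a)" for a
  have add: "g a ** g b = g (a + b)" for a b
    unfolding g_def by (rule givens_add[OF assms(1,2)])
  have conj: "phase i (-1) ** g a ** phase i (-1) = g (- a)" for a
    unfolding matrix_eq matrix_vector_mul_assoc[symmetric] g_def givens_vector[OF assms(1)] phase_vector vec_eq_iff
    using assms(1) by auto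
  have "det (g a) * det (g a) = 1" for a
  proof -
    have "det (g a) * det (g (- a)) = det (g 0)"
      unfolding det_mul[symmetric] add by simp
    also have "g 0 = mat 1" by (simp add: g_def givens_def)
    also have "det (g (- a)) = det (g a)"
      unfolding conj[symmetric] by (simp add: det_mul det_phase)
    finally show ?thesis by simp
  qed
  from this[of "\<theta> / 2"] show ?thesis
    unfolding det_mul[symmetric] add by (simp add: g_def \<theta>)
qed

text \<open>A multiplicative closed condition on unitary matrices may be checked on plane rotations and
  on diagonal matrices.\<close>

lemma unitary_induct:
  fixes P :: "'f::star_algebra^'n^'n \<Rightarrow> bool"
  assumes "A \<in> unitary_group"
    and closed: "closed {B \<in> unitary_group. P B}"
    and mult: "\<And>B C. B \<in> unitary_group \<Longrightarrow> C \<in> unitary_group \<Longrightarrow> P B \<Longrightarrow> P C \<Longrightarrow> P (B ** C)"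
    and inv: "\<And>B. B \<in> unitary_group \<Longrightarrow> P B \<Longrightarrow> P (mstar B)"
    and givens: "\<And>i j u c s. i \<noteq> j \<Longrightarrow> norm u = 1 \<Longrightarrow> c\<^sup>2 + s\<^sup>2 = 1 \<Longrightarrow> P (givens i j u c s)"
    and diagonal: "\<And>B. B \<in> unitary_group \<Longrightarrow> (\<And>i j. i \<noteq> j \<Longrightarrow> B $ i $ j = 0) \<Longrightarrow> P B"
  shows "P A"
proof -
  define C where "C = {B \<in> unitary_group. P B}"
  have "compact C"
    using closed compact_Int_closed[OF compact_unitary_group closed] by (simp add: C_def Int_def)
  moreover have "P (mat 1)" by (rule diagonal[OF unitary_mat_1]) (simp add: mat_def)
  then have "mat 1 \<in> C" by (simp add: C_def)
  moreover obtain f :: "'n \<Rightarrow> nat" where f: "inj f"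
    using finite_imp_inj_to_nat_seg[of "UNIV :: 'n set"] by auto
  define c where "c = (\<chi> i. real (f i) + 1)"
  have "\<And>i. c $ i > 0" "inj (($) c)"
    using f by (auto simp: inj_def c_def)
  ultimately obtain R Q where RQ: "R \<in> C" "Q \<in> C" "\<And>i j. i \<noteq> j \<Longrightarrow> (R ** A ** Q) $ i $ j = 0"
    using trace_maximizer[of C c A] mult givens unitary_mult givens_unitary unfolding C_def
    by (smt (verit, del_insts) mem_Collect_eq)
  have RQ': "R \<in> unitary_group" "Q \<in> unitary_group" "P R" "P Q" using RQ by (auto simp: C_def)
  define N where "N = R ** A ** Q"
  have N: "N \<in> unitary_group" unfolding N_def using RQ' assms(1) by (intro unitary_mult)
  then have "P N" using diagonal RQ(3) by (simp add: N_def)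
  have "A = mstar R ** N ** mstar Q"
    by (simp add: N_def matrix_mul_assoc unitary_groupD[OF RQ'(1)] unitary_cancel(2)[OF RQ'(2)])
  then show ?thesis
    using RQ' N \<open>P N\<close> by (simp add: mult inv unitary_mult unitary_mstar)
qed

lemma norm_det_unitary:
  fixes A :: "'f::{star_algebra,real_normed_field}^'n^'n"
  assumes "A \<in> unitary_group" shows "norm (det A) = 1"
  using assms
proof (rule unitary_induct)
  have "{B :: 'f^'n^'n. B \<in> unitary_group \<and> norm (det B) = 1} = unitary_group \<inter> {B. norm (det B) = 1}"
    by auto
  then show "closed {B \<in> unitary_group. norm (det (B :: 'f^'n^'n)) = 1}"
    by (simp only:) (intro closed_Int compact_imp_closed compact_unitary_group closed_Collect_eq continuous_intros)
  show "norm (det (mstar B)) = 1" if "B \<in> unitary_group" "norm (det B) = 1" for B :: "'f^'n^'n"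
  proof -
    have "det (mstar B) * det B = 1"
      unfolding det_mul[symmetric] unitary_groupD[OF that(1)] by simp
    then have "norm (det (mstar B)) * norm (det B) = 1" by (simp flip: norm_mult)
    then show ?thesis using that(2) by simp
  qed
  show "norm (det B) = 1" if "B \<in> unitary_group" "\<And>i j. i \<noteq> j \<Longrightarrow> B $ i $ j = 0" for B :: "'f^'n^'n"
    using det_diagonal[of B] that unitary_diagonal_entry[OF that] by (simp add: prod_norm[symmetric])
qed (simp_all add: det_mul norm_mult det_givens)

lemma det_mstar_unitary:
  fixes A :: "'f::{star_algebra,real_normed_field}^'n^'n"
  assumes "A \<in> unitary_group" shows "det (mstar A) * det A = 1"
  unfolding det_mul[symmetric] unitary_groupD[OF assms] by simp

lemma prod_UNIV_sum: "(\<Prod>x\<in>UNIV. f x) = (\<Prod>a\<in>UNIV. f (Inl a)) * (\<Prod>b\<in>UNIV. f (Inr b :: 'a::finite + 'b::finite))"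
  using prod.Plus[of "UNIV :: 'a set" "UNIV :: 'b set" f] by simp

text \<open>Padding a plane rotation by an identity block gives a plane rotation again, with
  determinant 1, and padded diagonal matrices stay diagonal; \<open>unitary_induct\<close> does the
  rest.\<close>

lemma det_block_left:
  fixes A :: "'f::{star_algebra,real_normed_field}^'n::finite^'n"
  assumes "A \<in> unitary_group"
  shows "det (block A 0 0 (mat 1 :: 'f^'m::finite^'m)) = det A"
  using assms
proof (rule unitary_induct)
  have "{B :: 'f^'n^'n. B \<in> unitary_group \<and> det (block B 0 0 (mat 1 :: 'f^'m^'m)) = det B}
      = unitary_group \<inter> {B. det (block B 0 0 (mat 1 :: 'f^'m^'m)) = det B}"
    by auto
  then show "closed {B \<in> unitary_group. det (block B 0 0 (mat 1 :: 'f^'m^'m)) = det (B :: 'f^'n^'n)}"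
    by (simp only:) (intro closed_Int compact_imp_closed compact_unitary_group closed_Collect_eq continuous_intros)
  have mult: "block (B ** C) 0 0 (mat 1 :: 'f^'m^'m) = block B 0 0 (mat 1) ** block C 0 0 (mat 1)" for B C :: "'f^'n^'n"
    by (simp add: block_mult)
  show "det (block (B ** C) 0 0 (mat 1 :: 'f^'m^'m)) = det (B ** C)"
    if "det (block B 0 0 (mat 1 :: 'f^'m^'m)) = det B" "det (block C 0 0 (mat 1 :: 'f^'m^'m)) = det C" for B C :: "'f^'n^'n"
    using that by (simp add: mult det_mul)
  show "det (block (mstar B) 0 0 (mat 1 :: 'f^'m^'m)) = det (mstar B)"
    if "B \<in> unitary_group" "det (block B 0 0 (mat 1 :: 'f^'m^'m)) = det B" for B :: "'f^'n^'n"
  proof -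
    have "det (block (mstar B) 0 0 (mat 1 :: 'f^'m^'m)) * det (block B 0 0 (mat 1 :: 'f^'m^'m)) = 1"
      unfolding det_mul[symmetric] mult[symmetric] unitary_groupD[OF that(1)] by (simp add: block_mat_1)
    then show ?thesis
      using det_mstar_unitary[OF that(1)] that(2) by (metis mult_cancel_right mult_zero_right zero_neq_one)
  qed
  show "det (block (givens i j u c s) 0 0 (mat 1 :: 'f^'m^'m)) = det (givens i j u c s :: 'f^'n^'n)"
    if "i \<noteq> j" "norm u = 1" "c\<^sup>2 + s\<^sup>2 = 1" for i j :: 'n and u :: 'f and c s
  proof -
    have "block (givens i j u c s) 0 0 (mat 1 :: 'f^'m^'m) = givens (Inl i) (Inl j) u c s"
      by (auto simp: vec_eq_iff block_def givens_def axis_def mat_def split: sum.split)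
    then show ?thesis using that by (simp add: det_givens)
  qed
  show "det (block B 0 0 (mat 1 :: 'f^'m^'m)) = det B" if "\<And>i j. i \<noteq> j \<Longrightarrow> B $ i $ j = 0" for B :: "'f^'n^'n"
  proof -
    have "det (block B 0 0 (mat 1 :: 'f^'m^'m)) = (\<Prod>i\<in>UNIV. block B 0 0 (mat 1 :: 'f^'m^'m) $ i $ i)"
      by (rule det_diagonal) (auto simp: block_def mat_def split: sum.split, use that in blast)
    also have "\<dots> = (\<Prod>i\<in>UNIV. B $ i $ i)"
      by (simp add: prod_UNIV_sum block_def mat_def)
    finally show ?thesis using det_diagonal[of B] that by simp
  qed
qed

lemma det_block_right:
  fixes D :: "'f::{star_algebra,real_normed_field}^'n::finite^'n"
  assumes "D \<in> unitary_group"
  shows "det (block (mat 1 :: 'f^'m::finite^'m) 0 0 D) = det D"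
  using assms
proof (rule unitary_induct)
  have "{B :: 'f^'n^'n. B \<in> unitary_group \<and> det (block (mat 1 :: 'f^'m^'m) 0 0 B) = det B}
      = unitary_group \<inter> {B. det (block (mat 1 :: 'f^'m^'m) 0 0 B) = det B}"
    by auto
  then show "closed {B \<in> unitary_group. det (block (mat 1 :: 'f^'m^'m) 0 0 B) = det (B :: 'f^'n^'n)}"
    by (simp only:) (intro closed_Int compact_imp_closed compact_unitary_group closed_Collect_eq continuous_intros)
  have mult: "block (mat 1 :: 'f^'m^'m) 0 0 (B ** C) = block (mat 1) 0 0 B ** block (mat 1) 0 0 C" for B C :: "'f^'n^'n"
    by (simp add: block_mult)
  show "det (block (mat 1 :: 'f^'m^'m) 0 0 (B ** C)) = det (B ** C)"
    if "det (block (mat 1 :: 'f^'m^'m) 0 0 B) = det B" "det (block (mat 1 :: 'f^'m^'m) 0 0 C) = det C" for B C :: "'f^'n^'n"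
    using that by (simp add: mult det_mul)
  show "det (block (mat 1 :: 'f^'m^'m) 0 0 (mstar B)) = det (mstar B)"
    if "B \<in> unitary_group" "det (block (mat 1 :: 'f^'m^'m) 0 0 B) = det B" for B :: "'f^'n^'n"
  proof -
    have "det (block (mat 1 :: 'f^'m^'m) 0 0 (mstar B)) * det (block (mat 1 :: 'f^'m^'m) 0 0 B) = 1"
      unfolding det_mul[symmetric] mult[symmetric] unitary_groupD[OF that(1)] by (simp add: block_mat_1)
    then show ?thesis
      using det_mstar_unitary[OF that(1)] that(2) by (metis mult_cancel_right mult_zero_right zero_neq_one)
  qed
  show "det (block (mat 1 :: 'f^'m^'m) 0 0 (givens i j u c s)) = det (givens i j u c s :: 'f^'n^'n)"
    if "i \<noteq> j" "norm u = 1" "c\<^sup>2 + s\<^sup>2 = 1" for i j :: 'n and u :: 'f and c s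
  proof -
    have "block (mat 1 :: 'f^'m^'m) 0 0 (givens i j u c s) = givens (Inr i) (Inr j) u c s"
      by (auto simp: vec_eq_iff block_def givens_def axis_def mat_def split: sum.split)
    then show ?thesis using that by (simp add: det_givens)
  qed
  show "det (block (mat 1 :: 'f^'m^'m) 0 0 B) = det B" if "\<And>i j. i \<noteq> j \<Longrightarrow> B $ i $ j = 0" for B :: "'f^'n^'n"
  proof -
    have "det (block (mat 1 :: 'f^'m^'m) 0 0 B) = (\<Prod>i\<in>UNIV. block (mat 1 :: 'f^'m^'m) 0 0 B $ i $ i)"
      by (rule det_diagonal) (auto simp: block_def mat_def split: sum.split, use that in blast)
    also have "\<dots> = (\<Prod>i\<in>UNIV. B $ i $ i)"
      by (simp add: prod_UNIV_sum block_def mat_def)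
    finally show ?thesis using det_diagonal[of B] that by simp
  qed
qed

lemma det_block_unitary:
  fixes A :: "'f::{star_algebra,real_normed_field}^'n::finite^'n" and D :: "'f^'m::finite^'m"
  assumes "A \<in> unitary_group" "D \<in> unitary_group"
  shows "det (block A 0 0 D) = det A * det D"
proof -
  have "block A 0 0 D = block A 0 0 (mat 1) ** block (mat 1) 0 0 D" by (simp add: block_mult)
  then show ?thesis by (simp add: det_mul det_block_left det_block_right assms)
qed

text \<open>Conjugation by \<open>Jmat\<close> turns a_t into its inverse, so the determinant
  squares to 1; and a_t is the square of a_(t/2).\<close>

lemma det_a_mat:
  "det (a_mat t :: 'f::{star_algebra,real_normed_field}^(('q::finite + 'r::finite) + 'q)^(('q + 'r) + 'q)) = 1"
proof -
  have sq: "det (a_mat t :: 'f^(('q + 'r) + 'q)^(('q + 'r) + 'q)) * det (a_mat t :: 'f^(('q + 'r) + 'q)^(('q + 'r) + 'q)) = 1" for t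
  proof -
    let ?a = "\<lambda>t. a_mat t :: 'f^(('q + 'r) + 'q)^(('q + 'r) + 'q)"
    have J: "det (Jmat :: 'f^(('q + 'r) + 'q)^(('q + 'r) + 'q)) * det (Jmat :: 'f^(('q + 'r) + 'q)^(('q + 'r) + 'q)) = 1"
      unfolding det_mul[symmetric] Jmat_square by simp
    have "det (?a (- t)) = det (?a t)"
      unfolding Jmat_a_mat[symmetric] using J by (simp add: det_mul algebra_simps)
    moreover have "det (?a t) * det (?a (- t)) = 1"
      unfolding det_mul[symmetric] a_mat_mult by (simp add: a_mat_0)
    ultimately show ?thesis by simp
  qed
  have "(1 / 2) *\<^sub>R t + (1 / 2) *\<^sub>R t = t" by (simp flip: scaleR_left_distrib)
  then show ?thesis
    using sq[of "(1 / 2) *\<^sub>R t"] unfolding det_mul[symmetric] a_mat_mult by simp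
qed

lemma det_pos_definite:
  fixes S :: "'f::{star_algebra,real_normed_field}^'q::{finite,linorder}^'q::{finite,linorder}"
  assumes "pos_definite S" shows "det S = of_real (adet S)"
proof -
  obtain Q s where Q: "Q \<in> unitary_group" "S = mstar Q ** diag s ** Q" "adet S = (\<Prod>i\<in>UNIV. s $ i)"
    using pos_definite_spectral[OF assms] by metis
  have "det (diag s :: (('f, 'q) vec, 'q) vec) = (\<Prod>i\<in>UNIV. diag s $ i $ i)"
    by (rule det_diagonal) (simp add: diag_nth)
  then have "det (diag s :: (('f, 'q) vec, 'q) vec) = of_real (adet S)"
    by (simp add: diag_nth Q(3))
  then show ?thesis
    using det_mstar_unitary[OF Q(1)] by (simp add: Q(2) det_mul mult_ac)
qed

section \<open>Adjusting determinants\<close>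

text \<open>A phase in one arbitrary coordinate among the last p - q of the upper block. It fixes
  \<open>frame0\<close>, commutes with a_t and has determinant c, so it adjusts determinants without
  affecting anything else.\<close>

definition twist :: "'f::star_algebra \<Rightarrow> 'f^('q::finite + 'r::finite)^('q + 'r)"
  where "twist c = block (mat 1) 0 0 (phase undefined c)"

lemma twist_unitary:
  assumes "norm c = 1" shows "twist c \<in> unitary_group"
  by (simp add: twist_def unitary_group_def mstar_block block_mult block_mat_1
      unitary_groupD[OF phase_unitary[OF assms]])

lemma mstar_twist: "mstar (twist c) = twist (fconj c)"
  by (simp add: twist_def mstar_block mstar_phase)

lemma twist_frame0: "twist c ** frame0 = frame0"
  by (simp only: twist_def block_frame0) (simp only: frame0_def)

lemma det_twist: "norm c = 1 \<Longrightarrow> det (twist c :: 'f::{star_algebra,real_normed_field}^('q::finite + 'r::finite)^('q + 'r)) = c"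
  by (simp add: twist_def det_block_right phase_unitary det_phase)

lemma twist_a_mat:
  fixes c :: "'f::star_algebra" and t :: "real^'q::finite"
  shows "block (twist c :: 'f^('q + 'r::finite)^('q + 'r)) 0 0 (mat 1) ** a_mat t = a_mat t ** block (twist c) 0 0 (mat 1)"
proof -
  have "mstar (frame0 :: 'f^'q^('q + 'r::finite)) ** twist c = mstar (twist (fconj c) ** frame0)"
    by (simp add: mstar_mult mstar_twist)
  then have "mstar (frame0 :: 'f^'q^('q + 'r::finite)) ** twist c = mstar frame0"
    by (simp add: twist_frame0)
  then have right: "A ** mstar (frame0 :: 'f^'q^('q + 'r)) ** twist c = A ** mstar frame0" for A :: "'f^'q^'q"
    by (simp flip: matrix_mul_assoc)
  have left: "twist c ** (frame0 ** A) = (frame0 ** A :: 'f^'q^('q + 'r))" for A :: "'f^'q^'q"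
    by (simp add: matrix_mul_assoc twist_frame0)
  have comm: "twist c ** block (cosh_diag t :: 'f^'q^'q) 0 0 (mat 1 :: 'f^'r^'r) = block (cosh_diag t) 0 0 (mat 1) ** twist c"
    by (simp add: twist_def block_mult)
  show ?thesis
    by (simp add: a_mat_block block_mult[of "twist c"] block_mult[where A' = "twist c"] left right comm)
qed

text \<open>A twist and its inverse are inserted around a_\<tau>, with which they commute. The twist
  normalises the left factor; the right factor is then normalised too because det g = 1.\<close>

lemma cartan_decomposition_det:
  fixes g :: "'f::{star_algebra,real_normed_field}^(('q::finite + 'r::finite) + 'q)^(('q + 'r) + 'q)"
  assumes "jiso g" "U \<in> unitary_group" "V \<in> unitary_group" "lr_block g = U ** cosh_diag \<tau> ** V" "\<And>i. 0 \<le> \<tau> $ i"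
    and "det g = 1"
  obtains X Y where "X \<in> unitary_group" "Y \<in> unitary_group" "det X * det U = 1" "det Y * det V = 1"
    "g = block X 0 0 U ** a_mat \<tau> ** block Y 0 0 V"
proof -
  obtain X Y where XY: "X \<in> unitary_group" "Y \<in> unitary_group" "g = block X 0 0 U ** a_mat \<tau> ** block Y 0 0 V"
    using cartan_decomposition[OF assms(1-5)] by blast
  define c where "c = inverse (det X * det U)"
  have c: "norm c = 1"
    using XY(1) assms(2) by (simp add: c_def norm_inverse norm_mult norm_det_unitary)
  define X' where "X' = X ** twist c"
  define Y' where "Y' = mstar (twist c) ** Y"
  have tw: "twist c \<in> (unitary_group :: ('f^('q + 'r)^('q + 'r)) set)" using c by (rule twist_unitary)
  have X': "X' \<in> unitary_group" and Y': "Y' \<in> unitary_group"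
    using XY tw by (auto simp: X'_def Y'_def intro!: unitary_mult unitary_mstar)
  have "block X' 0 0 U ** a_mat \<tau> ** block Y' 0 0 V
      = block X 0 0 U ** (block (twist c) 0 0 (mat 1) ** a_mat \<tau>) ** block (mstar (twist c)) 0 0 (mat 1) ** block Y 0 0 V"
  proof -
    have "block X' 0 0 U = block X 0 0 U ** block (twist c) 0 0 (mat 1)"
      "block Y' 0 0 V = block (mstar (twist c)) 0 0 (mat 1) ** block Y 0 0 V"
      by (simp_all add: X'_def Y'_def block_mult)
    then show ?thesis by (simp add: matrix_mul_assoc)
  qed
  also have "\<dots> = block X 0 0 U ** a_mat \<tau> ** (block (twist c) 0 0 (mat 1) ** block (mstar (twist c)) 0 0 (mat 1)) ** block Y 0 0 V"
    by (simp add: twist_a_mat matrix_mul_assoc)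
  also have "block (twist c) 0 0 (mat 1) ** block (mstar (twist c)) 0 0 (mat 1) = (mat 1 :: 'f^(('q + 'r) + 'q)^(('q + 'r) + 'q))"
    using unitary_groupD(2)[OF tw] by (simp add: block_mult block_mat_1)
  finally have g: "g = block X' 0 0 U ** a_mat \<tau> ** block Y' 0 0 V" by (simp add: XY(3))
  have "det X \<noteq> 0" "det U \<noteq> 0" using norm_det_unitary[OF XY(1)] norm_det_unitary[OF assms(2)] by auto
  then have detX: "det X' * det U = 1"
    using c by (simp add: X'_def det_mul det_twist) (simp add: c_def field_simps)
  have "det g = (det X' * det U) * (det Y' * det V)"
    unfolding g by (simp add: det_mul det_block_unitary X' Y' assms(2,3) det_a_mat)
  then have "det Y' * det V = 1" using assms(6) detX by simp
  then show ?thesis using that X' Y' detX g by blast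
qed

text \<open>Complete the frame to a unitary matrix and correct its determinant by a twist, which
  leaves the first q columns alone.\<close>

lemma frame_completion_det:
  fixes X :: "'f::{star_algebra,real_normed_field}^'q::finite^('q + 'r::finite)"
  assumes "mstar X ** X = mat 1" "norm c = 1"
  obtains A where "A \<in> unitary_group" "A ** frame0 = X" "det A * c = 1"
proof -
  obtain A where A: "A \<in> unitary_group" "X = A ** frame0 ** diag 1"
    using frame_extension[of X 1] assms(1) by (auto simp: diag_1)
  define u where "u = inverse (det A * c)"
  have u: "norm u = 1" using assms(2) A(1) by (simp add: u_def norm_inverse norm_mult norm_det_unitary)
  have "det A \<noteq> 0" "c \<noteq> 0" using norm_det_unitary[OF A(1)] assms(2) by auto
  then have "det (A ** twist u) * c = 1" using u by (simp add: det_mul det_twist) (simp add: u_def field_simps)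
  moreover have "A ** twist u ** frame0 = X"
    by (simp add: A(2) diag_1 twist_frame0 flip: matrix_mul_assoc)
  ultimately show ?thesis
    using that[OF unitary_mult[OF A(1) twist_unitary[OF u]]] by blast
qed

section \<open>The quaternionic determinant\<close>

lemma quat_sum_sel:
  "qRe (\<Sum>i\<in>I. f i) = (\<Sum>i\<in>I. qRe (f i))" "qI (\<Sum>i\<in>I. f i) = (\<Sum>i\<in>I. qI (f i))"
  "qJ (\<Sum>i\<in>I. f i) = (\<Sum>i\<in>I. qJ (f i))" "qK (\<Sum>i\<in>I. f i) = (\<Sum>i\<in>I. qK (f i))"
  by (induction I rule: infinite_finite_induct) auto

lemma quat_to_complex_mult:
  "quat_to_complex (X ** Y) = quat_to_complex X ** quat_to_complex (Y :: quat^'n::finite^'n)"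
  unfolding quat_to_complex_def block_mult block_eq_iff
  by (auto simp: vec_eq_iff matrix_matrix_mult_def complex_eq_iff quat_sum_sel
      simp flip: sum.distrib sum_subtractf sum_negf intro!: sum.cong)

lemma quat_to_complex_1: "quat_to_complex (mat 1) = (mat 1 :: complex^('n::finite + 'n)^('n + 'n))"
  by (auto simp: vec_eq_iff quat_to_complex_def block_def mat_def complex_eq_iff split: sum.split)

lemma det_quat_to_complex_diag:
  "det (quat_to_complex (diag s)) = of_real ((\<Prod>i\<in>UNIV. s $ i)\<^sup>2)" for s :: "real^'n::finite"
proof -
  have sel: "qRe (of_real r) = r" "qI (of_real r) = 0" "qJ (of_real r) = 0" "qK (of_real r) = 0" for r
    by (simp_all add: of_real_def)
  let ?A = "quat_to_complex (diag s :: quat^'n^'n)"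
  have nth: "?A $ i $ j = (if i = j then of_real (case i of Inl a \<Rightarrow> s $ a | Inr a \<Rightarrow> s $ a) else 0)" for i j
    by (auto simp: quat_to_complex_def block_def diag_nth sel complex_eq_iff split: sum.split)
  have "det ?A = (\<Prod>i\<in>UNIV. ?A $ i $ i)"
    by (rule det_diagonal) (simp add: nth)
  then show ?thesis by (simp add: nth prod_UNIV_sum power2_eq_square)
qed

lemma Delta_R_pos_definite:
  "pos_definite S \<Longrightarrow> Delta_R S = of_real (adet (S :: real^'q::{finite,linorder}^'q::{finite,linorder}))"
  by (simp add: Delta_R_def det_pos_definite)

lemma Delta_C_pos_definite:
  "pos_definite S \<Longrightarrow> Delta_C S = of_real (adet (S :: complex^'q::{finite,linorder}^'q::{finite,linorder}))"
  by (simp add: Delta_C_def det_pos_definite)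

text \<open>In the complex matrix of S each eigenvalue occurs twice, so its determinant is the
  square of \<open>adet S\<close>, and \<open>csqrt\<close> returns the nonnegative root.\<close>

lemma Delta_H_pos_definite:
  fixes S :: "quat^'q::{finite,linorder}^'q::{finite,linorder}"
  assumes "pos_definite S" shows "Delta_H S = of_real (adet S)"
proof -
  obtain Q s where Q: "Q \<in> unitary_group" "S = mstar Q ** diag s ** Q" "adet S = (\<Prod>i\<in>UNIV. s $ i)"
    using pos_definite_spectral[OF assms] by metis
  have "det (quat_to_complex (mstar Q)) * det (quat_to_complex Q) = 1"
    unfolding det_mul[symmetric] quat_to_complex_mult[symmetric] unitary_groupD[OF Q(1)] quat_to_complex_1 by simp
  then have "det (quat_to_complex S) = det (quat_to_complex (diag s :: ((quat, 'q) vec, 'q) vec))"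
    by (simp add: Q(2) det_mul quat_to_complex_mult mult_ac)
  also have "\<dots> = (of_real (adet S))\<^sup>2" by (simp add: det_quat_to_complex_diag Q(3))
  finally show ?thesis by (simp add: Delta_H_def csqrt_square)
qed

section \<open>The three families of groups\<close>

lemma block_unitary:
  fixes A :: "'f::star_algebra^'n::finite^'n" and D :: "'f^'m::finite^'m"
  assumes "A \<in> unitary_group" "D \<in> unitary_group"
  shows "block A 0 0 D \<in> unitary_group"
  using assms by (simp add: unitary_group_def mstar_block block_mult block_mat_1)

lemma a_mat_SO0: "a_mat \<tau> \<in> (SO0 :: (real^(('q::finite + 'r::finite) + 'q)^(('q + 'r) + 'q)) set)"
proof -
  let ?a = "\<lambda>r. a_mat (r *\<^sub>R \<tau>) :: real^(('q + 'r) + 'q)^(('q + 'r) + 'q)"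
  have "range ?a \<subseteq> SO0"
    unfolding SO0_def
  proof (rule connected_component_maximal)
    show "mat 1 \<in> range ?a"
      by (rule image_eqI[of _ _ 0]) (simp_all add: a_mat_0)
    show "connected (range ?a)"
      by (intro connected_continuous_image continuous_intros connected_UNIV)
    show "range ?a \<subseteq> {A \<in> pq_isometries. det A = 1}"
      by (auto simp: det_a_mat jiso_pq_isometries jiso_a_mat)
  qed
  moreover have "a_mat \<tau> = ?a 1" by simp
  ultimately show ?thesis by blast
qed

lemma a_mat_SU: "a_mat \<tau> \<in> (SU :: (complex^(('q::finite + 'r::finite) + 'q)^(('q + 'r) + 'q)) set)"
  by (simp add: SU_def det_a_mat jiso_pq_isometries jiso_a_mat)

lemma a_mat_Sp: "a_mat \<tau> \<in> (Sp :: (quat^(('q::finite + 'r::finite) + 'q)^(('q + 'r) + 'q)) set)"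
  by (simp add: Sp_def jiso_pq_isometries jiso_a_mat)

lemma det_mstar_eq_1:
  fixes A :: "'f::{star_algebra,real_normed_field}^'n^'n"
  shows "A \<in> unitary_group \<Longrightarrow> det A = 1 \<Longrightarrow> det (mstar A) = 1"
  using det_mstar_unitary[of A] by simp

lemma haar_group_K_R:
  "normalized_haar K_R dk \<Longrightarrow> haar_group (K_R :: (real^('p::finite + 'q::finite)^('p + 'q)) set) dk"
proof
  show "K_R \<subseteq> (unitary_group :: (real^('p + 'q)^('p + 'q)) set)"
    by (auto simp: K_R_def intro: block_unitary)
  have "mat 1 = (block (mat 1) 0 0 (mat 1) :: real^('p + 'q)^('p + 'q))" by (simp add: block_mat_1)
  then show "mat 1 \<in> (K_R :: (real^('p + 'q)^('p + 'q)) set)"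
    unfolding K_R_def by (intro CollectI exI conjI) (assumption | rule unitary_mat_1 det_I)+
  show "x ** y \<in> K_R" if xy: "x \<in> K_R" "y \<in> K_R" for x y :: "real^('p + 'q)^('p + 'q)"
  proof -
    obtain A D A' D' where x: "x = block A 0 0 D" "A \<in> unitary_group" "D \<in> unitary_group" "det A = 1" "det D = 1"
      and y: "y = block A' 0 0 D'" "A' \<in> unitary_group" "D' \<in> unitary_group" "det A' = 1" "det D' = 1"
      using xy unfolding K_R_def by blast
    have "x ** y = block (A ** A') 0 0 (D ** D')" by (simp add: x y block_mult)
    moreover have "det (A ** A') = 1" "det (D ** D') = 1" using x y by (simp_all add: det_mul)
    ultimately show ?thesis
      unfolding K_R_def
      by (intro CollectI exI conjI) (assumption | rule unitary_mult x(2,3) y(2,3))+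
  qed
  show "mstar x \<in> K_R" if x: "x \<in> K_R" for x :: "real^('p + 'q)^('p + 'q)"
  proof -
    obtain A D where x: "x = block A 0 0 D" "A \<in> unitary_group" "D \<in> unitary_group" "det A = 1" "det D = 1"
      using x unfolding K_R_def by blast
    have "mstar x = block (mstar A) 0 0 (mstar D)" by (simp add: x mstar_block)
    then show ?thesis
      unfolding K_R_def
      by (intro CollectI exI conjI) (assumption | rule unitary_mstar det_mstar_eq_1 x(2-5))+
  qed
qed

lemma haar_group_K_C:
  "normalized_haar K_C dk \<Longrightarrow> haar_group (K_C :: (complex^('p::finite + 'q::finite)^('p + 'q)) set) dk"
proof
  show "K_C \<subseteq> (unitary_group :: (complex^('p + 'q)^('p + 'q)) set)"
    by (auto simp: K_C_def intro: block_unitary)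
  have "mat 1 = (block (mat 1) 0 0 (mat 1) :: complex^('p + 'q)^('p + 'q))"
    "det (mat 1 :: complex^'p^'p) * det (mat 1 :: complex^'q^'q) = 1"
    by (simp_all add: block_mat_1)
  then show "mat 1 \<in> (K_C :: (complex^('p + 'q)^('p + 'q)) set)"
    unfolding K_C_def by (intro CollectI exI conjI) (assumption | rule unitary_mat_1)+
  show "x ** y \<in> K_C" if xy: "x \<in> K_C" "y \<in> K_C" for x y :: "complex^('p + 'q)^('p + 'q)"
  proof -
    obtain A D A' D' where x: "x = block A 0 0 D" "A \<in> unitary_group" "D \<in> unitary_group" "det A * det D = 1"
      and y: "y = block A' 0 0 D'" "A' \<in> unitary_group" "D' \<in> unitary_group" "det A' * det D' = 1"
      using xy unfolding K_C_def by blast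
    have "x ** y = block (A ** A') 0 0 (D ** D')" by (simp add: x y block_mult)
    moreover have "det (A ** A') * det (D ** D') = (det A * det D) * (det A' * det D')"
      by (simp only: det_mul mult_ac)
    then have "det (A ** A') * det (D ** D') = 1" using x(4) y(4) by simp
    ultimately show ?thesis
      unfolding K_C_def
      by (intro CollectI exI conjI) (assumption | rule unitary_mult x(2,3) y(2,3))+
  qed
  show "mstar x \<in> K_C" if x: "x \<in> K_C" for x :: "complex^('p + 'q)^('p + 'q)"
  proof -
    obtain A D where x: "x = block A 0 0 D" "A \<in> unitary_group" "D \<in> unitary_group" "det A * det D = 1"
      using x unfolding K_C_def by blast
    have "mstar x = block (mstar A) 0 0 (mstar D)" by (simp add: x mstar_block)
    moreover have "(det (mstar A) * det A) * (det (mstar D) * det D) = (det (mstar A) * det (mstar D)) * (det A * det D)"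
      by (simp only: mult_ac)
    then have "det (mstar A) * det (mstar D) = 1"
      by (simp add: x(4) det_mstar_unitary[OF x(2)] det_mstar_unitary[OF x(3)])
    ultimately show ?thesis
      unfolding K_C_def
      by (intro CollectI exI conjI) (assumption | rule unitary_mstar x(2,3))+
  qed
qed

lemma haar_group_K_H:
  "normalized_haar K_H dk \<Longrightarrow> haar_group (K_H :: (quat^('p::finite + 'q::finite)^('p + 'q)) set) dk"
proof
  show "K_H \<subseteq> (unitary_group :: (quat^('p + 'q)^('p + 'q)) set)"
    by (auto simp: K_H_def intro: block_unitary)
  have "mat 1 = (block (mat 1) 0 0 (mat 1) :: quat^('p + 'q)^('p + 'q))" by (simp add: block_mat_1)
  then show "mat 1 \<in> (K_H :: (quat^('p + 'q)^('p + 'q)) set)"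
    unfolding K_H_def by (intro CollectI exI conjI) (assumption | rule unitary_mat_1)+
  show "x ** y \<in> K_H" if xy: "x \<in> K_H" "y \<in> K_H" for x y :: "quat^('p + 'q)^('p + 'q)"
  proof -
    obtain A D A' D' where x: "x = block A 0 0 D" "A \<in> unitary_group" "D \<in> unitary_group"
      and y: "y = block A' 0 0 D'" "A' \<in> unitary_group" "D' \<in> unitary_group"
      using xy unfolding K_H_def by blast
    have "x ** y = block (A ** A') 0 0 (D ** D')" by (simp add: x y block_mult)
    then show ?thesis
      unfolding K_H_def
      by (intro CollectI exI conjI) (assumption | rule unitary_mult x(2,3) y(2,3))+
  qed
  show "mstar x \<in> K_H" if x: "x \<in> K_H" for x :: "quat^('p + 'q)^('p + 'q)"
  proof -
    obtain A D where x: "x = block A 0 0 D" "A \<in> unitary_group" "D \<in> unitary_group"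
      using x unfolding K_H_def by blast
    have "mstar x = block (mstar A) 0 0 (mstar D)" by (simp add: x mstar_block)
    then show ?thesis
      unfolding K_H_def
      by (intro CollectI exI conjI) (assumption | rule unitary_mstar x(2,3))+
  qed
qed

lemma block_group_K_R:
  fixes dk :: "(real^(('q::{finite,linorder} + 'r::finite) + 'q)^(('q + 'r) + 'q)) measure"
  assumes "normalized_haar K_R dk" "normalized_haar unitary_group0 dv" "CARD('q) \<le> CARD('r)"
  shows "block_group K_R dk dv"
proof (intro block_group.intro block_group_axioms.intro haar_group_K_R haar_group_unitary_group0 assms)
  show "\<exists>A\<in>unitary_group. \<exists>D\<in>unitary_group0. k = block A 0 0 D"
    if "k \<in> K_R" for k :: "real^(('q + 'r) + 'q)^(('q + 'r) + 'q)"
    using that unfolding K_R_def unitary_group0_real by blast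
  show "\<exists>A. block A 0 0 v \<in> K_R \<and> A ** frame0 = X"
    if X: "mstar X ** X = mat 1" and v: "v \<in> unitary_group0" for X :: "((real, 'q) vec, 'q + 'r) vec" and v :: "((real, 'q) vec, 'q) vec"
  proof -
    have "norm (1 :: real) = 1" by simp
    then obtain A where "A \<in> unitary_group" "A ** frame0 = X" "det A * 1 = 1"
      using frame_completion_det[OF X] by blast
    then show ?thesis
      using v unfolding K_R_def unitary_group0_real by auto
  qed
qed

text \<open>Here \<open>v\<close> may have any determinant of modulus 1; the completed frame
  receives the reciprocal determinant.\<close>

lemma block_group_K_C:
  fixes dk :: "(complex^(('q::{finite,linorder} + 'r::finite) + 'q)^(('q + 'r) + 'q)) measure"
  assumes "normalized_haar K_C dk" "normalized_haar unitary_group0 dv" "CARD('q) \<le> CARD('r)"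
  shows "block_group K_C dk dv"
proof (intro block_group.intro block_group_axioms.intro haar_group_K_C haar_group_unitary_group0 assms)
  have U: "(unitary_group0 :: ((complex, 'q) vec, 'q) vec set) = unitary_group"
    by (rule unitary_group_connected) simp
  show "\<exists>A\<in>unitary_group. \<exists>D\<in>unitary_group0. k = block A 0 0 D"
    if "k \<in> K_C" for k :: "complex^(('q + 'r) + 'q)^(('q + 'r) + 'q)"
    using that unfolding K_C_def U by blast
  show "\<exists>A. block A 0 0 v \<in> K_C \<and> A ** frame0 = X"
    if X: "mstar X ** X = mat 1" and v: "v \<in> unitary_group0" for X :: "((complex, 'q) vec, 'q + 'r) vec" and v :: "((complex, 'q) vec, 'q) vec"
  proof -
    have v': "v \<in> unitary_group" using v by (simp add: U)
    obtain A where "A \<in> unitary_group" "A ** frame0 = X" "det A * det v = 1"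
      using frame_completion_det[OF X norm_det_unitary[OF v']] by blast
    then show ?thesis
      using v' unfolding K_C_def by blast
  qed
qed

lemma block_group_K_H:
  fixes dk :: "(quat^(('q::{finite,linorder} + 'r::finite) + 'q)^(('q + 'r) + 'q)) measure"
  assumes "normalized_haar K_H dk" "normalized_haar unitary_group0 dv" "CARD('q) \<le> CARD('r)"
  shows "block_group K_H dk dv"
proof (intro block_group.intro block_group_axioms.intro haar_group_K_H haar_group_unitary_group0 assms)
  have U: "(unitary_group0 :: ((quat, 'q) vec, 'q) vec set) = unitary_group"
    by (rule unitary_group_connected) simp
  show "\<exists>A\<in>unitary_group. \<exists>D\<in>unitary_group0. k = block A 0 0 D"
    if "k \<in> K_H" for k :: "quat^(('q + 'r) + 'q)^(('q + 'r) + 'q)"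
    using that unfolding K_H_def U by blast
  show "\<exists>A. block A 0 0 v \<in> K_H \<and> A ** frame0 = X"
    if X: "mstar X ** X = mat 1" and v: "v \<in> unitary_group0" for X :: "((quat, 'q) vec, 'q + 'r) vec" and v :: "((quat, 'q) vec, 'q) vec"
  proof -
    have "mstar X ** X = diag 1 ** diag 1" "\<And>i :: 'q. 0 \<le> (1 :: (real, 'q) vec) $ i"
      using X by (simp_all add: diag_1)
    then obtain A where "A \<in> unitary_group" "X = A ** frame0 ** diag 1"
      using frame_extension by blast
    then show ?thesis
      using v unfolding K_H_def U by (auto simp: diag_1)
  qed
qed

lemma jiso_a_mat_block:
  fixes A :: "'f::star_algebra^('q::finite + 'r::finite)^('q + 'r)"
  assumes "A \<in> unitary_group" "D \<in> unitary_group"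
  shows "jiso (a_mat t ** block A 0 0 D ** a_mat s)"
  by (intro jiso_mult jiso_a_mat jiso_block_diagonal assms)

lemma cartan_K_H:
  fixes k :: "quat^(('q::{finite,linorder} + 'r::finite) + 'q)^(('q + 'r) + 'q)"
  assumes "k \<in> K_H"
  shows "\<exists>k1\<in>K_H. \<exists>k2\<in>K_H. a_mat t ** k ** a_mat s
      = k1 ** a_mat (arcosh_vec (spec_s (lr_block (a_mat t ** k ** a_mat s)))) ** k2"
proof -
  obtain A D where k: "k = block A 0 0 D" "A \<in> unitary_group" "D \<in> unitary_group"
    using assms unfolding K_H_def by blast
  define g where "g = a_mat t ** k ** a_mat s"
  have "jiso g" unfolding g_def k(1) by (intro jiso_a_mat_block k)
  obtain U V where UV: "U \<in> unitary_group" "V \<in> unitary_group"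
    "lr_block g = U ** cosh_diag (arcosh_vec (spec_s (lr_block g))) ** V" "\<And>i. 0 \<le> arcosh_vec (spec_s (lr_block g)) $ i"
    using spec_s_cosh[OF lr_block_expanding[OF \<open>jiso g\<close>]] by blast
  obtain X Y where "X \<in> unitary_group" "Y \<in> unitary_group"
    "g = block X 0 0 U ** a_mat (arcosh_vec (spec_s (lr_block g))) ** block Y 0 0 V"
    using cartan_decomposition[OF \<open>jiso g\<close> UV] by blast
  then show ?thesis
    unfolding g_def[symmetric] K_H_def using UV(1,2) by blast
qed

lemma cartan_K_C:
  fixes k :: "complex^(('q::{finite,linorder} + 'r::finite) + 'q)^(('q + 'r) + 'q)"
  assumes "k \<in> K_C"
  shows "\<exists>k1\<in>K_C. \<exists>k2\<in>K_C. a_mat t ** k ** a_mat s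
      = k1 ** a_mat (arcosh_vec (spec_s (lr_block (a_mat t ** k ** a_mat s)))) ** k2"
proof -
  obtain A D where k: "k = block A 0 0 D" "A \<in> unitary_group" "D \<in> unitary_group" "det A * det D = 1"
    using assms unfolding K_C_def by blast
  define g where "g = a_mat t ** k ** a_mat s"
  have "jiso g" unfolding g_def k(1) by (intro jiso_a_mat_block k)
  have "det g = 1" by (simp add: g_def k(1) det_mul det_a_mat det_block_unitary k(2-4))
  obtain U V where UV: "U \<in> unitary_group" "V \<in> unitary_group"
    "lr_block g = U ** cosh_diag (arcosh_vec (spec_s (lr_block g))) ** V" "\<And>i. 0 \<le> arcosh_vec (spec_s (lr_block g)) $ i"
    using spec_s_cosh[OF lr_block_expanding[OF \<open>jiso g\<close>]] by blast
  obtain X Y where "X \<in> unitary_group" "Y \<in> unitary_group" "det X * det U = 1" "det Y * det V = 1"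
    "g = block X 0 0 U ** a_mat (arcosh_vec (spec_s (lr_block g))) ** block Y 0 0 V"
    using cartan_decomposition_det[OF \<open>jiso g\<close> UV \<open>det g = 1\<close>] by blast
  then show ?thesis
    unfolding g_def[symmetric] K_C_def using UV(1,2) by blast
qed

text \<open>Over the reals the two lower right factors need determinant 1 as well. The determinant of the
  expanding block keeps its sign along \<open>r \<mapsto> (r t, r s)\<close>, so these factors have equal determinants.\<close>

lemma det_lr_block_pos:
  fixes A :: "real^('q::finite + 'r::finite)^('q + 'r)"
  assumes "A \<in> unitary_group" "D \<in> unitary_group" "det D = 1"
  shows "0 < det (lr_block (a_mat t ** block A 0 0 D ** a_mat s))"
proof (rule ccontr)
  define M where "M r = lr_block (a_mat (r *\<^sub>R t) ** block A 0 0 D ** a_mat (r *\<^sub>R s))" for r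
  have "det (M r) \<noteq> 0" for r
  proof -
    have "x = 0" if "M r *v x = 0" for x
      using lr_block_expanding[OF jiso_a_mat_block[OF assms(1,2)], of x "r *\<^sub>R t" "r *\<^sub>R s"] that
      by (simp add: M_def)
    then have "invertible (M r)"
      unfolding invertible_left_inverse matrix_left_invertible_ker by blast
    then show ?thesis by (simp add: invertible_det_nz)
  qed
  moreover have "continuous_on {0..1} (\<lambda>r. det (M r))"
    unfolding M_def lr_block_a_mat sinh_diag_def cosh_diag_def
    by (intro continuous_intros continuous_on_vec_lambda continuous_on_component)
  moreover have "M 0 = D" by (simp add: M_def a_mat_0)
  moreover assume "\<not> 0 < det (lr_block (a_mat t ** block A 0 0 D ** a_mat s))"
  then have "det (M 1) \<le> 0" by (simp add: M_def)
  ultimately show False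
    using IVT2'[of "\<lambda>r. det (M r)" 1 0 0] assms(3) by auto
qed

lemma cartan_K_R:
  fixes k :: "real^(('q::{finite,linorder} + 'r::finite) + 'q)^(('q + 'r) + 'q)"
  assumes "k \<in> K_R"
  shows "\<exists>k1\<in>K_R. \<exists>k2\<in>K_R. a_mat t ** k ** a_mat s
      = k1 ** a_mat (arcosh_vec (spec_s (lr_block (a_mat t ** k ** a_mat s)))) ** k2"
proof -
  obtain A D where k: "k = block A 0 0 D" "A \<in> unitary_group" "D \<in> unitary_group" "det A = 1" "det D = 1"
    using assms unfolding K_R_def by blast
  define g where "g = a_mat t ** k ** a_mat s"
  define \<tau> where "\<tau> = arcosh_vec (spec_s (lr_block g))"
  have "jiso g" unfolding g_def k(1) by (intro jiso_a_mat_block k)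
  have "det g = 1" by (simp add: g_def k(1) det_mul det_a_mat det_block_unitary k(2-5))
  obtain U V where UV: "U \<in> unitary_group" "V \<in> unitary_group"
    "lr_block g = U ** cosh_diag \<tau> ** V" "\<And>i. 0 \<le> \<tau> $ i"
    using spec_s_cosh[OF lr_block_expanding[OF \<open>jiso g\<close>]] unfolding \<tau>_def by blast
  have "det (cosh_diag \<tau> :: ((real, 'q) vec, 'q) vec) = (\<Prod>i\<in>UNIV. cosh_diag \<tau> $ i $ i)"
    by (rule det_diagonal) (simp add: cosh_diag_def diag_nth)
  then have "0 < det (cosh_diag \<tau> :: ((real, 'q) vec, 'q) vec)"
    by (simp add: cosh_diag_def diag_nth prod_pos)
  moreover have "0 < det (lr_block g)"
    unfolding g_def k(1) by (rule det_lr_block_pos[OF k(2,3,5)])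
  ultimately have "0 < det U * det V"
    by (simp add: UV(3) det_mul zero_less_mult_iff[of _ "det V"] zero_less_mult_iff[of "det U"] mult_less_0_iff)
  define u where "u = det U"
  have u: "u * u = 1" "det V = u"
    using det_unitary_real[OF UV(1)] det_unitary_real[OF UV(2)] \<open>0 < det U * det V\<close>
    by (auto simp: u_def power2_eq_square square_eq_1_iff)
  then have "norm u = 1" by (auto simp: square_eq_1_iff)
  \<comment> \<open>A sign change in one coordinate, or the identity. It is its own inverse and
    commutes with the diagonal factor, so it can be moved into both U and V; as both have
    determinant u, both become special.\<close>
  define P where "P = (phase undefined u :: ((real, 'q) vec, 'q) vec)"
  have P: "P \<in> unitary_group" "det P = u"
    unfolding P_def using \<open>norm u = 1\<close> by (simp_all add: phase_unitary det_phase)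
  have "P ** cosh_diag \<tau> ** P = cosh_diag \<tau>"
    unfolding P_def matrix_eq matrix_vector_mul_assoc[symmetric] phase_vector vec_eq_iff
    using u(1) by (auto simp: cosh_diag_def)
  then have "lr_block g = U ** P ** cosh_diag \<tau> ** (P ** V)"
    by (simp add: UV(3) flip: matrix_mul_assoc) (simp add: matrix_mul_assoc)
  moreover have "U ** P \<in> unitary_group" "P ** V \<in> unitary_group"
    using UV(1,2) P(1) by (simp_all add: unitary_mult)
  moreover have det: "det (U ** P) = 1" "det (P ** V) = 1"
    using u by (simp_all add: det_mul P(2) u_def)
  ultimately obtain X Y where "X \<in> unitary_group" "Y \<in> unitary_group" "det X = 1" "det Y = 1"
    "g = block X 0 0 (U ** P) ** a_mat \<tau> ** block Y 0 0 (P ** V)"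
    using cartan_decomposition_det[of g "U ** P" "P ** V" \<tau>] \<open>jiso g\<close> UV(4) \<open>det g = 1\<close> by (metis mult.right_neutral)
  then show ?thesis
    unfolding g_def[symmetric] \<tau>_def[symmetric] K_R_def
    using det \<open>U ** P \<in> unitary_group\<close> \<open>P ** V \<in> unitary_group\<close> by blast
qed

section \<open>The product formula\<close>

theorem proposition2p2:
  fixes phi_R :: "real^(('q::{finite,linorder} + 'r::finite) + 'q)^(('q + 'r) + 'q) \<Rightarrow> complex"
    and phi_C :: "complex^(('q + 'r) + 'q)^(('q + 'r) + 'q) \<Rightarrow> complex"
    and phi_H :: "quat^(('q + 'r) + 'q)^(('q + 'r) + 'q) \<Rightarrow> complex"
    and t s :: "real^'q::{finite,linorder}"
  assumes "CARD('q + 'r) \<ge> 2 * CARD('q)" and "t \<in> chamber" and "s \<in> chamber"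
  shows
    "(normalized_haar K_R dk_R \<and> spherical_function SO0 K_R dk_R phi_R \<and>
      normalized_haar unitary_group0 dv_R \<longrightarrow>
      phi_R (a_mat t) * phi_R (a_mat s) =
        1 / kappa (Delta_R :: real^'q::{finite,linorder}^'q::{finite,linorder} \<Rightarrow> complex)
              (of_real (real CARD('q + 'r) * 1 / 2)) *
        (LINT w:B_ball|lborel. LINT v|dv_R.
          phi_R (a_mat (arcosh_vec (spec_s
            (sinh_diag t ** w ** sinh_diag s + cosh_diag t ** v ** cosh_diag s)))) *
          Delta_R (mat 1 - mstar w ** w)
            powr of_real (real CARD('q + 'r) * 1 / 2 - gam 1 CARD('q)))) \<and>
     (normalized_haar K_C dk_C \<and> spherical_function SU K_C dk_C phi_C \<and>
      normalized_haar unitary_group0 dv_C \<longrightarrow>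
      phi_C (a_mat t) * phi_C (a_mat s) =
        1 / kappa (Delta_C :: complex^'q::{finite,linorder}^'q::{finite,linorder} \<Rightarrow> complex)
              (of_real (real CARD('q + 'r) * 2 / 2)) *
        (LINT w:B_ball|lborel. LINT v|dv_C.
          phi_C (a_mat (arcosh_vec (spec_s
            (sinh_diag t ** w ** sinh_diag s + cosh_diag t ** v ** cosh_diag s)))) *
          Delta_C (mat 1 - mstar w ** w)
            powr of_real (real CARD('q + 'r) * 2 / 2 - gam 2 CARD('q)))) \<and>
     (normalized_haar K_H dk_H \<and> spherical_function Sp K_H dk_H phi_H \<and>
      normalized_haar unitary_group0 dv_H \<longrightarrow>
      phi_H (a_mat t) * phi_H (a_mat s) =
        1 / kappa (Delta_H :: quat^'q::{finite,linorder}^'q::{finite,linorder} \<Rightarrow> complex)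
              (of_real (real CARD('q + 'r) * 4 / 2)) *
        (LINT w:B_ball|lborel. LINT v|dv_H.
          phi_H (a_mat (arcosh_vec (spec_s
            (sinh_diag t ** w ** sinh_diag s + cosh_diag t ** v ** cosh_diag s)))) *
          Delta_H (mat 1 - mstar w ** w)
            powr of_real (real CARD('q + 'r) * 4 / 2 - gam 4 CARD('q))))"
proof -
  have sum: "CARD('q + 'r) = CARD('q) + CARD('r)"
    using card_Plus[of "UNIV :: 'q set" "UNIV :: 'r set"] by simp
  \<comment> \<open>\<open>'q + 'r\<close> has p elements, so p >= 2q says that the lower (p - q) x
    q block has at least as many rows as columns.\<close>
  then have card: "CARD('q) \<le> CARD('r)" using assms(1) by simp
  have exponent: "real CARD('q + 'r) * real d / 2 - gam d CARD('q)
      = real d * (real CARD('r) - real CARD('q) + 1) / 2 - 1" for d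
    by (simp add: sum gam_def field_simps)
  show ?thesis
  proof (intro conjI impI; elim conjE)
    assume hyp: "normalized_haar K_R dk_R" "spherical_function SO0 K_R dk_R phi_R" "normalized_haar unitary_group0 dv_R"
    interpret block_group K_R dk_R dv_R by (rule block_group_K_R[OF hyp(1,3) card])
    have \<mu>: "real CARD('q + 'r) * 1 / 2 - gam DIM(real) CARD('q) = expo"
      using exponent[of 1] by (simp only: expo_def DIM_real of_nat_1)
    show "phi_R (a_mat t) * phi_R (a_mat s) =
        1 / kappa (Delta_R :: ((real, 'q) vec, 'q) vec \<Rightarrow> complex) (of_real (real CARD('q + 'r) * 1 / 2)) *
        (LINT w:B_ball|lborel. LINT v|dv_R.
          phi_R (a_mat (arcosh_vec (spec_s (sinh_diag t ** w ** sinh_diag s + cosh_diag t ** v ** cosh_diag s)))) *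
          Delta_R (mat 1 - mstar w ** w) powr of_real (real CARD('q + 'r) * 1 / 2 - gam 1 CARD('q)))"
      using product_formula[OF Delta_R_pos_definite hyp(2) a_mat_SO0 cartan_K_R \<mu>] by (simp only: DIM_real)
  next
    assume hyp: "normalized_haar K_C dk_C" "spherical_function SU K_C dk_C phi_C" "normalized_haar unitary_group0 dv_C"
    interpret block_group K_C dk_C dv_C by (rule block_group_K_C[OF hyp(1,3) card])
    have \<mu>: "real CARD('q + 'r) * 2 / 2 - gam DIM(complex) CARD('q) = expo"
      using exponent[of 2] by (simp only: expo_def DIM_complex of_nat_numeral)
    show "phi_C (a_mat t) * phi_C (a_mat s) =
        1 / kappa (Delta_C :: ((complex, 'q) vec, 'q) vec \<Rightarrow> complex) (of_real (real CARD('q + 'r) * 2 / 2)) *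
        (LINT w:B_ball|lborel. LINT v|dv_C.
          phi_C (a_mat (arcosh_vec (spec_s (sinh_diag t ** w ** sinh_diag s + cosh_diag t ** v ** cosh_diag s)))) *
          Delta_C (mat 1 - mstar w ** w) powr of_real (real CARD('q + 'r) * 2 / 2 - gam 2 CARD('q)))"
      using product_formula[OF Delta_C_pos_definite hyp(2) a_mat_SU cartan_K_C \<mu>] by (simp only: DIM_complex)
  next
    assume hyp: "normalized_haar K_H dk_H" "spherical_function Sp K_H dk_H phi_H" "normalized_haar unitary_group0 dv_H"
    interpret block_group K_H dk_H dv_H by (rule block_group_K_H[OF hyp(1,3) card])
    have \<mu>: "real CARD('q + 'r) * 4 / 2 - gam DIM(quat) CARD('q) = expo"
      using exponent[of 4] by (simp only: expo_def DIM_quat of_nat_numeral)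
    show "phi_H (a_mat t) * phi_H (a_mat s) =
        1 / kappa (Delta_H :: ((quat, 'q) vec, 'q) vec \<Rightarrow> complex) (of_real (real CARD('q + 'r) * 4 / 2)) *
        (LINT w:B_ball|lborel. LINT v|dv_H.
          phi_H (a_mat (arcosh_vec (spec_s (sinh_diag t ** w ** sinh_diag s + cosh_diag t ** v ** cosh_diag s)))) *
          Delta_H (mat 1 - mstar w ** w) powr of_real (real CARD('q + 'r) * 4 / 2 - gam 4 CARD('q)))"
      using product_formula[OF Delta_H_pos_definite hyp(2) a_mat_Sp cartan_K_H \<mu>] by (simp only: DIM_quat)
  qed
qed

end
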